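(* Let $k\ge1$, $d\ge1$ and $n_1,\dots,n_k\ge2$ be integers, let $K\in\mathcal{K}^d$ be a $d$-dimensional convex body and $n:=n_1\cdots n_k$. Suppose there is no $\Sigma_k(n_1,\dots,n_k)$-equivariant map $C_k(d;n_1,\dots,n_k)\to S(W_k(d;n_1,\dots,n_k))$. Then for every probability measure $\mu$ on $\mathbb{R}^d$ absolutely continuous with respect to Lebesgue measure and all continuous functions $\varphi_1,\dots,\varphi_{d-1}:\mathcal{K}^d\to\mathbb{R}$, there exists an iterated partition $(K_1,\dots,K_n)$ of $K$ of level $k$ and type $(n_1,\dots,n_k)$ such that $\mu(K_1)=\dots=\mu(K_n)$ and $\varphi_i(K_1)=\dots=\varphi_i(K_n)$ for every $1\le i\le d-1$.
   Context: $\mathcal{K}^d$: compact convex subsets of $\mathbb{R}^d$ with nonempty interior, Hausdorff metric. $W_n=\{x\in\mathbb{R}^n:\sum x_i=0\}$; $F(\mathbb{R}^d,n)$ the configuration space of $n$ pairwise distinct points; $S_n$ acts on both by $\sigma\cdot(x_1,\dots,x_n)=(x_{\sigma^{-1}(1)},\dots,x_{\sigma^{-1}(n)})$. Wreath product action: if $G$ acts on $X$ and $S_n$ on $Y$, $G^{\times n}\rtimes S_n$ ($S_n$ permuting factors) acts on $X^{\times n}\times Y$ by $(g_1,\dots,g_n;\sigma)\cdot(x_1,\dots,x_n;y)=(g_1x_{\sigma^{-1}(1)},\dots,g_nx_{\sigma^{-1}(n)};\sigma y)$. $\Sigma_1(n_1)=S_{n_1}$, $\Sigma_k(n_1,\dots,n_k)=\Sigma_{k-1}(n_1,\dots,n_{k-1})^{\times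 n_k}\rtimes S_{n_k}$. $C_1(d;n_1)=F(\mathbb{R}^d,n_1)$, $C_k=C_{k-1}(d;n_1,\dots,n_{k-1})^{\times n_k}\times F(\mathbb{R}^d,n_k)$; $W_1(d;n_1)=W_{n_1}^{\oplus(d-1)}$ (as $\{(z_1,\dots,z_{n_1})\in(\mathbb{R}^{d-1})^{n_1}:\sum z_i=0\}$, $S_{n_1}$ permuting the $z_i$), $W_k(d;n_1,\dots,n_k)=W_{k-1}(d;n_1,\dots,n_{k-1})^{\oplus n_k}\oplus W_{n_k}^{\oplus(d-1)}$; all with the inductively defined wreath product actions. $S(V)$ is the unit sphere. Iterated partitions: for sites $x\in F(\mathbb{R}^d,n)$ and weights $w\in\mathbb{R}^n$ let $C_i(x,w)=\{p:\|p-x_i\|^2-w_i\le\|p-x_j\|^2-w_j\ \forall j\}$; for $L\in\mathcal{K}^d$ there are unique $w\in W_n$ such that the pieces $L\cap C_i(x,w)$ are convex bodies of equal $\mu$-measure, and this tuple is the regular equipartition of $L$ with sites $x$. A partition is iterated of level $1$ and type $n$ if it is such a regular equipartition; for $k\ge2$ an iterated partition of $K$ of level $k$ and type $(n_1,\dots,n_k)$ is obtained from one of level $k-1$ and type $(n_1,\dots,n_{k-1})$ by replacing each piece $K_i$ with an iterated partition of $K_i$ of level $1$ and type $n_k$. *)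

theory Defs
  imports "HOL-Probability.Probability"
begin

definition convex_bodies :: "'a::euclidean_space set set" where
  "convex_bodies = {L. compact L \<and> convex L \<and> interior L \<noteq> {}}"

definition haus_dist :: "'a::euclidean_space set \<Rightarrow> 'a set \<Rightarrow> real" where
  "haus_dist A B = max (SUP a\<in>A. infdist a B) (SUP b\<in>B. infdist b A)"

definition haus_continuous :: "('a::euclidean_space set \<Rightarrow> real) \<Rightarrow> bool" where
  "haus_continuous \<phi> \<longleftrightarrow>
     (\<forall>L\<in>convex_bodies. \<forall>e>0. \<exists>\<delta>>0. \<forall>L'\<in>convex_bodies.
        haus_dist L' L < \<delta> \<longrightarrow> \<bar>\<phi> L' - \<phi> L\<bar> < e)"

definition power_cell :: "nat \<Rightarrow> (nat \<Rightarrow> 'a::euclidean_space) \<Rightarrow> (nat \<Rightarrow> real) \<Rightarrow> nat \<Rightarrow> 'a set" where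
  "power_cell n x w i = {p. \<forall>j<n. (norm (p - x i))\<^sup>2 - w i \<le> (norm (p - x j))\<^sup>2 - w j}"

definition regular_equipartition :: "'a::euclidean_space measure \<Rightarrow> 'a set \<Rightarrow> nat \<Rightarrow> (nat \<Rightarrow> 'a set) \<Rightarrow> bool" where
  "regular_equipartition \<mu> L n P \<longleftrightarrow>
     (\<exists>x w. (\<forall>i<n. \<forall>j<n. i \<noteq> j \<longrightarrow> x i \<noteq> x j) \<and> (\<Sum>i<n. w i) = 0 \<and>
        (\<forall>i<n. P i = L \<inter> power_cell n x w i \<and> P i \<in> convex_bodies) \<and>
        (\<forall>i<n. \<forall>j<n. measure \<mu> (P i) = measure \<mu> (P j)))"

text \<open>Iterated partitions, type list given in reverse order [n_k,...,n_1];
  level 0 is the trivial partition (K). Piece index i*n_k + j: j-th piece of the i-th old piece.\<close>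
fun iter_partition_rev :: "'a::euclidean_space measure \<Rightarrow> 'a set \<Rightarrow> nat list \<Rightarrow> (nat \<Rightarrow> 'a set) \<Rightarrow> bool" where
  "iter_partition_rev \<mu> K [] P \<longleftrightarrow> P 0 = K"
| "iter_partition_rev \<mu> K (n # rs) P \<longleftrightarrow>
     (\<exists>Q. iter_partition_rev \<mu> K rs Q \<and>
          (\<forall>i<prod_list rs. regular_equipartition \<mu> (Q i) n (\<lambda>j. P (i * n + j))))"

definition iterated_partition :: "'a::euclidean_space measure \<Rightarrow> 'a set \<Rightarrow> nat list \<Rightarrow> (nat \<Rightarrow> 'a set) \<Rightarrow> bool" where
  "iterated_partition \<mu> K ns P \<longleftrightarrow> iter_partition_rev \<mu> K (rev ns) P"

text \<open>All indexed by the reversed type list rs = [n_k,...,n_1]. An element is a function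
  p i, where the path p = [] addresses the top factor (F(R^d,n_k) resp. W_{n_k}^{d-1}) and
  p = j # q addresses position q in the j-th copy of the level-(k-1) object.
  Unused coordinates are 0. Base case: level 0 is a point.\<close>

fun C_space :: "nat list \<Rightarrow> (nat list \<Rightarrow> nat \<Rightarrow> 'a::real_vector) set" where
  "C_space [] = {x. \<forall>p i. x p i = 0}"
| "C_space (n # rs) = {x. (\<forall>j<n. (\<lambda>q. x (j # q)) \<in> C_space rs) \<and>
      (\<forall>i<n. \<forall>i'<n. i \<noteq> i' \<longrightarrow> x [] i \<noteq> x [] i') \<and>
      (\<forall>i. n \<le> i \<longrightarrow> x [] i = 0) \<and> (\<forall>j q i. n \<le> j \<longrightarrow> x (j # q) i = 0)}"

fun W_space :: "nat \<Rightarrow> nat list \<Rightarrow> (nat list \<Rightarrow> nat \<Rightarrow> nat \<Rightarrow> real) set" where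
  "W_space d [] = {w. \<forall>p i c. w p i c = 0}"
| "W_space d (n # rs) = {w. (\<forall>j<n. (\<lambda>q. w (j # q)) \<in> W_space d rs) \<and>
      (\<forall>c. (\<Sum>i<n. w [] i c) = 0) \<and>
      (\<forall>i c. n \<le> i \<or> d - 1 \<le> c \<longrightarrow> w [] i c = 0) \<and> (\<forall>j q i c. n \<le> j \<longrightarrow> w (j # q) i c = 0)}"

fun W_norm2 :: "nat \<Rightarrow> nat list \<Rightarrow> (nat list \<Rightarrow> nat \<Rightarrow> nat \<Rightarrow> real) \<Rightarrow> real" where
  "W_norm2 d [] w = 0"
| "W_norm2 d (n # rs) w = (\<Sum>j<n. W_norm2 d rs (\<lambda>q. w (j # q))) + (\<Sum>i<n. \<Sum>c<d - 1. (w [] i c)\<^sup>2)"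

definition W_sphere :: "nat \<Rightarrow> nat list \<Rightarrow> (nat list \<Rightarrow> nat \<Rightarrow> nat \<Rightarrow> real) set" where
  "W_sphere d rs = {w \<in> W_space d rs. W_norm2 d rs w = 1}"

text \<open>Iterated wreath product: g [] is the top permutation sigma in S_{n_k},
  g (j # q) is the j-th component in Sigma_{k-1}.\<close>
fun Sigma_group :: "nat list \<Rightarrow> (nat list \<Rightarrow> nat \<Rightarrow> nat) set" where
  "Sigma_group [] = {g. \<forall>p. g p = id}"
| "Sigma_group (n # rs) = {g. g [] permutes {..<n} \<and>
      (\<forall>j<n. (\<lambda>q. g (j # q)) \<in> Sigma_group rs) \<and> (\<forall>j q. n \<le> j \<longrightarrow> g (j # q) = id)}"

text \<open>(g_1..g_n; sigma).(x_1..x_n; y) = (g_1 x_{sigma^-1 1},..., g_n x_{sigma^-1 n}; sigma y),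
  with (sigma y)_i = y_{sigma^-1 i}.\<close>
fun wr_act :: "nat list \<Rightarrow> (nat list \<Rightarrow> nat \<Rightarrow> nat) \<Rightarrow> (nat list \<Rightarrow> nat \<Rightarrow> 'v) \<Rightarrow> nat list \<Rightarrow> nat \<Rightarrow> 'v" where
  "wr_act [] g x = x"
| "wr_act (n # rs) g x = (\<lambda>p. case p of
        [] \<Rightarrow> (\<lambda>i. x [] (inv (g []) i))
      | j # q \<Rightarrow> wr_act rs (\<lambda>q'. g (j # q')) (\<lambda>q'. x (inv (g []) j # q')) q)"

definition equivariant_map_exists :: "'a::euclidean_space itself \<Rightarrow> nat list \<Rightarrow> bool" where
  "equivariant_map_exists _ rs \<longleftrightarrow>
     (\<exists>f :: (nat list \<Rightarrow> nat \<Rightarrow> 'a) \<Rightarrow> (nat list \<Rightarrow> nat \<Rightarrow> nat \<Rightarrow> real).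
        continuous_on (C_space rs) f \<and> f ` C_space rs \<subseteq> W_sphere DIM('a) rs \<and>
        (\<forall>g\<in>Sigma_group rs. \<forall>x\<in>C_space rs. f (wr_act rs g x) = wr_act rs g (f x)))"

end

theory Submission
  imports Defs "HOL-Probability.Probability" "Jordan_Normal_Form.Determinant" "HOL-Library.Sublist"
    "HOL-Number_Theory.Number_Theory"
begin

text \<open>Two cases are distinguished by whether some prime \<open>p\<close> divides all the binomial coefficients \<open>n\<^sub>i choose m\<close> with
  \<open>0 < m < n\<^sub>i\<close>, that is, whether all the \<open>n\<^sub>i\<close> are powers of \<open>p\<close>.

  If so, sites of the cells are parametrised by a vector \<open>u\<close> assigning \<open>d - 1\<close> numbers to every piece, and the deviations of
  the \<open>\<phi>\<^sub>i\<close> from their means, corrected by the mean of \<open>u\<close>, form a map that commutes with relabellings of the children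
  of a node across a gap in the site positions. On a fine Kuhn triangulation of a large cube the degree of its piecewise
  linear approximation is one, while the simplices far from the origin contribute in orbits whose sizes are multiples of
  some \<open>n\<^sub>i choose m\<close>; so some simplex near the origin contributes, and in the limit the map has a zero. This
  proves the conclusion whether or not equivariant maps exist.

  If not, then in dimension at least two an equivariant map does exist. The identity of the test space is modified in
  tubes around the orbits of two-cluster vectors, changing its degree by integer multiples of the \<open>n\<^sub>i choose m\<close>; by
  Bezout the total degree can be made zero, and the map extends over the ball without zeros.
  Sorting the points of a configuration by their last coordinate turns this into an equivariant map.

  The case distinction also makes the argument independent of the order of the levels, which differs between the
  wreath product and the partitions.\<close>
section \<open>Counting cofactor signs\<close>

text \<open>The gcd of \<open>n choose m\<close> over 0 < m < n is p if n is a power of p, and 1 if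
  n is not a prime power; over several n it is therefore a prime or 1. The binomials enter as orbit
  sizes: when n siblings split into two distant clusters, a relabelling that is increasing on each
  cluster is determined by the set of labels that the first cluster receives. Only such relabellings
  have to be respected. Siblings that nearly agree in d - 1 coordinates are told apart by the order
  of the last one, and reversing that order is never asked for. This replaces configurations, whose
  points must stay distinct, by arbitrary vectors, for which degree is elementary. Two difficulties
  shape the details. Degree is counted over finitely many simplices, so labels must be in general
  position, and the perturbation that achieves this must not break the relabelling symmetry; hence
  it is computed from invariant codes. And tubes around different rays have to be moved into one
  plane before they can be unwound together; this needs a plane in general position, hence at least
  four dimensions.\<close>

definition dt :: "nat => (nat => nat => real) => real" where
 "dt M y = Determinant.det (Matrix.mat M M (%(i, j). y i j))"

lemma dt_leibniz: "dt M y = (\<Sum>p | p permutes {0..<M}. of_int (sign p) * (\<Prod>i = 0..<M. y i (p i)))"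
 unfolding dt_def by (subst det_def') (auto intro!: sum.cong prod.cong simp: permutes_in_image)

lemma dt_cong: "(\<And>i j. i < M ==> j < M ==> y i j = z i j) ==> dt M y = dt M z"
 unfolding dt_leibniz by (auto intro!: sum.cong prod.cong simp: permutes_in_image)

lemma dt_permute_coords:
 assumes "\<tau> permutes {0..<M}"
 shows "dt M (%i j. y i (\<tau> j)) = of_int (sign \<tau>) * dt M y"
proof -
 have fin: "finite {0..<M}" by simp
 have "dt M (%i j. y i (\<tau> j)) =
  (\<Sum>p | p permutes {0..<M}. of_int (sign p) * (\<Prod>i = 0..<M. y i ((\<tau> \<circ> p) i)))"
  unfolding dt_leibniz by simp
 also have "\<dots> = (\<Sum>p | p permutes {0..<M}. of_int (sign \<tau>) * (of_int (sign (\<tau> \<circ> p)) * (\<Prod>i = 0..<M. y i ((\<tau> \<circ> p) i))))"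
 proof (rule sum.cong[OF refl])
  fix p assume "p \<in> {p. p permutes {0..<M}}"
  then have p: "permutation p" "permutation \<tau>" using assms fin permutation_permutes by blast+
  have "sign \<tau> * sign (\<tau> \<circ> p) = sign p"
   using sign_compose[OF p(2,1)] sign_idempotent[of \<tau>] by (simp add: mult.assoc[symmetric])
  then have "of_int (sign \<tau>) * of_int (sign (\<tau> \<circ> p)) = (of_int (sign p) :: real)"
   by (metis of_int_mult)
  then show "of_int (sign p) * (\<Prod>i = 0..<M. y i ((\<tau> \<circ> p) i)) =
   of_int (sign \<tau>) * (of_int (sign (\<tau> \<circ> p)) * (\<Prod>i = 0..<M. y i ((\<tau> \<circ> p) i)))"
   by (simp add: mult.assoc[symmetric])
 qed
 also have "\<dots> = of_int (sign \<tau>) * (\<Sum>p | p permutes {0..<M}. of_int (sign (\<tau> \<circ> p)) * (\<Prod>i = 0..<M. y i ((\<tau> \<circ> p) i)))"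
  by (simp add: sum_distrib_left)
 also have "(\<Sum>p | p permutes {0..<M}. of_int (sign (\<tau> \<circ> p)) * (\<Prod>i = 0..<M. y i ((\<tau> \<circ> p) i))) = dt M y"
  unfolding dt_leibniz
  by (rule setum_permutations_compose_left[OF assms, symmetric])
 finally show ?thesis .
qed

lemma dt_zero_iff: "dt M y = 0 \<longleftrightarrow> (\<exists>c. (\<exists>i<M. c i ~= 0) \<and> (\<forall>r<M. (\<Sum>i<M. c i * y i r) = 0))"
proof -
 let ?A = "transpose_mat (Matrix.mat M M (%(i, j). y i j))"
 have A: "?A \<in> carrier_mat M M" by simp
 have "dt M y = Determinant.det ?A" unfolding dt_def by (subst det_transpose) auto
 then have *: "dt M y = 0 \<longleftrightarrow> (\<exists>v. v \<in> carrier_vec M \<and> v ~= 0\<^sub>v M \<and> ?A *\<^sub>v v = 0\<^sub>v M)"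
  using det_0_iff_vec_prod_zero_field[OF A] by simp
 have ev: "(?A *\<^sub>v v = 0\<^sub>v M) \<longleftrightarrow> (\<forall>r<M. (\<Sum>i<M. Matrix.vec_index v i * y i r) = 0)" if "v \<in> carrier_vec M" for v
  using that by (auto simp: vec_eq_iff scalar_prod_def atLeast0LessThan mult.commute)
 show ?thesis
 proof
  assume "dt M y = 0"
  then obtain v where v: "v \<in> carrier_vec M" "v ~= 0\<^sub>v M" "?A *\<^sub>v v = 0\<^sub>v M" using * by blast
  then have "\<exists>i<M. Matrix.vec_index v i ~= 0" by auto
  then show "\<exists>c. (\<exists>i<M. c i ~= 0) \<and> (\<forall>r<M. (\<Sum>i<M. c i * y i r) = 0)"
   using ev[OF v(1)] v(3) by (intro exI[of _ "Matrix.vec_index v"]) auto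
 next
  assume "\<exists>c. (\<exists>i<M. c i ~= 0) \<and> (\<forall>r<M. (\<Sum>i<M. c i * y i r) = 0)"
  then obtain c where c: "\<exists>i<M. c i ~= 0" "\<forall>r<M. (\<Sum>i<M. c i * y i r) = 0" by blast
  let ?v = "Matrix.vec M c"
  have v: "?v \<in> carrier_vec M" by simp
  have "?v ~= 0\<^sub>v M" using c(1) by (metis index_vec index_zero_vec(1))
  moreover have "?A *\<^sub>v ?v = 0\<^sub>v M" using c(2) by (subst ev[OF v]) auto
  ultimately show "dt M y = 0" using * v by blast
 qed
qed

lemma dt_unique:
 assumes "dt M y ~= 0" "\<And>r. r < M ==> (\<Sum>i<M. c i * y i r) = 0" "i < M"
 shows "c i = 0"
 using assms dt_zero_iff by blast

lemma dt_span:
 assumes "dt M y ~= 0"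
 obtains c where "\<And>r. r < M ==> (\<Sum>i<M. c i * y i r) = w r"
proof -
 let ?A = "transpose_mat (Matrix.mat M M (%(i, j). y i j))"
 have A: "?A \<in> carrier_mat M M" by simp
 have d: "Determinant.det ?A ~= 0" using assms unfolding dt_def by (subst det_transpose) auto
 from det_non_zero_imp_unit[OF A d] obtain B where B: "B \<in> carrier_mat M M" "?A * B = 1\<^sub>m M"
  unfolding Units_def ring_mat_def by auto
 let ?v = "B *\<^sub>v Matrix.vec M w"
 have v: "?v \<in> carrier_vec M" using B by auto
 have "?A *\<^sub>v ?v = (?A * B) *\<^sub>v Matrix.vec M w" using assoc_mult_mat_vec[OF A B(1), of "Matrix.vec M w"] by simp
 then have e: "?A *\<^sub>v ?v = Matrix.vec M w" using B by simp
 have "(\<Sum>i<M. Matrix.vec_index ?v i * y i r) = w r" if "r < M" for r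
 proof -
  have "Matrix.vec_index (?A *\<^sub>v ?v) r = w r" using e that by simp
  moreover have "Matrix.vec_index (?A *\<^sub>v ?v) r = (\<Sum>i<M. Matrix.vec_index ?v i * y i r)"
   using that v B by (auto simp: scalar_prod_def atLeast0LessThan mult.commute intro!: sum.cong)
  ultimately show ?thesis by simp
 qed
 then show ?thesis using that by blast
qed

definition skip :: "nat => (nat => 'a) => nat => 'a" where
 "skip j y = (%i. if i < j then y i else y (Suc i))"

text \<open>Signed maximal minors of the (M + 1) x M matrix with rows y. In general position they
  are, up to scale, the coefficients of the only linear relation among the rows.\<close>

definition minor :: "nat => (nat => nat => real) => nat => real" where
 "minor M y j = (- 1) ^ j * dt M (skip j y)"

lemma sum_skip:
 fixes f :: "nat => real"
 assumes "j <= M"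
 shows "(\<Sum>i<M. skip j f i) = (\<Sum>i\<in>{..M} - {j}. f i)"
proof -
 have "bij_betw (%i. if i < j then i else Suc i) {..<M} ({..M} - {j})"
  by (rule bij_betwI[where g = "%i. if i < j then i else i - 1"]) (use assms in \<open>auto split: if_splits\<close>)
 from sum.reindex_bij_betw[OF this, of f] show ?thesis
  by (simp add: skip_def if_distrib cong: if_cong)
qed

text \<open>Laplace expansion of the determinant of a square matrix in which column r has been
  duplicated.\<close>

lemma minor_relation:
 assumes "r < M"
 shows "(\<Sum>j\<le>M. minor M y j * y j r) = 0"
proof -
 let ?N = "Suc M"
 let ?A = "Matrix.mat ?N ?N (%(i, j). if j = 0 then y i r else y i (j - 1))"
 have A: "?A \<in> carrier_mat ?N ?N" by simp
 have c: "col ?A 0 = col ?A (Suc r)" using assms by (auto simp: col_def)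
 have "Determinant.det ?A = 0"
  by (rule det_identical_columns[OF A _ _ _ c]) (use assms in auto)
 moreover have "Determinant.det ?A = (\<Sum>i<?N. ?A $$ (i, 0) * cofactor ?A i 0)"
  by (rule laplace_expansion_column[OF A]) simp
 moreover have "?A $$ (i, 0) * cofactor ?A i 0 = minor M y i * y i r" if "i < ?N" for i
 proof -
  have "mat_delete ?A i 0 = Matrix.mat M M (%(a, b). skip i y a b)"
   by (rule eq_matI) (use that in \<open>auto simp: mat_delete_def skip_def\<close>)
  then show ?thesis using that by (simp add: cofactor_def minor_def dt_def)
 qed
 moreover from this have "(\<Sum>i<?N. ?A $$ (i, 0) * cofactor ?A i 0) = (\<Sum>i<?N. minor M y i * y i r)"
  by (intro sum.cong) (simp_all only: lessThan_iff)
 ultimately have "(\<Sum>i<?N. minor M y i * y i r) = 0" by (simp only:)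
 then show ?thesis by (simp only: lessThan_Suc_atMost)
qed

definition sgi :: "real => int" where "sgi x = (if x > 0 then 1 else if x < 0 then - 1 else 0)"

lemma sgi_pm: "sgi ((- 1) ^ j * x) = (- 1) ^ j * sgi x"
 by (cases "even j") (auto simp: sgi_def)

text \<open>The index pairs hit by a generic ray form the end points of the segment of nonnegative
 representations of the ray's direction.\<close>

lemma signed_endpoint_count:
 fixes l t :: "nat => real"
 assumes l: "\<And>i. i <= M ==> l i ~= 0" and t: "inj_on t {..M}"
 shows "(\<Sum>j\<le>M. if \<forall>i\<le>M. i ~= j --> l i * (t i - t j) > 0 then sgi (l j) else 0) =
  (if \<forall>j\<le>M. l j > 0 then 1 else if \<forall>j\<le>M. l j < 0 then - 1 else (0::int))"
proof -
 let ?h = "%j. \<forall>i\<le>M. i ~= j --> l i * (t i - t j) > 0"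
 let ?P = "{i. i <= M \<and> l i > 0}" and ?N = "{i. i <= M \<and> l i < 0}"
 have fin: "finite ?P" "finite ?N" by auto
 have un: "{..M} = ?P \<union> ?N" using l by (auto intro: linorder_neqE_linordered_idom)
 have dj: "?P \<inter> ?N = {}" by auto
 have pos: "l i * (t i - t j) > 0 \<longleftrightarrow> t j < t i" if "i \<in> ?P" for i j
  using that by (simp add: zero_less_mult_iff)
 have neg: "l i * (t i - t j) > 0 \<longleftrightarrow> t i < t j" if "i \<in> ?N" for i j
  using that by (simp add: zero_less_mult_iff)
 have tne: "t i ~= t j" if "i <= M" "j <= M" "i ~= j" for i j
  using t that by (auto dest: inj_onD)
 have h_iff: "?h j \<longleftrightarrow> (\<forall>i\<in>?P. i ~= j --> t j < t i) \<and> (\<forall>i\<in>?N. i ~= j --> t i < t j)" for j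
 proof -
  have "?h j \<longleftrightarrow> (\<forall>i\<in>?P \<union> ?N. i ~= j --> l i * (t i - t j) > 0)" unfolding un[symmetric] by (simp add: Ball_def)
  then show ?thesis unfolding ball_Un using pos neg by (simp cong: ball_cong)
 qed
 have hP: "?h j \<longleftrightarrow> (\<forall>i\<in>?P. t j <= t i) \<and> (\<forall>i\<in>?N. t i < t j)" if j: "j \<in> ?P" for j
 proof -
  have "(i ~= j --> t j < t i) \<longleftrightarrow> t j <= t i" if "i \<in> ?P" for i
   using tne[of j i] j that by (cases "i = j") (simp_all add: less_le)
  moreover have "(i ~= j --> t i < t j) \<longleftrightarrow> t i < t j" if "i \<in> ?N" for i using that j by (cases "i = j") simp_all
  ultimately show ?thesis unfolding h_iff by (intro arg_cong2[where f = "(\<and>)"] ball_cong refl)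
 qed
 have hN: "?h j \<longleftrightarrow> (\<forall>i\<in>?P. t j < t i) \<and> (\<forall>i\<in>?N. t i <= t j)" if j: "j \<in> ?N" for j
 proof -
  have "(i ~= j --> t i < t j) \<longleftrightarrow> t i <= t j" if "i \<in> ?N" for i
   using tne[of i j] j that by (cases "i = j") (simp_all add: less_le)
  moreover have "(i ~= j --> t j < t i) \<longleftrightarrow> t j < t i" if "i \<in> ?P" for i using that j by (cases "i = j") simp_all
  ultimately show ?thesis unfolding h_iff by (intro arg_cong2[where f = "(\<and>)"] ball_cong refl)
 qed
 have split: "(\<Sum>j\<le>M. if ?h j then sgi (l j) else 0) = (\<Sum>j\<in>?P. if ?h j then 1 else 0) - (\<Sum>j\<in>?N. if ?h j then 1 else 0)"
 proof -
  have "(\<Sum>j\<in>?P. if ?h j then sgi (l j) else 0) = (\<Sum>j\<in>?P. if ?h j then 1 else 0)"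
   by (rule sum.cong[OF refl], rule if_cong[OF refl]) (auto simp: sgi_def)
  moreover have "(\<Sum>j\<in>?N. if ?h j then sgi (l j) else 0) = (\<Sum>j\<in>?N. - (if ?h j then 1 else 0))"
   unfolding if_distrib[of uminus] by (rule sum.cong[OF refl], rule if_cong[OF refl]) (auto simp: sgi_def)
  ultimately show ?thesis unfolding un sum.union_disjoint[OF fin dj] by (simp only: sum_negf diff_conv_add_uminus)
 qed
 \<comment> \<open>The admissible parameters form the interval from the largest t on
   \<open>?N\<close> to the smallest t on \<open>?P\<close>. Only its ends b and a can satisfy
   \<open>?h\<close>; if both exist they do so together, with opposite signs.\<close>
 define a where "a = arg_min_on t ?P"
 define b where "b = arg_min_on (%i. - t i) ?N"
 have aP: "a \<in> ?P" "\<forall>i\<in>?P. t a <= t i" if "?P ~= {}"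
  using arg_min_if_finite[OF fin(1) that, of t] unfolding a_def[symmetric] by (auto simp: not_less dest: leD)
 have bN: "b \<in> ?N" "\<forall>i\<in>?N. t i <= t b" if "?N ~= {}"
  using arg_min_if_finite[OF fin(2) that, of "%i. - t i"] unfolding b_def[symmetric] by (auto simp: not_less dest: leD)
 have sP: "(\<Sum>j\<in>?P. if ?h j then 1 else 0) = (if ?h a then 1 else (0::int))" if ne: "?P ~= {}"
 proof -
  have "?h j ==> j = a" if "j \<in> ?P" for j
  proof -
   assume "?h j"
   then have "t j <= t a" using hP[OF that] aP(1)[OF ne] by blast
   then have "t j = t a" using aP(2)[OF ne] that by (simp add: antisym)
   then show "j = a" using tne[of j a] that aP(1)[OF ne] by blast
  qed
  then have *: "\<not> ?h j" if "j \<in> ?P" "j ~= a" for j using that by blast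
  have "(\<Sum>j\<in>?P. if ?h j then 1 else (0::int)) = (\<Sum>j\<in>?P. if j = a then (if ?h a then 1 else 0) else 0)"
  proof (rule sum.cong[OF refl])
   fix j assume j: "j \<in> ?P"
   show "(if ?h j then 1 else (0::int)) = (if j = a then (if ?h a then 1 else 0) else 0)"
   proof (cases "j = a")
    case False
    show ?thesis unfolding if_not_P[OF False] if_not_P[OF *[OF j False]] ..
   qed (simp only: if_True refl)
  qed
  then show ?thesis using aP(1)[OF ne] fin by (simp add: sum.delta)
 qed
 have sN: "(\<Sum>j\<in>?N. if ?h j then 1 else 0) = (if ?h b then 1 else (0::int))" if ne: "?N ~= {}"
 proof -
  have "?h j ==> j = b" if "j \<in> ?N" for j
  proof -
   assume "?h j"
   then have "t b <= t j" using hN[OF that] bN(1)[OF ne] by blast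
   then have "t j = t b" using bN(2)[OF ne] that by (simp add: antisym)
   then show "j = b" using tne[of j b] that bN(1)[OF ne] by blast
  qed
  then have *: "\<not> ?h j" if "j \<in> ?N" "j ~= b" for j using that by blast
  have "(\<Sum>j\<in>?N. if ?h j then 1 else (0::int)) = (\<Sum>j\<in>?N. if j = b then (if ?h b then 1 else 0) else 0)"
  proof (rule sum.cong[OF refl])
   fix j assume j: "j \<in> ?N"
   show "(if ?h j then 1 else (0::int)) = (if j = b then (if ?h b then 1 else 0) else 0)"
   proof (cases "j = b")
    case False
    show ?thesis unfolding if_not_P[OF False] if_not_P[OF *[OF j False]] ..
   qed (simp only: if_True refl)
  qed
  then show ?thesis using bN(1)[OF ne] fin by (simp add: sum.delta)
 qed
 consider "?P = {}" "?N ~= {}" | "?P ~= {}" "?N = {}" | "?P ~= {}" "?N ~= {}" using un by blast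
 then show ?thesis
 proof cases
  case 1
  then have *: "\<forall>j\<le>M. l j < 0" using un by blast
  then have n: "\<not> (\<forall>j\<le>M. l j > 0)" by force
  have "\<forall>i\<in>?P. t b < t i" unfolding 1(1) by simp
  then have hb: "?h b" using hN[OF bN(1)[OF 1(2)]] bN(2)[OF 1(2)] by argo
  have s: "(\<Sum>j\<in>?N. if ?h j then 1 else (0::int)) = 1" using sN[OF 1(2)] unfolding if_P[OF hb] .
  have "(\<Sum>j\<in>?P. if ?h j then 1 else (0::int)) = 0" unfolding 1(1) by simp
  then show ?thesis unfolding split s if_not_P[OF n] if_P[OF *] by simp
 next
  case 2
  then have *: "\<forall>j\<le>M. l j > 0" using un by blast
  have "\<forall>i\<in>?N. t i < t a" unfolding 2(2) by simp
  then have ha: "?h a" using hP[OF aP(1)[OF 2(1)]] aP(2)[OF 2(1)] by argo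
  have s: "(\<Sum>j\<in>?P. if ?h j then 1 else (0::int)) = 1" using sP[OF 2(1)] unfolding if_P[OF ha] .
  have "(\<Sum>j\<in>?N. if ?h j then 1 else (0::int)) = 0" unfolding 2(2) by simp
  then show ?thesis unfolding split s if_P[OF *] by simp
 next
  case 3
  have n1: "\<not> (\<forall>j\<le>M. l j > 0)" using bN(1)[OF 3(2)] by (auto simp: not_less intro: order_less_imp_le)
  have n2: "\<not> (\<forall>j\<le>M. l j < 0)" using aP(1)[OF 3(1)] by (auto simp: not_less intro: order_less_imp_le)
  have "?h a \<longleftrightarrow> (\<forall>i\<in>?N. t i < t a)" using hP[OF aP(1)[OF 3(1)]] aP(2)[OF 3(1)] by argo
  also have "\<dots> \<longleftrightarrow> t b < t a" using bN[OF 3(2)] by (meson le_less_trans)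
  finally have ha: "?h a \<longleftrightarrow> t b < t a" .
  have "?h b \<longleftrightarrow> (\<forall>i\<in>?P. t b < t i)" using hN[OF bN(1)[OF 3(2)]] bN(2)[OF 3(2)] by argo
  also have "\<dots> \<longleftrightarrow> t b < t a" using aP[OF 3(1)] by (meson less_le_trans)
  finally have hb: "?h b \<longleftrightarrow> t b < t a" .
  show ?thesis unfolding split sP[OF 3(1)] sN[OF 3(2)] if_not_P[OF n1] if_not_P[OF n2] unfolding ha hb by simp
 qed
qed

section \<open>Labelled Kuhn triangulations\<close>

text \<open>Signed count of the origin in the open simplex spanned by M + 1 labels: cofactors of one
  sign, once normalised, write 0 as a strict convex combination, and their common sign is the
  orientation.\<close>

definition Phi :: "nat => (nat => nat => real) => int" where
 "Phi M y = (if \<forall>j\<le>M. minor M y j > 0 then 1 else if \<forall>j\<le>M. minor M y j < 0 then - 1 else 0)"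

text \<open>The analogue of \<open>Phi\<close> for a facet: the ray through w takes the place of the
  origin, and the open cone over M labels that of the simplex.\<close>

definition psi :: "nat => (nat => real) => (nat => nat => real) => int" where
 "psi M w y = (if \<exists>c. (\<forall>i<M. c i > 0) \<and> (\<forall>r<M. (\<Sum>i<M. c i * y i r) = w r) then sgi (dt M y) else 0)"

lemma psi_cong:
 assumes "\<And>i r. i < M ==> y i r = z i r"
 shows "psi M w y = psi M w z"
proof -
 have "(\<Sum>i<M. c i * y i r) = (\<Sum>i<M. c i * z i r)" for c r
  using assms by (intro sum.cong) auto
 moreover have "dt M y = dt M z" using assms by (intro dt_cong) auto
 ultimately show ?thesis unfolding psi_def by (simp only:)
qed

text \<open>The coefficient vectors that represent w by the M + 1 labels form a line with direction
  \<open>minor M y\<close>. Facet j counts when the point of this line with j-th coefficient 0 is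
  positive elsewhere, so the sum is the one in \<open>signed_endpoint_count\<close>.\<close>

lemma Phi_eq_psi_sum:
 assumes gen: "\<And>j. j <= M ==> dt M (skip j y) ~= 0"
  and genw: "\<And>j i. j <= M ==> i < M ==> dt M ((skip j y)(i := w)) ~= 0"
 shows "(\<Sum>j\<le>M. (- 1) ^ j * psi M w (skip j y)) = Phi M y"
proof -
 let ?l = "minor M y"
 have l0: "?l j ~= 0" if "j <= M" for j using gen[OF that] by (simp add: minor_def)
 have "\<exists>a. a j = 0 \<and> (\<forall>r<M. (\<Sum>i\<le>M. a i * y i r) = w r)" if j: "j <= M" for j
 proof -
  obtain c where c: "\<And>r. r < M ==> (\<Sum>i<M. c i * skip j y i r) = w r" using dt_span[OF gen[OF j]] by blast
  let ?a = "%i. if i < j then c i else if i = j then 0 else c (i - 1)"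
  have "(\<Sum>i\<le>M. ?a i * y i r) = w r" if "r < M" for r
  proof -
   have "(\<Sum>i\<le>M. ?a i * y i r) = (\<Sum>i\<in>{..M} - {j}. ?a i * y i r)"
    using j by (intro sum.mono_neutral_right) auto
   also have "\<dots> = (\<Sum>i<M. skip j (%i. ?a i * y i r) i)" by (rule sum_skip[OF j, symmetric])
   also have "\<dots> = (\<Sum>i<M. c i * skip j y i r)" by (rule sum.cong) (auto simp: skip_def)
   finally show ?thesis using c[OF that] by simp
  qed
  then show ?thesis by (intro exI[of _ ?a]) auto
 qed
 then obtain A where A0: "\<And>j. j <= M ==> A j j = 0"
  and A: "\<And>j r. j <= M ==> r < M ==> (\<Sum>i\<le>M. A j i * y i r) = w r" by metis
 have skip_eq: "(\<Sum>i<M. skip j a i * skip j y i r) = (\<Sum>i\<le>M. a i * y i r)" if "j <= M" "a j = 0" for a :: "nat => real" and j r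
 proof -
  have "(\<Sum>i\<le>M. a i * y i r) = (\<Sum>i\<in>{..M} - {j}. a i * y i r)"
   using that by (intro sum.mono_neutral_right) auto
  also have "\<dots> = (\<Sum>i<M. skip j (%i. a i * y i r) i)" by (rule sum_skip[OF that(1), symmetric])
  finally show ?thesis by (auto simp: skip_def intro!: sum.cong)
 qed
 have skip_ex: "\<exists>i'<M. skip j b i' = b i \<and> (\<forall>b :: nat => real. skip j b i' = b i)" if "j <= M" "i <= M" "i ~= j" for i j and b :: "nat => real"
  by (rule exI[of _ "if i < j then i else i - 1"]) (use that in \<open>auto simp: skip_def\<close>)
 have uniq: "a i = b i" if j: "j <= M" "a j = 0" "b j = 0" and i: "i <= M"
  and eq: "\<And>r. r < M ==> (\<Sum>i\<le>M. a i * y i r) = (\<Sum>i\<le>M. b i * y i r)" for a b :: "nat => real" and i j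
 proof (cases "i = j")
  case False
  obtain i' where i': "i' < M" "\<forall>b :: nat => real. skip j b i' = b i" using skip_ex[OF j(1) i False] by blast
  have "(\<Sum>i<M. skip j (%i. a i - b i) i * skip j y i r) = 0" if "r < M" for r
   using eq[OF that]
   by (subst skip_eq) (use j in \<open>auto simp: left_diff_distrib sum_subtractf\<close>)
  from dt_unique[OF gen[OF \<open>j <= M\<close>] this i'(1)] show ?thesis using i'(2) by auto
 qed (use that in auto)
 \<comment> \<open>A further vanishing coefficient would express w by M - 1 labels, against
   \<open>genw\<close>.\<close>
 have Anz: "A j i ~= 0" if ij: "j <= M" "i <= M" "i ~= j" for i j
 proof
  assume z: "A j i = 0"
  obtain i' where i': "i' < M" "\<forall>b :: nat => real. skip j b i' = b i" using skip_ex[OF ij] by blast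
  let ?c = "(skip j (A j))(i' := - 1)"
  have "(\<Sum>k<M. ?c k * ((skip j y)(i' := w)) k r) = 0" if "r < M" for r
  proof -
   have "(\<Sum>k<M. ?c k * ((skip j y)(i' := w)) k r) = - w r + (\<Sum>k\<in>{..<M} - {i'}. skip j (A j) k * skip j y k r)"
    using i'(1) by (subst sum.remove[of _ i']) (auto intro!: sum.cong)
   also have "(\<Sum>k\<in>{..<M} - {i'}. skip j (A j) k * skip j y k r) = (\<Sum>k<M. skip j (A j) k * skip j y k r)"
    using i' z by (subst (2) sum.remove[of _ i']) auto
   also have "\<dots> = w r" using skip_eq[of j "A j"] A0 A that ij by simp
   finally show ?thesis by simp
  qed
  from dt_unique[OF genw[OF ij(1) i'(1)] this i'(1)] show False by simp
 qed
 \<comment> \<open>The parameter at which the i-th coefficient vanishes on the line of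
   representations, run through from \<open>A 0\<close> in direction - \<open>?l\<close>.\<close>
 define t where "t i = A 0 i / ?l i" for i
 have Aj: "A j i = ?l i * (t i - t j)" if ij: "j <= M" "i <= M" for i j
 proof -
  have "A j i = A 0 i - t j * ?l i"
  proof (rule uniq[OF ij(1) _ _ ij(2)])
   show "A j j = 0" using A0 ij by simp
   show "A 0 j - t j * ?l j = 0" using l0[OF ij(1)] by (simp add: t_def)
   fix r assume r: "r < M"
   have "(\<Sum>i\<le>M. (A 0 i - t j * ?l i) * y i r) = (\<Sum>i\<le>M. A 0 i * y i r) - t j * (\<Sum>i\<le>M. ?l i * y i r)"
    by (simp add: left_diff_distrib sum_subtractf sum_distrib_left mult.assoc)
   then show "(\<Sum>i\<le>M. A j i * y i r) = (\<Sum>i\<le>M. (A 0 i - t j * ?l i) * y i r)"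
    using A[OF ij(1) r] A[of 0 r] r minor_relation[OF r, of y] by simp
  qed
  moreover have "?l i * t i = A 0 i" using l0[OF ij(2)] by (simp add: t_def)
  ultimately show ?thesis by (simp add: right_diff_distrib mult.commute)
 qed
 have tinj: "inj_on t {..M}"
 proof (rule inj_onI)
  fix i j assume "i \<in> {..M}" "j \<in> {..M}" "t i = t j"
  then show "i = j" using Aj[of j i] Anz[of j i] by (cases "i = j") auto
 qed
 have "(- 1) ^ j * psi M w (skip j y) = (if \<forall>i\<le>M. i ~= j --> ?l i * (t i - t j) > 0 then sgi (?l j) else 0)"
  if j: "j <= M" for j
 proof -
  have "(\<exists>c. (\<forall>i<M. c i > 0) \<and> (\<forall>r<M. (\<Sum>i<M. c i * skip j y i r) = w r)) \<longleftrightarrow>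
   (\<forall>i\<le>M. i ~= j --> ?l i * (t i - t j) > 0)" (is "?L \<longleftrightarrow> ?R")
  proof
   assume ?L
   then obtain c where c: "\<forall>i<M. c i > 0" "\<forall>r<M. (\<Sum>i<M. c i * skip j y i r) = w r" by blast
   show ?R
   proof (intro allI impI)
    fix i assume i: "i <= M" "i ~= j"
    obtain i' where i': "i' < M" "\<forall>b :: nat => real. skip j b i' = b i" using skip_ex[OF j i] by blast
    have "(\<Sum>k<M. (c k - skip j (A j) k) * skip j y k r) = 0" if "r < M" for r
     using c(2) that skip_eq[of j "A j" r] A0[OF j] A[OF j that] j by (simp add: left_diff_distrib sum_subtractf)
    from dt_unique[OF gen[OF j] this i'(1)] have "c i' = A j i" using i'(2) by simp
    then show "?l i * (t i - t j) > 0" using c(1) i'(1) Aj[OF j i(1)] by metis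
   qed
  next
   assume R: ?R
   have "skip j (A j) i > 0" if "i < M" for i
    using R Aj[OF j] that j by (auto simp: skip_def)
   moreover have "\<forall>r<M. (\<Sum>i<M. skip j (A j) i * skip j y i r) = w r" using skip_eq[of j "A j"] A0 A j by simp
   ultimately show ?L by blast
  qed
  then have "psi M w (skip j y) = (if \<forall>i\<le>M. i ~= j --> ?l i * (t i - t j) > 0 then sgi (dt M (skip j y)) else 0)"
   unfolding psi_def by (simp only:)
  then show ?thesis using sgi_pm[of j "dt M (skip j y)"] unfolding minor_def[of M y j] by (simp only: if_distrib[of "%x. (- 1) ^ j * x"] mult_zero_right)
 qed
 then have "(\<Sum>j\<le>M. (- 1) ^ j * psi M w (skip j y)) = (\<Sum>j\<le>M. if \<forall>i\<le>M. i ~= j --> ?l i * (t i - t j) > 0 then sgi (?l j) else 0)"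
  by (intro sum.cong) auto
 also have "\<dots> = Phi M y" unfolding Phi_def by (rule signed_endpoint_count[OF l0 tinj])
 finally show ?thesis .
qed

lemma Phi_permute:
 assumes "\<tau> permutes {0..<M}"
 shows "Phi M (%k r. y k (\<tau> r)) = sign \<tau> * Phi M y"
proof -
 have "minor M (%k r. y k (\<tau> r)) j = of_int (sign \<tau>) * minor M y j" for j
 proof -
  have "skip j (%k r. y k (\<tau> r)) = (%i r. skip j y i (\<tau> r))" by (auto simp: skip_def)
  then show ?thesis using dt_permute_coords[OF assms, of "skip j y"] by (simp add: minor_def)
 qed
 then have *: "Phi M (%k r. y k (\<tau> r)) = (if \<forall>j\<le>M. of_int (sign \<tau>) * minor M y j > 0 then 1
  else if \<forall>j\<le>M. of_int (sign \<tau>) * minor M y j < 0 then - 1 else 0)" unfolding Phi_def by (simp only:)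
 have n: "\<not> (\<forall>j\<le>M. minor M y j < 0)" if "\<forall>j\<le>M. minor M y j > 0" using that by (auto intro!: exI[of _ 0] simp: not_less less_imp_le)
 show ?thesis
 proof (cases "sign \<tau> = 1")
  case True
  then show ?thesis using * by (simp add: Phi_def)
 next
  case False
  then have "sign \<tau> = - 1" using sign_cases by blast
  then show ?thesis using * n by (simp add: Phi_def)
 qed
qed

lemma Phi_convex:
 assumes "Phi M y ~= 0"
 obtains c where "\<And>j. j <= M ==> c j > 0" "(\<Sum>j\<le>M. c j) = 1" "\<And>r. r < M ==> (\<Sum>j\<le>M. c j * y j r) = 0"
proof -
 obtain e :: real where e: "\<And>j. j <= M ==> e * minor M y j > 0"
 proof (cases "\<forall>j\<le>M. minor M y j > 0")
  case True
  then show ?thesis using that[of 1] by simp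
 next
  case False
  then show ?thesis using assms that[of "- 1"] by (auto simp: Phi_def split: if_splits)
 qed
 define S where "S = (\<Sum>j\<le>M. e * minor M y j)"
 have S: "S > 0" unfolding S_def using e by (intro sum_pos) auto
 show ?thesis
 proof (rule that[of "%j. e * minor M y j / S"])
  show "e * minor M y j / S > 0" if "j <= M" for j using e that S by simp
  show "(\<Sum>j\<le>M. e * minor M y j / S) = 1" using S by (simp add: sum_divide_distrib[symmetric] S_def)
  fix r assume "r < M"
  have "(\<Sum>j\<le>M. e * minor M y j / S * y j r) = e / S * (\<Sum>j\<le>M. minor M y j * y j r)"
   by (simp add: sum_distrib_left algebra_simps)
  then show "(\<Sum>j\<le>M. e * minor M y j / S * y j r) = 0" using minor_relation[OF \<open>r < M\<close>] by simp
 qed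
qed

section \<open>Kuhn's triangulation and the cancellation of its facets\<close>

definition kv :: "(nat => int) => (nat => nat) => nat => nat => int" where
 "kv g \<pi> k = (%i. g i + (if i \<in> \<pi> ` {..<k} then 1 else 0))"

text \<open>The simplex (g, \<pi>) starts at g and takes unit steps in the directions \<pi> 0, \<pi>
  1, and so on. Without its first vertex it is the simplex started one step later, with steps in the
  order \<pi> composed with this cycle, without its last vertex.\<close>

definition rot :: "nat => nat => nat" where
 "rot M i = (if Suc i < M then Suc i else if Suc i = M then 0 else i)"

lemma rot_permutes_sign: "M > 0 ==> rot M permutes {0..<M} \<and> sign (rot M) = (- 1) ^ (M - 1)"
proof (induction M rule: nat_induct_non_zero)
 case 1
 have "rot 1 = id" by (auto simp: rot_def fun_eq_iff)
 then show ?case by (auto simp: permutes_id sign_id)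
next
 case (Suc M)
 have e: "rot (Suc M) = Transposition.transpose 0 M \<circ> rot M"
  using Suc.hyps by (auto simp: rot_def fun_eq_iff Transposition.transpose_def)
 have p1: "rot M permutes {0..<Suc M}" using Suc.IH by (auto elim: permutes_subset)
 have p2: "Transposition.transpose 0 M permutes {0..<Suc M}" by (rule permutes_swap_id) auto
 have "sign (rot (Suc M)) = sign (Transposition.transpose 0 M) * sign (rot M)"
  unfolding e by (rule sign_compose) (use p1 p2 in \<open>auto intro: permutation_permutes[THEN iffD2]\<close>)
 also have "\<dots> = (- 1) ^ (Suc M - 1)" using Suc by (cases M) (auto simp: sign_swap_id)
 finally show ?case using permutes_compose[OF p1 p2] unfolding e by blast
qed

definition zbox :: "nat => int => (nat => int) set" where
 "zbox M L = {g. (\<forall>i<M. \<bar>g i\<bar> <= L) \<and> (\<forall>i\<ge>M. g i = 0)}"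

lemma finite_zbox [simp]: "finite (zbox M L)"
proof -
 have "zbox M L \<subseteq> {g. \<forall>i. (i \<in> {..<M} --> g i \<in> {- L..L}) \<and> (i \<notin> {..<M} --> g i = 0)}"
  by (auto simp: zbox_def abs_le_iff)
 moreover have "finite \<dots>" by (rule finite_set_of_finite_funs) auto
 ultimately show ?thesis by (rule finite_subset)
qed

text \<open>Each facet occurs twice with opposite signs: a middle one for \<pi> and for \<pi> after
  the transposition of k - 1 and k, the one opposite vertex 0 as the last facet of the simplex one
  step ahead. Facets at the boundary of the box are killed by \<open>supp\<close>.\<close>

lemma kuhn_boundary:
 fixes \<theta> :: "(nat => nat => int) => int"
 assumes M: "M > 0"
  and cong: "\<And>u v. (\<And>i. i < M ==> u i = v i) ==> \<theta> u = \<theta> v"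
  and supp: "\<And>u. (\<And>i. i < M ==> u i \<notin> zbox M (L - 2)) ==> \<theta> u = 0"
 shows "(\<Sum>g\<in>zbox M L. \<Sum>\<pi> | \<pi> permutes {0..<M}. sign \<pi> * (\<Sum>k\<le>M. (- 1) ^ k * \<theta> (skip k (kv g \<pi>)))) = 0"
proof -
 let ?P = "{\<pi>. \<pi> permutes {0..<M}}"
 have finP: "finite ?P" by (rule finite_permutations) simp
 define T where "T k = (\<Sum>g\<in>zbox M L. \<Sum>\<pi>\<in>?P. sign \<pi> * \<theta> (skip k (kv g \<pi>)))" for k
 have tot: "(\<Sum>g\<in>zbox M L. \<Sum>\<pi>\<in>?P. sign \<pi> * (\<Sum>k\<le>M. (- 1) ^ k * \<theta> (skip k (kv g \<pi>)))) = (\<Sum>k\<le>M. (- 1) ^ k * T k)"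
 proof -
  have "(\<Sum>k\<le>M. (- 1) ^ k * T k) = (\<Sum>k\<le>M. \<Sum>g\<in>zbox M L. \<Sum>\<pi>\<in>?P. sign \<pi> * ((- 1) ^ k * \<theta> (skip k (kv g \<pi>))))"
   unfolding T_def by (simp add: sum_distrib_left mult.left_commute)
  also have "\<dots> = (\<Sum>g\<in>zbox M L. \<Sum>k\<le>M. \<Sum>\<pi>\<in>?P. sign \<pi> * ((- 1) ^ k * \<theta> (skip k (kv g \<pi>))))"
   by (rule sum.swap)
  also have "\<dots> = (\<Sum>g\<in>zbox M L. \<Sum>\<pi>\<in>?P. \<Sum>k\<le>M. sign \<pi> * ((- 1) ^ k * \<theta> (skip k (kv g \<pi>))))"
   by (intro sum.cong refl) (rule sum.swap)
  finally show ?thesis by (simp add: sum_distrib_left)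
 qed
 have mid: "T k = 0" if k: "0 < k" "k < M" for k
 proof -
  let ?t = "Transposition.transpose (k - 1) k"
  have pt: "?t permutes {0..<M}" by (rule permutes_swap_id) (use k in auto)
  have st: "sign ?t = - 1" using k by (simp add: sign_swap_id)
  have "(\<Sum>\<pi>\<in>?P. sign \<pi> * \<theta> (skip k (kv g \<pi>))) = - (\<Sum>\<pi>\<in>?P. sign \<pi> * \<theta> (skip k (kv g \<pi>)))" for g
  proof -
   have "(\<Sum>\<pi>\<in>?P. sign \<pi> * \<theta> (skip k (kv g \<pi>))) = (\<Sum>\<pi>\<in>?P. sign (\<pi> \<circ> ?t) * \<theta> (skip k (kv g (\<pi> \<circ> ?t))))"
    by (rule sum_permutations_compose_right[OF pt])
   also have "\<dots> = (\<Sum>\<pi>\<in>?P. - (sign \<pi> * \<theta> (skip k (kv g \<pi>))))"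
   proof (rule sum.cong[OF refl])
    fix \<pi> assume "\<pi> \<in> ?P"
    then have "sign (\<pi> \<circ> ?t) = sign \<pi> * sign ?t"
     using pt by (intro sign_compose) (auto intro: permutation_permutes[THEN iffD2])
    moreover have "\<theta> (skip k (kv g (\<pi> \<circ> ?t))) = \<theta> (skip k (kv g \<pi>))"
    proof (rule cong)
     fix i assume "i < M"
     have im: "?t ` {..<j} = {..<j}" if "j ~= k" for j
     proof -
      have "(k - 1 \<in> {..<j}) = (k \<in> {..<j})" using that k by auto
      then show ?thesis by (rule transpose_image_eq)
     qed
     have "(\<pi> \<circ> ?t) ` {..<j} = \<pi> ` {..<j}" if "j ~= k" for j
      by (simp only: image_comp[symmetric] im[OF that])
     then have "kv g (\<pi> \<circ> ?t) j = kv g \<pi> j" if "j ~= k" for j using that unfolding kv_def by simp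
     then show "skip k (kv g (\<pi> \<circ> ?t)) i = skip k (kv g \<pi>) i" unfolding skip_def by auto
    qed
    ultimately show "sign (\<pi> \<circ> ?t) * \<theta> (skip k (kv g (\<pi> \<circ> ?t))) = - (sign \<pi> * \<theta> (skip k (kv g \<pi>)))" using st by simp
   qed
   finally show ?thesis by (simp add: sum_negf)
  qed
  then have "(\<Sum>\<pi>\<in>?P. sign \<pi> * \<theta> (skip k (kv g \<pi>))) = 0" for g by (metis equal_neg_zero)
  then show ?thesis unfolding T_def by simp
 qed
 define \<theta>' where "\<theta>' g \<pi> = \<theta> (kv g \<pi>)" for g \<pi>
 have TM: "T M = (\<Sum>\<pi>\<in>?P. sign \<pi> * (\<Sum>g\<in>zbox M L. \<theta>' g \<pi>))"
 proof -
  have "\<theta> (skip M (kv g \<pi>)) = \<theta>' g \<pi>" for g \<pi>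
   unfolding \<theta>'_def by (rule cong) (simp add: skip_def)
  then show ?thesis unfolding T_def by (subst sum.swap) (simp add: sum_distrib_left)
 qed
 have r: "rot M permutes {0..<M}" "sign (rot M) = (- 1) ^ (M - 1)" using rot_permutes_sign[OF M] by auto
 have T0: "T 0 = (\<Sum>\<pi>\<in>?P. sign \<pi> * (\<Sum>g\<in>zbox M L. \<theta>' g (\<pi> \<circ> rot M)))"
 proof -
  have "\<theta> (skip 0 (kv g \<pi>)) = \<theta>' (g(\<pi> 0 := g (\<pi> 0) + 1)) (\<pi> \<circ> rot M)" if "\<pi> \<in> ?P" for g \<pi>
   unfolding \<theta>'_def
  proof (rule cong)
   fix i assume i: "i < M"
   have "{..<Suc i} = insert 0 (rot M ` {..<i})"
   proof -
    have "rot M ` {..<i} = Suc ` {..<i}" using i by (intro image_cong) (auto simp: rot_def)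
    then show ?thesis by (simp add: lessThan_Suc_eq_insert_0)
   qed
   then have im: "\<pi> ` {..<Suc i} = insert (\<pi> 0) ((\<pi> \<circ> rot M) ` {..<i})" by (simp add: image_comp)
   have inj: "inj \<pi>" using that permutes_inj by blast
   have "\<pi> 0 \<notin> (\<pi> \<circ> rot M) ` {..<i}" using i by (auto simp: rot_def inj_eq[OF inj])
   then show "skip 0 (kv g \<pi>) i = kv (g(\<pi> 0 := g (\<pi> 0) + 1)) (\<pi> \<circ> rot M) i"
    unfolding skip_def kv_def using im by (auto simp: fun_eq_iff)
  qed
  \<comment> \<open>The shift of the base by one unit does not change the sum: only bases in
    \<open>?B\<close> count, and \<open>zbox M L\<close> has one more layer around them.\<close>
  moreover have "(\<Sum>g\<in>zbox M L. \<theta>' (g(a := g a + 1)) \<sigma>) = (\<Sum>g\<in>zbox M L. \<theta>' g \<sigma>)" if a: "a < M" and s: "\<sigma> \<in> ?P" for a \<sigma>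
  proof -
   let ?B = "zbox M (L - 1)"
   let ?f = "%g::nat => int. g(a := g a + 1)"
   have z: "\<theta>' g \<sigma> = 0" if "g \<notin> ?B" for g
    unfolding \<theta>'_def
   proof (rule supp)
    fix i assume "i < M"
    show "kv g \<sigma> i \<notin> zbox M (L - 2)"
    proof
     assume k: "kv g \<sigma> i \<in> zbox M (L - 2)"
     have "\<bar>g j\<bar> <= L - 1" if "j < M" for j
      using k that unfolding zbox_def kv_def by (auto dest!: spec[of _ j] split: if_splits)
     moreover have "g j = 0" if "j >= M" for j
     proof -
      have "\<sigma> ` {..<i} \<subseteq> {0..<M}" using s \<open>i < M\<close> permutes_image[of \<sigma> "{0..<M}"] by fastforce
      then have "j \<notin> \<sigma> ` {..<i}" using that by auto
      then show ?thesis using k that unfolding zbox_def kv_def by (auto dest!: spec[of _ j])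
     qed
     ultimately show False using \<open>g \<notin> ?B\<close> by (auto simp: zbox_def)
    qed
   qed
   have "(\<Sum>g\<in>zbox M L. \<theta>' (?f g) \<sigma>) = (\<Sum>g\<in>{g\<in>zbox M L. ?f g \<in> ?B}. \<theta>' (?f g) \<sigma>)"
    by (rule sum.mono_neutral_right) (auto intro: z)
   also have "\<dots> = (\<Sum>g\<in>?B. \<theta>' g \<sigma>)"
   proof (rule sum.reindex_bij_witness[where i = "%g. g(a := g a - 1)" and j = ?f])
    fix b assume b: "b \<in> ?B"
    then have "\<bar>b i\<bar> <= L - 1" if "i < M" for i using that by (simp add: zbox_def)
    then have "\<bar>(b(a := b a - 1)) i\<bar> <= L" if "i < M" for i using that by (cases "i = a") (force, smt (verit) fun_upd_other)
    then have "b(a := b a - 1) \<in> zbox M L" using a b unfolding zbox_def by simp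
    then show "b(a := b a - 1) \<in> {g\<in>zbox M L. ?f g \<in> ?B}" using b by simp
   qed auto
   also have "\<dots> = (\<Sum>g\<in>zbox M L. \<theta>' g \<sigma>)"
   proof (rule sum.mono_neutral_left)
    show "?B \<subseteq> zbox M L" by (force simp: zbox_def)
   qed (auto intro: z)
   finally show ?thesis .
  qed
  ultimately have "(\<Sum>g\<in>zbox M L. \<theta> (skip 0 (kv g \<pi>))) = (\<Sum>g\<in>zbox M L. \<theta>' g (\<pi> \<circ> rot M))" if "\<pi> \<in> ?P" for \<pi>
   using that M permutes_compose[OF r(1)] by (simp add: permutes_nat_less)
  then have "(\<Sum>\<pi>\<in>?P. sign \<pi> * (\<Sum>g\<in>zbox M L. \<theta> (skip 0 (kv g \<pi>)))) = (\<Sum>\<pi>\<in>?P. sign \<pi> * (\<Sum>g\<in>zbox M L. \<theta>' g (\<pi> \<circ> rot M)))"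
   by (intro sum.cong refl) simp
  then show ?thesis unfolding T_def by (subst sum.swap) (simp add: sum_distrib_left)
 qed
 have "T M = (\<Sum>\<pi>\<in>?P. sign (\<pi> \<circ> rot M) * (\<Sum>g\<in>zbox M L. \<theta>' g (\<pi> \<circ> rot M)))"
  unfolding TM by (rule sum_permutations_compose_right[OF r(1)])
 also have "\<dots> = (\<Sum>\<pi>\<in>?P. (- 1) ^ (M - 1) * (sign \<pi> * (\<Sum>g\<in>zbox M L. \<theta>' g (\<pi> \<circ> rot M))))"
 proof (rule sum.cong[OF refl])
  fix \<pi> assume "\<pi> \<in> ?P"
  then have "sign (\<pi> \<circ> rot M) = sign \<pi> * sign (rot M)"
   using r by (intro sign_compose) (auto intro: permutation_permutes[THEN iffD2])
  then show "sign (\<pi> \<circ> rot M) * (\<Sum>g\<in>zbox M L. \<theta>' g (\<pi> \<circ> rot M)) = (- 1) ^ (M - 1) * (sign \<pi> * (\<Sum>g\<in>zbox M L. \<theta>' g (\<pi> \<circ> rot M)))"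
   using r(2) by simp
 qed
 finally have "T M = (- 1) ^ (M - 1) * T 0" unfolding T0 by (simp add: sum_distrib_left)
 \<comment> \<open>(- 1) ^ M times the sign of \<open>rot M\<close> is - 1.\<close>
 then have ends: "T 0 + (- 1) ^ M * T M = 0"
  using M by (cases M) (simp_all flip: power_add mult.assoc)
 have "(\<Sum>k\<le>M. (- 1) ^ k * T k) = (\<Sum>k\<in>{0, M}. (- 1) ^ k * T k)"
  using mid by (intro sum.mono_neutral_right) (auto simp: order_le_less)
 also have "\<dots> = 0" using ends M by simp
 finally show ?thesis using tot by simp
qed

section \<open>General position by powers of two with spread exponents\<close>

lemma sum_distinct_powers_nonzero:
 fixes e :: "'a => nat" and s :: "'a => int"
 assumes "finite S" "S ~= {}" "inj_on e S" "\<And>x. x \<in> S ==> s x = 1 \<or> s x = - 1"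
 shows "(\<Sum>x\<in>S. s x * 2 ^ e x) ~= 0"
proof -
 \<comment> \<open>The largest power dominates, since all smaller ones together add up to
   less.\<close>
 obtain m where m: "m \<in> S" "\<And>x. x \<in> S ==> e x <= e m"
  using finite_ranking_induct[OF assms(1)] Max_in[of "e ` S"] Max_ge[of "e ` S"] assms(1,2)
  by (metis (no_types, lifting) finite_imageI imageE image_eqI image_is_empty)
 have lt: "e x < e m" if "x \<in> S - {m}" for x
  using m(2)[of x] that inj_onD[OF assms(3), of x m] m(1) by (auto simp: order_le_less)
 have "\<bar>\<Sum>x\<in>S - {m}. s x * 2 ^ e x\<bar> <= (\<Sum>x\<in>S - {m}. \<bar>s x * 2 ^ e x\<bar>)" by (rule sum_abs)
 also have "\<dots> = (\<Sum>x\<in>S - {m}. 2 ^ e x)"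
 proof (rule sum.cong[OF refl])
  fix x assume "x \<in> S - {m}"
  then show "\<bar>s x * 2 ^ e x\<bar> = 2 ^ e x" using assms(4)[of x] by (auto simp: abs_mult)
 qed
 also have "\<dots> = (\<Sum>k\<in>e ` (S - {m}). 2 ^ k)"
  using inj_on_subset[OF assms(3)] by (subst sum.reindex) auto
 also have "\<dots> <= (\<Sum>k<e m. 2 ^ k)"
  by (rule sum_mono2) (use lt in auto)
 also have "(\<Sum>k<n. 2 ^ k) < (2::int) ^ n" for n by (induction n) auto
 finally have "\<bar>\<Sum>x\<in>S - {m}. s x * 2 ^ e x\<bar> < 2 ^ e m" .
 moreover have "(\<Sum>x\<in>S. s x * 2 ^ e x) = s m * 2 ^ e m + (\<Sum>x\<in>S - {m}. s x * 2 ^ e x)"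
  by (rule sum.remove[OF assms(1) m(1)])
 moreover have "\<bar>s m * 2 ^ e m\<bar> = 2 ^ e m" using assms(4)[OF m(1)] by (auto simp: abs_mult)
 ultimately show ?thesis by linarith
qed

text \<open>Doubly exponential, so that a product over distinct codes is 2 to the binary encoding of
  the set of codes: the product remembers the set.\<close>

definition huge :: "nat => real" where "huge n = 2 ^ (2 ^ n)"

text \<open>The Leibniz terms are signed powers of two whose exponents encode the code sets picked
  by the permutations. Injective codes make these sets, hence the exponents, pairwise
  different.\<close>

lemma dt_huge_nonzero:
 assumes inj: "inj_on (%(i, r). c i r) ({..<M} \<times> {..<M})"
 shows "dt M (%i r. huge (c i r)) ~= 0"
proof -
 let ?P = "{p. p permutes {0..<M}}"
 define A where "A p = (%i. c i (p i)) ` {0..<M}" for p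
 define e where "e p = set_encode (A p)" for p
 have prod: "(\<Prod>i = 0..<M. huge (c i (p i))) = 2 ^ e p" if "p \<in> ?P" for p
 proof -
  have p: "p i < M" if "i < M" for i using that \<open>p \<in> ?P\<close> permutes_in_image[of p "{0..<M}" i] by auto
  have inj': "inj_on (%i. c i (p i)) {0..<M}"
  proof (rule inj_onI)
   fix i j assume "i \<in> {0..<M}" "j \<in> {0..<M}" "c i (p i) = c j (p j)"
   then show "i = j" using inj_onD[OF inj, of "(i, p i)" "(j, p j)"] p by auto
  qed
  have "(\<Prod>i = 0..<M. huge (c i (p i))) = 2 ^ (\<Sum>i = 0..<M. 2 ^ c i (p i))"
   by (simp add: huge_def power_sum)
  also have "(\<Sum>i = 0..<M. 2 ^ c i (p i)) = e p"
   unfolding e_def A_def set_encode_def by (subst sum.reindex[OF inj']) auto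
  finally show ?thesis .
 qed
 have "inj_on e ?P"
 proof (rule inj_onI)
  fix p q assume pq: "p \<in> ?P" "q \<in> ?P" "e p = e q"
  have AA: "A p = A q" using pq(3) inj_on_set_encode unfolding e_def by (auto simp: inj_on_def A_def)
  show "p = q"
  proof
   fix i
   show "p i = q i"
   proof (cases "i < M")
    case True
    have "c i (p i) \<in> A q" using True AA by (auto simp: A_def)
    then obtain j where j: "j < M" "c i (p i) = c j (q j)" by (auto simp: A_def)
    have "p i < M" "q j < M" using pq True j permutes_in_image[of _ "{0..<M}"] by auto
    then show ?thesis using inj_onD[OF inj, of "(i, p i)" "(j, q j)"] True j by auto
   next
    case False
    then show ?thesis using pq by (simp add: permutes_not_in)
   qed
  qed
 qed
 moreover have "id \<in> ?P" by (simp add: permutes_id)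
 ultimately have "(\<Sum>p\<in>?P. sign p * 2 ^ e p) ~= (0::int)"
 proof (intro sum_distinct_powers_nonzero)
  show "finite ?P" by (rule finite_permutations) simp
  show "?P ~= {}" using \<open>id \<in> ?P\<close> by blast
 qed (simp_all add: sign_def)
 moreover have "dt M (%i r. huge (c i r)) = of_int (\<Sum>p\<in>?P. sign p * 2 ^ e p)"
  unfolding dt_leibniz of_int_sum by (intro sum.cong refl) (simp add: prod)
 ultimately show ?thesis by (simp only: of_int_eq_0_iff not_False_eq_True)
qed

text \<open>The determinant is a polynomial in s with \<open>dt M B\<close> as coefficient of s ^ M.
  That it is not the zero polynomial is read off by dividing by s ^ M and letting s tend to
  infinity.\<close>

lemma dt_perturb:
 assumes B: "dt M B ~= 0"
 shows "finite {s. dt M (%i r. A i r + s * B i r) = 0}"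
proof -
 let ?P = "{p. p permutes {0..<M}}"
 define q where "q = (\<Sum>p\<in>?P. Polynomial.smult (of_int (sign p)) (\<Prod>i = 0..<M. [:A i (p i), B i (p i):]))"
 have ev: "poly q s = dt M (%i r. A i r + s * B i r)" for s
  unfolding dt_leibniz q_def by (simp add: poly_sum poly_prod mult.commute)
 have "q ~= 0"
 proof
  assume q: "q = 0"
  have "((%s::real. dt M (%i r. A i r * (1 / s) + B i r)) \<longlongrightarrow> dt M (%i r. A i r * 0 + B i r)) at_top"
   unfolding dt_leibniz by (intro tendsto_intros tendsto_divide_0[OF tendsto_const] filterlim_at_top_imp_at_infinity filterlim_ident)
  moreover have "dt M (%i r. A i r * (1 / s) + B i r) = 0" if "s > 0" for s
  proof -
   have "dt M (%i r. A i r * (1 / s) + B i r) = (1 / s) ^ M * dt M (%i r. A i r + s * B i r)"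
    unfolding dt_leibniz sum_distrib_left
   proof (intro sum.cong refl)
    fix p
    have "(1 / s) ^ M * (\<Prod>i = 0..<M. A i (p i) + s * B i (p i)) = (\<Prod>i = 0..<M. (1 / s) * (A i (p i) + s * B i (p i)))"
     by (simp only: prod.distrib) simp
    also have "\<dots> = (\<Prod>i = 0..<M. A i (p i) * (1 / s) + B i (p i))"
     using that by (intro prod.cong refl) (simp add: field_simps)
    finally show "of_int (sign p) * (\<Prod>i = 0..<M. A i (p i) * (1 / s) + B i (p i)) =
     (1 / s) ^ M * (of_int (sign p) * (\<Prod>i = 0..<M. A i (p i) + s * B i (p i)))" by simp
   qed
   then show ?thesis using ev[of s] q by (simp only: poly_0 mult_zero_right)
  qed
  then have "eventually (%s. dt M (%i r. A i r * (1 / s) + B i r) = 0) at_top"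
   by (intro eventually_mono[OF eventually_gt_at_top[of 0]])
  ultimately have "((%s::real. 0::real) \<longlongrightarrow> dt M (%i r. A i r * 0 + B i r)) at_top"
   by (rule Lim_transform_eventually)
  then have "dt M (%i r. A i r * 0 + B i r) = 0" by (simp add: tendsto_const_iff)
  then show False using B by simp
 qed
 from poly_roots_finite[OF this] show ?thesis by (simp add: ev)
qed

lemma finite_avoid_small:
 fixes Z :: "real set"
 assumes "finite Z"
 obtains s0 where "s0 > 0" "\<And>s. 0 < s ==> s < s0 ==> s \<notin> Z"
proof -
 let ?Z = "insert 1 {z\<in>Z. z > 0}"
 have "finite ?Z" using assms by simp
 then have "Min ?Z \<in> ?Z" by (rule Min_in) simp
 then have "Min ?Z > 0" by auto
 moreover have "s \<notin> Z" if "0 < s" "s < Min ?Z" for s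
  using Min_le[OF \<open>finite ?Z\<close>, of s] that by auto
 ultimately show ?thesis using that by blast
qed

text \<open>The barycentre of the Kuhn simplex (0, id): coordinate r equals 1 at M - r of its M + 1
  vertices and 0 at the others.\<close>

definition y0 :: "nat => nat => real" where "y0 M r = (real M - real r) / (real M + 1)"

text \<open>Reference labels whose degree can be computed by hand: the identity far out, but
  translated near the origin so that the zero is the barycentre of one simplex rather than a vertex
  of many.\<close>

definition b0 :: "nat => (nat => int) => nat => real" where
 "b0 M g r = (if g \<in> zbox M 3 then of_int (g r) - y0 M r else of_int (g r))"

lemma kv_at_perm:
 assumes "\<pi> permutes {0..<M}"
 shows "kv g \<pi> k (\<pi> i) = g (\<pi> i) + (if i < k then 1 else 0)"
 using permutes_inj[OF assms] by (auto simp: kv_def inj_image_mem_iff)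

text \<open>On a simplex that leaves the box of radius 3, some coordinate of the labels has constant
  sign. On any other, a zero of the interpolated labels means a point close to \<open>y0\<close>;
  the coordinates of \<open>y0\<close> lie strictly between 0 and 1 and are 1 / (M + 1) apart, which
  exceeds the error, so they determine both the base and the order of the steps.\<close>

lemma near_id_unique:
 assumes ne: "Phi M (%k r. b0 M (kv g \<pi> k) r + e k r) ~= 0"
  and e: "\<And>k r. k <= M ==> r < M ==> \<bar>e k r\<bar> <= 1 / (8 * (real M + 1))"
  and p: "\<pi> permutes {0..<M}" and g: "\<And>r. r >= M ==> g r = 0"
 shows "g = (%_. 0) \<and> \<pi> = id"
proof -
 obtain c where c: "\<And>j. j <= M ==> c j > 0" "(\<Sum>j\<le>M. c j) = 1"
  "\<And>r. r < M ==> (\<Sum>k\<le>M. c k * (b0 M (kv g \<pi> k) r + e k r)) = 0"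
  using Phi_convex[OF ne] by blast
 define t where "t = 1 / (8 * (real M + 1))"
 have t: "t <= 1 / 8" "t > 0" "t < 1 / (real M + 1)" by (auto simp: t_def field_simps)
 note e = e[folded t_def]
 have y0: "y0 M r >= 1 / (real M + 1)" "y0 M r <= 1 - 1 / (real M + 1)" if "r < M" for r
  using that by (auto simp: y0_def field_simps)
 have y01: "0 < y0 M r" "y0 M r < 1" if "r < M" for r
  using that by (auto simp: y0_def field_simps)
 have kvM: "kv g \<pi> k r = 0" if "r >= M" "k <= M" for k r
 proof -
  have "\<pi> ` {..<k} \<subseteq> {0..<M}" using p that(2) permutes_image[OF p] by fastforce
  then show ?thesis using that g by (auto simp: kv_def)
 qed
 have nosign: False if r: "r < M" and s: "\<And>k. k <= M ==> a * (b0 M (kv g \<pi> k) r + e k r) > 0" for a r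
 proof -
  have "(\<Sum>k\<le>M. c k * (a * (b0 M (kv g \<pi> k) r + e k r))) > 0"
   using c(1) s by (intro sum_pos) (simp_all only: atMost_iff mult_pos_pos finite_atMost, auto)
  moreover have "(\<Sum>k\<le>M. c k * (a * (b0 M (kv g \<pi> k) r + e k r))) = a * (\<Sum>k\<le>M. c k * (b0 M (kv g \<pi> k) r + e k r))"
   by (simp add: sum_distrib_left algebra_simps)
  ultimately show False using c(3)[OF r] by simp
 qed
 have all3: "kv g \<pi> k \<in> zbox M 3" if k: "k <= M" for k
 proof (rule ccontr)
  assume "kv g \<pi> k \<notin> zbox M 3"
  then obtain r where r: "r < M" "\<bar>kv g \<pi> k r\<bar> > 3" using kvM k by (auto simp: zbox_def not_le)
  have d: "kv g \<pi> k' r = g r \<or> kv g \<pi> k' r = g r + 1" for k' by (auto simp: kv_def)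
  have b: "b0 M (kv g \<pi> k') r >= of_int (kv g \<pi> k' r) - 1" "b0 M (kv g \<pi> k') r <= of_int (kv g \<pi> k' r)" for k'
   using y01[OF r(1)] by (auto simp: b0_def)
  show False
  proof (cases "kv g \<pi> k r > 3")
   case True
   show False
   proof (rule nosign[OF r(1), of 1])
    fix k' assume k': "k' <= M"
    have "kv g \<pi> k' r >= 3" using d[of k'] d[of k] True by auto
    then have "real_of_int (kv g \<pi> k' r) >= 3" by linarith
     then have "b0 M (kv g \<pi> k') r >= 2" using b(1)[of k'] by linarith
     moreover have "- (e k' r) <= 1 / 8" using e[OF k' r(1)] t(1) by (meson abs_le_D2 order_trans)
     ultimately show "1 * (b0 M (kv g \<pi> k') r + e k' r) > 0" by simp
   qed
  next
   case False
   show False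
   proof (rule nosign[OF r(1), of "- 1"])
    fix k' assume k': "k' <= M"
    have "kv g \<pi> k' r <= - 3" using d[of k'] d[of k] False r(2) by auto
    then have "real_of_int (kv g \<pi> k' r) <= - 3" by linarith
     then have "b0 M (kv g \<pi> k') r <= - 3" using b(2)[of k'] by linarith
     moreover have "e k' r <= 1 / 8" using e[OF k' r(1)] t(1) by (meson abs_le_D1 order_trans)
     ultimately show "- 1 * (b0 M (kv g \<pi> k') r + e k' r) > 0" by simp
   qed
  qed
 qed
 \<comment> \<open>The fractional part in direction \<pi> i: the weight of the vertices that come
   after the i-th step.\<close>
 define X where "X i = (\<Sum>k\<le>M. if i < k then c k else 0)" for i
 have X01: "0 <= X i" "X i <= 1" for i
 proof -
  show "0 <= X i" unfolding X_def using c(1) by (intro sum_nonneg) (auto intro: less_imp_le)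
  have "X i <= (\<Sum>k\<le>M. c k)" unfolding X_def using c(1) by (intro sum_mono) (auto intro: less_imp_le)
  then show "X i <= 1" using c(2) by simp
 qed
 have Xmono: "X j <= X i" if "i <= j" for i j
  unfolding X_def using c(1) that by (intro sum_mono) (auto intro: less_imp_le)
 have key: "\<bar>of_int (g (\<pi> i)) + X i - y0 M (\<pi> i)\<bar> <= t" if i: "i < M" for i
 proof -
  have r: "\<pi> i < M" using permutes_in_image[OF p, of i] i by simp
  let ?G = "of_int (g (\<pi> i)) - y0 M (\<pi> i)"
  have "c k * (b0 M (kv g \<pi> k) (\<pi> i) + e k (\<pi> i)) = c k * ?G + ((if i < k then c k else 0) + c k * e k (\<pi> i))"
   if "k <= M" for k
  proof -
   have "b0 M (kv g \<pi> k) (\<pi> i) = ?G + (if i < k then 1 else 0)"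
    using all3[OF that] by (simp add: b0_def kv_at_perm[OF p])
   then show ?thesis by (simp only:) (simp add: algebra_simps)
  qed
  then have "(\<Sum>k\<le>M. c k * (b0 M (kv g \<pi> k) (\<pi> i) + e k (\<pi> i))) =
   (\<Sum>k\<le>M. c k * ?G + ((if i < k then c k else 0) + c k * e k (\<pi> i)))"
   by (intro sum.cong) auto
  also have "\<dots> = ?G + (X i + (\<Sum>k\<le>M. c k * e k (\<pi> i)))"
   by (simp only: sum.distrib sum_distrib_right[symmetric] c(2) X_def mult_1)
  finally have "\<bar>of_int (g (\<pi> i)) + X i - y0 M (\<pi> i)\<bar> = \<bar>\<Sum>k\<le>M. c k * e k (\<pi> i)\<bar>" using c(3)[OF r] by linarith
  also have "\<dots> <= (\<Sum>k\<le>M. \<bar>c k * e k (\<pi> i)\<bar>)" by (rule sum_abs)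
  also have "\<dots> <= (\<Sum>k\<le>M. c k * t)"
  proof (rule sum_mono)
   fix k assume "k \<in> {..M}"
   then show "\<bar>c k * e k (\<pi> i)\<bar> <= c k * t" using c(1)[of k] e[OF _ r, of k] by (simp add: abs_mult)
  qed
  also have "\<dots> = t" by (simp only: sum_distrib_right[symmetric] c(2) mult_1)
  finally show ?thesis .
 qed
 have g0: "g (\<pi> i) = 0" if i: "i < M" for i
 proof -
  have r: "\<pi> i < M" using permutes_in_image[OF p, of i] i by simp
  have "of_int (g (\<pi> i)) < (1::real)" "of_int (g (\<pi> i)) > (- 1::real)"
   using key[OF i] X01[of i] y0[OF r] t(3) by linarith+
  then show ?thesis by linarith
 qed
 have "g = (%_. 0)"
 proof
  fix r show "g r = 0"
  proof (cases "r < M")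
   case True
   then obtain i where "i < M" "r = \<pi> i" using permutes_image[OF p] by (metis atLeast0LessThan imageE lessThan_iff)
   then show ?thesis using g0 by simp
  qed (use g in simp)
 qed
 have step: "\<pi> i < \<pi> j" if ij: "i < j" "j < M" for i j
 proof -
  have r: "\<pi> i < M" "\<pi> j < M" using permutes_in_image[OF p] ij by auto
  have "y0 M (\<pi> i) >= y0 M (\<pi> j) - 2 * t"
   using key[of i] key[of j] g0[of i] g0[of j] Xmono[of i j] ij by (simp add: abs_le_iff)
  then have "(real (\<pi> i) - real (\<pi> j)) / (real M + 1) <= 2 * t" by (simp add: y0_def diff_divide_distrib)
  then have "real (\<pi> i) - real (\<pi> j) <= 2 * t * (real M + 1)" by (simp add: pos_divide_le_eq)
  also have "\<dots> = 1 / 4" unfolding t_def by (simp add: add_nonneg_eq_0_iff)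
  finally have "real (\<pi> i) - real (\<pi> j) <= 1 / 4" .
  then have "\<pi> i <= \<pi> j" by linarith
  moreover have "\<pi> i ~= \<pi> j" using permutes_inj[OF p] ij by (auto dest: injD)
  ultimately show ?thesis by simp
 qed
 have "\<pi> i >= i" if "i < M" for i
  using that
 proof (induction i)
  case (Suc i)
  then show ?case using step[of i "Suc i"] by simp
 qed simp
 then have "\<forall>i. i <= \<pi> i" using permutes_not_in[OF p] by (metis atLeastLessThan_iff le_refl zero_le not_less)
 then have "\<pi> = id" using permutes_natset_ge[OF p] by simp
 then show ?thesis using \<open>g = (%_. 0)\<close> by simp
qed

text \<open>Cofactors are nearly proportional to the barycentric coordinates of \<open>y0\<close>,
  all equal to 1 / (M + 1), so they share the sign of their sum S. The error is a fraction of A, the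
  sum of their absolute values, and A is in turn at most 4 / 3 times the absolute value of
  S.\<close>

lemma near_id_value:
 assumes e: "\<And>k r. k <= M ==> r < M ==> \<bar>e k r\<bar> <= 1 / (8 * (real M + 1))"
  and gen: "\<And>j. j <= M ==> dt M (skip j (%k r. b0 M (kv (%_. 0) id k) r + e k r)) ~= 0"
 shows "Phi M (%k r. b0 M (kv (%_. 0) id k) r + e k r) ~= 0"
proof -
 let ?y = "%k r. b0 M (kv (%_. 0) id k) r + e k r"
 define l where "l = minor M ?y"
 define t where "t = 1 / (8 * (real M + 1))"
 have tp: "t > 0" by (simp add: t_def)
 have tM: "t * (real M + 1) = 1 / 8" by (simp add: t_def)
 note e = e[folded t_def]
 have l0: "l j ~= 0" if "j <= M" for j using gen[OF that] by (simp add: l_def minor_def)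
 have yv: "?y k r = (if r < k then 1 else 0) - y0 M r + e k r" if "k <= M" for k r
  using that by (auto simp: b0_def kv_def zbox_def)
 \<comment> \<open>Coordinate i of vertex k is 1 exactly when i < k, so these tail sums are what the
   linear relations determine; consecutive ones differ by a single cofactor.\<close>
 define T where "T i = (\<Sum>k\<le>M. if i < k then l k else 0)" for i
 define S where "S = (\<Sum>k\<le>M. l k)"
 define A where "A = (\<Sum>k\<le>M. \<bar>l k\<bar>)"
 define d where "d i = (if i < M then - (\<Sum>k\<le>M. l k * e k i) else 0)" for i
 have dle: "\<bar>d i\<bar> <= t * A" for i
 proof (cases "i < M")
  case True
  have "\<bar>\<Sum>k\<le>M. l k * e k i\<bar> <= (\<Sum>k\<le>M. \<bar>l k * e k i\<bar>)" by (rule sum_abs)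
  also have "\<dots> <= (\<Sum>k\<le>M. \<bar>l k\<bar> * t)" 
   using e[OF _ True] by (intro sum_mono) (simp add: abs_mult mult_left_mono)
  finally show ?thesis using True by (simp add: d_def A_def sum_distrib_left mult.commute[of _ t])
 next
  case False
  then show ?thesis using tp by (simp add: d_def A_def sum_nonneg)
 qed
 have TM: "T M = 0" unfolding T_def by (intro sum.neutral) auto
 have Teq: "T i = y0 M i * S + d i" if "i <= M" for i
 proof (cases "i < M")
  case True
  have "(\<Sum>k\<le>M. l k * ?y k i) = (\<Sum>k\<le>M. (if i < k then l k else 0) - y0 M i * l k + l k * e k i)"
  proof (rule sum.cong[OF refl])
   fix k assume "k \<in> {..M}"
   then have "?y k i = (if i < k then 1 else 0) - y0 M i + e k i" using yv by simp
   then show "l k * ?y k i = (if i < k then l k else 0) - y0 M i * l k + l k * e k i" by (simp only:) (simp add: algebra_simps)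
  qed
  then have "0 = (\<Sum>k\<le>M. (if i < k then l k else 0) - y0 M i * l k + l k * e k i)"
   using minor_relation[OF True, of ?y] unfolding l_def[symmetric] by simp
  then show ?thesis using True by (simp add: sum.distrib sum_subtractf T_def S_def d_def sum_distrib_left)
 next
  case False
  then show ?thesis using that TM by (simp add: y0_def d_def)
 qed
 have lk: "\<exists>q. l k = S / (real M + 1) + q \<and> \<bar>q\<bar> <= 2 * t * A" if k: "k <= M" for k
 proof (cases k)
  case 0
  have "S = l 0 + T 0"
   unfolding S_def T_def by (subst sum.atMost_shift, subst sum.atMost_shift) simp
  then have "l 0 = S / (real M + 1) + (- d 0)" using Teq[of 0] by (simp add: y0_def field_simps)
  moreover have "\<bar>- d 0\<bar> <= 2 * t * A" using dle[of 0] by linarith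
  ultimately show ?thesis using 0 by blast
 next
  case (Suc m)
  have "(\<Sum>i\<le>M. if m < i then l i else 0) = (\<Sum>i\<le>M. (if Suc m < i then l i else 0) + (if i = Suc m then l i else 0))"
   by (intro sum.cong) auto
  then have "T m = T (Suc m) + l (Suc m)" unfolding T_def using k Suc by (simp add: sum.distrib)
  then have "l k = (y0 M m - y0 M (Suc m)) * S + (d m - d (Suc m))" using Teq[of m] Teq[of "Suc m"] k Suc by (simp add: algebra_simps)
  moreover have "(y0 M m - y0 M (Suc m)) = 1 / (real M + 1)" by (simp add: y0_def diff_divide_distrib[symmetric])
  moreover have "\<bar>d m - d (Suc m)\<bar> <= 2 * t * A" using dle[of m] dle[of "Suc m"] by linarith
  ultimately show ?thesis by auto
 qed
 have Apos: "A > 0" unfolding A_def using l0 by (intro sum_pos) auto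
 have "A <= (\<Sum>k\<le>M. \<bar>S\<bar> / (real M + 1) + 2 * t * A)"
  unfolding A_def[symmetric] apply (subst A_def)
 proof (rule sum_mono)
  fix k assume "k \<in> {..M}"
  then obtain q where q: "l k = S / (real M + 1) + q" "\<bar>q\<bar> <= 2 * t * A" using lk[of k] by auto
  have "\<bar>l k\<bar> <= \<bar>S / (real M + 1)\<bar> + \<bar>q\<bar>" unfolding q(1) by (rule abs_triangle_ineq)
  then show "\<bar>l k\<bar> <= \<bar>S\<bar> / (real M + 1) + 2 * t * A" using q(2) by simp
 qed
 also have "\<dots> = \<bar>S\<bar> + 2 * A * (t * (real M + 1))" proof -
  have "(real M + 1) * (\<bar>S\<bar> / (real M + 1)) = \<bar>S\<bar>" by (simp add: add_nonneg_eq_0_iff)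
  then show ?thesis by (simp add: algebra_simps)
 qed
 also have "\<dots> = \<bar>S\<bar> + A / 4" unfolding tM by simp
 finally have AS: "A <= 4 / 3 * \<bar>S\<bar>" by simp
 then have S0: "S ~= 0" using Apos by auto
 have "l k * S > 0" if k: "k <= M" for k
 proof -
  obtain q where q: "l k = S / (real M + 1) + q" "\<bar>q\<bar> <= 2 * t * A" using lk[OF k] by blast
  have "2 * t * A <= 2 * t * (4 / 3 * \<bar>S\<bar>)" using AS tp by (intro mult_left_mono) auto
  also have "\<dots> < \<bar>S\<bar> / (real M + 1)" using S0 by (simp add: t_def divide_simps)
  finally have "\<bar>q\<bar> < \<bar>S / (real M + 1)\<bar>" using q(2) by simp
  then have "(S > 0 --> l k > 0) \<and> (S < 0 --> l k < 0)" using q(1) by (auto simp: abs_if divide_less_0_iff zero_less_divide_iff split: if_splits)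
  then show ?thesis using S0 by (auto simp: zero_less_mult_iff neq_iff)
 qed
 then show ?thesis using S0 unfolding Phi_def l_def[symmetric] by (auto simp: zero_less_mult_iff neq_iff)
qed


lemma dt_generic:
 assumes "finite J" and inj: "\<And>A c. (A, c) \<in> J ==> inj_on (%(i, r). c i r) ({..<M} \<times> {..<M})"
 shows "\<exists>s0>0. \<forall>s A c. 0 < s --> s < s0 --> (A, c) \<in> J --> dt M (%i r. A i r + s * huge (c i r)) ~= 0"
proof -
 have "finite (\<Union>(A, c)\<in>J. {s. dt M (%i r. A i r + s * huge (c i r)) = 0})"
  using assms(1) dt_perturb[OF dt_huge_nonzero[OF inj]] by (intro finite_UN_I) auto
 from finite_avoid_small[OF this] obtain s0 where "s0 > 0"
  "\<And>s. 0 < s ==> s < s0 ==> s \<notin> (\<Union>(A, c)\<in>J. {s. dt M (%i r. A i r + s * huge (c i r)) = 0})" by blast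
 then show ?thesis by (intro exI[of _ s0]) auto
qed

text \<open>Labels that agree with the identity near the boundary of the box have degree one;
 the perturbation by \<open>huge\<close> brings the labels into general position without breaking any symmetry
 of the codes.\<close>

theorem kuhn_degree_one:
 fixes b :: "(nat => int) => nat => real" and code :: "(nat => int) => nat => nat"
 assumes M: "M > 0" and L: "L >= 6"
  and b: "\<And>g r. g \<notin> zbox M (L - 2) ==> b g r = of_int (g r)"
  and code: "\<And>g \<pi>. g \<in> zbox M L ==> \<pi> permutes {0..<M} ==>
   inj_on (%(k, r). code (kv g \<pi> k) r) ({..M} \<times> {..<M})"
 obtains s0 where "s0 > 0" "\<And>s. 0 < s ==> s < s0 ==>
  \<bar>\<Sum>g\<in>zbox M L. \<Sum>\<pi> | \<pi> permutes {0..<M}. sign \<pi> *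
   Phi M (%k r. b (kv g \<pi> k) r + s * huge (code (kv g \<pi> k) r))\<bar> = 1"
proof -
 let ?P = "{\<pi>. \<pi> permutes {0..<M}}"
 have finP: "finite ?P" by (rule finite_permutations) simp
 define V where "V = (%(g, \<pi>, k). kv g \<pi> k) ` (zbox M L \<times> ?P \<times> {..M})"
 have finV: "finite V" unfolding V_def using finP by auto
 define N where "N = Suc (Max ((%(v, r). code v r) ` (V \<times> {..<M}) \<union> {0}))"
 have N: "code v r < N" if "v \<in> V" "r < M" for v r
  unfolding N_def less_Suc_eq_le using finV that by (intro Max_ge) auto
 \<comment> \<open>Codes above those of all labels: the direction w of the counting ray is itself
   made of \<open>huge\<close> values, which puts it in general position with the labels.\<close>
 define cw where "cw r = N + r" for r :: nat
 define JB where "JB B = (%(g, \<pi>, j). (skip j (%k. B (kv g \<pi> k)), skip j (%k. code (kv g \<pi> k)))) ` (zbox M L \<times> ?P \<times> {..M})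
  \<union> (%(g, \<pi>, j, i). ((skip j (%k. B (kv g \<pi> k)))(i := %_. 0), (skip j (%k. code (kv g \<pi> k)))(i := cw))) ` (zbox M L \<times> ?P \<times> {..M} \<times> {..<M})"
  for B :: "(nat => int) => nat => real"
 have JB1: "(skip j (%k. B (kv g \<pi> k)), skip j (%k. code (kv g \<pi> k))) \<in> JB B"
  if "g \<in> zbox M L" "\<pi> \<in> ?P" "j <= M" for B g \<pi> j
  unfolding JB_def by (rule UnI1, rule image_eqI[of _ _ "(g, \<pi>, j)"]) (use that in auto)
 have JB2: "((skip j (%k. B (kv g \<pi> k)))(i := %_. 0), (skip j (%k. code (kv g \<pi> k)))(i := cw)) \<in> JB B"
  if "g \<in> zbox M L" "\<pi> \<in> ?P" "j <= M" "i < M" for B g \<pi> j i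
  unfolding JB_def by (rule UnI2, rule image_eqI[of _ _ "(g, \<pi>, j, i)"]) (use that in auto)
 have finJ: "finite (JB B)" for B unfolding JB_def using finP by auto
 have skip_inj: "inj_on (%(i, r). skip j (%k. code (kv g \<pi> k)) i r) ({..<M} \<times> {..<M})"
  if "g \<in> zbox M L" "\<pi> \<in> ?P" for g \<pi> j
 proof (rule inj_onI, clarsimp)
  fix i r i' r'
  assume a: "i < M" "r < M" "i' < M" "r' < M" "skip j (%k. code (kv g \<pi> k)) i r = skip j (%k. code (kv g \<pi> k)) i' r'"
  let ?f = "%i. if i < j then i else Suc i"
  have "code (kv g \<pi> (?f i)) r = code (kv g \<pi> (?f i')) r'" using a(5) by (auto simp: skip_def split: if_splits)
  then have "(?f i, r) = (?f i', r')"
   using inj_onD[OF code[of g \<pi>], of "(?f i, r)" "(?f i', r')"] that a by auto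
  then show "i = i' \<and> r = r'" by (auto split: if_splits)
 qed
 have injJ: "inj_on (%(i, r). c i r) ({..<M} \<times> {..<M})" if "(A, c) \<in> JB B" for A c B
  using that unfolding JB_def
 proof (elim UnE imageE)
  fix x assume "x \<in> zbox M L \<times> ?P \<times> {..M}" "(A, c) = (%(g, \<pi>, j). (skip j (%k. B (kv g \<pi> k)), skip j (%k. code (kv g \<pi> k)))) x"
  then show ?thesis using skip_inj by auto
 next
  fix x assume x: "x \<in> zbox M L \<times> ?P \<times> {..M} \<times> {..<M}"
   "(A, c) = (%(g, \<pi>, j, i). ((skip j (%k. B (kv g \<pi> k)))(i := %_. 0), (skip j (%k. code (kv g \<pi> k)))(i := cw))) x"
  obtain g \<pi> j i where xe: "x = (g, \<pi>, j, i)" by (cases x) auto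
  have c: "c = (skip j (%k. code (kv g \<pi> k)))(i := cw)" and m: "g \<in> zbox M L" "\<pi> \<in> ?P" "j <= M" using x xe by auto
  have lt: "skip j (%k. code (kv g \<pi> k)) i' r < N" if "i' < M" "r < M" for i' r
  proof -
   have "kv g \<pi> i' \<in> V" "kv g \<pi> (Suc i') \<in> V" using that m unfolding V_def by force+
   then show ?thesis using N that by (simp add: skip_def)
  qed
  show ?thesis
  proof (rule inj_onI, clarsimp)
   fix a r a' r' assume a: "a < M" "r < M" "a' < M" "r' < M" "c a r = c a' r'"
   consider "a = i" "a' = i" | "a = i" "a' ~= i" | "a ~= i" "a' = i" | "a ~= i" "a' ~= i" by blast
   then show "a = a' \<and> r = r'"
   proof cases
    case 1 then show ?thesis using a c by (simp add: cw_def)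
   next
    case 2 then show ?thesis using a c lt[of a' r'] by (simp add: cw_def)
   next
    case 3 then show ?thesis using a c lt[of a r] by (simp add: cw_def)
   next
    case 4 then show ?thesis using a c inj_onD[OF skip_inj[OF m(1,2), of j], of "(a, r)" "(a', r')"] by simp
   qed
  qed
 qed
 have "finite (JB b \<union> JB (b0 M))" using finJ by simp
 moreover have "inj_on (%(i, r). c i r) ({..<M} \<times> {..<M})" if "(A, c) \<in> JB b \<union> JB (b0 M)" for A c
  using that injJ by blast
 ultimately have "\<exists>s0>0. \<forall>s A c. 0 < s --> s < s0 --> (A, c) \<in> JB b \<union> JB (b0 M) --> dt M (%i r. A i r + s * huge (c i r)) ~= 0"
  by (rule dt_generic)
 then obtain s1 where s1: "s1 > 0"
  "\<And>s A c. 0 < s ==> s < s1 ==> (A, c) \<in> JB b \<union> JB (b0 M) ==> dt M (%i r. A i r + s * huge (c i r)) ~= 0"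
  by blast
 define s2 where "s2 = 1 / (8 * (real M + 1)) / huge N"
 have hN: "huge N > 0" by (simp add: huge_def)
 have s2: "s2 > 0" unfolding s2_def using hN by simp
 have hmono: "huge m <= huge n" if "m <= n" for m n using that by (simp add: huge_def)
 have main: "\<bar>\<Sum>g\<in>zbox M L. \<Sum>\<pi>\<in>?P. sign \<pi> * Phi M (%k r. b (kv g \<pi> k) r + s * huge (code (kv g \<pi> k) r))\<bar> = 1"
  if s: "0 < s" "s < min s1 s2" for s
 proof -
  define w where "w r = s * huge (cw r)" for r
  define l where "l B v r = B v r + s * huge (code v r)" for B :: "(nat => int) => nat => real" and v r
  have Phi_psi: "Phi M (%k. l B (kv g \<pi> k)) = (\<Sum>j\<le>M. (- 1) ^ j * psi M w (%i. l B (skip j (kv g \<pi>) i)))"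
   if B: "B = b \<or> B = b0 M" and m: "g \<in> zbox M L" "\<pi> \<in> ?P" for B g \<pi>
  proof -
   have sk: "skip j (%k. l B (kv g \<pi> k)) = (%i. l B (skip j (kv g \<pi>) i))" for j by (auto simp: skip_def)
   have "dt M (skip j (%k. l B (kv g \<pi> k))) ~= 0" if "j <= M" for j
   proof -
    have "(skip j (%k. B (kv g \<pi> k)), skip j (%k. code (kv g \<pi> k))) \<in> JB b \<union> JB (b0 M)"
     using B JB1[OF m that] by auto
    from s1(2)[OF s(1) _ this] s
    have "dt M (%i r. skip j (%k. B (kv g \<pi> k)) i r + s * huge (skip j (%k. code (kv g \<pi> k)) i r)) ~= 0" by simp
    moreover have "(%i r. skip j (%k. B (kv g \<pi> k)) i r + s * huge (skip j (%k. code (kv g \<pi> k)) i r)) = skip j (%k. l B (kv g \<pi> k))"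
     by (auto simp: skip_def l_def fun_eq_iff)
    ultimately show ?thesis by simp
   qed
   moreover have "dt M ((skip j (%k. l B (kv g \<pi> k)))(i := w)) ~= 0" if "j <= M" "i < M" for j i
   proof -
    have "((skip j (%k. B (kv g \<pi> k)))(i := %_. 0), (skip j (%k. code (kv g \<pi> k)))(i := cw)) \<in> JB b \<union> JB (b0 M)"
     using B JB2[OF m that] by auto
    from s1(2)[OF s(1) _ this] s have "dt M (%i' r. ((skip j (%k. B (kv g \<pi> k)))(i := %_. 0)) i' r + s * huge (((skip j (%k. code (kv g \<pi> k)))(i := cw)) i' r)) ~= 0" by simp
    moreover have "(%i' r. ((skip j (%k. B (kv g \<pi> k)))(i := %_. 0)) i' r + s * huge (((skip j (%k. code (kv g \<pi> k)))(i := cw)) i' r)) = (skip j (%k. l B (kv g \<pi> k)))(i := w)"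
     by (auto simp: fun_eq_iff skip_def l_def w_def)
    ultimately show ?thesis by simp
   qed
   ultimately show ?thesis using Phi_eq_psi_sum[of M "%k. l B (kv g \<pi> k)" w] unfolding sk by simp
  qed
  \<comment> \<open>Both labellings are the identity outside the inner box, so the difference of
    their facet counts has the support that \<open>kuhn_boundary\<close> asks for, and the two
    degrees agree.\<close>
  define \<theta> where "\<theta> u = psi M w (%i. l b (u i)) - psi M w (%i. l (b0 M) (u i))" for u
  have "(\<Sum>g\<in>zbox M L. \<Sum>\<pi>\<in>?P. sign \<pi> * (\<Sum>k\<le>M. (- 1) ^ k * \<theta> (skip k (kv g \<pi>)))) = 0"
  proof (rule kuhn_boundary[OF M])
   fix u v :: "nat => nat => int" assume uv: "\<And>i. i < M ==> u i = v i"
   have "psi M w (%i. l B (u i)) = psi M w (%i. l B (v i))" for B by (rule psi_cong) (simp add: uv)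
   then show "\<theta> u = \<theta> v" unfolding \<theta>_def by simp
  next
   fix u :: "nat => nat => int" assume u: "\<And>i. i < M ==> u i \<notin> zbox M (L - 2)"
   have "psi M w (%i. l b (u i)) = psi M w (%i. l (b0 M) (u i))"
   proof (rule psi_cong)
    fix i r assume "i < M"
    have "u i \<notin> zbox M 3" using u[OF \<open>i < M\<close>] L by (force simp: zbox_def)
    then show "l b (u i) r = l (b0 M) (u i) r" using b[OF u[OF \<open>i < M\<close>]] by (simp add: l_def b0_def)
   qed
   then show "\<theta> u = 0" by (simp add: \<theta>_def)
  qed
  then have "(\<Sum>g\<in>zbox M L. \<Sum>\<pi>\<in>?P. sign \<pi> * (Phi M (%k. l b (kv g \<pi> k)) - Phi M (%k. l (b0 M) (kv g \<pi> k)))) = 0"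
   using Phi_psi by (simp add: \<theta>_def right_diff_distrib sum_subtractf)
  then have "(\<Sum>g\<in>zbox M L. \<Sum>\<pi>\<in>?P. sign \<pi> * Phi M (%k. l b (kv g \<pi> k))) =
   (\<Sum>g\<in>zbox M L. \<Sum>\<pi>\<in>?P. sign \<pi> * Phi M (%k. l (b0 M) (kv g \<pi> k)))"
   by (simp add: right_diff_distrib sum_subtractf)
  also have "\<dots> = (\<Sum>g\<in>{%_. 0}. \<Sum>\<pi>\<in>{id}. sign \<pi> * Phi M (%k. l (b0 M) (kv g \<pi> k)))"
  proof -
   have small: "\<bar>s * huge (code (kv g \<pi> k) r)\<bar> <= 1 / (8 * (real M + 1))" if "g \<in> zbox M L" "\<pi> \<in> ?P" "k <= M" "r < M" for g \<pi> k r
   proof -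
    have "kv g \<pi> k \<in> V" using that unfolding V_def by force
    then have "huge (code (kv g \<pi> k) r) <= huge N" using N that(4) by (intro hmono) (simp add: less_imp_le)
    then have "s * huge (code (kv g \<pi> k) r) <= s2 * huge N" using s s2 hN by (intro mult_mono) (auto simp: huge_def)
    then show ?thesis using s hN unfolding s2_def by (simp add: abs_mult huge_def)
   qed
   have uniq: "g = (%_. 0) \<and> \<pi> = id" if m: "g \<in> zbox M L" "\<pi> \<in> ?P" and ne: "Phi M (%k. l (b0 M) (kv g \<pi> k)) ~= 0" for g \<pi>
   proof (rule near_id_unique)
    show "Phi M (%k r. b0 M (kv g \<pi> k) r + s * huge (code (kv g \<pi> k) r)) ~= 0" using ne unfolding l_def .
   qed (use m small in \<open>auto simp: zbox_def\<close>)
   have in0: "(%_. 0) \<in> zbox M L" "id \<in> ?P" using L by (auto simp: zbox_def permutes_id)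
   have "(\<Sum>g\<in>zbox M L. \<Sum>\<pi>\<in>?P. sign \<pi> * Phi M (%k. l (b0 M) (kv g \<pi> k))) =
    (\<Sum>g\<in>{%_. 0}. \<Sum>\<pi>\<in>?P. sign \<pi> * Phi M (%k. l (b0 M) (kv g \<pi> k)))"
   proof (rule sum.mono_neutral_right)
    show "\<forall>g\<in>zbox M L - {%_. 0}. (\<Sum>\<pi>\<in>?P. sign \<pi> * Phi M (%k. l (b0 M) (kv g \<pi> k))) = 0"
     using uniq by (intro ballI sum.neutral) auto
   qed (use in0 in auto)
   also have "\<dots> = (\<Sum>g\<in>{%_. 0}. \<Sum>\<pi>\<in>{id}. sign \<pi> * Phi M (%k. l (b0 M) (kv g \<pi> k)))"
    using uniq in0 finP by (intro sum.cong refl sum.mono_neutral_right) auto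
   finally show ?thesis .
  qed
  also have "\<dots> = Phi M (%k. l (b0 M) (kv (%_. 0) id k))" by (simp add: sign_id)
  finally have tot: "(\<Sum>g\<in>zbox M L. \<Sum>\<pi>\<in>?P. sign \<pi> * Phi M (%k. l b (kv g \<pi> k))) = Phi M (%k. l (b0 M) (kv (%_. 0) id k))" .
  have in0: "(%_. 0) \<in> zbox M L" "id \<in> ?P" using L by (auto simp: zbox_def permutes_id)
  have "Phi M (%k r. b0 M (kv (%_. 0) id k) r + s * huge (code (kv (%_. 0) id k) r)) ~= 0"
  proof (rule near_id_value)
   fix k r assume kr: "k <= M" "r < M"
   have "kv (%_. 0) id k \<in> V" using in0 kr unfolding V_def by force
   then have "huge (code (kv (%_. 0) id k) r) <= huge N" using N kr by (intro hmono) (simp add: less_imp_le)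
   then have "s * huge (code (kv (%_. 0) id k) r) <= s2 * huge N" using s s2 hN by (intro mult_mono) (auto simp: huge_def)
   then show "\<bar>s * huge (code (kv (%_. 0) id k) r)\<bar> <= 1 / (8 * (real M + 1))"
    using s hN unfolding s2_def by (simp add: abs_mult huge_def)
  next
   fix j assume "j <= M"
   then have "(skip j (%k. b0 M (kv (%_. 0) id k)), skip j (%k. code (kv (%_. 0) id k))) \<in> JB b \<union> JB (b0 M)"
    using JB1[OF in0] by blast
   from s1(2)[OF s(1) _ this] s
   have "dt M (%i r. skip j (%k. b0 M (kv (%_. 0) id k)) i r + s * huge (skip j (%k. code (kv (%_. 0) id k)) i r)) ~= 0" by simp
   moreover have "(%i r. skip j (%k. b0 M (kv (%_. 0) id k)) i r + s * huge (skip j (%k. code (kv (%_. 0) id k)) i r)) =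
    skip j (%k r. b0 M (kv (%_. 0) id k) r + s * huge (code (kv (%_. 0) id k) r))" by (auto simp: skip_def fun_eq_iff)
   ultimately show "dt M (skip j (%k r. b0 M (kv (%_. 0) id k) r + s * huge (code (kv (%_. 0) id k) r))) ~= 0" by simp
  qed
  then have "\<bar>Phi M (%k. l (b0 M) (kv (%_. 0) id k))\<bar> = 1" unfolding l_def Phi_def by (auto split: if_splits)
  then show ?thesis using tot unfolding l_def by simp
 qed
 show ?thesis by (rule that[of "min s1 s2"]) (use s1(1) s2 main in auto)
qed

section \<open>Paths in the partition tree\<close>

text \<open>By Tychonoff the product of the intervals is compact; over a countable index set it is
  also metrisable, hence sequentially compact.\<close>

lemma bounded_pointwise_subseq:
 fixes f :: "nat => 'i::countable => real"
 assumes "\<And>t i. \<bar>f t i\<bar> <= B i"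
 obtains r g where "strict_mono (r :: nat => nat)" "\<And>i. (%t. f (r t) i) \<longlonglongrightarrow> g i" "\<And>i. \<bar>g i\<bar> <= B i"
proof -
 let ?S = "Pi\<^sub>E UNIV (%i. {- B i..B i})"
 have "compactin (product_topology (%i. euclidean) UNIV) ?S"
  by (subst compactin_PiE) auto
 then have "compact ?S" by (simp add: euclidean_product_topology)
 then have "seq_compact ?S" by (rule compact_imp_seq_compact)
 moreover have "f t i \<in> {- B i..B i}" for t i using assms[of t i] unfolding atLeastAtMost_iff by linarith
 then have "\<forall>t. f t \<in> ?S" by blast
 ultimately obtain g r where g: "g \<in> ?S" "strict_mono r" "(f \<circ> r) \<longlonglongrightarrow> g"
  by (rule seq_compactE)
 have "(%t. f (r t) i) \<longlonglongrightarrow> g i" for i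
 proof -
  have "continuous_on UNIV (%h :: 'i => real. h i)" by (rule continuous_on_product_coordinates)
  then have "isCont (%h :: 'i => real. h i) g" using continuous_on_eq_continuous_at[OF open_UNIV] by blast
  from isCont_tendsto_compose[OF this g(3)] show ?thesis by (simp add: o_def)
 qed
 moreover have "\<bar>g i\<bar> <= B i" for i
 proof -
  have "g i \<in> {- B i..B i}" using g(1) by blast
  then show ?thesis unfolding atLeastAtMost_iff by linarith
 qed
 ultimately show ?thesis using that g(2) by blast
qed

text \<open>Paths list the most recent choice first; the arities are listed in the same order.\<close>

fun leaves :: "nat list => nat list set" where
 "leaves [] = {[]}"
| "leaves (n # rs) = (%(j, p). j # p) ` ({..<n} \<times> leaves rs)"

lemma finite_leaves [simp]: "finite (leaves rs)"
 by (induction rs) auto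

lemma leaves_Cons [simp]: "q \<in> leaves (n # rs) \<longleftrightarrow> (\<exists>j p. q = j # p \<and> j < n \<and> p \<in> leaves rs)"
 by auto

lemma card_leaves: "card (leaves rs) = prod_list rs"
proof (induction rs)
 case (Cons n rs)
 have "inj_on (%(j, p). j # p) ({..<n} \<times> leaves rs)" by (auto simp: inj_on_def)
 then show ?case using Cons by (simp add: card_image card_cartesian_product)
qed simp

declare leaves.simps(2) [simp del]

lemma length_leaves: "p \<in> leaves rs ==> length p = length rs"
 by (induction rs arbitrary: p) auto

lemma leaves_append: "us @ vs = rs ==> q \<in> leaves rs \<longleftrightarrow> (\<exists>a b. q = a @ b \<and> a \<in> leaves us \<and> b \<in> leaves vs)"
proof (induction us arbitrary: q rs)
 case (Cons n us)
 have rs: "rs = n # (us @ vs)" using Cons.prems by simp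
 show ?case
 proof
  assume "q \<in> leaves rs"
  then obtain j q' where q: "q = j # q'" "j < n" "q' \<in> leaves (us @ vs)" unfolding rs by auto
  then obtain a b where "q' = a @ b" "a \<in> leaves us" "b \<in> leaves vs" using Cons.IH[OF refl] by blast
  then have "q = (j # a) @ b \<and> j # a \<in> leaves (n # us) \<and> b \<in> leaves vs" using q by simp
  then show "\<exists>a b. q = a @ b \<and> a \<in> leaves (n # us) \<and> b \<in> leaves vs" by blast
 next
  assume "\<exists>a b. q = a @ b \<and> a \<in> leaves (n # us) \<and> b \<in> leaves vs"
  then obtain j a b where "q = j # (a @ b)" "j < n" "a \<in> leaves us" "b \<in> leaves vs" by auto
  then show "q \<in> leaves rs" unfolding rs using Cons.IH[OF refl, of "a @ b"] by auto
 qed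
qed auto

text \<open>Relabelling of the children of the node P, applied to whole paths: the tail of a path is
  its parent, so the test looks for P among the ancestors.\<close>

fun sh :: "nat list => (nat => nat) => nat list => nat list" where
 "sh P \<sigma> [] = []"
| "sh P \<sigma> (i # q) = (if q = P then \<sigma> i else i) # sh P \<sigma> q"

lemma sh_length [simp]: "length (sh P \<sigma> q) = length q"
 by (induction q) auto

lemma sh_short: "length q <= length P ==> sh P \<sigma> q = q"
 by (induction q) auto

lemma sh_append: "sh P \<sigma> (a @ i # P) = a @ \<sigma> i # P"
 by (induction a) (auto simp: sh_short)

lemma sh_other: "\<not> (\<exists>a i. q = a @ i # P) ==> sh P \<sigma> q = q"
proof (induction q)
 case (Cons i q)
 then have "q ~= P" by (metis append_Nil)
 moreover have "\<not> (\<exists>a i. q = a @ i # P)" using Cons.prems by (metis append_Cons)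
 ultimately show ?case using Cons.IH by simp
qed simp

lemma sh_compose: "sh P \<sigma> (sh P \<tau> q) = sh P (\<sigma> \<circ> \<tau>) q"
proof (cases "\<exists>a i. q = a @ i # P")
 case True
 then show ?thesis by (auto simp: sh_append)
qed (simp add: sh_other)

lemma sh_id [simp]: "sh P id q = q"
proof (cases "\<exists>a i. q = a @ i # P")
 case True
 then show ?thesis by (auto simp: sh_append)
qed (simp add: sh_other)

lemma sh_append2: "\<exists>a'. sh P \<sigma> (a @ q) = a' @ sh P \<sigma> q"
 by (induction a) auto

lemma suffix_sh: "suffix q q' ==> suffix (sh P \<sigma> q) (sh P \<sigma> q')"
 unfolding suffix_def using sh_append2 by metis

lemma sh_leaves:
 assumes "\<sigma> permutes {..<n}" "P \<in> leaves vs" "rs = us @ n # vs" "q \<in> leaves rs"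
 shows "sh P \<sigma> q \<in> leaves rs"
proof -
 obtain a b where ab: "q = a @ b" "a \<in> leaves us" "b \<in> leaves (n # vs)"
  using leaves_append[of us "n # vs"] assms(3,4) by blast
 obtain i v where b: "b = i # v" "i < n" "v \<in> leaves vs" using ab(3) by auto
 show ?thesis
 proof (cases "v = P")
  case True
  have "\<sigma> i # P \<in> leaves (n # vs)" using permutes_in_image[OF assms(1)] b assms(2) by (auto simp: leaves_Cons)
  then show ?thesis using leaves_append[of us "n # vs"] assms(3) ab b True sh_append by blast
 next
  case False
  have "sh P \<sigma> q = q"
  proof (rule sh_other, clarify)
   fix a' i' assume q: "q = a' @ i' # P"
   have "length v = length P" using length_leaves b(3) assms(2) by metis
   then have "v = P" using q ab b by (metis append_eq_append_conv list.inject length_Cons)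
   then show False using False by simp
  qed
  then show ?thesis using assms(4) by simp
 qed
qed

lemma sh_bij:
 assumes "\<sigma> permutes {..<n}"
 shows "sh P \<sigma> (sh P (inv_into UNIV \<sigma>) q) = q" "sh P (inv_into UNIV \<sigma>) (sh P \<sigma> q) = q"
 by (simp_all add: sh_compose permutes_inv_o[OF assms])

section \<open>Node totals and gaps between siblings\<close>

definition Bsum :: "nat list => (nat list => nat => 'r::comm_monoid_add) => nat list => nat => 'r" where
 "Bsum rs u p c = (\<Sum>q\<in>{q\<in>leaves rs. suffix p q}. u q c)"

lemma Bsum_sh:
 assumes s: "\<sigma> permutes {..<n}" "P \<in> leaves vs" "rs = us @ n # vs"
  and u: "\<And>q. q \<in> leaves rs ==> u' (sh P \<sigma> q) c = u q c"
 shows "Bsum rs u' (sh P \<sigma> p) c = Bsum rs u p c"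
proof -
 note s' = permutes_inv[OF s(1)]
 show ?thesis unfolding Bsum_def
 proof (rule sum.reindex_bij_witness[where i = "sh P \<sigma>" and j = "sh P (inv_into UNIV \<sigma>)"])
  fix a assume a: "a \<in> {q \<in> leaves rs. suffix (sh P \<sigma> p) q}"
  show "sh P \<sigma> (sh P (inv_into UNIV \<sigma>) a) = a" by (rule sh_bij[OF s(1)])
  show "sh P (inv_into UNIV \<sigma>) a \<in> {q \<in> leaves rs. suffix p q}"
   using a sh_leaves[OF s' s(2,3)] suffix_sh[of "sh P \<sigma> p" a P "inv_into UNIV \<sigma>"] by (simp add: sh_bij[OF s(1)])
  then show "u (sh P (inv_into UNIV \<sigma>) a) c = u' a c" using u[of "sh P (inv_into UNIV \<sigma>) a"] by (simp add: sh_bij[OF s(1)])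
 next
  fix b assume b: "b \<in> {q \<in> leaves rs. suffix p q}"
  show "sh P (inv_into UNIV \<sigma>) (sh P \<sigma> b) = b" by (rule sh_bij[OF s(1)])
  show "sh P \<sigma> b \<in> {q \<in> leaves rs. suffix (sh P \<sigma> p) q}"
   using b sh_leaves[OF s] suffix_sh by blast
 qed
qed

lemma Bsum_split:
 assumes "P \<in> leaves vs" "rs = us @ n # vs"
 shows "Bsum rs u P c = (\<Sum>j<n. Bsum rs u (j # P) c)"
proof -
 have e: "{q \<in> leaves rs. suffix P q} = (\<Union>j\<in>{..<n}. {q \<in> leaves rs. suffix (j # P) q})"
 proof (intro Set.set_eqI iffI)
  fix q assume q: "q \<in> {q \<in> leaves rs. suffix P q}"
  then obtain a b where ab: "q = a @ b" "b \<in> leaves (n # vs)" using leaves_append[of us "n # vs"] assms(2) by blast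
  then obtain j v where b: "b = j # v" "j < n" "v \<in> leaves vs" by auto
  have "suffix v q" using ab b by (auto simp: suffix_def)
  moreover have "length v = length P" using length_leaves b(3) assms(1) by metis
  ultimately have "v = P" using q suffix_length_suffix[of v q P] suffix_length_suffix[of P q v]
   by (metis (mono_tags, lifting) le_refl mem_Collect_eq suffix_order.antisym)
  then have "suffix (j # P) q" using ab b by (auto simp: suffix_def)
  then show "q \<in> (\<Union>j\<in>{..<n}. {q \<in> leaves rs. suffix (j # P) q})" using q b by blast
 next
  fix q assume "q \<in> (\<Union>j\<in>{..<n}. {q \<in> leaves rs. suffix (j # P) q})"
  then show "q \<in> {q \<in> leaves rs. suffix P q}" using suffix_order.trans[of P] by (auto simp: suffix_Cons intro: suffix_ConsD)
 qed
 have "(\<Sum>q\<in>(\<Union>j\<in>{..<n}. {q \<in> leaves rs. suffix (j # P) q}). u q c) = (\<Sum>j<n. \<Sum>q\<in>{q \<in> leaves rs. suffix (j # P) q}. u q c)"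
 proof (rule sum.UNION_disjoint)
  show "\<forall>i\<in>{..<n}. \<forall>j\<in>{..<n}. i ~= j --> {q \<in> leaves rs. suffix (i # P) q} \<inter> {q \<in> leaves rs. suffix (j # P) q} = {}"
  proof (intro ballI impI, rule ccontr)
   fix i j assume "i ~= j" "{q \<in> leaves rs. suffix (i # P) q} \<inter> {q \<in> leaves rs. suffix (j # P) q} ~= {}"
   then obtain q where "suffix (i # P) q" "suffix (j # P) q" by blast
   then have "i # P = j # P" using suffix_length_suffix[of "i # P" q "j # P"] suffix_length_suffix[of "j # P" q "i # P"]
    by (metis length_Cons le_refl suffix_order.antisym)
   then show False using \<open>i ~= j\<close> by simp
  qed
 qed auto
 then show ?thesis unfolding Bsum_def e by simp
qed

lemma Bsum_leaf:
 assumes "q \<in> leaves rs"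
 shows "Bsum rs u q c = u q c"
proof -
 have "{q' \<in> leaves rs. suffix q q'} = {q}"
 proof (intro Set.set_eqI iffI)
  fix q' assume q': "q' \<in> {q' \<in> leaves rs. suffix q q'}"
  then have "length q' = length q" using assms length_leaves by (metis mem_Collect_eq)
  then show "q' \<in> {q}" using q' by (auto simp: suffix_def)
 qed (use assms in auto)
 then show ?thesis by (simp add: Bsum_def)
qed

text \<open>If the n children of a node have totals within s of each other, then n times the total
  of a child is within n * s of that of the node. So each step down adds at most s to the
  bound.\<close>

lemma Bsum_bound:
 fixes u :: "nat list => nat => int"
 assumes pos: "\<forall>n\<in>set rs. n > 0" and s: "s >= 0"
  and spread: "\<And>us n vs P i j. rs = us @ n # vs ==> P \<in> leaves vs ==> i < n ==> j < n ==>
   Bsum rs u (i # P) c - Bsum rs u (j # P) c <= s"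
  and root: "\<bar>Bsum rs u [] c\<bar> <= t"
 shows "us @ vs = rs ==> P \<in> leaves vs ==> \<bar>Bsum rs u P c\<bar> <= t + int (length vs) * s"
proof (induction vs arbitrary: us P)
 case Nil
 then show ?case using root by simp
next
 case (Cons n vs)
 obtain i P' where P: "P = i # P'" "i < n" "P' \<in> leaves vs" using Cons.prems(2) by auto
 let ?B = "%j. Bsum rs u (j # P') c"
 have IH: "\<bar>Bsum rs u P' c\<bar> <= t + int (length vs) * s"
  using Cons.IH[of "us @ [n]" P'] Cons.prems(1) P(3) by simp
 have rs: "rs = us @ n # vs" using Cons.prems by simp
 have n0: "n > 0" using P by simp
 have split: "Bsum rs u P' c = (\<Sum>j<n. ?B j)" by (rule Bsum_split[OF P(3) rs])
 have "(\<Sum>j<n. ?B i - s) <= (\<Sum>j<n. ?B j)" "(\<Sum>j<n. ?B j) <= (\<Sum>j<n. ?B i + s)"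
  using spread[OF rs P(3) P(2)] spread[OF rs P(3) _ P(2)] by (intro sum_mono; force simp: algebra_simps)+
 then have b: "int n * (?B i - s) <= Bsum rs u P' c" "Bsum rs u P' c <= int n * (?B i + s)" unfolding split by simp_all
 have "\<bar>?B i\<bar> <= \<bar>Bsum rs u P' c\<bar> + s"
 proof (rule ccontr)
  assume "\<not> ?thesis"
  then consider "?B i - s > \<bar>Bsum rs u P' c\<bar>" | "?B i + s < - \<bar>Bsum rs u P' c\<bar>" by linarith
  then show False
  proof cases
   case 1
   then have "?B i - s <= int n * (?B i - s)" using n0 mult_right_mono[of 1 "int n" "?B i - s"] by simp
   then show False using b(1) 1 by linarith
  next
   case 2
   then have "int n * (?B i + s) <= ?B i + s" using n0 mult_right_mono_neg[of 1 "int n" "?B i + s"] by simp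
   then show False using b(2) 2 by linarith
  qed
 qed
 then show ?case using IH P(1) by (simp add: algebra_simps)
qed

definition gap :: "nat => (nat => int) => int => nat set => bool" where
 "gap n B G S \<longleftrightarrow> S \<subseteq> {..<n} \<and> S ~= {} \<and> S ~= {..<n} \<and> (\<forall>i\<in>S. \<forall>j\<in>{..<n} - S. B i + G <= B j)"

text \<open>Pigeonhole: of the n intervals of length G above the minimum, one contains none of the n
  - 1 other values.\<close>

lemma gap_exists:
 assumes "i0 < n" "i1 < n" "B i1 - B i0 > int n * G" "G > 0"
 shows "\<exists>S. gap n B G S"
proof -
 obtain a where a: "a < n" "\<And>i. i < n ==> B a <= B i"
 proof -
  have "Min (B ` {..<n}) \<in> B ` {..<n}" using assms(1) by (intro Min_in) auto
  then obtain a where "a < n" "Min (B ` {..<n}) = B a" by auto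
  then show ?thesis using that[of a] Min_le[of "B ` {..<n}"] by auto
 qed
 have big: "B i1 > B a + int n * G" using a(2)[OF assms(1)] assms(3) by linarith
 have "\<exists>t<n. \<forall>i<n. \<not> (B a + int t * G < B i \<and> B i <= B a + int (Suc t) * G)"
 proof (rule ccontr)
  assume "\<not> ?thesis"
  then obtain f where f: "\<And>t. t < n ==> f t < n \<and> B a + int t * G < B (f t) \<and> B (f t) <= B a + int (Suc t) * G" by metis
  have "inj_on f {..<n}"
  proof (rule inj_onI)
   fix t t' assume t: "t \<in> {..<n}" "t' \<in> {..<n}" "f t = f t'"
   then have "int t * G < int (Suc t') * G" "int t' * G < int (Suc t) * G" using f[of t] f[of t'] by auto
   then show "t = t'" using assms(4) by (auto simp: mult_less_cancel_right)
  qed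
  moreover have "f ` {..<n} \<subseteq> {..<n} - {a}"
  proof
   fix x assume "x \<in> f ` {..<n}"
   then obtain t where t: "t < n" "x = f t" by auto
   have "int t * G >= 0" using assms(4) by simp
   then have "B a < B (f t)" using f[OF t(1)] by linarith
   then show "x \<in> {..<n} - {a}" using f[OF t(1)] t(2) by auto
  qed
  ultimately have "card {..<n} <= card ({..<n} - {a})" by (intro card_inj_on_le) auto
  then show False using a(1) by simp
 qed
 then obtain t where t: "t < n" "\<And>i. i < n ==> \<not> (B a + int t * G < B i \<and> B i <= B a + int (Suc t) * G)" by blast
 let ?S = "{i. i < n \<and> B i <= B a + int t * G}"
 have "a \<in> ?S" using a assms(4) by simp
 moreover have "i1 \<notin> ?S"
 proof -
  have "int t * G <= int n * G" using t(1) assms(4) by simp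
  then show ?thesis using big by auto
 qed
 moreover have "B i + G <= B j" if "i \<in> ?S" "j \<in> {..<n} - ?S" for i j
  using that t(2)[of j] by (auto simp: algebra_simps)
 ultimately have "gap n B G ?S" unfolding gap_def using assms(2) by auto
 then show ?thesis ..
qed

definition mingap :: "nat => (nat => int) => int => nat set => bool" where
 "mingap n B G S \<longleftrightarrow> gap n B G S \<and> (\<forall>S'. gap n B G S' --> S \<subseteq> S')"

lemma gapD: "gap n B G S ==> i \<in> S ==> j \<in> {..<n} - S ==> B i + G <= B j"
 unfolding gap_def by (elim conjE) (drule bspec, assumption, erule bspec)

text \<open>Gap sets are initial segments of the siblings in the order of B, so any two are nested
  and one of least size is contained in all others.\<close>

lemma mingap_exists:
 assumes "gap n B G S" "G > 0"
 shows "\<exists>!S. mingap n B G S"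
proof -
 obtain S0 where S0: "gap n B G S0" "\<And>S'. gap n B G S' ==> card S0 <= card S'"
  using ex_has_least_nat[of "gap n B G" S card, OF assms(1)] by (elim exE conjE) simp
 have "S0 \<subseteq> S'" if g: "gap n B G S'" for S'
 proof (rule ccontr)
  assume "\<not> S0 \<subseteq> S'"
  then obtain i where i: "i \<in> S0" "i \<notin> S'" by blast
  have fin: "finite S0" "finite S'" using S0(1) g finite_subset[OF _ finite_lessThan] unfolding gap_def by blast+
  have "\<not> S' \<subset> S0"
  proof
   assume "S' \<subset> S0"
   from psubset_card_mono[OF fin(1) this] S0(2)[OF g] show False by simp
  qed
  then obtain j where j: "j \<in> S'" "j \<notin> S0" using i by blast
  have "i < n" "j < n" using S0(1) g i j by (auto simp: gap_def)
  then have "i \<in> {..<n} - S'" "j \<in> {..<n} - S0" using i j by auto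
  then have "B i + G <= B j" "B j + G <= B i" using gapD[OF S0(1) i(1)] gapD[OF g j(1)] by simp_all
  then show False using assms(2) by simp
 qed
 then have "mingap n B G S0" using S0(1) by (simp add: mingap_def)
 moreover have "S = S0" if m: "mingap n B G S" for S
 proof (rule subset_antisym)
  show "S \<subseteq> S0" using m S0(1) by (simp add: mingap_def)
  show "S0 \<subseteq> S" using m \<open>mingap n B G S0\<close> by (simp add: mingap_def)
 qed
 ultimately show ?thesis by (rule ex1I)
qed

lemma gap_permute:
 assumes s: "\<sigma> permutes {..<n}" and B: "\<And>i. i < n ==> B' (\<sigma> i) = B i"
 shows "gap n B' G (\<sigma> ` S) \<longleftrightarrow> gap n B G S"
proof -
 have inj: "inj \<sigma>" by (rule permutes_inj[OF s])
 have im: "\<sigma> ` {..<n} = {..<n}" by (rule permutes_image[OF s])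
 have "\<sigma> ` S \<subseteq> {..<n} \<longleftrightarrow> S \<subseteq> {..<n}" using inj_image_subset_iff[OF inj, of S "{..<n}"] unfolding im .
 moreover have "\<sigma> ` S = {..<n} \<longleftrightarrow> S = {..<n}" using inj_image_eq_iff[OF inj, of S "{..<n}"] unfolding im .
 moreover have "{..<n} - \<sigma> ` S = \<sigma> ` ({..<n} - S)" using image_set_diff[OF inj, of "{..<n}" S] unfolding im by simp
 moreover have "(\<forall>i\<in>\<sigma> ` S. \<forall>j\<in>\<sigma> ` ({..<n} - S). B' i + G <= B' j) \<longleftrightarrow> (\<forall>i\<in>S. \<forall>j\<in>{..<n} - S. B i + G <= B j)"
  if "S \<subseteq> {..<n}"
 proof -
  have "B' (\<sigma> i) = B i" if "i \<in> S" for i using B that \<open>S \<subseteq> {..<n}\<close> by (meson lessThan_iff subsetD)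
  moreover have "B' (\<sigma> j) = B j" if "j \<in> {..<n} - S" for j using B that by (meson DiffD1 lessThan_iff)
  ultimately have "(\<forall>i\<in>S. \<forall>j\<in>{..<n} - S. B' (\<sigma> i) + G <= B' (\<sigma> j)) \<longleftrightarrow> (\<forall>i\<in>S. \<forall>j\<in>{..<n} - S. B i + G <= B j)"
   by (intro ball_cong refl) (simp only:)
  then show ?thesis by simp
 qed
 ultimately show ?thesis unfolding gap_def image_is_empty by (simp only: cong: conj_cong)
qed

lemma mingap_permute:
 assumes s: "\<sigma> permutes {..<n}" and B: "\<And>i. i < n ==> B' (\<sigma> i) = B i"
  and m: "mingap n B G S"
 shows "mingap n B' G (\<sigma> ` S)"
proof -
 have surj: "\<exists>S''. S' = \<sigma> ` S''" for S'
  by (rule exI[of _ "\<sigma> -` S'"]) (simp add: surj_image_vimage_eq permutes_surj[OF s])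
 have g: "gap n B' G (\<sigma> ` S') \<longleftrightarrow> gap n B G S'" for S' by (rule gap_permute[OF s]) (rule B)
 show ?thesis unfolding mingap_def
 proof (intro conjI allI impI)
  show "gap n B' G (\<sigma> ` S)" using m g by (simp add: mingap_def)
  fix S' assume "gap n B' G S'"
  moreover obtain S'' where "S' = \<sigma> ` S''" using surj by blast
  ultimately have "gap n B G S''" "S' = \<sigma> ` S''" using g by simp_all
  then show "\<sigma> ` S \<subseteq> S'" using m image_mono[of S S'' \<sigma>] unfolding mingap_def by simp
 qed
qed

text \<open>The order-preserving representative of the coset that S describes: increasing from the
  first \<open>card S\<close> indices onto S, and increasing from the remaining indices onto the
  complement.\<close>

definition shuffle :: "nat => nat set => nat => nat" where
 "shuffle n S i = (if i < n then (sorted_list_of_set S @ sorted_list_of_set ({..<n} - S)) ! i else i)"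

lemma shuffle:
 assumes "S \<subseteq> {..<n}"
 shows "shuffle n S permutes {..<n}" "shuffle n S ` {..<card S} = S"
  "strict_mono_on {..<card S} (shuffle n S)" "strict_mono_on {card S..<n} (shuffle n S)"
proof -
 let ?a = "sorted_list_of_set S" and ?b = "sorted_list_of_set ({..<n} - S)"
 have fin: "finite S" using assms finite_subset by blast
 have la: "length ?a = card S" by simp
 have lb: "length ?b = n - card S" using assms fin by (simp add: card_Diff_subset)
 have cn: "card S <= n" using card_mono[OF _ assms] by simp
 have len: "length (?a @ ?b) = n" using cn lb by simp
 have d: "distinct (?a @ ?b)" using fin by auto
 have st: "set (?a @ ?b) = {..<n}" using assms fin by auto
 have "bij_betw (%i. (?a @ ?b) ! i) {..<n} {..<n}"
  using bij_betw_nth[OF d, of "{..<n}" "{..<n}"] len st by simp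
 then have "bij_betw (shuffle n S) {..<n} {..<n}"
  by (rule bij_betw_cong[THEN iffD1, rotated]) (simp add: shuffle_def)
 then show "shuffle n S permutes {..<n}" by (rule bij_imp_permutes) (simp add: shuffle_def)
 have "shuffle n S ` {..<card S} = (%i. ?a ! i) ` {..<card S}"
  using cn la by (intro image_cong) (auto simp: shuffle_def nth_append)
 also have "\<dots> = set ?a" unfolding set_conv_nth la by auto
 finally show "shuffle n S ` {..<card S} = S" using fin by simp
 show "strict_mono_on {..<card S} (shuffle n S)"
 proof (rule strict_mono_onI)
  fix i j assume "i \<in> {..<card S}" "j \<in> {..<card S}" "i < j"
  then show "shuffle n S i < shuffle n S j"
   using sorted_wrt_nth_less[OF strict_sorted_list_of_set[of S], of i j] cn la by (simp add: shuffle_def nth_append)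
 qed
 show "strict_mono_on {card S..<n} (shuffle n S)"
 proof (rule strict_mono_onI)
  fix i j assume "i \<in> {card S..<n}" "j \<in> {card S..<n}" "i < j"
  then show "shuffle n S i < shuffle n S j"
   using sorted_wrt_nth_less[OF strict_sorted_list_of_set[of "{..<n} - S"], of "i - card S" "j - card S"] lb
   by (simp add: shuffle_def nth_append)
 qed
qed

text \<open>\<open>pe_inv\<close> is the partial equivariance satisfied by every quantity that is read off the sites:
 a node's children may be relabelled by a permutation that is increasing on two blocks
 separated by a gap.\<close>

definition pe_inv :: "nat list => nat => ((nat list => nat => real) => nat list => 'x) => bool" where
 "pe_inv rs D H \<longleftrightarrow> (\<forall>us n vs P \<sigma> m c u u'. rs = us @ n # vs --> P \<in> leaves vs --> \<sigma> permutes {..<n} -->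
   strict_mono_on {..<m} \<sigma> --> strict_mono_on {m..<n} \<sigma> --> m <= n --> c < D -->
   (\<forall>i<m. \<forall>j\<in>{m..<n}. Bsum rs u (i # P) c + 1 <= Bsum rs u (j # P) c) -->
   (\<forall>q\<in>leaves rs. \<forall>c<D. u' (sh P \<sigma> q) c = u q c) -->
   (\<forall>q\<in>leaves rs. H u' (sh P \<sigma> q) = H u q))"

section \<open>The lattice of leaf values and the relabellings that act on it\<close>

locale leaf_grid =
 fixes rs :: "nat list" and D :: nat
 assumes rs: "rs ~= []" "\<And>n. n \<in> set rs ==> 2 <= n" and D: "D >= 1"
begin

definition "Idx = leaves rs \<times> {..<D}"
definition "M = card Idx"
definition "ix = (SOME h. bij_betw h {..<M} Idx)"
definition "xi = inv_into {..<M} ix"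
definition "Nl = card (leaves rs)"

lemma finite_Idx: "finite Idx" by (simp add: Idx_def)

lemma ix_bij: "bij_betw ix {..<M} Idx"
proof -
 have "\<exists>h. bij_betw h {..<M} Idx"
  using ex_bij_betw_nat_finite[OF finite_Idx] unfolding M_def atLeast0LessThan by blast
 then show ?thesis unfolding ix_def by (rule someI_ex)
qed

lemma ix_mem: "r < M ==> ix r \<in> Idx" using ix_bij by (auto simp: bij_betw_def)
lemma xi_mem: "x \<in> Idx ==> xi x < M"
 using bij_betw_inv_into[OF ix_bij] by (auto simp: bij_betw_def xi_def)
lemma ix_xi: "x \<in> Idx ==> ix (xi x) = x" unfolding xi_def using bij_betw_inv_into_right[OF ix_bij] by auto
lemma xi_ix: "r < M ==> xi (ix r) = r" unfolding xi_def using bij_betw_inv_into_left[OF ix_bij] by auto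

lemma Nl_pos: "Nl > 0"
proof -
 have "prod_list rs > 0" using rs(2) by (induction rs) (auto, force)
 then show ?thesis by (simp add: Nl_def card_leaves)
qed

lemma M_pos: "M > 0"
 using Nl_pos D by (simp add: M_def Idx_def card_cartesian_product Nl_def)

definition V :: "(nat => int) => nat list => nat => int" where
 "V g q c = (if (q, c) \<in> Idx then g (xi (q, c)) else 0)"

definition node :: "nat list => bool" where
 "node P \<longleftrightarrow> (\<exists>us n vs. rs = us @ n # vs \<and> P \<in> leaves vs)"

definition ar :: "nat list => nat" where "ar P = rs ! (length rs - Suc (length P))"

lemma ar_eq: "rs = us @ n # vs ==> P \<in> leaves vs ==> ar P = n"
proof -
 assume r: "rs = us @ n # vs" and P: "P \<in> leaves vs"
 have "length rs - Suc (length P) = length us" using length_leaves[OF P] by (simp add: r)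
 then show "ar P = n" unfolding ar_def by (simp add: r)
qed

lemma nodeE:
 assumes "node P"
 obtains us vs where "rs = us @ ar P # vs" "P \<in> leaves vs"
 using assms ar_eq unfolding node_def by metis

lemma ar_in: "node P ==> ar P \<in> set rs"
 by (metis in_set_conv_decomp nodeE)

abbreviation B :: "(nat => int) => nat list => nat => int" where "B g \<equiv> Bsum rs (V g)"

text \<open>The vertices of a Kuhn simplex arise from its base by adding 0/1 vectors, so node totals
  vary by at most the number of leaves.\<close>

lemma B_kv:
 assumes "\<pi> permutes {0..<M}"
 shows "B g P c <= B (kv g \<pi> k) P c" "B (kv g \<pi> k) P c <= B g P c + int Nl"
proof -
 have d: "V g q c <= V (kv g \<pi> k) q c" "V (kv g \<pi> k) q c <= V g q c + 1" for q by (auto simp: V_def kv_def)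
 show "B g P c <= B (kv g \<pi> k) P c" unfolding Bsum_def using d(1) by (intro sum_mono)
 have "B (kv g \<pi> k) P c <= (\<Sum>q\<in>{q \<in> leaves rs. suffix P q}. V g q c + 1)" unfolding Bsum_def using d(2) by (intro sum_mono)
 also have "\<dots> = B g P c + int (card {q \<in> leaves rs. suffix P q})" by (simp add: sum.distrib Bsum_def)
 also have "card {q \<in> leaves rs. suffix P q} <= Nl" unfolding Nl_def by (intro card_mono) auto
 finally show "B (kv g \<pi> k) P c <= B g P c + int Nl" by simp
qed

definition T :: "nat list => (nat => nat) => nat => nat" where
 "T P \<sigma> r = (if r < M then xi (sh P \<sigma> (fst (ix r)), snd (ix r)) else r)"

definition act :: "(nat => nat) => (nat => 'z) => nat => 'z" where
 "act t g = (%r. g (inv_into UNIV t r))"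

lemma sh_Idx:
 assumes "node P" "\<sigma> permutes {..<ar P}" "(q, c) \<in> Idx"
 shows "(sh P \<sigma> q, c) \<in> Idx"
proof -
 obtain us vs where r: "rs = us @ ar P # vs" "P \<in> leaves vs" using nodeE[OF assms(1)] .
 then show ?thesis using sh_leaves[OF assms(2) r(2,1)] assms(3) by (auto simp: Idx_def)
qed

lemma T_ix:
 assumes "node P" "\<sigma> permutes {..<ar P}" "r < M"
 shows "T P \<sigma> r < M" "ix (T P \<sigma> r) = (sh P \<sigma> (fst (ix r)), snd (ix r))"
proof -
 have "(sh P \<sigma> (fst (ix r)), snd (ix r)) \<in> Idx" using sh_Idx[OF assms(1,2)] ix_mem[OF assms(3)] by simp
 then show "T P \<sigma> r < M" "ix (T P \<sigma> r) = (sh P \<sigma> (fst (ix r)), snd (ix r))"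
  using assms(3) xi_mem ix_xi by (simp_all add: T_def)
qed

lemma T_inverse:
 assumes "node P" "\<sigma> permutes {..<ar P}"
 shows "T P (inv_into UNIV \<sigma>) (T P \<sigma> r) = r"
proof (cases "r < M")
 case True
 then show ?thesis using T_ix[OF assms True] sh_bij(2)[OF assms(2)] xi_ix[OF True]
  by (simp add: T_def[of P "inv_into UNIV \<sigma>"])
qed (simp add: T_def)

lemma T_permutes:
 assumes "node P" "\<sigma> permutes {..<ar P}"
 shows "T P \<sigma> permutes {0..<M}"
proof (rule bij_imp_permutes)
 have i: "inv_into UNIV (inv_into UNIV \<sigma>) = \<sigma>" by (rule permutes_inv_inv[OF assms(2)])
 show "bij_betw (T P \<sigma>) {0..<M} {0..<M}"
 proof (rule bij_betwI[where g = "T P (inv_into UNIV \<sigma>)"])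
  show "T P \<sigma> (T P (inv_into UNIV \<sigma>) x) = x" for x
   using T_inverse[OF assms(1) permutes_inv[OF assms(2)]] unfolding i .
 qed (use T_ix(1)[OF assms] T_ix(1)[OF assms(1) permutes_inv[OF assms(2)]] T_inverse[OF assms] in auto)
qed (simp add: T_def)

lemma inv_T:
 assumes "node P" "\<sigma> permutes {..<ar P}"
 shows "inv_into UNIV (T P \<sigma>) = T P (inv_into UNIV \<sigma>)"
proof
 fix r
 have "T P \<sigma> (T P (inv_into UNIV \<sigma>) r) = r"
  using T_inverse[OF assms(1) permutes_inv[OF assms(2)]] unfolding permutes_inv_inv[OF assms(2)] .
 then show "inv_into UNIV (T P \<sigma>) r = T P (inv_into UNIV \<sigma>) r"
  using permutes_inverses(2)[OF T_permutes[OF assms]] by metis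
qed

lemma act_T [simp]: "t permutes {0..<M} ==> act t g (t r) = g r"
 by (simp add: act_def permutes_inverses)

lemma act_act_inv:
 assumes "node P" "\<sigma> permutes {..<ar P}"
 shows "act (T P \<sigma>) (act (T P (inv_into UNIV \<sigma>)) g) = g" "act (T P (inv_into UNIV \<sigma>)) (act (T P \<sigma>) g) = g"
proof -
 have i: "inv_into UNIV (T P (inv_into UNIV \<sigma>)) = T P \<sigma>"
  using inv_T[OF assms(1) permutes_inv[OF assms(2)]] unfolding permutes_inv_inv[OF assms(2)] .
 have 1: "T P \<sigma> (T P (inv_into UNIV \<sigma>) r) = r" for r
  using T_inverse[OF assms(1) permutes_inv[OF assms(2)]] unfolding permutes_inv_inv[OF assms(2)] .
 show "act (T P \<sigma>) (act (T P (inv_into UNIV \<sigma>)) g) = g" "act (T P (inv_into UNIV \<sigma>)) (act (T P \<sigma>) g) = g"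
  unfolding act_def inv_T[OF assms] i 1 T_inverse[OF assms] by simp_all
qed

lemma V_act:
 assumes "node P" "\<sigma> permutes {..<ar P}" "q \<in> leaves rs"
 shows "V (act (T P \<sigma>) g) (sh P \<sigma> q) c = V g q c"
proof (cases "c < D")
 case True
 then have q: "(q, c) \<in> Idx" using assms by (simp add: Idx_def)
 note q' = sh_Idx[OF assms(1,2) q]
 have "xi (sh P \<sigma> q, c) = T P \<sigma> (xi (q, c))" using xi_mem[OF q] ix_xi[OF q] by (simp add: T_def)
 then show ?thesis using q q' T_permutes[OF assms(1,2)] by (simp add: V_def)
qed (simp add: V_def Idx_def)

lemma B_act:
 assumes "node P" "\<sigma> permutes {..<ar P}"
 shows "B (act (T P \<sigma>) g) (sh P \<sigma> p) c = B g p c"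
proof -
 obtain us vs where "rs = us @ ar P # vs" "P \<in> leaves vs" using nodeE[OF assms(1)] .
 then show ?thesis using Bsum_sh[OF assms(2)] V_act[OF assms] by metis
qed

lemma act_zbox: "t permutes {0..<M} ==> act t g \<in> zbox M L \<longleftrightarrow> g \<in> zbox M L"
proof -
 assume t: "t permutes {0..<M}"
 note t' = permutes_inv[OF t]
 have 1: "(\<forall>i<M. \<bar>g (inv_into UNIV t i)\<bar> <= L) \<longleftrightarrow> (\<forall>i<M. \<bar>g i\<bar> <= L)"
  using permutes_image[OF t'] by (metis (no_types, opaque_lifting) atLeast0LessThan image_iff lessThan_iff)
 have 2: "inv_into UNIV t i = i" if "i >= M" for i using permutes_not_in[OF t'] that by simp
 show ?thesis unfolding zbox_def act_def using 1 2 by simp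
qed

lemma act_sum: "t permutes {0..<M} ==> (\<Sum>r<M. act t g r) = (\<Sum>r<M. g r)"
 unfolding act_def atLeast0LessThan[symmetric] by (rule sum.permute[OF permutes_inv, symmetric, unfolded o_def])

text \<open>Kuhn's triangulation is invariant under permutations of the coordinates, which transport
  the base and the order of steps together.\<close>

lemma kv_act:
 assumes "t permutes {0..<M}"
 shows "kv (act t g) (t \<circ> \<pi>) k = act t (kv g \<pi> k)"
proof
 fix r
 have "r \<in> (t \<circ> \<pi>) ` {..<k} \<longleftrightarrow> inv_into UNIV t r \<in> \<pi> ` {..<k}"
 proof
  assume "r \<in> (t \<circ> \<pi>) ` {..<k}"
  then obtain x where "x < k" "r = t (\<pi> x)" by auto
  then show "inv_into UNIV t r \<in> \<pi> ` {..<k}" using permutes_inverses(2)[OF assms] by auto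
 next
  assume "inv_into UNIV t r \<in> \<pi> ` {..<k}"
  then obtain x where "x < k" "inv_into UNIV t r = \<pi> x" by auto
  then have "x < k" "r = (t \<circ> \<pi>) x" using permutes_inverses(1)[OF assms, of r] by simp_all
  then show "r \<in> (t \<circ> \<pi>) ` {..<k}" by blast
 qed
 then show "kv (act t g) (t \<circ> \<pi>) k r = act t (kv g \<pi> k) r" by (simp add: kv_def act_def)
qed

definition hasgap :: "int => (nat => int) => nat list => nat => bool" where
 "hasgap G g P c \<longleftrightarrow> node P \<and> c < D \<and> (\<exists>S. gap (ar P) (%i. B g (i # P) c) G S)"

lemma gap_act:
 assumes "node P" "\<sigma> permutes {..<ar P}"
 shows "gap (ar P) (%i. B (act (T P \<sigma>) g) (i # P) c) G (\<sigma> ` S) \<longleftrightarrow> gap (ar P) (%i. B g (i # P) c) G S"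
 by (rule gap_permute[OF assms(2)]) (use B_act[OF assms, of g "_ # P"] in \<open>simp add: sh_short\<close>)

lemma hasgap_act:
 assumes "node P" "\<sigma> permutes {..<ar P}" "length P' <= length P"
 shows "hasgap G (act (T P \<sigma>) g) P' c \<longleftrightarrow> hasgap G g P' c"
proof (cases "P' = P")
 case True
 have "\<exists>S'. S = \<sigma> ` S'" for S
  by (rule exI[of _ "\<sigma> -` S"]) (simp add: surj_image_vimage_eq permutes_surj[OF assms(2)])
 then show ?thesis unfolding hasgap_def True using gap_act[OF assms(1,2)] by metis
next
 case False
 then have "sh P \<sigma> (i # P') = i # P'" for i using assms(3) by (simp add: sh_short)
 then have "B (act (T P \<sigma>) g) (i # P') c = B g (i # P') c" for i using B_act[OF assms(1,2), of g "i # P'" c] by simp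
 then show ?thesis unfolding hasgap_def by simp
qed

text \<open>\<open>lev\<close>, \<open>kap\<close> and \<open>Sg\<close> single out one gap: at a
  node as close to the root as possible, first in an encoding among those, and there the smallest
  gap set. Relabelling the children of that node moves only nodes strictly below it, so the chosen
  node stays the same and its gap set is permuted.\<close>

definition lev :: "int => (nat => int) => nat" where "lev G g = (LEAST l. \<exists>P c. length P = l \<and> hasgap G g P c)"
definition kap :: "int => (nat => int) => nat list \<times> nat" where
 "kap G g = from_nat (LEAST e. \<exists>P c. length P = lev G g \<and> hasgap G g P c \<and> e = to_nat (P, c))"
definition Sg :: "int => (nat => int) => nat set" where
 "Sg G g = (THE S. mingap (ar (fst (kap G g))) (%i. B g (i # fst (kap G g)) (snd (kap G g))) G S)"

lemma kap:
 assumes "\<exists>P c. hasgap G g P c"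
 shows "hasgap G g (fst (kap G g)) (snd (kap G g))" "length (fst (kap G g)) = lev G g"
  "\<And>P c. hasgap G g P c ==> lev G g <= length P"
proof -
 have "\<exists>l P c. length P = l \<and> hasgap G g P c" using assms by blast
 then have l: "\<exists>P c. length P = lev G g \<and> hasgap G g P c" unfolding lev_def by (rule LeastI_ex)
 then have "\<exists>e P c. length P = lev G g \<and> hasgap G g P c \<and> e = to_nat (P, c)" by blast
 from LeastI_ex[OF this] obtain P c where e: "length P = lev G g" "hasgap G g P c"
  "(LEAST e. \<exists>P c. length P = lev G g \<and> hasgap G g P c \<and> e = to_nat (P, c)) = to_nat (P, c)" by blast
 have "kap G g = (P, c)" unfolding kap_def e(3) by simp
 then show "hasgap G g (fst (kap G g)) (snd (kap G g))" "length (fst (kap G g)) = lev G g" using e by simp_all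
 show "lev G g <= length P" if "hasgap G g P c" for P c unfolding lev_def using that by (intro Least_le) blast
qed

lemma kap_act:
 assumes gap: "\<exists>P c. hasgap G g P c" and k: "kap G g = (P, c)" and s: "\<sigma> permutes {..<ar P}"
 shows "kap G (act (T P \<sigma>) g) = (P, c)" "\<exists>P' c'. hasgap G (act (T P \<sigma>) g) P' c'"
proof -
 have P: "hasgap G g P c" "length P = lev G g" using kap[OF gap] k by simp_all
 have n: "node P" using P by (simp add: hasgap_def)
 note inv = hasgap_act[OF n s, of _ G g]
 have h: "hasgap G (act (T P \<sigma>) g) P c" using inv P by simp
 then show ex: "\<exists>P' c'. hasgap G (act (T P \<sigma>) g) P' c'" by blast
 have "lev G (act (T P \<sigma>) g) = lev G g"
 proof (rule antisym)
  show "lev G (act (T P \<sigma>) g) <= lev G g" using kap(3)[OF ex h] P by simp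
  then have "length (fst (kap G (act (T P \<sigma>) g))) <= length P" using kap(2)[OF ex] P by simp
  then have "hasgap G g (fst (kap G (act (T P \<sigma>) g))) (snd (kap G (act (T P \<sigma>) g)))" using inv kap(1)[OF ex] by blast
  then show "lev G g <= lev G (act (T P \<sigma>) g)" using kap(3)[OF gap] kap(2)[OF ex] by metis
 qed
 then have "(\<exists>P' c. length P' = lev G (act (T P \<sigma>) g) \<and> hasgap G (act (T P \<sigma>) g) P' c \<and> e = to_nat (P', c)) \<longleftrightarrow>
  (\<exists>P' c. length P' = lev G g \<and> hasgap G g P' c \<and> e = to_nat (P', c))" for e
  using inv P by (metis order_refl)
 then show "kap G (act (T P \<sigma>) g) = (P, c)" using k unfolding kap_def by simp
qed

lemma Sg:
 assumes "\<exists>P c. hasgap G g P c" "G > 0" "kap G g = (P, c)"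
 shows "mingap (ar P) (%i. B g (i # P) c) G (Sg G g)"
  "\<And>S. mingap (ar P) (%i. B g (i # P) c) G S ==> Sg G g = S"
proof -
 have "\<exists>S. gap (ar P) (%i. B g (i # P) c) G S" using kap(1)[OF assms(1)] assms(3) by (simp add: hasgap_def)
 then have ex: "\<exists>!S. mingap (ar P) (%i. B g (i # P) c) G S" using mingap_exists[OF _ assms(2)] by blast
 show "mingap (ar P) (%i. B g (i # P) c) G (Sg G g)" unfolding Sg_def assms(3) fst_conv snd_conv by (rule theI'[OF ex])
 show "Sg G g = S" if "mingap (ar P) (%i. B g (i # P) c) G S" for S
  unfolding Sg_def assms(3) fst_conv snd_conv using that ex by (intro the1_equality)
qed

lemma Sg_act:
 assumes gap: "\<exists>P c. hasgap G g P c" and G: "G > 0" and k: "kap G g = (P, c)" and s: "\<sigma> permutes {..<ar P}"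
 shows "Sg G (act (T P \<sigma>) g) = \<sigma> ` Sg G g"
proof -
 have n: "node P" using kap(1)[OF gap] k by (simp add: hasgap_def)
 have "mingap (ar P) (%i. B (act (T P \<sigma>) g) (i # P) c) G (\<sigma> ` Sg G g)"
  by (rule mingap_permute[OF s _ Sg(1)[OF gap G k]]) (use B_act[OF n s, of g "_ # P"] in \<open>simp add: sh_short\<close>)
 from Sg(2)[OF kap_act(2)[OF gap k s] G kap_act(1)[OF gap k s] this] show ?thesis .
qed

text \<open>Sort the points by the chosen node and the size m of the gap set. Through
  \<open>shuffle\<close> each class is the product of the m-subsets of the children with the points
  whose gap set is the first m children. Since \<open>val\<close> is constant along the first
  factor, the class adds up to a multiple of \<open>n choose m\<close>.\<close>

lemma class_sum_dvd:
 fixes val :: "(nat => int) => int"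
 assumes G: "G > 0" and gap: "\<And>g. g \<in> Om ==> \<exists>P c. hasgap G g P c"
  and fin: "finite Om" and inv: "\<And>t g. t permutes {0..<M} ==> g \<in> Om ==>
   \<exists>P \<sigma>. node P \<and> \<sigma> permutes {..<ar P} \<and> t = T P \<sigma> ==> act t g \<in> Om"
  and p: "\<And>n m. n \<in> set rs ==> 0 < m ==> m < n ==> p dvd (n choose m)"
  and val: "\<And>g P c m S. g \<in> Om ==> kap G g = (P, c) ==> Sg G g = {..<m} ==> m < ar P ==> S \<subseteq> {..<ar P} ==> card S = m ==>
   val (act (T P (shuffle (ar P) S)) g) = val g"
 shows "int p dvd (\<Sum>g\<in>Om. val g)"
proof -
 let ?cls = "%g. (kap G g, card (Sg G g))"
 have "(\<Sum>g\<in>Om. val g) = (\<Sum>y\<in>?cls ` Om. \<Sum>g\<in>{g\<in>Om. ?cls g = y}. val g)" by (rule sum.image_gen[OF fin])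
 moreover have "int p dvd (\<Sum>g\<in>{g\<in>Om. ?cls g = y}. val g)" if y: "y \<in> ?cls ` Om" for y
 proof -
  obtain g1 where g1: "g1 \<in> Om" "y = ?cls g1" using y by blast
  obtain P c where k1: "kap G g1 = (P, c)" by (cases "kap G g1")
  define m where "m = card (Sg G g1)"
  let ?n = "ar P"
  have nd: "node P" using kap(1)[OF gap[OF g1(1)]] k1 by (simp add: hasgap_def)
  have sub: "Sg G g \<subseteq> {..<?n} \<and> Sg G g ~= {} \<and> Sg G g ~= {..<?n}" if "g \<in> Om" "kap G g = (P, c)" for g
   using Sg(1)[OF gap[OF that(1)] G that(2)] by (simp add: mingap_def gap_def)
  have m: "0 < m" "m < ?n"
  proof -
   have "finite (Sg G g1)" using sub[OF g1(1) k1] finite_subset by blast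
   then show "0 < m" using sub[OF g1(1) k1] by (simp add: m_def card_gt_0_iff)
   have "Sg G g1 \<subset> {..<?n}" using sub[OF g1(1) k1] by blast
   from psubset_card_mono[OF _ this] show "m < ?n" by (simp add: m_def)
  qed
  let ?C = "{g\<in>Om. ?cls g = y}" and ?N = "{g\<in>Om. kap G g = (P, c) \<and> Sg G g = {..<m}}"
  let ?Q = "{S. S \<subseteq> {..<?n} \<and> card S = m}"
  let ?s = "%S. shuffle ?n S"
  have sp: "?s S permutes {..<?n}" "?s S ` {..<m} = S" if "S \<in> ?Q" for S using shuffle[of S ?n] that by auto
  have C: "g \<in> ?C \<longleftrightarrow> g \<in> Om \<and> kap G g = (P, c) \<and> card (Sg G g) = m" for g using g1(2) k1 m_def by auto
  have "(\<Sum>g\<in>?C. val g) = (\<Sum>(S, g)\<in>?Q \<times> ?N. val (act (T P (?s S)) g))"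
  proof (rule sum.reindex_bij_witness[where j = "%g. (Sg G g, act (T P (inv_into UNIV (?s (Sg G g)))) g)"
    and i = "%(S, g). act (T P (?s S)) g"])
   fix g assume "g \<in> ?C"
   then have g: "g \<in> Om" "kap G g = (P, c)" "card (Sg G g) = m" using C by blast+
   have SQ: "Sg G g \<in> ?Q" using sub[OF g(1,2)] g(3) by blast
   note s = sp[OF SQ]
   note s' = permutes_inv[OF s(1)]
   show e: "(case (Sg G g, act (T P (inv_into UNIV (?s (Sg G g)))) g) of (S, g) => act (T P (?s S)) g) = g"
    using act_act_inv(1)[OF nd s(1)] by simp
   show "(case (Sg G g, act (T P (inv_into UNIV (?s (Sg G g)))) g) of (S, g) => val (act (T P (?s S)) g)) = val g"
    using e by simp
   have "Sg G (act (T P (inv_into UNIV (?s (Sg G g)))) g) = inv_into UNIV (?s (Sg G g)) ` Sg G g"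
    by (rule Sg_act[OF gap[OF g(1)] G g(2) s'])
   also have "\<dots> = inv_into UNIV (?s (Sg G g)) ` (?s (Sg G g) ` {..<m})" unfolding s(2) ..
   also have "\<dots> = {..<m}" using permutes_inj[OF s(1)] by (simp add: image_inv_f_f)
   finally have "Sg G (act (T P (inv_into UNIV (?s (Sg G g)))) g) = {..<m}" .
   moreover have "act (T P (inv_into UNIV (?s (Sg G g)))) g \<in> Om" using inv[OF T_permutes[OF nd s'] g(1)] nd s' by blast
   ultimately show "(Sg G g, act (T P (inv_into UNIV (?s (Sg G g)))) g) \<in> ?Q \<times> ?N"
    using SQ kap_act(1)[OF gap[OF g(1)] g(2) s'] by simp
  next
   fix b assume "b \<in> ?Q \<times> ?N"
   then obtain S g where b: "b = (S, g)" "S \<in> ?Q" "g \<in> Om" "kap G g = (P, c)" "Sg G g = {..<m}" by blast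
   note s = sp[OF b(2)]
   have S1: "Sg G (act (T P (?s S)) g) = S" using Sg_act[OF gap[OF b(3)] G b(4) s(1)] b(5) s(2) by simp
   then show "(%g. (Sg G g, act (T P (inv_into UNIV (?s (Sg G g)))) g)) (case b of (S, g) => act (T P (?s S)) g) = b"
    using act_act_inv(2)[OF nd s(1)] b(1) by simp
   have "act (T P (?s S)) g \<in> Om" using inv[OF T_permutes[OF nd s(1)] b(3)] nd s(1) by blast
   then have "act (T P (?s S)) g \<in> ?C" unfolding C using kap_act(1)[OF gap[OF b(3)] b(4) s(1)] S1 b(2) by simp
   then show "(case b of (S, g) => act (T P (?s S)) g) \<in> ?C" using b(1) by simp
  qed
  also have "\<dots> = (\<Sum>(S, g)\<in>?Q \<times> ?N. val g)"
  proof (rule sum.cong[OF refl])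
   fix x assume "x \<in> ?Q \<times> ?N"
   then obtain S g where x: "x = (S, g)" "S \<in> ?Q" "g \<in> ?N" by blast
   have "val (act (T P (?s S)) g) = val g" using x val[of g P c m S] m by auto
   then show "(case x of (S, g) => val (act (T P (?s S)) g)) = (case x of (S, g) => val g)" using x(1) by simp
  qed
  also have "\<dots> = (\<Sum>S\<in>?Q. \<Sum>g\<in>?N. val g)" by (rule sum.cartesian_product[symmetric])
  also have "\<dots> = int (?n choose m) * (\<Sum>g\<in>?N. val g)"
   using n_subsets[of "{..<?n}" m] by (simp add: conj_commute)
  finally show ?thesis using p[OF ar_in[OF nd] m] by (simp add: dvd_mult2 int_dvd_int_iff)
 qed
 ultimately show ?thesis by (simp only: dvd_sum)
qed

end

section \<open>Zeros of partially equivariant maps\<close>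

context leaf_grid
begin

definition U :: "nat => (nat => int) => nat list => nat => real" where
 "U K g q c = of_int (V g q c) / real K"

lemma Bsum_U: "Bsum rs (U K g) P c = of_int (B g P c) / real K"
 by (simp add: Bsum_def U_def sum_divide_distrib)

text \<open>Radius, in units of K, beyond which small root totals force a gap: this is the bound of
  \<open>Bsum_bound\<close> when siblings spread by no more than gap-free siblings can.\<close>

definition Rn :: nat where "Rn = Nl + length rs * (Nl * (1 + 2 * Nl))"

lemma ar_le: "node P ==> ar P <= Nl"
proof -
 assume "node P"
 then have "ar P dvd prod_list rs" using ar_in by (simp add: prod_list_dvd)
 then show "ar P <= Nl" using Nl_pos by (simp add: Nl_def card_leaves dvd_imp_le)
qed

lemma far_has_gap:
 assumes K: "K > 0" and g: "g \<notin> zbox M (int K * int Rn)" "\<And>r. r >= M ==> g r = 0"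
  and root: "\<And>c. c < D ==> \<bar>B g [] c\<bar> <= int Nl"
 shows "\<exists>P c. hasgap (int K + 2 * int Nl) g P c"
proof (rule ccontr)
 assume no: "\<not> ?thesis"
 let ?G = "int K + 2 * int Nl"
 obtain r where r: "r < M" "\<bar>g r\<bar> > int K * int Rn" using g by (auto simp: zbox_def not_le)
 obtain q c where qc: "ix r = (q, c)" by (cases "ix r")
 have m: "q \<in> leaves rs" "c < D" using ix_mem[OF r(1)] qc by (auto simp: Idx_def)
 have "\<bar>Bsum rs (V g) q c\<bar> <= int Nl + int (length rs) * (int Nl * ?G)"
 proof (rule Bsum_bound[where us = "[]"])
  show "\<forall>n\<in>set rs. n > 0" using rs(2) by force
  show "int Nl * ?G >= 0" by simp
  fix us n vs P i j assume s: "rs = us @ n # vs" "P \<in> leaves vs" "i < n" "j < n"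
  have n: "node P" "ar P = n" using s ar_eq unfolding node_def by blast+
  have "\<not> B g (i # P) c - B g (j # P) c > int n * ?G"
  proof
   assume "B g (i # P) c - B g (j # P) c > int n * ?G"
   from gap_exists[OF s(4,3), of ?G "%i. B g (i # P) c", OF this] have "\<exists>S. gap n (%i. B g (i # P) c) ?G S" using K by simp
   then have "hasgap ?G g P c" using n m by (simp add: hasgap_def)
   then show False using no by blast
  qed
  moreover have "int n * ?G <= int Nl * ?G" using ar_le[OF n(1)] n(2) by (intro mult_right_mono) auto
  ultimately show "B g (i # P) c - B g (j # P) c <= int Nl * ?G" by linarith
 qed (use root m in auto)
 moreover have "Bsum rs (V g) q c = g r"
 proof -
  have "V g q c = g r" using qc xi_ix[OF r(1)] ix_mem[OF r(1)] by (simp add: V_def)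
  then show ?thesis using Bsum_leaf[OF m(1), of "V g" c] by simp
 qed
 moreover have "int Nl + int (length rs) * (int Nl * ?G) <= int K * int Rn"
 proof -
  have "1 * int Nl <= int K * int Nl" using K by (intro mult_right_mono) auto
  then have KN: "int Nl <= int K * int Nl" by simp
  then have "?G <= int K * (1 + 2 * int Nl)" by (simp add: distrib_left)
  then have "int (length rs) * (int Nl * ?G) <= int (length rs) * (int Nl * (int K * (1 + 2 * int Nl)))" by (intro mult_left_mono) auto
  then show ?thesis using KN unfolding Rn_def by (simp add: algebra_simps)
 qed
 ultimately show False using r(2) by linarith
qed

text \<open>K is the fineness of the lattice. Points are scaled by 1 / K, so that a gap of K lattice
  units becomes the unit gap of \<open>pe_inv\<close>, and the searched box keeps the radius
  \<open>Rn\<close> for every K.\<close>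

lemma pe_approx:
 fixes F :: "(nat list => nat => real) => nat list => nat => real"
  and A :: "(nat list => nat => real) => nat list => 'b"
 assumes p: "prime p" "\<And>n m. n \<in> set rs ==> 0 < m ==> m < n ==> p dvd (n choose m)"
  and sumF: "\<And>u c. c < D ==> (\<Sum>q\<in>leaves rs. F u q c) = (\<Sum>q\<in>leaves rs. u q c)"
  and F: "pe_inv rs D F" and A: "pe_inv rs D A" and Ainj: "\<And>u. inj_on (A u) (leaves rs)"
  and K: "K > 0"
 obtains g \<pi> k where "g \<in> zbox M (int K * int Rn)" "\<pi> permutes {0..<M}" "\<And>j. j <= M ==> k j > (0::real)"
  "(\<Sum>j\<le>M. k j) = 1" "\<And>q c. q \<in> leaves rs ==> c < D ==> \<bar>\<Sum>j\<le>M. k j * F (U K (kv g \<pi> j)) q c\<bar> <= 1 / real K"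
proof -
 let ?P = "{\<pi>. \<pi> permutes {0..<M}}"
 \<comment> \<open>Node totals grow by at most \<open>Nl\<close> inside a simplex, so a gap of this
   size at its base leaves one of at least K at every vertex.\<close>
 define G where "G = int K + 2 * int Nl"
 have G: "G > 0" using K by (simp add: G_def)
 define L where "L = int K * (int Rn + 1) + 8"
 have LK: "int K * int Rn + 1 <= int K * (int Rn + 1)" using K by (simp add: distrib_left)
 have zmono: "zbox M a \<subseteq> zbox M b" if "a <= b" for a b using that by (force simp: zbox_def)
 \<comment> \<open>F is used up to one layer of thickness K beyond the searched box and the identity
   outside. The switch does no harm to the symmetry, because relabelling preserves the box and both
   labellings respect it.\<close>
 define b where "b v r = (if v \<in> zbox M (int K * (int Rn + 1)) then F (U K v) (fst (ix r)) (snd (ix r)) else of_int (v r))" for v r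
 \<comment> \<open>A code that relabelling cannot change and that still separates all labels of one
   simplex: the coordinate sum tells its vertices apart, A tells the leaves apart, the last entry
   the components.\<close>
 define tri where "tri v r = ((\<Sum>r<M. v r) :: int, A (U K v) (fst (ix r)), snd (ix r))" for v r
 define Vs where "Vs = (%(g, \<pi>, k). kv g \<pi> k) ` (zbox M L \<times> ?P \<times> {..M})"
 have finP: "finite ?P" by (rule finite_permutations) simp
 have finVs: "finite Vs" unfolding Vs_def using finP by auto
 have Vs: "kv g \<pi> k \<in> Vs" if "g \<in> zbox M L" "\<pi> \<in> ?P" "k <= M" for g \<pi> k
  unfolding Vs_def by (rule image_eqI[of _ _ "(g, \<pi>, k)"]) (use that in auto)
 define Tr where "Tr = (%(v, r). tri v r) ` (Vs \<times> {..<M})"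
 have finT: "finite Tr" unfolding Tr_def using finVs by auto
 have trT: "tri v r \<in> Tr" if "v \<in> Vs" "r < M" for v r
  unfolding Tr_def by (rule image_eqI[of _ _ "(v, r)"]) (use that in auto)
 define code where "code v r = to_nat_on Tr (tri v r)" for v r
 have sum_kv: "(\<Sum>r<M. kv g \<pi> k r) = (\<Sum>r<M. g r) + int k" if "\<pi> \<in> ?P" "k <= M" for g \<pi> k
 proof -
  have "\<pi> ` {..<k} \<subseteq> {..<M}" using that permutes_image[of \<pi> "{0..<M}"] by fastforce
  then have "{..<M} \<inter> \<pi> ` {..<k} = \<pi> ` {..<k}" by blast
  then have "card ({..<M} \<inter> \<pi> ` {..<k}) = k" using that permutes_inj_on[of \<pi> "{0..<M}" "{..<k}"] by (simp add: card_image)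
  then show ?thesis by (simp add: kv_def sum.distrib sum.If_cases[of "{..<M}", simplified Int_def[symmetric]] Collect_mem_eq)
 qed
 have codeinj: "inj_on (%(k, r). code (kv g \<pi> k) r) ({..M} \<times> {..<M})" if g: "g \<in> zbox M L" and pi: "\<pi> permutes {0..<M}" for g \<pi>
 proof -
  have piP: "\<pi> \<in> ?P" using pi by simp
  have main: "k = k' \<and> r = r'" if a: "k <= M" "r < M" "k' <= M" "r' < M" and eq: "code (kv g \<pi> k) r = code (kv g \<pi> k') r'" for k r k' r'
  proof -
   note t1 = trT[OF Vs[OF g piP a(1)] a(2)] and t2 = trT[OF Vs[OF g piP a(3)] a(4)]
   have inj: "inj_on (to_nat_on Tr) Tr" by (rule inj_on_to_nat_on[OF countable_finite[OF finT]])
   have "tri (kv g \<pi> k) r = tri (kv g \<pi> k') r'"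
    using eq unfolding code_def inj_on_eq_iff[OF inj t1 t2] .
   note t' = this[unfolded tri_def prod.inject]
   note t = conjunct1[OF t'] conjunct1[OF conjunct2[OF t']] conjunct2[OF conjunct2[OF t']]
   have kk: "k = k'" using t(1) unfolding sum_kv[OF piP a(1)] sum_kv[OF piP a(3)] by linarith
   have l: "fst (ix r) \<in> leaves rs" "fst (ix r') \<in> leaves rs" using ix_mem[OF a(2)] ix_mem[OF a(4)] by (auto simp: Idx_def)
   have "fst (ix r) = fst (ix r')" using t(2) unfolding kk inj_on_eq_iff[OF Ainj l] .
   then have "ix r = ix r'" using t(3) by (rule prod_eqI)
   then have "xi (ix r) = xi (ix r')" by (rule arg_cong)
   then show ?thesis using kk unfolding xi_ix[OF a(2)] xi_ix[OF a(4)] by (rule conjI[rotated])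
  qed
  show ?thesis
  proof (rule inj_onI)
   fix x y assume x: "x \<in> {..M} \<times> {..<M}" and y: "y \<in> {..M} \<times> {..<M}"
    and e: "(case x of (k, r) => code (kv g \<pi> k) r) = (case y of (k, r) => code (kv g \<pi> k) r)"
   obtain k r where xx: "x = (k, r)" by (cases x)
   obtain k' r' where yy: "y = (k', r')" by (cases y)
   have m: "k <= M" "r < M" "k' <= M" "r' < M" using x y unfolding xx yy mem_Times_iff fst_conv snd_conv by (elim conjE; simp only: atMost_iff lessThan_iff)+
   show "x = y" using main[OF m e[unfolded xx yy prod.case]] unfolding xx yy prod.inject .
  qed
 qed
 have bout: "b g r = of_int (g r)" if "g \<notin> zbox M (L - 2)" for g r
 proof -
  have "zbox M (int K * (int Rn + 1)) \<subseteq> zbox M (L - 2)" by (rule zmono) (simp add: L_def)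
  then have "g \<notin> zbox M (int K * (int Rn + 1))" using that by blast
  then show ?thesis by (simp add: b_def)
 qed
 have L6: "L >= 6" by (simp add: L_def)
 have "\<exists>s0>0. \<forall>s. 0 < s --> s < s0 --> \<bar>\<Sum>g\<in>zbox M L. \<Sum>\<pi>\<in>?P. sign \<pi> * Phi M (%k r. b (kv g \<pi> k) r + s * huge (code (kv g \<pi> k) r))\<bar> = 1"
 proof (rule kuhn_degree_one[OF M_pos L6, of b code])
  show "b g r = of_int (g r)" if "g \<notin> zbox M (L - 2)" for g r by (rule bout[OF that])
  show "inj_on (%(k, r). code (kv g \<pi> k) r) ({..M} \<times> {..<M})" if "g \<in> zbox M L" "\<pi> permutes {0..<M}" for g \<pi>
   by (rule codeinj[OF that])
  fix s0 :: real
  assume a: "0 < s0" and b: "\<And>s. 0 < s ==> s < s0 ==> \<bar>\<Sum>g\<in>zbox M L. \<Sum>\<pi>\<in>?P. sign \<pi> * Phi M (%k r. b (kv g \<pi> k) r + s * huge (code (kv g \<pi> k) r))\<bar> = 1"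
  show ?thesis
  proof (intro exI[of _ s0] conjI allI impI)
   fix s assume "0 < s" "s < s0"
   then show "\<bar>\<Sum>g\<in>zbox M L. \<Sum>\<pi>\<in>?P. sign \<pi> * Phi M (%k r. b (kv g \<pi> k) r + s * huge (code (kv g \<pi> k) r))\<bar> = 1" by (rule b)
  qed (rule a)
 qed
 then obtain s0 where s0': "s0 > 0 \<and> (\<forall>s. 0 < s --> s < s0 --> \<bar>\<Sum>g\<in>zbox M L. \<Sum>\<pi>\<in>?P. sign \<pi> * Phi M (%k r. b (kv g \<pi> k) r + s * huge (code (kv g \<pi> k) r))\<bar> = 1)"
  by (rule exE)
 note s0 = conjunct1[OF s0'] conjunct2[OF s0', rule_format]
 define N where "N = Max (to_nat_on Tr ` Tr \<union> {0})"
 have N: "code v r <= N" if "v \<in> Vs" "r < M" for v r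
  unfolding N_def code_def using finT trT[OF that] by (intro Max_ge) auto
 have hN: "huge N > 0" by (simp add: huge_def)
 \<comment> \<open>Summed over the \<open>Nl\<close> leaves, the perturbations stay within 1 / (2
   K), half of the smallest nonzero value of a scaled root total.\<close>
 define dl where "dl = 1 / (2 * real K * real Nl)"
 have dl: "dl > 0" "dl <= 1 / real K" using K Nl_pos by (auto simp: dl_def field_simps)
 define s where "s = min (s0 / 2) (dl / huge N)"
 have s: "0 < s" "s < s0" using s0(1) dl hN by (auto simp: s_def)
 have pert: "0 <= s * huge (code v r)" "s * huge (code v r) <= dl" if "v \<in> Vs" "r < M" for v r
 proof -
  have "huge (code v r) <= huge N" using N[OF that] by (simp add: huge_def)
  then have "s * huge (code v r) <= (dl / huge N) * huge N" using s hN by (intro mult_mono) (auto simp: s_def huge_def)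
  then show "s * huge (code v r) <= dl" using hN by simp
  show "0 <= s * huge (code v r)" using s by (simp add: huge_def)
 qed
 define lab where "lab v r = b v r + s * huge (code v r)" for v r
 define val where "val g = (\<Sum>\<pi>\<in>?P. sign \<pi> * Phi M (%k. lab (kv g \<pi> k)))" for g
 have tot: "\<bar>\<Sum>g\<in>zbox M L. val g\<bar> = 1" using s0(2)[OF s] unfolding val_def lab_def .
 have sum_coord: "(\<Sum>r\<in>{r. r < M \<and> snd (ix r) = c}. f (ix r)) = (\<Sum>q\<in>leaves rs. f (q, c))" if c: "c < D" for c and f :: "nat list \<times> nat => real"
 proof (rule sum.reindex_bij_witness[where i = "%q. xi (q, c)" and j = "%r. fst (ix r)"])
  fix a assume a: "a \<in> {r. r < M \<and> snd (ix r) = c}"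
  then have e: "(fst (ix a), c) = ix a" by (simp add: prod_eq_iff)
  show "xi (fst (ix a), c) = a" "f (fst (ix a), c) = f (ix a)" using a xi_ix unfolding e by auto
  show "fst (ix a) \<in> leaves rs" using ix_mem[of a] a by (auto simp: Idx_def)
 next
  fix q assume "q \<in> leaves rs"
  then have "(q, c) \<in> Idx" using c by (simp add: Idx_def)
  then show "fst (ix (xi (q, c))) = q" "xi (q, c) \<in> {r. r < M \<and> snd (ix r) = c}" using ix_xi xi_mem by simp_all
 qed
 \<comment> \<open>Summing a component of the labels over all leaves gives a positive multiple of
   the root total under both labellings: by \<open>sumF\<close> for F, and directly for the
   identity.\<close>
 have b_sum: "\<exists>e>0. (\<Sum>r\<in>{r. r < M \<and> snd (ix r) = c}. b v r) = e * of_int (B v [] c) \<and> e >= 1 / real K" if c: "c < D" for v c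
 proof (cases "v \<in> zbox M (int K * (int Rn + 1))")
  case True
  have "(\<Sum>r\<in>{r. r < M \<and> snd (ix r) = c}. b v r) = (\<Sum>r\<in>{r. r < M \<and> snd (ix r) = c}. F (U K v) (fst (ix r)) (snd (ix r)))"
   using True by (simp add: b_def)
  also have "\<dots> = (\<Sum>q\<in>leaves rs. F (U K v) q c)" using sum_coord[OF c, of "%(q, c). F (U K v) q c"] by (simp add: case_prod_beta)
  also have "\<dots> = Bsum rs (U K v) [] c" unfolding sumF[OF c] by (simp add: Bsum_def)
  also have "\<dots> = 1 / real K * of_int (B v [] c)" by (simp add: Bsum_U)
  finally show ?thesis using K by (intro exI[of _ "1 / real K"]) auto
 next
  case False
  have "(\<Sum>r\<in>{r. r < M \<and> snd (ix r) = c}. b v r) = (\<Sum>r\<in>{r. r < M \<and> snd (ix r) = c}. of_int (v r))" using False by (simp add: b_def)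
  also have "\<dots> = (\<Sum>r\<in>{r. r < M \<and> snd (ix r) = c}. of_int (v (xi (ix r))))" using xi_ix by (intro sum.cong) auto
  also have "\<dots> = (\<Sum>q\<in>leaves rs. of_int (v (xi (q, c))))" using sum_coord[OF c, of "%x. of_int (v (xi x))"] by simp
  also have "\<dots> = of_int (B v [] c)" using c by (simp add: Bsum_def V_def Idx_def)
  finally show ?thesis using K by (intro exI[of _ 1]) auto
 qed
 \<comment> \<open>If the root total had the same sign at all vertices, so would the component sum
   of the labels, and 0 would not lie in their hull.\<close>
 have root: "\<bar>B g [] c\<bar> <= int Nl" if g: "g \<in> zbox M L" and pi: "\<pi> \<in> ?P" and ne: "Phi M (%k. lab (kv g \<pi> k)) ~= 0" and c: "c < D" for g \<pi> c
 proof (rule ccontr)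
  assume n: "\<not> ?thesis"
  obtain k where k: "\<And>j. j <= M ==> k j > 0" "(\<Sum>j\<le>M. k j) = 1" "\<And>r. r < M ==> (\<Sum>j\<le>M. k j * lab (kv g \<pi> j) r) = 0"
   using Phi_convex[OF ne] by blast
  let ?R = "{r. r < M \<and> snd (ix r) = c}"
  define S where "S j = (\<Sum>r\<in>?R. lab (kv g \<pi> j) r)" for j
  have cR: "card ?R = Nl"
   using sum_coord[OF c, of "%_. 1"] by (simp add: Nl_def)
  have z: "(\<Sum>j\<le>M. k j * S j) = 0"
  proof -
   have "(\<Sum>j\<le>M. k j * S j) = (\<Sum>r\<in>?R. \<Sum>j\<le>M. k j * lab (kv g \<pi> j) r)"
    unfolding S_def sum_distrib_left by (rule sum.swap)
   then show ?thesis using k(3) by simp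
  qed
  have Sj: "\<exists>e\<ge>1 / real K. \<exists>d\<ge>0. d <= 1 / (2 * real K) \<and> S j = e * of_int (B (kv g \<pi> j) [] c) + d" if j: "j <= M" for j
  proof -
   obtain e where e: "e >= 1 / real K" "(\<Sum>r\<in>?R. b (kv g \<pi> j) r) = e * of_int (B (kv g \<pi> j) [] c)" using b_sum[OF c] by blast
   let ?d = "\<Sum>r\<in>?R. s * huge (code (kv g \<pi> j) r)"
   have "?d <= (\<Sum>r\<in>?R. dl)" using pert Vs[OF g pi j] by (intro sum_mono) auto
   also have "\<dots> = 1 / (2 * real K)" using cR Nl_pos by (simp add: dl_def)
   finally have "?d <= 1 / (2 * real K)" .
   moreover have "?d >= 0" using pert Vs[OF g pi j] by (intro sum_nonneg) auto
   moreover have "S j = e * of_int (B (kv g \<pi> j) [] c) + ?d" unfolding S_def lab_def sum.distrib e(2) ..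
   ultimately show ?thesis using e(1) by blast
  qed
  have K2: "1 / (2 * real K) < 1 / real K" "1 / real K > 0" using K by (auto simp: field_simps)
  consider "B g [] c >= 1" | "B g [] c + int Nl <= - 1" using n by linarith
  then show False
  proof cases
   case 1
   have "k j * S j > 0" if j: "j <= M" for j
   proof -
    obtain e d where ed: "e >= 1 / real K" "d >= 0" "S j = e * of_int (B (kv g \<pi> j) [] c) + d" using Sj[OF j] by blast
    have "of_int (B (kv g \<pi> j) [] c) >= (1::real)" using B_kv(1)[of \<pi> g "[]" c j] pi 1 by simp
    moreover have "e > 0" using ed(1) K2(2) by linarith
    ultimately have "e * of_int (B (kv g \<pi> j) [] c) > 0" by (intro mult_pos_pos) linarith+
    then show ?thesis using k(1)[OF j] ed by simp
   qed
   then have "(\<Sum>j\<le>M. k j * S j) > 0" by (intro sum_pos) auto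
   then show False using z by simp
  next
   case 2
   have "- (k j * S j) > 0" if j: "j <= M" for j
   proof -
    obtain e d where ed: "e >= 1 / real K" "d <= 1 / (2 * real K)" "S j = e * of_int (B (kv g \<pi> j) [] c) + d" using Sj[OF j] by blast
    have "of_int (B (kv g \<pi> j) [] c) <= (- 1::real)" using B_kv(2)[of \<pi> g j "[]" c] pi 2 by simp
    moreover have "e >= 0" using ed(1) K2(2) by linarith
    ultimately have "e * of_int (B (kv g \<pi> j) [] c) <= e * (- 1)" by (rule mult_left_mono)
    then have "S j < 0" using ed K2 by linarith
    then show ?thesis using k(1)[OF j] by (simp add: mult_pos_neg)
   qed
   then have "(\<Sum>j\<le>M. - (k j * S j)) > 0" by (intro sum_pos) auto
   then show False using z by (simp add: sum_negf)
  qed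
 qed
 define Om where "Om = {g\<in>zbox M L. g \<notin> zbox M (int K * int Rn) \<and> (\<forall>c<D. \<bar>B g [] c\<bar> <= int Nl)}"
 have gapOm: "\<exists>P c. hasgap G g P c" if "g \<in> Om" for g
  using far_has_gap[OF K, of g] that unfolding G_def Om_def by (auto simp: zbox_def)
 have kap_node: "node P \<and> c < D" if "g \<in> Om" "kap G g = (P, c)" for g P c
  using kap(1)[OF gapOm[OF that(1)]] that(2) by (simp add: hasgap_def)
 have act_Om: "act t g \<in> Om" if t: "t permutes {0..<M}" "g \<in> Om" and ex: "\<exists>P \<sigma>. node P \<and> \<sigma> permutes {..<ar P} \<and> t = T P \<sigma>" for t g
 proof -
  obtain P \<sigma> where P: "node P" "\<sigma> permutes {..<ar P}" "t = T P \<sigma>" using ex by blast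
  have "B (act t g) [] c = B g [] c" for c using B_act[OF P(1,2), of g "[]" c] P(3) by simp
  then show ?thesis using that(2) act_zbox[OF t(1)] by (simp add: Om_def)
 qed
 have lab_act: "lab (act (T P \<sigma>) (kv g \<pi> k)) (T P \<sigma> r) = lab (kv g \<pi> k) r"
  if g: "g \<in> Om" "kap G g = (P, c)" "Sg G g = {..<m}" and m: "m < ar P" and S: "S \<subseteq> {..<ar P}" "card S = m" and sg: "\<sigma> = shuffle (ar P) S"
   and pi: "\<pi> \<in> ?P" and r: "r < M" for g P c m S \<sigma> \<pi> k r
 proof -
  have n: "node P" "c < D" using kap_node[OF g(1,2)] by auto
  obtain us vs where dec: "rs = us @ ar P # vs" "P \<in> leaves vs" using nodeE[OF n(1)] .
  have s: "\<sigma> permutes {..<ar P}" "strict_mono_on {..<m} \<sigma>" "strict_mono_on {m..<ar P} \<sigma>" using shuffle[OF S(1)] S(2) sg by auto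
  note t = T_permutes[OF n(1) s(1)]
  let ?v = "kv g \<pi> k" let ?w = "act (T P \<sigma>) ?v"
  have gp: "gap (ar P) (%i. B g (i # P) c) G {..<m}" using Sg(1)[OF gapOm[OF g(1)] G g(2)] g(3) by (simp add: mingap_def)
  have gapv: "\<forall>i<m. \<forall>j\<in>{m..<ar P}. Bsum rs (U K ?v) (i # P) c + 1 <= Bsum rs (U K ?v) (j # P) c"
  proof (intro allI impI ballI)
   fix i j assume ij: "i < m" "j \<in> {m..<ar P}"
   have "B g (i # P) c + G <= B g (j # P) c" using gapD[OF gp, of i j] ij by auto
   then have "B ?v (i # P) c + int K <= B ?v (j # P) c"
    using B_kv(2)[of \<pi> g k "i # P" c] B_kv(1)[of \<pi> g "j # P" c k] pi unfolding G_def by simp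
   then have "real_of_int (B ?v (i # P) c) + real K <= of_int (B ?v (j # P) c)" by linarith
   then have "(real_of_int (B ?v (i # P) c) + real K) / real K <= of_int (B ?v (j # P) c) / real K" by (intro divide_right_mono) auto
   then show "Bsum rs (U K ?v) (i # P) c + 1 <= Bsum rs (U K ?v) (j # P) c" using K unfolding Bsum_U by (simp add: add_divide_distrib)
  qed
  have uw: "\<forall>q\<in>leaves rs. \<forall>c<D. U K ?w (sh P \<sigma> q) c = U K ?v q c" using V_act[OF n(1) s(1)] by (simp add: U_def)
  obtain q e where qe: "ix r = (q, e)" by (cases "ix r")
  have q: "q \<in> leaves rs" using ix_mem[OF r] qe by (simp add: Idx_def)
  have Feq: "F (U K ?w) (sh P \<sigma> q) = F (U K ?v) q"
   using F[unfolded pe_inv_def, rule_format, OF dec s less_imp_le[OF m] n(2)] gapv uw q by blast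
  have Aeq: "A (U K ?w) (sh P \<sigma> q) = A (U K ?v) q"
   using A[unfolded pe_inv_def, rule_format, OF dec s less_imp_le[OF m] n(2)] gapv uw q by blast
  have ixt: "ix (T P \<sigma> r) = (sh P \<sigma> q, e)" using T_ix(2)[OF n(1) s(1) r] qe by simp
  have "b ?w (T P \<sigma> r) = b ?v r" unfolding b_def act_zbox[OF t] ixt qe using Feq t by simp
  moreover have "tri ?w (T P \<sigma> r) = tri ?v r" unfolding tri_def act_sum[OF t] ixt qe using Aeq by simp
  ultimately show ?thesis unfolding lab_def code_def by simp
 qed
 have "int p dvd (\<Sum>g\<in>Om. val g)"
 proof (rule class_sum_dvd[OF G gapOm])
  show "finite Om" by (simp add: Om_def)
  show "p dvd (n choose m)" if "n \<in> set rs" "0 < m" "m < n" for n m by (rule p(2)[OF that])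
  show "act t g \<in> Om" if "t permutes {0..<M}" "g \<in> Om" "\<exists>P \<sigma>. node P \<and> \<sigma> permutes {..<ar P} \<and> t = T P \<sigma>" for t g by (rule act_Om[OF that])
  fix g P c m S
  assume h: "g \<in> Om" "kap G g = (P, c)" "Sg G g = {..<m}" "m < ar P" "S \<subseteq> {..<ar P}" "card S = m"
  let ?s = "shuffle (ar P) S" let ?t = "T P ?s"
  have n: "node P" using kap_node[OF h(1,2)] by auto
  have t: "?t permutes {0..<M}" using T_permutes[OF n shuffle(1)[OF h(5)]] .
  have "val (act ?t g) = (\<Sum>\<pi>\<in>?P. sign (?t \<circ> \<pi>) * Phi M (%k. lab (kv (act ?t g) (?t \<circ> \<pi>) k)))"
   unfolding val_def by (rule setum_permutations_compose_left[OF t])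
  \<comment> \<open>The sign of the relabelling enters twice, through the order of the steps and
    through the permuted components of the labels, and cancels.\<close>
  also have "\<dots> = val g"
   unfolding val_def
  proof (rule sum.cong[OF refl])
   fix \<pi> assume pi: "\<pi> \<in> ?P"
   have sg: "sign (?t \<circ> \<pi>) = sign ?t * sign \<pi>"
    using t pi by (intro sign_compose) (auto intro: permutation_permutes[THEN iffD2])
   have l: "lab (kv (act ?t g) (?t \<circ> \<pi>) k) (?t r) = lab (kv g \<pi> k) r" if "r < M" for k r
    unfolding kv_act[OF t] using lab_act[OF h refl pi that] .
   have "sign ?t * Phi M (%k. lab (kv (act ?t g) (?t \<circ> \<pi>) k)) = Phi M (%k r. lab (kv (act ?t g) (?t \<circ> \<pi>) k) (?t r))"
    using Phi_permute[OF t, of "%k. lab (kv (act ?t g) (?t \<circ> \<pi>) k)"] by simp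
   also have "\<dots> = Phi M (%k. lab (kv g \<pi> k))"
   proof -
    have "minor M (%k r. lab (kv (act ?t g) (?t \<circ> \<pi>) k) (?t r)) j = minor M (%k. lab (kv g \<pi> k)) j" for j
     unfolding minor_def using l by (intro arg_cong2[where f = "(*)"] refl dt_cong) (simp add: skip_def)
    then show ?thesis unfolding Phi_def by (simp only:)
   qed
   finally show "sign (?t \<circ> \<pi>) * Phi M (%k. lab (kv (act ?t g) (?t \<circ> \<pi>) k)) = sign \<pi> * Phi M (%k. lab (kv g \<pi> k))"
    unfolding sg by (simp add: mult.assoc mult.left_commute)
  qed
  finally show "val (act ?t g) = val g" .
 qed
 moreover have "(\<Sum>g\<in>zbox M L. val g) = (\<Sum>g\<in>zbox M (int K * int Rn). val g) + (\<Sum>g\<in>Om. val g)"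
 proof -
  have sub: "zbox M (int K * int Rn) \<subseteq> zbox M L" using LK by (intro zmono) (simp add: L_def)
  have "(\<Sum>g\<in>zbox M L. val g) = (\<Sum>g\<in>zbox M L - zbox M (int K * int Rn). val g) + (\<Sum>g\<in>zbox M (int K * int Rn). val g)"
   by (rule sum.subset_diff[OF sub]) simp
  moreover have "(\<Sum>g\<in>zbox M L - zbox M (int K * int Rn). val g) = (\<Sum>g\<in>Om. val g)"
  proof (rule sum.mono_neutral_right)
   show "\<forall>g\<in>zbox M L - zbox M (int K * int Rn) - Om. val g = 0"
   proof
    fix g assume g: "g \<in> zbox M L - zbox M (int K * int Rn) - Om"
    then obtain c where c: "c < D" "\<not> \<bar>B g [] c\<bar> <= int Nl" by (auto simp: Om_def)
    have "Phi M (%k. lab (kv g \<pi> k)) = 0" if "\<pi> \<in> ?P" for \<pi>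
     using root[of g \<pi> c] g c that by blast
    then show "val g = 0" by (simp add: val_def)
   qed
  qed (auto simp: Om_def)
  ultimately show ?thesis by simp
 qed
 ultimately have "(\<Sum>g\<in>zbox M (int K * int Rn). val g) ~= 0"
 proof -
  assume d: "int p dvd (\<Sum>g\<in>Om. val g)" and e: "(\<Sum>g\<in>zbox M L. val g) = (\<Sum>g\<in>zbox M (int K * int Rn). val g) + (\<Sum>g\<in>Om. val g)"
  have "\<not> int p dvd (\<Sum>g\<in>zbox M L. val g)"
  proof
   assume "int p dvd (\<Sum>g\<in>zbox M L. val g)"
   then have "int p dvd \<bar>\<Sum>g\<in>zbox M L. val g\<bar>" by simp
   then have "int p dvd 1" unfolding tot .
   then show False using prime_gt_1_nat[OF p(1)] by simp
  qed
  then show ?thesis using d e by auto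
 qed
 then obtain g where g: "g \<in> zbox M (int K * int Rn)" "val g ~= 0" by (rule sum.not_neutral_contains_not_neutral)
 from g(2) obtain \<pi> where pi: "\<pi> \<in> ?P" "sign \<pi> * Phi M (%k. lab (kv g \<pi> k)) ~= 0"
  unfolding val_def by (rule sum.not_neutral_contains_not_neutral)
 then have pi: "\<pi> \<in> ?P" "Phi M (%k. lab (kv g \<pi> k)) ~= 0" by simp_all
 obtain k where k: "\<And>j. j <= M ==> k j > 0" "(\<Sum>j\<le>M. k j) = 1" "\<And>r. r < M ==> (\<Sum>j\<le>M. k j * lab (kv g \<pi> j) r) = 0"
  using Phi_convex[OF pi(2)] by blast
 have gL: "g \<in> zbox M L" using g(1) zmono[of "int K * int Rn" L] LK by (auto simp: L_def)
 have near: "kv g \<pi> j \<in> zbox M (int K * (int Rn + 1))" if "j <= M" for j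
 proof -
  have "\<bar>kv g \<pi> j r\<bar> <= int K * (int Rn + 1)" if "r < M" for r
  proof -
   have "\<bar>kv g \<pi> j r\<bar> <= \<bar>g r\<bar> + 1" unfolding kv_def by (cases "r \<in> \<pi> ` {..<j}") auto
   moreover have "\<bar>g r\<bar> <= int K * int Rn" using g(1) that by (simp add: zbox_def)
   ultimately show ?thesis using LK by linarith
  qed
  moreover have "kv g \<pi> j r = 0" if "r >= M" for r
  proof -
   have "\<pi> ` {..<j} \<subseteq> {0..<M}" using pi(1) \<open>j <= M\<close> permutes_image[of \<pi> "{0..<M}"] by fastforce
   then show ?thesis using g(1) that by (auto simp: kv_def zbox_def)
  qed
  ultimately show ?thesis by (simp add: zbox_def)
 qed
 show ?thesis
 proof (rule that[OF g(1)])
  show "\<pi> permutes {0..<M}" using pi by simp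
  show "k j > 0" if "j <= M" for j by (rule k(1)[OF that])
  show "(\<Sum>j\<le>M. k j) = 1" by (rule k(2))
  fix q c assume qc: "q \<in> leaves rs" "c < D"
  define r where "r = xi (q, c)"
  have I: "(q, c) \<in> Idx" using qc by (simp add: Idx_def)
  have r: "r < M" "ix r = (q, c)" using xi_mem[OF I] ix_xi[OF I] by (simp_all add: r_def)
  have "(\<Sum>j\<le>M. k j * F (U K (kv g \<pi> j)) q c) = - (\<Sum>j\<le>M. k j * (s * huge (code (kv g \<pi> j) r)))"
  proof -
   have "k j * lab (kv g \<pi> j) r = k j * F (U K (kv g \<pi> j)) q c + k j * (s * huge (code (kv g \<pi> j) r))" if "j <= M" for j
    using near[OF that] r(2) by (simp add: lab_def b_def distrib_left)
   then have "(\<Sum>j\<le>M. k j * lab (kv g \<pi> j) r) = (\<Sum>j\<le>M. k j * F (U K (kv g \<pi> j)) q c) + (\<Sum>j\<le>M. k j * (s * huge (code (kv g \<pi> j) r)))"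
    unfolding sum.distrib[symmetric] by (intro sum.cong) auto
   then show ?thesis using k(3)[OF r(1)] by simp
  qed
  moreover have "(\<Sum>j\<le>M. k j * (s * huge (code (kv g \<pi> j) r))) <= (\<Sum>j\<le>M. k j * dl)"
   using k(1) pert(2)[OF Vs[OF gL pi(1)] r(1)] by (intro sum_mono mult_left_mono) (auto intro: less_imp_le)
  moreover have "(\<Sum>j\<le>M. k j * dl) = dl" by (simp only: sum_distrib_right[symmetric] k(2) mult_1)
  moreover have "0 <= (\<Sum>j\<le>M. k j * (s * huge (code (kv g \<pi> j) r)))"
  proof (rule sum_nonneg)
   fix j assume "j \<in> {..M}"
   then show "0 <= k j * (s * huge (code (kv g \<pi> j) r))"
    using mult_nonneg_nonneg[OF less_imp_le[OF k(1)] pert(1)[OF Vs[OF gL pi(1)] r(1)]] by simp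
  qed
  ultimately show "\<bar>\<Sum>j\<le>M. k j * F (U K (kv g \<pi> j)) q c\<bar> <= 1 / real K" using dl(2) by simp
 qed
qed

text \<open>The vertices of the simplex found at fineness K are at most 1 / K apart in each
  coordinate, so along a subsequence all of them converge to one w, and the small convex
  combinations of their labels converge to F w.\<close>

theorem pe_zero:
 fixes F :: "(nat list => nat => real) => nat list => nat => real"
  and A :: "(nat list => nat => real) => nat list => 'b"
 assumes p: "prime p" "\<And>n m. n \<in> set rs ==> 0 < m ==> m < n ==> p dvd (n choose m)"
  and sumF: "\<And>u c. c < D ==> (\<Sum>q\<in>leaves rs. F u q c) = (\<Sum>q\<in>leaves rs. u q c)"
  and F: "pe_inv rs D F" and A: "pe_inv rs D A" and Ainj: "\<And>u. inj_on (A u) (leaves rs)"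
  and cont: "\<And>u w q c. (\<And>q c. (%t. u t q c) \<longlonglongrightarrow> w q c) ==> q \<in> leaves rs ==> c < D ==> (%t. F (u t) q c) \<longlonglongrightarrow> F w q c"
 obtains w where "\<And>q c. \<bar>w q c\<bar> <= real Rn" "\<And>q c. q \<in> leaves rs ==> c < D ==> F w q c = 0"
proof -
 define good where "good K g \<pi> k \<longleftrightarrow> g \<in> zbox M (int K * int Rn) \<and> \<pi> permutes {0..<M} \<and> (\<forall>j\<le>M. k j > (0::real)) \<and>
  (\<Sum>j\<le>M. k j) = 1 \<and> (\<forall>q\<in>leaves rs. \<forall>c<D. \<bar>\<Sum>j\<le>M. k j * F (U K (kv g \<pi> j)) q c\<bar> <= 1 / real K)" for K g \<pi> k
 have "\<exists>g \<pi> k. good (Suc t) g \<pi> k" for t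
 proof (rule pe_approx[OF p sumF F A Ainj zero_less_Suc[of t]])
  fix g \<pi> k
  assume "g \<in> zbox M (int (Suc t) * int Rn)" "\<pi> permutes {0..<M}" "\<And>j. j <= M ==> k j > (0::real)"
   "(\<Sum>j\<le>M. k j) = 1" "\<And>q c. q \<in> leaves rs ==> c < D ==> \<bar>\<Sum>j\<le>M. k j * F (U (Suc t) (kv g \<pi> j)) q c\<bar> <= 1 / real (Suc t)"
  then have "good (Suc t) g \<pi> k" unfolding good_def by blast
  then show ?thesis by blast
 qed
 then have "\<forall>t. \<exists>x. good (Suc t) (fst x) (fst (snd x)) (snd (snd x))" by (simp add: split_paired_Ex)
 from choice[OF this] obtain y where y: "\<And>t. good (Suc t) (fst (y t)) (fst (snd (y t))) (snd (snd (y t)))" by blast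
 define g \<pi> k where "g t = fst (y t)" and "\<pi> t = fst (snd (y t))" and "k t = snd (snd (y t))" for t
 have gd: "good (Suc t) (g t) (\<pi> t) (k t)" for t using y by (simp add: g_def \<pi>_def k_def)
 define f where "f t x = U (Suc t) (g t) (fst x) (snd x)" for t x
 have bnd: "\<bar>f t x\<bar> <= real Rn" for t x
 proof (cases "x \<in> Idx")
  case True
  have "\<bar>g t (xi x)\<bar> <= int (Suc t) * int Rn" using gd[of t] xi_mem[OF True] by (simp add: good_def zbox_def)
  then have "real_of_int \<bar>g t (xi x)\<bar> <= real_of_int (int (Suc t) * int Rn)" by (simp only: of_int_le_iff)
  then have "\<bar>real_of_int (g t (xi x))\<bar> <= real (Suc t) * real Rn" by simp
  then show ?thesis using True by (simp add: f_def U_def V_def abs_divide pos_divide_le_eq mult.commute del: of_nat_Suc)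
 qed (simp add: f_def U_def V_def)
 obtain r h where rh: "strict_mono r" "\<And>x. (%t. f (r t) x) \<longlonglongrightarrow> h x" "\<And>x. \<bar>h x\<bar> <= real Rn"
  using bounded_pointwise_subseq[of f "%_. real Rn", OF bnd] by blast
 define w where "w q c = h (q, c)" for q c
 have inv0: "(%t. 1 / real (Suc (r t))) \<longlonglongrightarrow> 0"
  using LIMSEQ_subseq_LIMSEQ[OF LIMSEQ_inverse_real_of_nat rh(1)] by (simp add: o_def inverse_eq_divide)
 have conv: "(%t. U (Suc (r t)) (kv (g (r t)) (\<pi> (r t)) j) q c) \<longlonglongrightarrow> w q c" for j q c
 proof -
  have d: "\<bar>U (Suc (r t)) (kv (g (r t)) (\<pi> (r t)) j) q c - f (r t) (q, c)\<bar> <= 1 / real (Suc (r t))" for t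
   by (simp add: U_def V_def kv_def f_def diff_divide_distrib[symmetric])
  have "(%t. U (Suc (r t)) (kv (g (r t)) (\<pi> (r t)) j) q c - f (r t) (q, c)) \<longlonglongrightarrow> 0"
   by (rule Lim_null_comparison[OF _ inv0]) (use d in simp)
  from tendsto_add[OF this rh(2)[of "(q, c)"]] show ?thesis by (simp add: w_def)
 qed
 have "F w q c = 0" if qc: "q \<in> leaves rs" "c < D" for q c
 proof -
  have lim: "(%t. F (U (Suc (r t)) (kv (g (r t)) (\<pi> (r t)) j)) q c - F w q c) \<longlonglongrightarrow> 0" for j
   using cont[of "%t. U (Suc (r t)) (kv (g (r t)) (\<pi> (r t)) j)" w, OF conv qc] by (rule LIM_zero)
  have "(%t. (\<Sum>j\<le>M. \<bar>F (U (Suc (r t)) (kv (g (r t)) (\<pi> (r t)) j)) q c - F w q c\<bar>) + 1 / real (Suc (r t))) \<longlonglongrightarrow> (\<Sum>j\<le>M. 0) + 0"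
   by (intro tendsto_add tendsto_sum tendsto_rabs_zero lim inv0)
  moreover have "\<bar>F w q c\<bar> <= (\<Sum>j\<le>M. \<bar>F (U (Suc (r t)) (kv (g (r t)) (\<pi> (r t)) j)) q c - F w q c\<bar>) + 1 / real (Suc (r t))" for t
  proof -
   let ?k = "k (r t)" let ?F = "%j. F (U (Suc (r t)) (kv (g (r t)) (\<pi> (r t)) j)) q c"
   have k: "\<And>j. j <= M ==> ?k j > 0" "(\<Sum>j\<le>M. ?k j) = 1" "\<bar>\<Sum>j\<le>M. ?k j * ?F j\<bar> <= 1 / real (Suc (r t))"
    using gd[of "r t"] qc unfolding good_def by auto
   have k1: "?k j <= 1" if "j <= M" for j
    using member_le_sum[of j "{..M}" ?k] k that by (auto intro: less_imp_le)
   have "F w q c = (\<Sum>j\<le>M. ?k j * F w q c)" by (simp only: sum_distrib_right[symmetric] k(2) mult_1)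
   also have "\<dots> = (\<Sum>j\<le>M. ?k j * ?F j) - (\<Sum>j\<le>M. ?k j * (?F j - F w q c))"
    by (simp add: sum_subtractf[symmetric] algebra_simps)
   finally have "\<bar>F w q c\<bar> <= \<bar>\<Sum>j\<le>M. ?k j * ?F j\<bar> + \<bar>\<Sum>j\<le>M. ?k j * (?F j - F w q c)\<bar>" by linarith
   also have "\<bar>\<Sum>j\<le>M. ?k j * (?F j - F w q c)\<bar> <= (\<Sum>j\<le>M. \<bar>?k j * (?F j - F w q c)\<bar>)" by (rule sum_abs)
   also have "\<dots> <= (\<Sum>j\<le>M. \<bar>?F j - F w q c\<bar>)"
   proof (rule sum_mono)
    fix j assume "j \<in> {..M}"
    then show "\<bar>?k j * (?F j - F w q c)\<bar> <= \<bar>?F j - F w q c\<bar>"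
     using k(1)[of j] k1[of j] mult_right_mono[of "?k j" 1 "\<bar>?F j - F w q c\<bar>"] by (simp add: abs_mult)
   qed
   finally show ?thesis using k(3) by simp
  qed
  ultimately have "\<bar>F w q c\<bar> <= (\<Sum>j\<le>M. 0) + 0" by (intro LIMSEQ_le_const) auto
  then show ?thesis by simp
 qed
 then show ?thesis using that[of w] rh(3) by (simp add: w_def)
qed

end

section \<open>Power cells and convergence of convex bodies\<close>

definition pval :: "(nat => 'a::euclidean_space) => (nat => real) => nat => 'a => real" where
 "pval x w i p = (norm (p - x i))\<^sup>2 - w i"

lemma power_cell_pval: "p \<in> power_cell n x w i \<longleftrightarrow> (\<forall>j<n. pval x w i p <= pval x w j p)"
 by (simp add: power_cell_def pval_def)

lemma pval_diff: "pval x w i p - pval x w j p = inner (2 *\<^sub>R (x j - x i)) p + ((norm (x i))\<^sup>2 - (norm (x j))\<^sup>2 - w i + w j)"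
 by (simp add: pval_def power2_norm_eq_inner algebra_simps inner_commute)

lemma pval_le_halfspace: "{p. pval x w i p <= pval x w j p} =
 {p. inner (2 *\<^sub>R (x j - x i)) p <= - ((norm (x i))\<^sup>2 - (norm (x j))\<^sup>2 - w i + w j)}"
proof (intro Collect_cong)
 fix p show "pval x w i p <= pval x w j p \<longleftrightarrow> inner (2 *\<^sub>R (x j - x i)) p <= - ((norm (x i))\<^sup>2 - (norm (x j))\<^sup>2 - w i + w j)"
  using pval_diff[of x w i p j] by linarith
qed

lemma power_cell_Inter: "power_cell n x w i = (\<Inter>j\<in>{..<n}. {p. pval x w i p <= pval x w j p})"
 by (auto simp: power_cell_pval)

lemma convex_power_cell: "convex (power_cell n x w i)"
 unfolding power_cell_Inter pval_le_halfspace by (intro convex_INT convex_halfspace_le)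

lemma closed_power_cell: "closed (power_cell n x w i)"
 unfolding power_cell_Inter pval_le_halfspace by (intro closed_INT ballI closed_halfspace_le)

lemma power_cells_cover: "n > 0 ==> \<exists>i<n. p \<in> power_cell n x w i"
proof -
 assume n: "n > 0"
 have "Min ((%i. pval x w i p) ` {..<n}) \<in> (%i. pval x w i p) ` {..<n}" using n by (intro Min_in) auto
 then obtain i where "i < n" "pval x w i p = Min ((%i. pval x w i p) ` {..<n})" by auto
 then show ?thesis unfolding power_cell_pval by (intro exI[of _ i]) auto
qed

lemma interior_halfspace_strict:
 assumes "p \<in> interior {p. pval x w i p <= pval x w j p}" "x i ~= x j"
 shows "pval x w i p < pval x w j p"
proof -
 have "p \<in> {p. inner (2 *\<^sub>R (x j - x i)) p < - ((norm (x i))\<^sup>2 - (norm (x j))\<^sup>2 - w i + w j)}"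
  using assms unfolding pval_le_halfspace by (subst (asm) interior_halfspace_le) auto
 then show ?thesis using pval_diff[of x w i p j] by simp
qed

lemma ties_negligible:
 assumes "x i ~= x j"
 shows "negligible {p. pval x w i p = pval x w j p}"
proof -
 have "{p. pval x w i p = pval x w j p} = {p. inner (2 *\<^sub>R (x j - x i)) p = - ((norm (x i))\<^sup>2 - (norm (x j))\<^sup>2 - w i + w j)}"
 proof (intro Collect_cong)
  fix p show "pval x w i p = pval x w j p \<longleftrightarrow> inner (2 *\<^sub>R (x j - x i)) p = - ((norm (x i))\<^sup>2 - (norm (x j))\<^sup>2 - w i + w j)"
   using pval_diff[of x w i p j] by linarith
 qed
 then show ?thesis using assms negligible_hyperplane[of "2 *\<^sub>R (x j - x i)"] by simp
qed

lemma continuous_pval [continuous_intros]: "continuous_on UNIV (pval x w i)"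
 unfolding pval_def by (intro continuous_intros)

text \<open>Pointwise convergence on the interior and locally uniform avoidance off L. Unlike
  Hausdorff convergence this passes directly to intersections with power cells; for bodies inside a
  compact set it implies Hausdorff convergence.\<close>

definition conv_sets :: "(nat => 'a::euclidean_space set) => 'a set => bool" where
 "conv_sets Lt L \<longleftrightarrow> (\<forall>p\<in>interior L. \<forall>\<^sub>F t in sequentially. p \<in> Lt t) \<and>
   (\<forall>p. p \<notin> L --> (\<forall>\<^sub>F zt in nhds p \<times>\<^sub>F sequentially. fst zt \<notin> Lt (snd zt)))"

lemma conv_sets_const: "closed L ==> conv_sets (%_. L) L"
 unfolding conv_sets_def
proof (intro conjI ballI allI impI)
 fix p assume "closed L" "p \<notin> L"
 then have "\<forall>\<^sub>F z in nhds p. z \<notin> L" using eventually_nhds_in_open[of "- L" p] by (simp add: open_Compl)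
 then show "\<forall>\<^sub>F zt in nhds p \<times>\<^sub>F sequentially. fst zt \<notin> L"
  using filterlim_fst[of "nhds p" sequentially] unfolding filterlim_iff by blast
qed (use interior_subset in auto)

lemma conv_sets_subseq: "conv_sets Lt L ==> strict_mono r ==> conv_sets (%t. Lt (r t)) L"
 unfolding conv_sets_def
proof (intro conjI ballI allI impI; elim conjE)
 fix p assume r: "strict_mono r"
 have r': "filterlim r sequentially sequentially" by (rule filterlim_subseq[OF r])
 show "\<forall>\<^sub>F t in sequentially. p \<in> Lt (r t)" if "p \<in> interior L" "\<forall>p\<in>interior L. \<forall>\<^sub>F t in sequentially. p \<in> Lt t"
  using that r' unfolding filterlim_iff by blast
 have "filterlim (%zt. (fst zt, r (snd zt))) (nhds p \<times>\<^sub>F sequentially) (nhds p \<times>\<^sub>F sequentially)"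
  by (intro filterlim_Pair filterlim_fst filterlim_compose[OF r'] filterlim_snd)
 then show "\<forall>\<^sub>F zt in nhds p \<times>\<^sub>F sequentially. fst zt \<notin> Lt (r (snd zt))" if "p \<notin> L"
  "\<forall>p. p \<notin> L --> (\<forall>\<^sub>F zt in nhds p \<times>\<^sub>F sequentially. fst zt \<notin> Lt (snd zt))"
  using that unfolding filterlim_iff by (auto dest!: spec[of _ "%zt. fst zt \<notin> Lt (snd zt)"])
qed

text \<open>At interior points of the limit cell the power inequalities are strict, because distinct
  sites give genuine half-spaces; strict inequalities survive small changes of sites and weights.
  Off the cell a strict inequality fails in the same stable way.\<close>

lemma conv_sets_cell:
 assumes L: "conv_sets Lt L" and x: "\<And>j. j < n ==> (%t. xt t j) \<longlonglongrightarrow> x j" and w: "\<And>j. j < n ==> (%t. wt t j) \<longlonglongrightarrow> w j"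
  and i: "i < n" and inj: "\<And>j. j < n ==> j ~= i ==> x j ~= x i"
 shows "conv_sets (%t. Lt t \<inter> power_cell n (xt t) (wt t) i) (L \<inter> power_cell n x w i)"
 unfolding conv_sets_def
proof (intro conjI ballI allI impI)
 fix p assume p: "p \<in> interior (L \<inter> power_cell n x w i)"
 have "\<forall>\<^sub>F t in sequentially. pval (xt t) (wt t) i p <= pval (xt t) (wt t) j p" if j: "j < n" for j
 proof (cases "j = i")
  case False
  have "L \<inter> power_cell n x w i \<subseteq> {p. pval x w i p <= pval x w j p}" using j by (auto simp: power_cell_pval)
  from interior_mono[OF this] have "p \<in> interior {p. pval x w i p <= pval x w j p}" using p by blast
  then have "pval x w i p < pval x w j p" using inj[OF j False] by (intro interior_halfspace_strict) auto
  moreover have "(%t. pval (xt t) (wt t) j p - pval (xt t) (wt t) i p) \<longlonglongrightarrow> pval x w j p - pval x w i p"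
   unfolding pval_def by (intro tendsto_intros x w i j)
  ultimately have "\<forall>\<^sub>F t in sequentially. 0 < pval (xt t) (wt t) j p - pval (xt t) (wt t) i p" by (intro order_tendstoD(1)) auto
  then show ?thesis by eventually_elim simp
 qed simp
 then have "\<forall>\<^sub>F t in sequentially. \<forall>j\<in>{..<n}. pval (xt t) (wt t) i p <= pval (xt t) (wt t) j p"
  by (intro eventually_ball_finite) auto
 moreover have "\<forall>\<^sub>F t in sequentially. p \<in> Lt t" using L p by (auto simp: conv_sets_def)
 ultimately show "\<forall>\<^sub>F t in sequentially. p \<in> Lt t \<inter> power_cell n (xt t) (wt t) i"
  by eventually_elim (auto simp: power_cell_pval)
next
 fix p assume p: "p \<notin> L \<inter> power_cell n x w i"
 show "\<forall>\<^sub>F zt in nhds p \<times>\<^sub>F sequentially. fst zt \<notin> Lt (snd zt) \<inter> power_cell n (xt (snd zt)) (wt (snd zt)) i"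
 proof (cases "p \<in> L")
  case False
  then have "\<forall>\<^sub>F zt in nhds p \<times>\<^sub>F sequentially. fst zt \<notin> Lt (snd zt)" using L by (simp add: conv_sets_def)
  then show ?thesis by eventually_elim simp
 next
  case True
  then obtain j where j: "j < n" "pval x w j p < pval x w i p" using p by (auto simp: power_cell_pval not_le)
  have f: "((%zt. fst zt) \<longlongrightarrow> p) (nhds p \<times>\<^sub>F sequentially)" by (rule filterlim_fst)
  have xx: "((%zt. xt (snd zt) j) \<longlongrightarrow> x j) (nhds p \<times>\<^sub>F sequentially)" if "j < n" for j
   by (rule filterlim_compose[OF x[OF that] filterlim_snd])
  have ww: "((%zt. wt (snd zt) j) \<longlongrightarrow> w j) (nhds p \<times>\<^sub>F sequentially)" if "j < n" for j
   by (rule filterlim_compose[OF w[OF that] filterlim_snd])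
  have "((%zt. pval (xt (snd zt)) (wt (snd zt)) i (fst zt) - pval (xt (snd zt)) (wt (snd zt)) j (fst zt)) \<longlongrightarrow> pval x w i p - pval x w j p) (nhds p \<times>\<^sub>F sequentially)"
   unfolding pval_def by (intro tendsto_intros f xx ww i j)
  then have "\<forall>\<^sub>F zt in nhds p \<times>\<^sub>F sequentially. 0 < pval (xt (snd zt)) (wt (snd zt)) i (fst zt) - pval (xt (snd zt)) (wt (snd zt)) j (fst zt)"
   using j by (intro order_tendstoD(1)) auto
  then show ?thesis by eventually_elim (use j in \<open>auto simp: power_cell_pval not_le\<close>)
 qed
qed

lemma null_sets_frontier:
 assumes "convex L" shows "frontier L \<in> null_sets lborel"
 using negligible_convex_frontier[OF assms] by (simp add: negligible_iff_null_sets null_sets_completion_iff)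

text \<open>Indicators converge off the frontier of L, which is a null set because L is convex;
  dominated convergence applies.\<close>

lemma conv_sets_measure:
 assumes "finite_measure N" and s: "sets N = sets borel" and ac: "absolutely_continuous lborel N"
  and L: "convex L" "closed L" and Lt: "\<And>t. closed (Lt t)" and conv: "conv_sets Lt L"
 shows "(%t. measure N (Lt t)) \<longlonglongrightarrow> measure N L"
proof -
 interpret finite_measure N by fact
 have sp: "space N = UNIV" using sets_eq_imp_space_eq[OF s] by simp
 have fr: "frontier L \<in> null_sets N" using ac null_sets_frontier[OF L(1)] by (auto simp: absolutely_continuous_def)
 have "(%t. integral\<^sup>L N (indicator (Lt t) :: _ => real)) \<longlonglongrightarrow> integral\<^sup>L N (indicator L)"
 proof (rule integral_dominated_convergence[where w = "%_. 1"])
  show "AE x in N. (%t. indicator (Lt t) x :: real) \<longlonglongrightarrow> indicator L x"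
  proof (rule AE_mp[OF AE_not_in[OF fr]], rule AE_I2, rule impI)
   fix p assume p: "p \<notin> frontier L"
   have "\<forall>\<^sub>F t in sequentially. (indicator L p :: real) = indicator (Lt t) p"
   proof (cases "p \<in> L")
    case True
    then have "p \<in> interior L" using p L by (simp add: frontier_def)
    then have "\<forall>\<^sub>F t in sequentially. p \<in> Lt t" using conv by (simp add: conv_sets_def)
    then show ?thesis by eventually_elim (simp add: True)
   next
    case False
    then have "\<forall>\<^sub>F zt in nhds p \<times>\<^sub>F sequentially. fst zt \<notin> Lt (snd zt)" using conv by (simp add: conv_sets_def)
    then obtain A B where AB: "eventually A (nhds p)" "eventually B sequentially" "\<And>z t. A z ==> B t ==> z \<notin> Lt t"
     unfolding eventually_prod_filter by auto
    have Ap: "A p" using AB(1) by (rule eventually_nhds_x_imp_x)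
    show ?thesis using AB(2) by eventually_elim (use AB(3) Ap False in auto)
   qed
   then show "(%t. indicator (Lt t) p :: real) \<longlonglongrightarrow> indicator L p"
    by (intro tendsto_eventually) (erule eventually_mono, simp)
  qed
  show "indicator L \<in> borel_measurable N" "indicator (Lt t) \<in> borel_measurable N" for t
   using L Lt s by (auto intro!: borel_measurable_indicator)
 qed (auto simp: indicator_def)
 then show ?thesis using L Lt s by (simp add: sp)
qed

text \<open>Compactness twice: finitely many interior points come within e / 2 of all of L, and
  finitely many open sets that the \<open>Lt t\<close> eventually miss cover the part of K at
  distance at least e / 2 from L.\<close>

lemma conv_sets_haus:
 assumes L: "L \<in> convex_bodies" and Lt: "\<And>t. Lt t \<in> convex_bodies" and K: "compact K" "\<And>t. Lt t \<subseteq> K"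
  and conv: "conv_sets Lt L" and e: "e > 0"
 shows "\<forall>\<^sub>F t in sequentially. haus_dist (Lt t) L < e"
proof -
 have cL: "compact L" "convex L" "interior L ~= {}" using L by (auto simp: convex_bodies_def)
 have ne: "L ~= {}" "Lt t ~= {}" for t using cL Lt[of t] interior_subset by (auto simp: convex_bodies_def)
 have cl: "closure (interior L) = L" using convex_closure_interior[OF cL(2,3)] cL(1) by (simp add: compact_imp_closed)
 have "L \<subseteq> (\<Union>p\<in>interior L. ball p (e/2))"
 proof
  fix x assume "x \<in> L"
  then have "x \<in> closure (interior L)" using cl by simp
  then obtain p where "p \<in> interior L" "dist p x < e/2" using e unfolding closure_approachable by (meson half_gt_zero)
  then show "x \<in> (\<Union>p\<in>interior L. ball p (e/2))" by auto
 qed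
 then obtain Q where Q: "Q \<subseteq> interior L" "finite Q" "L \<subseteq> (\<Union>p\<in>Q. ball p (e/2))"
  using compactE_image[OF cL(1), of "interior L" "%p. ball p (e/2)"] by auto
 have "\<forall>\<^sub>F t in sequentially. \<forall>p\<in>Q. p \<in> Lt t"
  using Q conv by (intro eventually_ball_finite) (auto simp: conv_sets_def)
 then have 1: "\<forall>\<^sub>F t in sequentially. \<forall>b\<in>L. infdist b (Lt t) <= e/2"
 proof eventually_elim
  fix t assume t: "\<forall>p\<in>Q. p \<in> Lt t"
  show "\<forall>b\<in>L. infdist b (Lt t) <= e/2"
  proof
   fix b assume "b \<in> L"
   then obtain p where "p \<in> Q" "dist p b < e/2" using Q by auto
   then show "infdist b (Lt t) <= e/2" using t infdist_le[of p "Lt t" b] by (force simp: dist_commute)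
  qed
 qed
 define C where "C = K \<inter> {x. e/2 <= infdist x L}"
 have cC: "compact C" unfolding C_def by (intro compact_Int_closed K closed_Collect_le continuous_intros)
 have "\<exists>A. open A \<and> p \<in> A \<and> (\<forall>\<^sub>F t in sequentially. A \<inter> Lt t = {})" if "p \<in> C" for p
 proof -
  have "p \<notin> L" using that e by (auto simp: C_def)
  then have "\<forall>\<^sub>F zt in nhds p \<times>\<^sub>F sequentially. fst zt \<notin> Lt (snd zt)" using conv by (simp add: conv_sets_def)
  then obtain A B where AB: "eventually A (nhds p)" "eventually B sequentially" "\<And>z t. A z ==> B t ==> z \<notin> Lt t"
   unfolding eventually_prod_filter by auto
  obtain S where S: "open S" "p \<in> S" "\<And>z. z \<in> S ==> A z" using AB(1) unfolding eventually_nhds by blast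
  have "\<forall>\<^sub>F t in sequentially. S \<inter> Lt t = {}" using AB(2) by eventually_elim (use AB(3) S(3) in auto)
  then show ?thesis using S by blast
 qed
 then have "\<forall>p\<in>C. \<exists>A. open A \<and> p \<in> A \<and> (\<forall>\<^sub>F t in sequentially. A \<inter> Lt t = {})" by blast
 from bchoice[OF this] obtain A where A: "\<forall>p\<in>C. open (A p) \<and> p \<in> A p \<and> (\<forall>\<^sub>F t in sequentially. A p \<inter> Lt t = {})" by blast
 have "C \<subseteq> (\<Union>p\<in>C. A p)" using A by blast
 then obtain Q' where Q': "Q' \<subseteq> C" "finite Q'" "C \<subseteq> (\<Union>p\<in>Q'. A p)"
  using compactE_image[OF cC, of C A] A by auto
 have "\<forall>\<^sub>F t in sequentially. \<forall>p\<in>Q'. A p \<inter> Lt t = {}" using Q' A by (intro eventually_ball_finite) auto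
 then have 2: "\<forall>\<^sub>F t in sequentially. \<forall>a\<in>Lt t. infdist a L <= e/2"
 proof eventually_elim
  fix t assume t: "\<forall>p\<in>Q'. A p \<inter> Lt t = {}"
  show "\<forall>a\<in>Lt t. infdist a L <= e/2"
  proof (rule ballI, rule ccontr)
   fix a assume a: "a \<in> Lt t" "\<not> infdist a L <= e/2"
   then have "a \<in> C" using K(2)[of t] by (auto simp: C_def)
   then show False using Q'(3) t a by blast
  qed
 qed
 from 1 2 show ?thesis
 proof eventually_elim
  case (elim t)
  have "(SUP a\<in>Lt t. infdist a L) <= e/2" "(SUP b\<in>L. infdist b (Lt t)) <= e/2"
   using elim ne by (intro cSUP_least; blast)+
  then show ?case using e by (simp add: haus_dist_def)
 qed
qed

lemma conv_sets_haus_continuous: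
 assumes "haus_continuous \<phi>" "L \<in> convex_bodies" "\<And>t. Lt t \<in> convex_bodies" "compact K" "\<And>t. Lt t \<subseteq> K" "conv_sets Lt L"
 shows "(%t. \<phi> (Lt t)) \<longlonglongrightarrow> \<phi> L"
proof (rule tendstoI)
 fix e :: real assume "e > 0"
 then obtain d where d: "d > 0" "\<And>L'. L' \<in> convex_bodies ==> haus_dist L' L < d ==> \<bar>\<phi> L' - \<phi> L\<bar> < e"
  using assms(1,2) unfolding haus_continuous_def by metis
 from conv_sets_haus[OF assms(2-6) d(1)] show "\<forall>\<^sub>F t in sequentially. dist (\<phi> (Lt t)) (\<phi> L) < e"
  by eventually_elim (simp add: dist_real_def d(2) assms(3))
qed

lemma tendsto_via_subseq:
 fixes f :: "nat => 'x::metric_space"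
 assumes "\<And>r. strict_mono (r :: nat => nat) ==> \<exists>s. strict_mono (s :: nat => nat) \<and> (%t. f (r (s t))) \<longlonglongrightarrow> l"
 shows "f \<longlonglongrightarrow> l"
proof (rule ccontr)
 assume "\<not> f \<longlonglongrightarrow> l"
 then obtain e where e: "e > 0" "\<not> (\<forall>\<^sub>F t in sequentially. dist (f t) l < e)" unfolding tendsto_iff by blast
 define S where "S = {t. \<not> dist (f t) l < e}"
 have "\<exists>\<^sub>F t in cofinite. t \<in> S" using e(2) by (simp add: S_def frequently_def cofinite_eq_sequentially)
 then have inf: "infinite S" by (simp add: frequently_cofinite)
 obtain s where s: "strict_mono (s :: nat => nat)" "(%t. f (enumerate S (s t))) \<longlonglongrightarrow> l"
  using assms[of "enumerate S"] strict_mono_enumerate[OF inf] by blast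
 have "\<forall>\<^sub>F t in sequentially. dist (f (enumerate S (s t))) l < e" using s(2) e(1) by (rule tendstoD)
 then obtain t where "dist (f (enumerate S (s t))) l < e" using eventually_happens'[OF sequentially_bot] by blast
 then show False using enumerate_in_set[OF inf, of "s t"] by (simp add: S_def)
qed

section \<open>Power diagrams with equal cell masses\<close>

definition dist_sites :: "nat => (nat => 'a::euclidean_space) => bool" where
 "dist_sites n x \<longleftrightarrow> (\<forall>i<n. \<forall>j<n. i ~= j --> x i ~= x j)"

text \<open>A point of the nonempty cell i bounds w j - w i by a squared distance; averaging over j
  works because the weights sum to 0.\<close>

lemma weights_bound:
 assumes ne: "\<And>i. i < n ==> K \<inter> power_cell n x w i ~= {}" and s: "(\<Sum>j<n. w j) = 0"
  and R: "\<And>p j. p \<in> K ==> j < n ==> norm (p - x j) <= R" and i: "i < n"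
 shows "\<bar>w i\<bar> <= R\<^sup>2"
proof -
 have d: "w j - w i <= R\<^sup>2" if ij: "i < n" "j < n" for i j
 proof -
  obtain p where p: "p \<in> K" "p \<in> power_cell n x w i" using ne[OF ij(1)] by blast
  then have "pval x w i p <= pval x w j p" using ij by (simp add: power_cell_pval)
  moreover have "(norm (p - x j))\<^sup>2 <= R\<^sup>2" using p ij R[of p j] by (intro power_mono) auto
  ultimately show ?thesis by (simp add: pval_def) (smt (verit) zero_le_power2)
 qed
 have n: "real n > 0" using i by simp
 have "(\<Sum>j<n. w j - w i) <= (\<Sum>j<n. R\<^sup>2)" using d i by (intro sum_mono) auto
 then have "real n * (- w i) <= real n * R\<^sup>2" by (simp add: sum_subtractf s)
 then have "- w i <= R\<^sup>2" using n by (rule mult_left_le_imp_le)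
 have "(\<Sum>j<n. w i - w j) <= (\<Sum>j<n. R\<^sup>2)" using d i by (intro sum_mono) auto
 then have "real n * w i <= real n * R\<^sup>2" by (simp add: sum_subtractf s)
 then have "w i <= R\<^sup>2" using n by (rule mult_left_le_imp_le)
 then show ?thesis using \<open>- w i <= R\<^sup>2\<close> by linarith
qed

text \<open>Positive mass on every nonempty open subset of K is what makes balanced weights unique,
  and uniqueness makes them continuous and symmetric.\<close>

locale body_mass =
 fixes K :: "'a::euclidean_space set" and \<nu> :: "'a measure"
 assumes K: "K \<in> convex_bodies" and fin: "finite_measure \<nu>" and sets_nu: "sets \<nu> = sets borel"
  and ac: "absolutely_continuous lborel \<nu>"
  and pos: "\<And>A. open A ==> A ~= {} ==> A \<subseteq> K ==> measure \<nu> A > 0"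
begin

sublocale finite_measure \<nu> by (rule fin)

lemma K': "compact K" "convex K" "interior K ~= {}" using K by (auto simp: convex_bodies_def)

lemma closed_nu [simp]: "closed A ==> A \<in> sets \<nu>" and open_nu [simp]: "open A ==> A \<in> sets \<nu>"
 by (simp_all add: sets_nu)

lemma null_nu: "N \<in> sets borel ==> negligible N ==> N \<in> null_sets \<nu>"
proof -
 assume "N \<in> sets borel" "negligible N"
 then have "N \<in> null_sets lborel" by (simp add: negligible_iff_null_sets null_sets_completion_iff)
 then show "N \<in> null_sets \<nu>" using ac by (auto simp: absolutely_continuous_def)
qed

lemma body_pos:
 assumes "convex L" "compact L" "L \<subseteq> K"
 shows "measure \<nu> L > 0 \<longleftrightarrow> interior L ~= {}"
proof
 assume p: "measure \<nu> L > 0"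
 show "interior L ~= {}"
 proof
  assume "interior L = {}"
  then have "negligible L" using assms by (simp add: negligible_convex_interior)
  then have "L \<in> null_sets \<nu>" using assms by (intro null_nu) (auto simp: compact_imp_closed)
  then show False using p by (simp add: measure_eq_0_null_sets)
 qed
next
 assume "interior L ~= {}"
 then have "measure \<nu> (interior L) > 0" using assms interior_subset[of L] by (intro pos) auto
 also have "measure \<nu> (interior L) <= measure \<nu> L" using assms interior_subset by (intro finite_measure_mono) (auto simp: compact_imp_closed)
 finally show "measure \<nu> L > 0" .
qed

abbreviation cell where "cell n x w L i \<equiv> L \<inter> power_cell n x w i"

definition sub_body :: "'a set => bool" where "sub_body L \<longleftrightarrow> L \<in> convex_bodies \<and> L \<subseteq> K"

lemma sub_bodyD: "sub_body L ==> compact L" "sub_body L ==> convex L" "sub_body L ==> interior L ~= {}" "sub_body L ==> L \<subseteq> K" "sub_body L ==> closed L"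
 by (auto simp: sub_body_def convex_bodies_def compact_imp_closed)

lemma cell_props: "sub_body L ==> compact (cell n x w L i)" "sub_body L ==> convex (cell n x w L i)" "sub_body L ==> closed (cell n x w L i)" "sub_body L ==> cell n x w L i \<subseteq> K"
 using sub_bodyD[of L] by (auto intro: compact_Int_closed closed_power_cell convex_Int convex_power_cell compact_imp_closed)

text \<open>Cells overlap only where two power values tie, which happens on hyperplanes.\<close>

lemma measure_cells:
 assumes L: "sub_body L" and d: "dist_sites n x" and J: "J \<subseteq> {..<n}"
 shows "measure \<nu> (\<Union>i\<in>J. cell n x w L i) = (\<Sum>i\<in>J. measure \<nu> (cell n x w L i))"
proof -
 have fJ: "finite J" using J finite_subset by blast
 have sp: "space \<nu> = UNIV" using sets_eq_imp_space_eq[OF sets_nu] by simp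
 have m: "cell n x w L i \<in> sets \<nu>" for i using cell_props(3)[OF L] by simp
 have "(\<Sum>i\<in>J. measure \<nu> (cell n x w L i)) = (\<Sum>i\<in>J. integral\<^sup>L \<nu> (indicator (cell n x w L i)))"
  by (intro sum.cong) (simp_all add: sp)
 also have "\<dots> = integral\<^sup>L \<nu> (%p. \<Sum>i\<in>J. indicator (cell n x w L i) p)"
  by (intro Bochner_Integration.integral_sum[symmetric] integrable_real_indicator) (use m emeasure_finite in \<open>auto simp: top.not_eq_extremum[symmetric]\<close>)
 also have "\<dots> = integral\<^sup>L \<nu> (indicator (\<Union>i\<in>J. cell n x w L i))"
 proof (rule integral_cong_AE)
  define T where "T = (\<Union>i\<in>J. \<Union>j\<in>J - {i}. {p. pval x w i p = pval x w j p})"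
  have "T \<in> null_sets \<nu>" unfolding T_def
  proof (intro null_sets.finite_UN fJ finite_Diff)
   fix i j assume ij: "i \<in> J" "j \<in> J - {i}"
   then have "i < n" "j < n" "i ~= j" using J by blast+
   then have "x i ~= x j" using d by (simp add: dist_sites_def)
   then show "{p. pval x w i p = pval x w j p} \<in> null_sets \<nu>"
    by (intro null_nu ties_negligible borel_closed closed_Collect_eq continuous_pval)
  qed
  from AE_not_in[OF this] show "AE p in \<nu>. (\<Sum>i\<in>J. indicator (cell n x w L i) p) = (indicator (\<Union>i\<in>J. cell n x w L i) p :: real)"
  proof (rule AE_mp, intro AE_I2 impI)
   fix p assume p: "p \<notin> T"
   show "(\<Sum>i\<in>J. indicator (cell n x w L i) p) = (indicator (\<Union>i\<in>J. cell n x w L i) p :: real)"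
   proof (cases "\<exists>i\<in>J. p \<in> cell n x w L i")
    case True
    then obtain i where i: "i \<in> J" "p \<in> cell n x w L i" by blast
    have "p \<notin> cell n x w L j" if j: "j \<in> J - {i}" for j
    proof
     assume "p \<in> cell n x w L j"
     then have "pval x w i p = pval x w j p" using i j J by (intro antisym) (auto simp: power_cell_pval subset_iff)
     then show False using p i j by (auto simp: T_def)
    qed
    then have "(\<Sum>i\<in>J - {i}. indicator (cell n x w L i) p) = (0::real)" by (intro sum.neutral) (auto simp: indicator_def)
    then show ?thesis using i fJ by (subst sum.remove[of _ i]) (auto simp: indicator_def)
   qed (auto simp: indicator_def)
  qed
  show "(%p. \<Sum>i\<in>J. indicator (cell n x w L i) p :: real) \<in> borel_measurable \<nu>"
   using m by (intro borel_measurable_sum borel_measurable_indicator)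
  show "(indicator (\<Union>i\<in>J. cell n x w L i) :: _ => real) \<in> borel_measurable \<nu>"
   using m fJ by (intro borel_measurable_indicator sets.finite_UN)
 qed
 also have "\<dots> = measure \<nu> (\<Union>i\<in>J. cell n x w L i)" by (simp add: sp)
 finally show ?thesis by simp
qed

lemma cells_total:
 assumes L: "sub_body L" and d: "dist_sites n x" and n: "n > 0"
 shows "(\<Sum>i<n. measure \<nu> (cell n x w L i)) = measure \<nu> L"
proof -
 have "(\<Union>i\<in>{..<n}. cell n x w L i) = L" using power_cells_cover[OF n, of _ x w] by blast
 then show ?thesis using measure_cells[OF L d order_refl, of w] by simp
qed

definition balanced :: "nat => (nat => 'a) => 'a set => (nat => real) => bool" where
 "balanced n x L w \<longleftrightarrow> (\<Sum>i<n. w i) = 0 \<and> (\<forall>i\<ge>n. w i = 0) \<and> (\<forall>i<n. measure \<nu> (cell n x w L i) = measure \<nu> L / real n)"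

lemma balanced_cell_body:
 assumes L: "sub_body L" and b: "balanced n x L w" and i: "i < n"
 shows "sub_body (cell n x w L i)"
proof -
 have "measure \<nu> (cell n x w L i) > 0" using b i body_pos[of L] sub_bodyD[OF L] by (auto simp: balanced_def)
 then have "interior (cell n x w L i) ~= {}" using body_pos[OF cell_props(2,1,4)[OF L]] by blast
 then show ?thesis using cell_props[OF L, of n x w i] by (simp add: sub_body_def convex_bodies_def)
qed

lemma balanced_bound:
 assumes L: "sub_body L" and b: "balanced n x L w" and R: "\<And>p j. p \<in> K ==> j < n ==> norm (p - x j) <= R"
 shows "\<bar>w i\<bar> <= R\<^sup>2"
proof (cases "i < n")
 case True
 have "K \<inter> power_cell n x w i ~= {}" if "i < n" for i
  using sub_bodyD(3)[OF balanced_cell_body[OF L b that]] interior_subset[of "cell n x w L i"] sub_bodyD(4)[OF L] by blast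
 then show ?thesis by (rule weights_bound[OF _ _ R True]) (use b in \<open>simp_all add: balanced_def\<close>)
qed (use b in \<open>simp add: balanced_def\<close>)

text \<open>Let I be the indices where w - w' is largest and J the others. Passing from w' to w, the
  union of the cells of J can only shrink. As L is connected, the two unions of cells meet, and near
  a common point J loses an open set, hence positive mass, although its total mass is
  prescribed.\<close>

lemma balanced_unique:
 assumes L: "sub_body L" and d: "dist_sites n x" and b: "balanced n x L w" "balanced n x L w'"
 shows "w = w'"
proof (rule ccontr)
 assume ne: "w ~= w'"
 then obtain k where k: "w k ~= w' k" by blast
 then have kn: "k < n" using b unfolding balanced_def by (metis not_le)
 define \<delta> where "\<delta> = Max ((%i. w i - w' i) ` {..<n})"
 define I where "I = {i. i < n \<and> w i - w' i = \<delta>}"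
 define J where "J = {i. i < n \<and> w i - w' i < \<delta>}"
 have le: "w i - w' i <= \<delta>" if "i < n" for i unfolding \<delta>_def using that by (intro Max_ge) auto
 have "\<delta> \<in> (%i. w i - w' i) ` {..<n}" unfolding \<delta>_def using kn by (intro Max_in) auto
 then obtain i0 where i0: "i0 \<in> I" by (auto simp: I_def)
 have IJ: "I \<union> J = {..<n}" using le by (force simp: I_def J_def)
 have "J ~= {}"
 proof
  assume "J = {}"
  then have c: "w i - w' i = \<delta>" if "i < n" for i using that IJ by (auto simp: I_def)
  have "(\<Sum>i<n. w i - w' i) = 0" using b by (simp add: sum_subtractf balanced_def)
  then have "real n * \<delta> = 0" using c by simp
  then have "\<delta> = 0" using kn by simp
  then show False using c[OF kn] k by simp
 qed
 then obtain j0 where j0: "j0 \<in> J" by blast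
 define C where "C = (\<Union>i\<in>I. cell n x w' L i)"
 define C' where "C' = (\<Union>i\<in>J. cell n x w' L i)"
 have fin: "finite I" "finite J" by (auto simp: I_def J_def)
 have cC: "closed C" "closed C'" unfolding C_def C'_def using cell_props(3)[OF L] fin by (intro closed_UN ballI; blast)+
 have LC: "L = C \<union> C'"
 proof -
  have "C \<union> C' = (\<Union>i\<in>I \<union> J. cell n x w' L i)" by (auto simp: C_def C'_def)
  then show ?thesis unfolding IJ using power_cells_cover[of n _ x w'] kn by fastforce
 qed
 have ne': "cell n x w' L i ~= {}" if "i < n" for i
  using sub_bodyD(3)[OF balanced_cell_body[OF L b(2) that]] interior_subset by blast
 have neC: "C ~= {}" "C' ~= {}" using i0 j0 ne' unfolding C_def C'_def I_def J_def by blast+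
 have con: "connected L" using sub_bodyD[OF L] by (simp add: convex_connected)
 have "C \<inter> C' ~= {}"
 proof
  assume e: "C \<inter> C' = {}"
  then have "C \<inter> C' \<inter> L = {}" by blast
  from connected_closedD[OF con this equalityD1[OF LC] cC] show False using neC unfolding LC by blast
 qed
 then obtain p i j where p: "i \<in> I" "j \<in> J" "p \<in> cell n x w' L i" "p \<in> cell n x w' L j" unfolding C_def C'_def by blast
 \<comment> \<open>Around p, which w' assigns to i and j alike, w strictly prefers i to every index
   of J.\<close>
 define N where "N = (\<Inter>l\<in>J. {q. pval x w i q < pval x w l q})"
 have oN: "open N" unfolding N_def using fin by (intro open_INT ballI open_Collect_less continuous_pval) auto
 have pN: "p \<in> N"
 proof -
  have "pval x w i p < pval x w l p" if l: "l \<in> J" for l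
  proof -
   have "pval x w' i p <= pval x w' l p" using p l by (auto simp: power_cell_pval J_def)
   moreover have "w i - w' i = \<delta>" "w l - w' l < \<delta>" using p(1) l by (auto simp: I_def J_def)
   ultimately show ?thesis unfolding pval_def by linarith
  qed
  then show ?thesis by (simp add: N_def)
 qed
 define Q where "Q = cell n x w' L j"
 have bQ: "sub_body Q" unfolding Q_def using balanced_cell_body[OF L b(2)] p(2) by (simp add: J_def)
 have "closure (interior Q) = Q" using convex_closure_interior[OF sub_bodyD(2,3)[OF bQ]] sub_bodyD(5)[OF bQ] by simp
 then have "p \<in> closure (interior Q)" using p(4) by (simp add: Q_def)
 then have "N \<inter> interior Q ~= {}" using oN pN open_Int_closure_eq_empty[of N "interior Q"] by blast
 then have mO: "measure \<nu> (N \<inter> interior Q) > 0"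
  using oN interior_subset[of Q] sub_bodyD(4)[OF bQ] by (intro pos) auto
 define E where "E = (\<Union>l\<in>J. cell n x w L l)"
 have J': "J \<subseteq> {..<n}" by (auto simp: J_def)
 have mE: "measure \<nu> E = measure \<nu> C'"
 proof -
  have "(\<Sum>i\<in>J. measure \<nu> (cell n x w L i)) = (\<Sum>i\<in>J. measure \<nu> (cell n x w' L i))"
   using b by (intro sum.cong) (auto simp: balanced_def J_def)
  then show ?thesis unfolding E_def C'_def measure_cells[OF L d J'] .
 qed
 have sub: "E \<subseteq> C' - (N \<inter> interior Q)"
 proof
  fix q assume "q \<in> E"
  then obtain l where l: "l \<in> J" "q \<in> cell n x w L l" unfolding E_def by blast
  have iJ: "i < n" using p(1) by (simp add: I_def)
  have "q \<notin> N" using l iJ by (auto simp: N_def power_cell_pval not_less)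
  obtain m where m: "m < n" "q \<in> power_cell n x w' m" using power_cells_cover[of n q x w'] kn by auto
  have "m \<in> J"
  proof (rule ccontr)
   assume "m \<notin> J"
   then have "m \<in> I" using IJ m by auto
   then have "w m - w' m = \<delta>" "w l - w' l < \<delta>" using l by (auto simp: I_def J_def)
   moreover have "pval x w' m q <= pval x w' l q" "pval x w l q <= pval x w m q" using m l by (auto simp: power_cell_pval J_def)
   ultimately show False unfolding pval_def by linarith
  qed
  then have "q \<in> C'" using m l unfolding C'_def by blast
  then show "q \<in> C' - (N \<inter> interior Q)" using \<open>q \<notin> N\<close> by blast
 qed
 have sC: "C' \<in> sets \<nu>" using cC(2) by simp
 have sO: "N \<inter> interior Q \<in> sets \<nu>" using oN by (intro open_nu) auto
 have OC: "N \<inter> interior Q \<subseteq> C'" using interior_subset[of Q] p(2) unfolding Q_def C'_def by blast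
 have "measure \<nu> E <= measure \<nu> (C' - (N \<inter> interior Q))" using sub sC sO by (intro finite_measure_mono) auto
 also have "\<dots> = measure \<nu> C' - measure \<nu> (N \<inter> interior Q)" by (rule finite_measure_Diff[OF sC sO OC])
 finally show False using mE mO by simp
qed

end

lemma power_cell_shift_cong:
 assumes "\<And>j. j < n ==> w' j = w j + c" "i < n"
 shows "power_cell n x w' i = power_cell n x w i"
 using assms by (auto simp: power_cell_def)

context body_mass
begin

lemma sites_bound:
 fixes n :: nat
 obtains R where "R >= 0" "\<And>p j. p \<in> K ==> j < n ==> norm (p - x j) <= R"
proof -
 obtain B where B: "\<And>p. p \<in> K ==> norm p <= B" using compact_imp_bounded[OF K'(1)] by (auto simp: bounded_iff)
 have b: "norm (x j) <= (\<Sum>j<n. norm (x j))" if "j < n" for j using that by (intro member_le_sum) auto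
 have "norm (p - x j) <= \<bar>B\<bar> + (\<Sum>j<n. norm (x j))" if "p \<in> K" "j < n" for p j
  using norm_triangle_ineq4[of p "x j"] b[OF that(2)] B[OF that(1)] by linarith
 then show ?thesis using that[of "\<bar>B\<bar> + (\<Sum>j<n. norm (x j))"] by (simp add: sum_nonneg)
qed

lemma cell_measure_tendsto:
 assumes L: "sub_body L" "\<And>t. sub_body (Lt t)" "conv_sets Lt L" and d: "dist_sites n x"
  and x: "\<And>j. j < n ==> (%t. xt t j) \<longlonglongrightarrow> x j" and w: "\<And>j. j < n ==> (%t. wt t j) \<longlonglongrightarrow> w j" and i: "i < n"
 shows "(%t. measure \<nu> (cell n (xt t) (wt t) (Lt t) i)) \<longlonglongrightarrow> measure \<nu> (cell n x w L i)"
 by (rule conv_sets_measure[OF fin sets_nu ac cell_props(2,3)[OF L(1)] cell_props(3)[OF L(2)] conv_sets_cell[OF L(3) x w i]])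
  (use d i in \<open>auto simp: dist_sites_def\<close>)

text \<open>Maximise the sum of the weights, with w 0 fixed at 0, subject to no cell other than cell
  0 exceeding its share. At a maximum none of them falls short: raising its weight slightly would
  keep it within its share and only shrink the others. Cell 0 then receives the rest, its own
  share.\<close>

lemma balanced_exists:
 assumes L: "sub_body L" and d: "dist_sites n x" and n: "n > 0"
 shows "\<exists>w. balanced n x L w"
proof -
 define f where "f w i = measure \<nu> (cell n x w L i)" for w i
 define m where "m = measure \<nu> L"
 have m: "m > 0" unfolding m_def using body_pos sub_bodyD[OF L] by blast
 obtain R where R: "R >= 0" "\<And>p j. p \<in> K ==> j < n ==> norm (p - x j) <= R" using sites_bound by blast
 \<comment> \<open>Weight - B against w 0 = 0 makes a cell empty, which gives a feasible start. The
   1 leaves room at the other end: as cell 0 has mass, each w i is at most B - 1 and can still be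
   raised.\<close>
 define B where "B = R\<^sup>2 + 1"
 have R2: "(norm (p - x j))\<^sup>2 <= R\<^sup>2" if "p \<in> L" "j < n" for p j using R(2)[of p j] that sub_bodyD(4)[OF L] by (intro power_mono) auto
 define S where "S = {w :: nat => real. w 0 = 0 \<and> (\<forall>i\<ge>n. w i = 0) \<and> (\<forall>i. \<bar>w i\<bar> <= B) \<and> (\<forall>i. 1 <= i \<and> i < n --> f w i <= m / n)}"
 define h where "h w = (\<Sum>i<n. w i)" for w :: "nat => real"
 have B: "B >= 1" by (simp add: B_def)
 have cont: "(%t. f (wt t) i) \<longlonglongrightarrow> f w i" if "\<And>j. (%t. wt t j) \<longlonglongrightarrow> w j" "i < n" for wt w i
  unfolding f_def using cell_measure_tendsto[OF L L conv_sets_const d _ that, of "%_. x"] sub_bodyD(5)[OF L] by simp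
 define w0 where "w0 i = (if 1 <= i \<and> i < n then - B else 0)" for i
 have "w0 \<in> S"
 proof -
  have "f w0 i <= m / n" if i: "1 <= i \<and> i < n" for i
  proof -
   have "cell n x w0 L i = {}"
   proof (rule equals0I)
    fix p assume p: "p \<in> cell n x w0 L i"
    then have "pval x w0 i p <= pval x w0 0 p" using n by (simp add: power_cell_pval)
    then have "(norm (p - x i))\<^sup>2 + B <= (norm (p - x 0))\<^sup>2" using i by (simp add: pval_def w0_def)
    moreover have "(norm (p - x 0))\<^sup>2 <= R\<^sup>2" using R2 p n by blast
    ultimately show False using zero_le_power2[of "norm (p - x i)"] unfolding B_def by linarith
   qed
   then show ?thesis using m n by (simp add: f_def)
  qed
  then show ?thesis using B by (auto simp: S_def w0_def)
 qed
 have hB: "h w <= real n * B" if "w \<in> S" for w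
 proof -
  have "w i <= B" for i using that by (auto simp: S_def abs_le_iff)
  then have "h w <= (\<Sum>i<n. B)" unfolding h_def by (intro sum_mono)
  then show ?thesis by simp
 qed
 define s where "s = (SUP w\<in>S. h w)"
 have bd: "bdd_above (h ` S)" using hB by (intro bdd_aboveI2)
 have hs: "h w <= s" if "w \<in> S" for w unfolding s_def by (rule cSUP_upper[OF that bd])
 have "\<forall>t. \<exists>w. w \<in> S \<and> h w > s - 1 / real (Suc t)"
 proof
  fix t
  have "s - 1 / real (Suc t) < (SUP w\<in>S. h w)" by (simp add: s_def)
  then show "\<exists>w. w \<in> S \<and> h w > s - 1 / real (Suc t)" using less_cSUP_iff[of S h] \<open>w0 \<in> S\<close> bd by blast
 qed
 from choice[OF this] obtain wt where wt: "\<And>t. wt t \<in> S" "\<And>t. h (wt t) > s - 1 / real (Suc t)" by blast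
 have "\<bar>wt t i\<bar> <= B" for t i using wt(1)[of t] by (simp add: S_def)
 then obtain r w where r: "strict_mono (r :: nat => nat)" and w: "\<And>i. (%t. wt (r t) i) \<longlonglongrightarrow> w i" and wB: "\<And>i. \<bar>w i\<bar> <= B"
  using bounded_pointwise_subseq[of wt "%_. B"] by blast
 have wS: "w \<in> S"
 proof -
  have z: "w i = 0" if "i = 0 \<or> i >= n" for i
  proof -
   have "wt (r t) i = 0" for t using that wt(1)[of "r t"] by (auto simp: S_def)
   then show ?thesis using w[of i] by (simp add: LIMSEQ_const_iff)
  qed
  have "f w i <= m / n" if i: "1 <= i" "i < n" for i
   by (rule LIMSEQ_le_const2[OF cont[OF w i(2)]]) (use wt(1) i in \<open>auto simp: S_def\<close>)
  then show ?thesis using z wB by (auto simp: S_def)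
 qed
 have hw: "h w >= s"
 proof -
  have "(%t. h (wt (r t)) + 1 / real (Suc (r t))) \<longlonglongrightarrow> h w + 0"
   unfolding h_def using LIMSEQ_subseq_LIMSEQ[OF LIMSEQ_inverse_real_of_nat r]
   by (intro tendsto_add tendsto_sum w) (simp add: o_def inverse_eq_divide)
  moreover have "h (wt (r t)) + 1 / real (Suc (r t)) >= s" for t using wt(2)[of "r t"] by linarith
  ultimately have "s <= h w + 0" by (intro LIMSEQ_le_const) auto
  then show ?thesis by simp
 qed
 have tot: "(\<Sum>i<n. f w i) = m" unfolding f_def m_def by (rule cells_total[OF L d n])
 have split: "(\<Sum>i<n. g i) = g 0 + (\<Sum>i\<in>{1..<n}. g i)" for g :: "nat => real"
  using n by (subst sum.remove[of _ 0]) (auto intro!: arg_cong2[where f = "(+)"] sum.cong)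
 have nn: "m = m / n + real (n - 1) * (m / n)" using n by (simp add: of_nat_diff field_simps)
 have f0: "f w 0 >= m / n"
 proof -
  have "(\<Sum>i\<in>{1..<n}. f w i) <= (\<Sum>i\<in>{1..<n}. m / n)" using wS by (intro sum_mono) (auto simp: S_def)
  then show ?thesis using tot nn unfolding split by simp
 qed
 have feq: "f w i = m / n" if i: "1 <= i" "i < n" for i
 proof (rule ccontr)
  assume "f w i ~= m / n"
  then have lt: "f w i < m / n" using wS i by (force simp: S_def)
  have "f w 0 > 0" using f0 m n by (smt (verit) divide_pos_pos of_nat_0_less_iff)
  then have "cell n x w L 0 ~= {}" unfolding f_def by (metis measure_empty less_irrefl)
  then obtain p where p: "p \<in> cell n x w L 0" by blast
  then have "pval x w 0 p <= pval x w i p" using i by (simp add: power_cell_pval)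
  then have "w i <= (norm (p - x i))\<^sup>2" using wS by (simp add: pval_def S_def) (smt (verit) zero_le_power2)
  then have wi: "w i <= B - 1" using R2[of p i] p i by (simp add: B_def)
  define v where "v t = w(i := w i + 1 / real (Suc t))" for t
  have "(%t. v t j) \<longlonglongrightarrow> w j" for j
  proof (cases "j = i")
   case True
   have "(%t. w i + 1 / real (Suc t)) \<longlonglongrightarrow> w i + 0" using LIMSEQ_inverse_real_of_nat by (intro tendsto_add) (simp_all add: inverse_eq_divide)
   then show ?thesis using True by (simp add: v_def)
  qed (simp add: v_def)
  from cont[OF this i(2)] have "\<forall>\<^sub>F t in sequentially. f (v t) i < m / n" using lt by (rule order_tendstoD)
  then obtain t where t: "f (v t) i < m / n" using eventually_happens'[OF sequentially_bot] by blast
  have "v t \<in> S"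
  proof -
   have "f (v t) j <= m / n" if j: "1 <= j" "j < n" for j
   proof (cases "j = i")
    case False
    have "cell n x (v t) L j \<subseteq> cell n x w L j"
    proof
     fix q assume q: "q \<in> cell n x (v t) L j"
     have "pval x w j q <= pval x w l q" if l: "l < n" for l
     proof -
      have "pval x (v t) j q <= pval x (v t) l q" using q l by (simp add: power_cell_pval)
      moreover have "pval x (v t) l q <= pval x w l q" by (simp add: pval_def v_def)
      ultimately show ?thesis using False by (simp add: pval_def v_def)
     qed
     then show "q \<in> cell n x w L j" using q by (simp add: power_cell_pval)
    qed
    then have "f (v t) j <= f w j" unfolding f_def using cell_props(3)[OF L] by (intro finite_measure_mono) auto
    then show ?thesis using wS j by (force simp: S_def)
   qed (use t in simp)
   moreover have "\<bar>v t j\<bar> <= B" for j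
   proof (cases "j = i")
    case True
    have "1 / real (Suc t) <= 1" "1 / real (Suc t) > 0" by simp_all
    moreover have "v t j = w i + 1 / real (Suc t)" using True by (simp add: v_def)
    ultimately show ?thesis using wi wB[of i] unfolding abs_le_iff by linarith
   qed (use wB in \<open>simp add: v_def\<close>)
   ultimately show ?thesis using wS i by (auto simp: S_def v_def)
  qed
  moreover have "h (v t) = h w + 1 / real (Suc t)"
  proof -
   have "h (v t) = (\<Sum>j<n. w j + (if j = i then 1 / real (Suc t) else 0))" unfolding h_def v_def by (intro sum.cong) auto
   then show ?thesis using i by (simp add: sum.distrib h_def)
  qed
  moreover have "1 / real (Suc t) > 0" by simp
  ultimately show False using hs[of "v t"] hw by linarith
 qed
 have all: "f w i = m / n" if i: "i < n" for i
 proof (cases "i = 0")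
  case True
  have "(\<Sum>i\<in>{1..<n}. f w i) = (\<Sum>i\<in>{1..<n}. m / n)" using feq by (intro sum.cong) auto
  then show ?thesis using True tot nn unfolding split by simp
 qed (use feq i in auto)
 define w' where "w' i = (if i < n then w i + (- h w / n) else 0)" for i
 have "balanced n x L w'" unfolding balanced_def
 proof (intro conjI allI impI)
  show "(\<Sum>i<n. w' i) = 0" using n by (simp add: w'_def sum.distrib h_def[symmetric] sum_subtractf)
  show "measure \<nu> (cell n x w' L i) = measure \<nu> L / real n" if "i < n" for i
  proof -
   have "power_cell n x w' i = power_cell n x w i" by (rule power_cell_shift_cong[OF _ that]) (simp add: w'_def)
   then show ?thesis using all[OF that] by (simp add: f_def m_def)
  qed
 qed (simp add: w'_def)
 then show ?thesis by blast
qed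

definition bw :: "nat => (nat => 'a) => 'a set => nat => real" where
 "bw n x L = (SOME w. balanced n x L w)"

lemma bw_balanced: "sub_body L ==> dist_sites n x ==> n > 0 ==> balanced n x L (bw n x L)"
 unfolding bw_def by (rule someI_ex[OF balanced_exists])

lemma bw_eqI: "sub_body L ==> dist_sites n x ==> n > 0 ==> balanced n x L w ==> bw n x L = w"
 using bw_balanced balanced_unique by blast

text \<open>The weights stay bounded, and every subsequential limit is balanced for the limiting
  sites and body, hence equal to \<open>bw n x L\<close> by uniqueness.\<close>

lemma bw_tendsto:
 assumes L: "sub_body L" "\<And>t. sub_body (Lt t)" "conv_sets Lt L" and d: "dist_sites n x" "\<And>t. dist_sites n (xt t)"
  and x: "\<And>j. j < n ==> (%t. xt t j) \<longlonglongrightarrow> x j" and n: "n > 0"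
 shows "(%t. bw n (xt t) (Lt t) i) \<longlonglongrightarrow> bw n x L i"
proof (rule tendsto_via_subseq)
 fix r :: "nat => nat" assume r: "strict_mono r"
 obtain B where B: "\<And>p. p \<in> K ==> norm p <= B" using compact_imp_bounded[OF K'(1)] by (auto simp: bounded_iff)
 have "\<forall>j\<in>{..<n}. \<exists>b. \<forall>t. norm (xt t j) <= b"
 proof
  fix j assume "j \<in> {..<n}"
  then have "Bseq (%t. xt t j)" using x by (intro convergent_imp_Bseq convergentI) auto
  then show "\<exists>b. \<forall>t. norm (xt t j) <= b" unfolding Bseq_def by blast
 qed
 from bchoice[OF this] obtain b where b': "\<forall>j\<in>{..<n}. \<forall>t. norm (xt t j) <= b j" ..
 then have b: "norm (xt t j) <= b j" if "j < n" for j t using that by simp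
 have R: "norm (p - xt t j) <= \<bar>B\<bar> + (\<Sum>j<n. \<bar>b j\<bar>)" if "p \<in> K" "j < n" for p t j
 proof -
  have "\<bar>b j\<bar> <= (\<Sum>j<n. \<bar>b j\<bar>)" using that by (intro member_le_sum) auto
  then show ?thesis using norm_triangle_ineq4[of p "xt t j"] b[OF that(2), of t] B[OF that(1)] by linarith
 qed
 have bal: "balanced n (xt t) (Lt t) (bw n (xt t) (Lt t))" for t by (rule bw_balanced[OF L(2) d(2) n])
 have bd: "\<bar>bw n (xt (r t)) (Lt (r t)) i\<bar> <= (\<bar>B\<bar> + (\<Sum>j<n. \<bar>b j\<bar>))\<^sup>2" for t i by (rule balanced_bound[OF L(2) bal R])
 obtain s w where s: "strict_mono (s :: nat => nat)" and w: "\<And>i. (%t. bw n (xt (r (s t))) (Lt (r (s t))) i) \<longlonglongrightarrow> w i"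
  by (rule bounded_pointwise_subseq[of "%t. bw n (xt (r t)) (Lt (r t))", OF bd]) (rule that)
 have rs: "strict_mono (%t. r (s t))" using strict_mono_o[OF r s] by (simp add: o_def)
 note L3 = conv_sets_subseq[OF L(3) rs]
 have x': "(%t. xt (r (s t)) j) \<longlonglongrightarrow> x j" if "j < n" for j
  using LIMSEQ_subseq_LIMSEQ[OF x[OF that] rs] by (simp add: o_def)
 have "balanced n x L w" unfolding balanced_def
 proof (intro conjI allI impI)
  have "(%t. \<Sum>i<n. bw n (xt (r (s t))) (Lt (r (s t))) i) \<longlonglongrightarrow> (\<Sum>i<n. w i)" by (intro tendsto_sum w)
  then show "(\<Sum>i<n. w i) = 0" using bal by (simp add: balanced_def LIMSEQ_const_iff)
  show "w i = 0" if "n <= i" for i using w[of i] bal that by (simp add: balanced_def LIMSEQ_const_iff)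
  fix i assume i: "i < n"
  have "(%t. measure \<nu> (cell n (xt (r (s t))) (bw n (xt (r (s t))) (Lt (r (s t)))) (Lt (r (s t))) i)) \<longlonglongrightarrow> measure \<nu> (cell n x w L i)"
   by (rule cell_measure_tendsto[OF L(1,2) L3 d(1) x' w i])
  then have "(%t. measure \<nu> (Lt (r (s t))) / real n) \<longlonglongrightarrow> measure \<nu> (cell n x w L i)"
   using bal i by (simp add: balanced_def)
  moreover have "(%t. measure \<nu> (Lt (r (s t))) / real n) \<longlonglongrightarrow> measure \<nu> L / real n"
   by (intro tendsto_divide tendsto_const conv_sets_measure[OF fin sets_nu ac sub_bodyD(2,5)[OF L(1)] sub_bodyD(5)[OF L(2)] L3]) (use n in simp)
  ultimately show "measure \<nu> (cell n x w L i) = measure \<nu> L / real n" by (rule LIMSEQ_unique)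
 qed
 then have "bw n x L = w" by (rule bw_eqI[OF L(1) d(1) n])
 then show "\<exists>s. strict_mono (s :: nat => nat) \<and> (%t. bw n (xt (r (s t))) (Lt (r (s t))) i) \<longlonglongrightarrow> bw n x L i"
  using s w[of i] by (intro exI[of _ s] conjI) simp_all
qed

definition bal_cell :: "nat => (nat => 'a) => 'a set => nat => 'a set" where
 "bal_cell n x L i = cell n x (bw n x L) L i"

lemma bal_cell_body:
 assumes "sub_body L" "dist_sites n x" "i < n"
 shows "sub_body (bal_cell n x L i)" "measure \<nu> (bal_cell n x L i) = measure \<nu> L / real n"
proof -
 have b: "balanced n x L (bw n x L)" using assms by (intro bw_balanced) auto
 then show "sub_body (bal_cell n x L i)" unfolding bal_cell_def using assms by (intro balanced_cell_body)
 show "measure \<nu> (bal_cell n x L i) = measure \<nu> L / real n" using b assms(3) by (simp add: bal_cell_def balanced_def)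
qed

lemma bal_cell_tendsto:
 assumes L: "sub_body L" "\<And>t. sub_body (Lt t)" "conv_sets Lt L" and d: "dist_sites n x" "\<And>t. dist_sites n (xt t)"
  and x: "\<And>j. j < n ==> (%t. xt t j) \<longlonglongrightarrow> x j" and i: "i < n"
 shows "conv_sets (%t. bal_cell n (xt t) (Lt t) i) (bal_cell n x L i)"
 unfolding bal_cell_def
 by (rule conv_sets_cell[OF L(3) x bw_tendsto[OF L d x] i]) (use d(1) i in \<open>auto simp: dist_sites_def\<close>)

text \<open>The permuted weights are balanced for the permuted sites, so by uniqueness they are the
  chosen ones.\<close>

lemma bal_cell_permute:
 assumes L: "sub_body L" and d: "dist_sites n x" and s: "\<sigma> permutes {..<n}"
  and x': "\<And>j. j < n ==> x' (\<sigma> j) = x j" and i: "i < n"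
 shows "bal_cell n x' L (\<sigma> i) = bal_cell n x L i"
proof -
 let ?\<tau> = "inv_into UNIV \<sigma>"
 have sn: "\<sigma> j < n \<longleftrightarrow> j < n" for j using permutes_in_image[OF s, of j] by simp
 have tn: "?\<tau> j < n \<longleftrightarrow> j < n" for j using permutes_in_image[OF permutes_inv[OF s], of j] by simp
 have ts: "?\<tau> (\<sigma> j) = j" "\<sigma> (?\<tau> j) = j" for j using permutes_inverses[OF s] by auto
 have n: "n > 0" using i by simp
 define w' where "w' j = bw n x L (?\<tau> j)" for j
 have b: "balanced n x L (bw n x L)" by (rule bw_balanced[OF L d n])
 have pc: "power_cell n x' w' (\<sigma> j) = power_cell n x (bw n x L) j" if j: "j < n" for j
 proof -
  have e: "pval x' w' (\<sigma> l) p = pval x (bw n x L) l p" if "l < n" for l p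
   using x'[OF that] by (simp add: pval_def w'_def ts)
  show ?thesis
  proof (intro Set.set_eqI iffI)
   fix p assume p: "p \<in> power_cell n x' w' (\<sigma> j)"
   have "pval x (bw n x L) j p <= pval x (bw n x L) l p" if "l < n" for l
    using p[unfolded power_cell_pval, rule_format, of "\<sigma> l"] that by (simp add: sn e j)
   then show "p \<in> power_cell n x (bw n x L) j" by (simp add: power_cell_pval)
  next
   fix p assume p: "p \<in> power_cell n x (bw n x L) j"
   have "pval x' w' (\<sigma> j) p <= pval x' w' l p" if "l < n" for l
    using p[unfolded power_cell_pval, rule_format, of "?\<tau> l"] that e[of "?\<tau> l" p] by (simp add: tn ts e j)
   then show "p \<in> power_cell n x' w' (\<sigma> j)" by (simp add: power_cell_pval)
  qed
 qed
 have d': "dist_sites n x'" unfolding dist_sites_def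
 proof (intro allI impI)
  fix i j assume ij: "i < n" "j < n" "i ~= j"
  then have "?\<tau> i ~= ?\<tau> j" using ts by metis
  then have "x (?\<tau> i) ~= x (?\<tau> j)" using d ij tn by (simp add: dist_sites_def)
  then show "x' i ~= x' j" using x'[of "?\<tau> i"] x'[of "?\<tau> j"] ij by (simp add: tn ts)
 qed
 have "balanced n x' L w'" unfolding balanced_def
 proof (intro conjI allI impI)
  have "(\<Sum>j<n. w' j) = (\<Sum>j<n. bw n x L j)"
   unfolding w'_def by (rule sum.reindex_bij_witness[where i = \<sigma> and j = ?\<tau>]) (simp_all add: ts tn sn)
  then show "(\<Sum>i<n. w' i) = 0" using b by (simp add: balanced_def)
  show "w' i = 0" if "n <= i" for i using b tn[of i] that by (simp add: balanced_def w'_def)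
  show "measure \<nu> (cell n x' w' L i) = measure \<nu> L / real n" if "i < n" for i
   using pc[of "?\<tau> i"] b that by (simp add: balanced_def tn ts)
 qed
 then have "bw n x' L = w'" by (rule bw_eqI[OF L d' n])
 then show ?thesis unfolding bal_cell_def using pc[OF i] by simp
qed

end

section \<open>Partition trees\<close>

lemma perturbed_mass:
 fixes \<mu> :: "'a::euclidean_space measure"
 assumes f: "finite_measure \<mu>" and s: "sets \<mu> = sets borel" and ac: "absolutely_continuous lborel \<mu>"
  and K: "K \<in> convex_bodies" and e: "e > 0"
 obtains \<nu> where "body_mass K \<nu>" "\<And>A. A \<in> sets borel ==> measure \<nu> A = measure \<mu> A + e * measure lborel (A \<inter> K)"
proof -
 interpret \<mu>: finite_measure \<mu> by fact
 obtain f where f: "f \<in> borel_measurable lborel" "density lborel f = \<mu>"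
  using sigma_finite_measure.Radon_Nikodym[OF sigma_finite_lborel ac] s by auto
 define \<nu> where "\<nu> = density lborel (%x. f x + ennreal e * indicator K x)"
 have cK: "compact K" using K by (simp add: convex_bodies_def)
 have mK: "K \<in> sets borel" using cK by (simp add: compact_imp_closed)
 have em: "emeasure \<nu> A = emeasure \<mu> A + ennreal e * emeasure lborel (A \<inter> K)" if A: "A \<in> sets borel" for A
 proof -
  have "emeasure \<nu> A = (\<integral>\<^sup>+x. (f x * indicator A x + ennreal e * indicator (A \<inter> K) x) \<partial>lborel)"
   unfolding \<nu>_def using f(1) mK A by (subst emeasure_density) (auto intro!: nn_integral_cong simp: indicator_def)
  also have "\<dots> = (\<integral>\<^sup>+x. f x * indicator A x \<partial>lborel) + (\<integral>\<^sup>+x. ennreal e * indicator (A \<inter> K) x \<partial>lborel)"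
   using f(1) mK A by (intro nn_integral_add) auto
  also have "(\<integral>\<^sup>+x. f x * indicator A x \<partial>lborel) = emeasure \<mu> A"
   using emeasure_density[OF f(1), of A] A unfolding f(2) by simp
  also have "(\<integral>\<^sup>+x. ennreal e * indicator (A \<inter> K) x \<partial>lborel) = ennreal e * emeasure lborel (A \<inter> K)"
   using mK A by (subst nn_integral_cmult_indicator) auto
  finally show ?thesis .
 qed
 have finK: "emeasure lborel (A \<inter> K) < \<infinity>" if "A \<in> sets borel" for A
  using emeasure_bounded_finite[of "A \<inter> K"] compact_imp_bounded[OF cK] bounded_subset by blast
 have ms: "measure \<nu> A = measure \<mu> A + e * measure lborel (A \<inter> K)" if A: "A \<in> sets borel" for A
 proof -
  have "emeasure \<nu> A = ennreal (measure \<mu> A) + ennreal e * ennreal (measure lborel (A \<inter> K))"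
   unfolding em[OF A] \<mu>.emeasure_eq_measure using finK[OF A] by (simp add: emeasure_eq_ennreal_measure)
  also have "\<dots> = ennreal (measure \<mu> A + e * measure lborel (A \<inter> K))"
   using e by (simp add: ennreal_mult ennreal_plus)
  finally have "enn2real (emeasure \<nu> A) = enn2real (ennreal (measure \<mu> A + e * measure lborel (A \<inter> K)))" by (rule arg_cong)
  then show ?thesis using e by (simp add: measure_def[of \<nu>] del: ennreal_plus)
 qed
 have "body_mass K \<nu>"
 proof (rule body_mass.intro)
  show "K \<in> convex_bodies" by fact
  show "finite_measure \<nu>"
  proof (rule finite_measureI)
   have "space \<nu> = UNIV" by (simp add: \<nu>_def)
   then show "emeasure \<nu> (space \<nu>) ~= \<infinity>" using em[of UNIV] finK[of UNIV] \<mu>.emeasure_finite[of UNIV]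
    by (auto simp: ennreal_mult_eq_top_iff top.not_eq_extremum)
  qed
  show "sets \<nu> = sets borel" by (simp add: \<nu>_def)
  show "absolutely_continuous lborel \<nu>" unfolding \<nu>_def using f mK by (intro absolutely_continuousI_density) auto
  show "measure \<nu> A > 0" if A: "open A" "A ~= {}" "A \<subseteq> K" for A
  proof -
   have "measure lborel A > 0"
   proof -
    have "\<not> negligible A" using A by (intro open_not_negligible)
    then have "emeasure lborel A ~= 0" using A by (auto simp: negligible_iff_null_sets null_sets_completion_iff null_sets_def)
    moreover have "A \<inter> K = A" using A by blast
    then have "emeasure lborel A < \<infinity>" using finK[of A] A by simp
    ultimately show ?thesis by (simp add: measure_def enn2real_positive_iff zero_less_iff_neq_zero)
   qed
   moreover have "A \<inter> K = A" using A by blast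
   ultimately show ?thesis using ms[of A] A e by (simp add: add_nonneg_pos)
  qed
 qed
 then show ?thesis using that ms by blast
qed

context leaf_grid
begin

fun gp :: "'a::euclidean_space set => (nat list => nat => 'a) => (nat list => nat => real) => nat list => 'a set" where
 "gp K x w [] = K"
| "gp K x w (j # R) = gp K x w R \<inter> power_cell (ar R) (x R) (w R) j"

text \<open>All nodes of the tree including the leaves, whereas \<open>node\<close> has only those
  with children.\<close>

definition tp :: "nat list => bool" where "tp Q \<longleftrightarrow> (\<exists>us vs. rs = us @ vs \<and> Q \<in> leaves vs)"

lemma tp_Nil [simp]: "tp []" unfolding tp_def by (intro exI[of _ rs] exI[of _ "[]"]) simp

lemma tp_ConsD:
 assumes "tp (j # R)" shows "node R" "j < ar R" "tp R"
proof -
 obtain us vs where r: "rs = us @ vs" "j # R \<in> leaves vs" using assms unfolding tp_def by blast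
 then obtain n vs' where v: "vs = n # vs'" by (cases vs) auto
 then have *: "j < n" "R \<in> leaves vs'" using r by auto
 have rs': "rs = us @ n # vs'" using r v by simp
 show "node R" unfolding node_def using rs' * by blast
 show "j < ar R" using ar_eq[OF rs' *(2)] * by simp
 have "rs = (us @ [n]) @ vs'" using rs' by simp
 then show "tp R" unfolding tp_def using * by blast
qed

lemma tp_leaf: "q \<in> leaves rs ==> tp q"
 unfolding tp_def by (intro exI[of _ "[]"] exI[of _ rs]) simp

lemma tp_Cons: "node R ==> j < ar R ==> tp (j # R)"
proof -
 assume "node R" "j < ar R"
 then obtain us vs where r: "rs = us @ ar R # vs" "R \<in> leaves vs" using nodeE by blast
 then show "tp (j # R)" unfolding tp_def using \<open>j < ar R\<close> by (intro exI[of _ us] exI[of _ "ar R # vs"]) simp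
qed

lemma gp_props: "compact K ==> convex K ==> compact (gp K x w Q) \<and> convex (gp K x w Q) \<and> gp K x w Q \<subseteq> K"
 by (induction Q) (auto intro: compact_Int_closed closed_power_cell convex_Int convex_power_cell)

lemma gp_tendsto:
 assumes K: "compact K" and d: "\<And>R. node R ==> dist_sites (ar R) (x R)"
  and x: "\<And>R j. node R ==> j < ar R ==> (%t. xt t R j) \<longlonglongrightarrow> x R j"
  and w: "\<And>R j. node R ==> j < ar R ==> (%t. wt t R j) \<longlonglongrightarrow> w R j"
 shows "tp Q ==> conv_sets (%t. gp K (xt t) (wt t) Q) (gp K x w Q)"
proof (induction Q)
 case Nil
 then show ?case using K by (simp add: conv_sets_const compact_imp_closed)
next
 case (Cons j R)
 note t = tp_ConsD[OF Cons.prems]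
 have inj: "x R i ~= x R j" if "i < ar R" "i ~= j" for i using d[OF t(1)] t(2) that by (simp add: dist_sites_def)
 show ?case unfolding gp.simps
  by (rule conv_sets_cell[OF Cons.IH[OF t(3)] x[OF t(1)] w[OF t(1)] t(2)]) (assumption, assumption, rule inj)
qed

definition eqtree :: "'a::euclidean_space set => 'a measure => (nat list => nat => 'a) => (nat list => nat => real) => bool" where
 "eqtree K \<nu> x w \<longleftrightarrow> (\<forall>R. node R --> dist_sites (ar R) (x R) \<and> (\<Sum>i<ar R. w R i) = 0) \<and>
   (\<forall>us vs Q. rs = us @ vs --> Q \<in> leaves vs -->
    gp K x w Q \<in> convex_bodies \<and> measure \<nu> (gp K x w Q) = measure \<nu> K / real (prod_list vs))"

definition eqval :: "'a::euclidean_space set => (nat list => nat => 'a) => (nat list => nat => real) => nat => (nat => 'a set => real) => bool" where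
 "eqval K x w m \<phi> \<longleftrightarrow> (\<forall>c<m. \<forall>q\<in>leaves rs. \<forall>q'\<in>leaves rs. \<phi> c (gp K x w q) = \<phi> c (gp K x w q'))"

lemma prod_pos: "rs = us @ vs ==> prod_list vs > 0"
proof -
 assume "rs = us @ vs"
 then have "n \<in> set vs ==> 2 <= n" for n using rs(2) by simp
 then show ?thesis by (induction vs) (auto, force)
qed

text \<open>The mass is perturbed by a multiple of Lebesgue measure on \<open>K\<close>, which makes balanced weights
 unique and continuous; the perturbation is removed by compactness.\<close>

theorem eqtree_limit:
 fixes K :: "'a::euclidean_space set" and \<mu> :: "'a measure" and X :: "(nat list => nat => real) => nat list => nat => 'a"
 assumes K: "K \<in> convex_bodies" and f: "finite_measure \<mu>" and s: "sets \<mu> = sets borel" and ac: "absolutely_continuous lborel \<mu>"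
  and dist: "\<And>u R. node R ==> dist_sites (ar R) (X u R)"
  and cont: "\<And>ut u R j. (\<And>q c. (%t. ut t q c) \<longlonglongrightarrow> u q c) ==> node R ==> j < ar R ==> (%t. X (ut t) R j) \<longlonglongrightarrow> X u R j"
  and haus: "\<And>c. c < m ==> haus_continuous (\<phi> c)"
  and res: "\<And>\<nu>. body_mass K \<nu> ==> \<exists>u w. (\<forall>q c. \<bar>u q c\<bar> <= Bd) \<and> eqtree K \<nu> (X u) w \<and> eqval K (X u) w m \<phi>"
 shows "\<exists>x w. eqtree K \<mu> x w \<and> eqval K x w m \<phi>"
proof -
 interpret \<mu>: finite_measure \<mu> by fact
 have cK: "compact K" "convex K" "K \<in> sets borel" using K by (auto simp: convex_bodies_def compact_imp_closed)
 have "\<forall>t. \<exists>\<nu>. body_mass K \<nu> \<and> (\<forall>A\<in>sets borel. measure \<nu> A = measure \<mu> A + 1 / real (Suc t) * measure lborel (A \<inter> K))"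
 proof
  fix t
  have "1 / real (Suc t) > 0" by simp
  then show "\<exists>\<nu>. body_mass K \<nu> \<and> (\<forall>A\<in>sets borel. measure \<nu> A = measure \<mu> A + 1 / real (Suc t) * measure lborel (A \<inter> K))"
   by (rule perturbed_mass[OF f s ac K]) (intro exI conjI ballI)
 qed
 from choice[OF this] obtain \<nu> where nu: "\<And>t. body_mass K (\<nu> t)"
  "\<And>t A. A \<in> sets borel ==> measure (\<nu> t) A = measure \<mu> A + 1 / real (Suc t) * measure lborel (A \<inter> K)" by blast
 have "\<forall>t. \<exists>uw. (\<forall>q c. \<bar>fst uw q c\<bar> <= Bd) \<and> eqtree K (\<nu> t) (X (fst uw)) (snd uw) \<and> eqval K (X (fst uw)) (snd uw) m \<phi>"
  using res[OF nu(1)] by (simp add: split_paired_Ex)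
 from choice[OF this] obtain uw where uw: "\<And>t. (\<forall>q c. \<bar>fst (uw t) q c\<bar> <= Bd) \<and> eqtree K (\<nu> t) (X (fst (uw t))) (snd (uw t)) \<and> eqval K (X (fst (uw t))) (snd (uw t)) m \<phi>" by blast
 define ut wt where "ut t = fst (uw t)" and "wt t = snd (uw t)" for t
 have ut: "\<bar>ut t q c\<bar> <= Bd" and et: "eqtree K (\<nu> t) (X (ut t)) (wt t)" and ev: "eqval K (X (ut t)) (wt t) m \<phi>" for t q c
  using uw[of t] by (simp_all add: ut_def wt_def)
 show ?thesis
 \<comment> \<open>If K is a null set, the tree found for any single perturbed mass is already equal
   in \<mu>. Otherwise the limit pieces have positive mass, which is how they are seen to have
   interior.\<close>
 proof (cases "measure \<mu> K = 0")
  case True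
  have z: "measure \<mu> (gp K (X (ut 0)) (wt 0) Q) = 0" for Q
  proof -
   have "measure \<mu> (gp K (X (ut 0)) (wt 0) Q) <= measure \<mu> K"
    using gp_props[OF cK(1,2)] cK s by (intro \<mu>.finite_measure_mono) auto
   then show ?thesis using True measure_nonneg[of \<mu> "gp K (X (ut 0)) (wt 0) Q"] by linarith
  qed
  note e0 = et[of 0, unfolded eqtree_def]
  have "eqtree K \<mu> (X (ut 0)) (wt 0)" unfolding eqtree_def
  proof (intro conjI allI impI)
   show "measure \<mu> (gp K (X (ut 0)) (wt 0) Q) = measure \<mu> K / real (prod_list vs)" for Q vs using z True by simp
  qed (use e0 in blast)+
  then show ?thesis using ev[of 0] by blast
 next
  case False
  then have pos: "measure \<mu> K > 0" using measure_nonneg[of \<mu> K] by linarith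
  obtain r h where r: "strict_mono (r :: nat => nat)" "\<And>x. (%t. ut (r t) (fst x) (snd x)) \<longlonglongrightarrow> h x"
   by (rule bounded_pointwise_subseq[of "%t x. ut t (fst x) (snd x)" "%_. Bd", OF ut]) (rule that)
  define u where "u q c = h (q, c)" for q c
  have u: "(%t. ut (r t) q c) \<longlonglongrightarrow> u q c" for q c using r(2)[of "(q, c)"] by (simp add: u_def)
  have Xc: "(%t. X (ut (r t)) R j) \<longlonglongrightarrow> X u R j" if "node R" "j < ar R" for R j by (rule cont[OF u that])
  obtain BK where BK: "\<And>p. p \<in> K ==> norm p <= BK" using compact_imp_bounded[OF cK(1)] by (auto simp: bounded_iff)
  have "\<forall>x. \<exists>b. node (fst x) \<and> snd x < ar (fst x) --> (\<forall>t. norm (X (ut (r t)) (fst x) (snd x)) <= b)"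
  proof
   fix x
   show "\<exists>b. node (fst x) \<and> snd x < ar (fst x) --> (\<forall>t. norm (X (ut (r t)) (fst x) (snd x)) <= b)"
   proof (cases "node (fst x) \<and> snd x < ar (fst x)")
    case True
    then have "Bseq (%t. X (ut (r t)) (fst x) (snd x))" using Xc by (intro convergent_imp_Bseq convergentI) auto
    then show ?thesis unfolding Bseq_def by blast
   qed blast
  qed
  from choice[OF this] obtain b where b': "\<forall>x. node (fst x) \<and> snd x < ar (fst x) --> (\<forall>t. norm (X (ut (r t)) (fst x) (snd x)) <= b x)" ..
  have b: "norm (X (ut (r t)) R j) <= b (R, j)" if "node R" "j < ar R" for t R j using b' that by force
  define C where "C x = (\<bar>BK\<bar> + (\<Sum>j<ar (fst x). \<bar>b (fst x, j)\<bar>))\<^sup>2" for x :: "nat list \<times> nat"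
  define v where "v t x = (if node (fst x) \<and> snd x < ar (fst x) then wt (r t) (fst x) (snd x) else 0)" for t and x :: "nat list \<times> nat"
  have vC: "\<bar>v t x\<bar> <= C x" for t x
  proof (cases "node (fst x) \<and> snd x < ar (fst x)")
   case True
   obtain R i where x: "x = (R, i)" by (cases x)
   have R: "node R" "i < ar R" using True x by auto
   have "\<bar>wt (r t) R i\<bar> <= (\<bar>BK\<bar> + (\<Sum>j<ar R. \<bar>b (R, j)\<bar>))\<^sup>2"
   proof (rule weights_bound[OF _ _ _ R(2)])
    show "K \<inter> power_cell (ar R) (X (ut (r t)) R) (wt (r t) R) i ~= {}" if ii: "i < ar R" for i
    proof -
     obtain us vs where "rs = us @ vs" "i # R \<in> leaves vs" using tp_Cons[OF R(1) ii] unfolding tp_def by blast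
     then have "gp K (X (ut (r t))) (wt (r t)) (i # R) \<in> convex_bodies" using et[of "r t"] unfolding eqtree_def by blast
     then have "interior (gp K (X (ut (r t))) (wt (r t)) (i # R)) ~= {}" by (simp add: convex_bodies_def)
     then show ?thesis using interior_subset[of "gp K (X (ut (r t))) (wt (r t)) (i # R)"] gp_props[OF cK(1,2), of _ _ R] by fastforce
    qed
    show "(\<Sum>j<ar R. wt (r t) R j) = 0" using et[of "r t"] R(1) unfolding eqtree_def by blast
    fix p j assume p: "p \<in> K" "j < ar R"
    have "\<bar>b (R, j)\<bar> <= (\<Sum>j<ar R. \<bar>b (R, j)\<bar>)" using p by (intro member_le_sum) auto
    then show "norm (p - X (ut (r t)) R j) <= \<bar>BK\<bar> + (\<Sum>j<ar R. \<bar>b (R, j)\<bar>)"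
     using norm_triangle_ineq4[of p "X (ut (r t)) R j"] b[OF R(1) p(2), of t] BK[OF p(1)] by linarith
   qed
   then show ?thesis using R by (simp add: v_def C_def x)
  qed (auto simp: v_def C_def)
  obtain r' h' where r': "strict_mono (r' :: nat => nat)" "\<And>x. (%t. v (r' t) x) \<longlonglongrightarrow> h' x"
   by (rule bounded_pointwise_subseq[of v C, OF vC]) (rule that)
  define w where "w R i = h' (R, i)" for R i
  have wc: "(%t. wt (r (r' t)) R i) \<longlonglongrightarrow> w R i" if "node R" "i < ar R" for R i
   using r'(2)[of "(R, i)"] that by (simp add: v_def w_def)
  define k where "k t = r (r' t)" for t
  have k: "strict_mono k" using strict_mono_o[OF r(1) r'(1)] by (simp add: k_def o_def strict_mono_def)
  have Xk: "(%t. X (ut (k t)) R j) \<longlonglongrightarrow> X u R j" if "node R" "j < ar R" for R j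
   using LIMSEQ_subseq_LIMSEQ[OF Xc[OF that] r'(1)] by (simp add: k_def o_def)
  have gc: "conv_sets (%t. gp K (X (ut (k t))) (wt (k t)) Q) (gp K (X u) w Q)" if "tp Q" for Q
   by (rule gp_tendsto[OF cK(1) dist Xk wc[folded k_def] that])
  have gb: "closed (gp K x w Q)" "convex (gp K x w Q)" "compact (gp K x w Q)" "gp K x w Q \<subseteq> K" for x w Q
   using gp_props[OF cK(1,2)] by (auto simp: compact_imp_closed)
  have inv0: "(%t. 1 / real (Suc (k t))) \<longlonglongrightarrow> 0"
   using LIMSEQ_subseq_LIMSEQ[OF LIMSEQ_inverse_real_of_nat k] by (simp add: o_def inverse_eq_divide)
  have meas: "measure \<mu> (gp K (X u) w Q) = measure \<mu> K / real (prod_list vs)" if Q: "rs = us @ vs" "Q \<in> leaves vs" for us vs Q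
  proof -
   define g where "g t = gp K (X (ut (k t))) (wt (k t)) Q" for t
   define l where "l = measure lborel K"
   have tQ: "tp Q" unfolding tp_def using Q by blast
   have l1: "(%t. measure \<mu> (g t)) \<longlonglongrightarrow> measure \<mu> (gp K (X u) w Q)"
    unfolding g_def by (rule conv_sets_measure[OF f s ac gb(2,1) gb(1) gc[OF tQ]])
   have finK: "K \<in> fmeasurable lborel" using cK(1) by (rule fmeasurable_compact)
   have eq: "measure \<mu> (g t) = (measure \<mu> K + 1 / real (Suc (k t)) * l) / real (prod_list vs) - 1 / real (Suc (k t)) * measure lborel (g t \<inter> K)" for t
   proof -
    have "measure (\<nu> (k t)) (g t) = measure (\<nu> (k t)) K / real (prod_list vs)"
     using et[of "k t"] Q unfolding eqtree_def g_def by blast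
    moreover have "g t \<in> sets borel" unfolding g_def using gb(1) by (rule borel_closed)
    ultimately show ?thesis using nu(2)[of "g t" "k t"] nu(2)[OF cK(3), of "k t"] by (simp add: l_def)
   qed
   have "(%t. measure \<mu> (g t)) \<longlonglongrightarrow> (measure \<mu> K + 0 * l) / real (prod_list vs) - 0"
    unfolding eq
   proof (intro tendsto_diff tendsto_divide tendsto_add tendsto_mult tendsto_const inv0)
    have "real (prod_list vs) > 0" using prod_pos[OF Q(1)] by (simp only: of_nat_0_less_iff)
    then show "real (prod_list vs) ~= 0" by linarith
    show "(%t. 1 / real (Suc (k t)) * measure lborel (g t \<inter> K)) \<longlonglongrightarrow> 0"
    proof (rule Lim_null_comparison)
     show "(%t. 1 / real (Suc (k t)) * l) \<longlonglongrightarrow> 0" using tendsto_mult[OF inv0 tendsto_const[of l]] by simp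
     have "measure lborel (g t \<inter> K) <= l" for t
      unfolding l_def using gb(1) cK(3) finK by (intro measure_mono_fmeasurable) (auto simp: g_def borel_closed)
     then show "\<forall>\<^sub>F t in sequentially. norm (1 / real (Suc (k t)) * measure lborel (g t \<inter> K)) <= 1 / real (Suc (k t)) * l"
      by (intro always_eventually allI) (simp add: mult_left_mono divide_right_mono)
    qed
   qed
   then show ?thesis using LIMSEQ_unique[OF l1] by simp
  qed
  have body: "gp K (X u) w Q \<in> convex_bodies" if Q: "rs = us @ vs" "Q \<in> leaves vs" for us vs Q
  proof -
   have "measure \<mu> (gp K (X u) w Q) > 0" using meas[OF Q] pos prod_pos[OF Q(1)] by simp
   have "interior (gp K (X u) w Q) ~= {}"
   proof
    assume "interior (gp K (X u) w Q) = {}"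
    then have "negligible (gp K (X u) w Q)" using gb(2) by (simp add: negligible_convex_interior)
    then have "gp K (X u) w Q \<in> null_sets lborel" using gb(1)[of "X u" w Q] by (simp add: negligible_iff_null_sets null_sets_completion_iff)
    then have "gp K (X u) w Q \<in> null_sets \<mu>" using ac by (auto simp: absolutely_continuous_def)
    then show False using \<open>measure \<mu> (gp K (X u) w Q) > 0\<close> by (simp add: measure_eq_0_null_sets)
   qed
   then show ?thesis using gb by (simp add: convex_bodies_def)
  qed
  have "eqtree K \<mu> (X u) w" unfolding eqtree_def
  proof (intro conjI allI impI)
   show "dist_sites (ar R) (X u R)" if "node R" for R by (rule dist[OF that])
   show "(\<Sum>i<ar R. w R i) = 0" if R: "node R" for R
   proof -
    have "(%t. \<Sum>i<ar R. wt (k t) R i) \<longlonglongrightarrow> (\<Sum>i<ar R. w R i)"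
     using wc[OF R] by (intro tendsto_sum) (simp add: k_def)
    moreover have "(\<Sum>i<ar R. wt (k t) R i) = 0" for t using et[of "k t"] R unfolding eqtree_def by blast
    ultimately show ?thesis by (simp add: LIMSEQ_const_iff)
   qed
  qed (use body meas in blast)+
  moreover have "eqval K (X u) w m \<phi>" unfolding eqval_def
  proof (intro allI impI ballI)
   fix c q q' assume c: "c < m" and q: "q \<in> leaves rs" "q' \<in> leaves rs"
   have lim: "(%t. \<phi> c (gp K (X (ut (k t))) (wt (k t)) q)) \<longlonglongrightarrow> \<phi> c (gp K (X u) w q)" if q: "q \<in> leaves rs" for q
   proof (rule conv_sets_haus_continuous[OF haus[OF c] _ _ cK(1) gb(4) gc[OF tp_leaf[OF q]]])
    show "gp K (X u) w q \<in> convex_bodies" by (rule body[of "[]" rs]) (simp_all add: q)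
    show "gp K (X (ut (k t))) (wt (k t)) q \<in> convex_bodies" for t
    proof -
     have "rs = [] @ rs" by simp
     then show ?thesis using et[of "k t"] q unfolding eqtree_def by blast
    qed
   qed
   have "\<phi> c (gp K (X (ut (k t))) (wt (k t)) q) = \<phi> c (gp K (X (ut (k t))) (wt (k t)) q')" for t
    using ev[of "k t"] c q unfolding eqval_def by blast
   then show "\<phi> c (gp K (X u) w q) = \<phi> c (gp K (X u) w q')" using LIMSEQ_unique[OF lim[OF q(1)]] lim[OF q(2)] by simp
  qed
  ultimately show ?thesis by blast
 qed
qed

end

section \<open>Sites that respect relabellings across gaps\<close>

definition bs :: "nat => 'a::euclidean_space" where "bs = (SOME h. bij_betw h {..<DIM('a)} Basis)"

lemma bs_inner:
 assumes "i < DIM('a)" "j < DIM('a)"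
 shows "inner (bs i) (bs j :: 'a::euclidean_space) = (if i = j then 1 else 0)"
proof -
 have "\<exists>h. bij_betw h {..<DIM('a)} (Basis :: 'a set)"
  using ex_bij_betw_nat_finite[OF finite_Basis] unfolding atLeast0LessThan by blast
 then have b: "bij_betw bs {..<DIM('a)} (Basis :: 'a set)" unfolding bs_def by (rule someI_ex)
 then have "bs i \<in> (Basis :: 'a set)" "bs j \<in> (Basis :: 'a set)" "i ~= j ==> bs i ~= (bs j :: 'a)"
  using assms by (auto simp: bij_betw_def inj_on_def)
 then show ?thesis by (auto simp: inner_Basis)
qed

context leaf_grid
begin

definition bmp :: "(nat list => nat => real) => nat list => nat => nat => real" where
 "bmp u R i j = max 0 (1 - (\<Sum>c<D. \<bar>Bsum rs u (i # R) c - Bsum rs u (j # R) c\<bar>))"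

text \<open>Close siblings before j minus close siblings after j, weighted by \<open>bmp\<close>: a
  continuous version of the rank of j within its cluster, strictly increasing along coinciding
  siblings.\<close>

definition vert :: "(nat list => nat => real) => nat list => nat => real" where
 "vert u R j = (\<Sum>i<ar R. (if i < j then 1 else if j < i then -1 else 0) * bmp u R i j)"

text \<open>Sites whose first \<open>D\<close> coordinates agree are told apart by the last one, and \<open>bmp\<close> vanishes across
 gaps of length one, so that relabellings across such gaps act on the sites.\<close>

definition site :: "(nat list => nat => real) => nat list => nat => 'a::euclidean_space" where
 "site u R j = (\<Sum>c<D. Bsum rs u (j # R) c *\<^sub>R bs (Suc c)) + vert u R j *\<^sub>R bs 0"

lemma site_inner:
 assumes "D < DIM('a)"
 shows "c < D ==> inner (site u R j :: 'a::euclidean_space) (bs (Suc c)) = Bsum rs u (j # R) c"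
  and "inner (site u R j :: 'a) (bs 0) = vert u R j"
proof -
 assume c: "c < D"
 have "inner (site u R j :: 'a) (bs (Suc c)) = (\<Sum>c'<D. if c' = c then Bsum rs u (j # R) c' else 0) + 0"
  unfolding site_def inner_add_left inner_sum_left using assms c by (intro arg_cong2[where f = "(+)"] sum.cong) (auto simp: bs_inner)
 then show "inner (site u R j :: 'a) (bs (Suc c)) = Bsum rs u (j # R) c" using c by simp
next
 have "inner (site u R j :: 'a) (bs 0) = (\<Sum>c'<D. Bsum rs u (j # R) c' * 0) + vert u R j"
  unfolding site_def inner_add_left inner_sum_left using assms by (intro arg_cong2[where f = "(+)"] sum.cong) (auto simp: bs_inner)
 then show "inner (site u R j :: 'a) (bs 0) = vert u R j" by simp
qed

text \<open>If the first D coordinates agree, i and j see every sibling with the same weight. The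
  difference of their ranks is then a sum of nonnegative terms, and the term of i itself equals
  1.\<close>

lemma site_less:
 assumes D: "D < DIM('a)" and ij: "i < j" "j < ar R"
 shows "(site u R i :: 'a::euclidean_space) ~= site u R j"
proof
 assume e: "(site u R i :: 'a) = site u R j"
 have b: "Bsum rs u (i # R) c = Bsum rs u (j # R) c" if "c < D" for c
  using site_inner(1)[OF D that, of u R i] site_inner(1)[OF D that, of u R j] e by simp
 have v: "vert u R i = vert u R j" using site_inner(2)[OF D, of u R i] site_inner(2)[OF D, of u R j] e by simp
 have bb: "bmp u R l i = bmp u R l j" for l
 proof -
  have "(\<Sum>c<D. \<bar>Bsum rs u (l # R) c - Bsum rs u (i # R) c\<bar>) = (\<Sum>c<D. \<bar>Bsum rs u (l # R) c - Bsum rs u (j # R) c\<bar>)"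
   by (rule sum.cong) (simp_all add: b)
  then show ?thesis by (simp add: bmp_def)
 qed
 have "(\<Sum>c<D. \<bar>Bsum rs u (i # R) c - Bsum rs u (j # R) c\<bar>) = 0" by (rule sum.neutral) (simp add: b)
 then have "bmp u R i j = 1" by (simp add: bmp_def)
 let ?g = "%l. ((if l < j then 1 else if j < l then -1 else 0) - (if l < i then 1 else if i < l then -1 else 0)) * bmp u R l j"
 have "vert u R j - vert u R i = (\<Sum>l<ar R. ?g l)"
  unfolding vert_def bb sum_subtractf[symmetric] left_diff_distrib ..
 also have "\<dots> >= (\<Sum>l\<in>{i}. ?g l)"
  using ij by (intro sum_mono2) (auto simp: bmp_def intro!: mult_nonneg_nonneg)
 finally show False using v ij \<open>bmp u R i j = 1\<close> by simp
qed

lemma site_dist: "D < DIM('a) ==> dist_sites (ar R) (site u R :: nat => 'a::euclidean_space)"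
 unfolding dist_sites_def using site_less by (metis linorder_neqE_nat)

lemma Bsum_tendsto: "(\<And>q c. (%t. ut t q c) \<longlonglongrightarrow> (u q c :: real)) ==> (%t. Bsum rs (ut t) Q c) \<longlonglongrightarrow> Bsum rs u Q c"
 unfolding Bsum_def by (intro tendsto_sum)

lemma site_tendsto:
 assumes "\<And>q c. (%t. ut t q c) \<longlonglongrightarrow> (u q c :: real)"
 shows "(%t. site (ut t) R j :: 'a::euclidean_space) \<longlonglongrightarrow> site u R j"
 unfolding site_def vert_def bmp_def by (intro tendsto_intros Bsum_tendsto assms)

context
 fixes us n vs P \<sigma> m c0 u u'
 assumes s: "rs = us @ n # vs" "P \<in> leaves vs" "\<sigma> permutes {..<n}" "strict_mono_on {..<m} \<sigma>" "strict_mono_on {m..<n} \<sigma>" "c0 < D"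
  and gp: "\<forall>i<m. \<forall>j\<in>{m..<n}. Bsum rs u (i # P) c0 + 1 <= Bsum rs u (j # P) c0"
  and u': "\<forall>q\<in>leaves rs. \<forall>c<D. u' (sh P \<sigma> q) c = (u q c :: real)"
begin

lemma Bsum_pe: "c < D ==> Bsum rs u' (sh P \<sigma> Q) c = Bsum rs u Q c"
 using Bsum_sh[OF s(3,2,1), of u' c u Q] u' by blast

lemma ar_sh: "ar (sh P \<sigma> R) = ar R" by (simp add: ar_def)

lemma ar_P: "ar P = n" using ar_eq s by blast

lemma bmp_gap: "i < m ==> m <= j ==> j < n ==> bmp u P i j = 0 \<and> bmp u P j i = 0"
proof -
 assume ij: "i < m" "m <= j" "j < n"
 have "Bsum rs u (i # P) c0 + 1 <= Bsum rs u (j # P) c0" using gp ij by simp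
 then have "\<bar>Bsum rs u (i # P) c0 - Bsum rs u (j # P) c0\<bar> >= 1" by linarith
 moreover have "\<bar>Bsum rs u (i # P) c0 - Bsum rs u (j # P) c0\<bar> <= (\<Sum>c<D. \<bar>Bsum rs u (i # P) c - Bsum rs u (j # P) c\<bar>)"
  using s(6) by (intro member_le_sum) auto
 moreover have "(\<Sum>c<D. \<bar>Bsum rs u (i # P) c - Bsum rs u (j # P) c\<bar>) = (\<Sum>c<D. \<bar>Bsum rs u (j # P) c - Bsum rs u (i # P) c\<bar>)"
  by (intro sum.cong) auto
 ultimately show "bmp u P i j = 0 \<and> bmp u P j i = 0" unfolding bmp_def by auto
qed

text \<open>The relabelling preserves the order inside each block, and siblings from different
  blocks have \<open>bmp\<close> 0. So every sign in \<open>vert\<close> that could change carries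
  the weight 0.\<close>

lemma site_pe:
 "site u' (sh P \<sigma> R) (if R = P then \<sigma> j else j) = (site u R j :: 'a::euclidean_space)"
proof -
 let ?f = "%j. if R = P then \<sigma> j else j"
 have B: "Bsum rs u' (?f j # sh P \<sigma> R) c = Bsum rs u (j # R) c" if "c < D" for c j
  using Bsum_pe[OF that, of "j # R"] by simp
 have b: "bmp u' (sh P \<sigma> R) (?f i) (?f j) = bmp u R i j" for i j
 proof -
  have "(\<Sum>c<D. \<bar>Bsum rs u' (?f i # sh P \<sigma> R) c - Bsum rs u' (?f j # sh P \<sigma> R) c\<bar>) = (\<Sum>c<D. \<bar>Bsum rs u (i # R) c - Bsum rs u (j # R) c\<bar>)"
   by (rule sum.cong[OF refl]) (simp only: lessThan_iff B)
  then show ?thesis by (simp only: bmp_def)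
 qed
 have "vert u' (sh P \<sigma> R) (?f j) = vert u R j"
 proof (cases "R = P")
  case False
  then show ?thesis unfolding vert_def ar_sh using b by simp
 next
  case True
  have b': "bmp u' P (\<sigma> i) (\<sigma> j) = bmp u P i j" for i j using b[of i j] True by (simp add: sh_short)
  show ?thesis
  proof (cases "j < n")
   case jn: True
   have "vert u' P (\<sigma> j) = (\<Sum>i<n. (if \<sigma> i < \<sigma> j then 1 else if \<sigma> j < \<sigma> i then -1 else 0) * bmp u' P (\<sigma> i) (\<sigma> j))"
    unfolding vert_def ar_P by (rule sum.permute[OF s(3), unfolded o_def])
   also have "\<dots> = (\<Sum>i<n. (if i < j then 1 else if j < i then -1 else 0) * bmp u P i j)"
   proof (rule sum.cong[OF refl])
    fix i assume i: "i \<in> {..<n}"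
    consider "i < m" "j < m" | "m <= i" "m <= j" | "bmp u P i j = 0"
     using bmp_gap[of i j] bmp_gap[of j i] i jn by (cases "i < m"; cases "j < m") auto
    then show "(if \<sigma> i < \<sigma> j then 1 else if \<sigma> j < \<sigma> i then -1 else 0) * bmp u' P (\<sigma> i) (\<sigma> j) = (if i < j then 1 else if j < i then -1 else 0) * bmp u P i j"
    proof cases
     case 1
     then have "\<sigma> i < \<sigma> j \<longleftrightarrow> i < j" "\<sigma> j < \<sigma> i \<longleftrightarrow> j < i" using strict_mono_on_less[OF s(4)] by auto
     then show ?thesis by (simp add: b')
    next
     case 2
     then have "\<sigma> i < \<sigma> j \<longleftrightarrow> i < j" "\<sigma> j < \<sigma> i \<longleftrightarrow> j < i" using strict_mono_on_less[OF s(5)] i jn by auto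
     then show ?thesis by (simp add: b')
    qed (simp add: b')
   qed
   also have "\<dots> = vert u P j" by (simp add: vert_def ar_P)
   finally show ?thesis using True by (simp add: sh_short)
  next
   case False
   then have "\<sigma> j = j" using permutes_not_in[OF s(3)] by simp
   have "vert u' P (\<sigma> j) = (\<Sum>i<n. (if \<sigma> i < \<sigma> j then 1 else if \<sigma> j < \<sigma> i then -1 else 0) * bmp u' P (\<sigma> i) (\<sigma> j))"
    unfolding vert_def ar_P by (rule sum.permute[OF s(3), unfolded o_def])
   also have "\<dots> = (\<Sum>i<n. (if i < j then 1 else if j < i then -1 else 0) * bmp u P i j)"
   proof (rule sum.cong[OF refl])
    fix i assume i: "i \<in> {..<n}"
    then have "\<sigma> i < n" using permutes_in_image[OF s(3), of i] by simp
    then show "(if \<sigma> i < \<sigma> j then 1 else if \<sigma> j < \<sigma> i then -1 else 0) * bmp u' P (\<sigma> i) (\<sigma> j) = (if i < j then 1 else if j < i then -1 else 0) * bmp u P i j"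
     using False i b'[of i j] unfolding \<open>\<sigma> j = j\<close> by simp
   qed
   also have "\<dots> = vert u P j" by (simp add: vert_def ar_P)
   finally show ?thesis using True by (simp add: sh_short)
  qed
 qed
 moreover have "(\<Sum>c<D. Bsum rs u' (?f j # sh P \<sigma> R) c *\<^sub>R bs (Suc c)) = (\<Sum>c<D. Bsum rs u (j # R) c *\<^sub>R bs (Suc c) :: 'a)"
  by (rule sum.cong[OF refl]) (simp only: lessThan_iff B)
 ultimately show ?thesis by (simp only: site_def)
qed

end

text \<open>The sites met along a path: a name for a leaf that does not mention labels. It serves as
  the invariant code A in \<open>pe_zero\<close>.\<close>

fun addr :: "(nat list => nat => 'a) => nat list => 'a list" where
 "addr x [] = []"
| "addr x (j # R) = x R j # addr x R"

lemma addr_inj: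
 assumes d: "\<And>R. node R ==> dist_sites (ar R) (x R)"
 shows "tp q ==> tp q' ==> addr x q = addr x q' ==> q = q'"
proof (induction q arbitrary: q')
 case Nil
 then show ?case by (cases q') auto
next
 case (Cons j R)
 then obtain j' R' where q': "q' = j' # R'" by (cases q') auto
 note t = tp_ConsD[OF Cons.prems(1)] and t' = tp_ConsD[OF Cons.prems(2)[unfolded q']]
 have "R = R'" using Cons.IH[OF t(3) t'(3)] Cons.prems(3) q' by simp
 then show ?case using d[OF t(1)] t(2) t'(2) Cons.prems(3) q' by (auto simp: dist_sites_def)
qed

end

section \<open>Equal values on all leaves\<close>

locale grid_mass = leaf_grid rs D + body_mass K \<nu> for rs D and K :: "'a::euclidean_space set" and \<nu>
begin

fun piece :: "(nat list => nat => 'a) => nat list => 'a set" where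
 "piece x [] = K"
| "piece x (j # R) = bal_cell (ar R) (x R) (piece x R) j"

definition wts :: "(nat list => nat => 'a) => nat list => nat => real" where
 "wts x R = bw (ar R) (x R) (piece x R)"

lemma gp_piece: "gp K x (wts x) Q = piece x Q"
 by (induction Q) (simp_all add: wts_def bal_cell_def)

lemma sub_body_K: "sub_body K" by (simp add: sub_body_def K)

lemma piece_body:
 assumes d: "\<And>R. node R ==> dist_sites (ar R) (x R)"
 shows "rs = us @ vs ==> Q \<in> leaves vs ==> sub_body (piece x Q) \<and> measure \<nu> (piece x Q) = measure \<nu> K / real (prod_list vs)"
proof (induction vs arbitrary: us Q)
 case Nil
 then have "Q = []" by simp
 then show ?case by (simp only: piece.simps sub_body_K) simp
next
 case (Cons n vs)
 then obtain j R where Q: "Q = j # R" "j < n" "R \<in> leaves vs" by auto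
 have n: "node R" "ar R = n" unfolding node_def using Cons.prems(1) Q(3) ar_eq by blast+
 have ih: "sub_body (piece x R)" "measure \<nu> (piece x R) = measure \<nu> K / real (prod_list vs)"
  using Cons.IH[of "us @ [n]" R] Cons.prems(1) Q(3) by auto
 show ?case using bal_cell_body[OF ih(1) d[OF n(1)], of j] Q n ih(2) by (simp add: mult.commute)
qed

lemma piece_tp: "(\<And>R. node R ==> dist_sites (ar R) (x R)) ==> tp Q ==> sub_body (piece x Q)"
 using piece_body unfolding tp_def by blast

lemma piece_eqtree:
 assumes d: "\<And>R. node R ==> dist_sites (ar R) (x R)"
 shows "eqtree K \<nu> x (wts x)"
 unfolding eqtree_def gp_piece
proof (intro conjI allI impI)
 show "dist_sites (ar R) (x R)" if "node R" for R by (rule d[OF that])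
 show "(\<Sum>i<ar R. wts x R i) = 0" if R: "node R" for R
 proof -
  obtain us vs where v: "rs = us @ ar R # vs" "R \<in> leaves vs" using nodeE[OF R] .
  have "rs = (us @ [ar R]) @ vs" using v by simp
  then have "sub_body (piece x R)" using piece_body[OF d] v by blast
  moreover have "ar R > 0" using rs(2)[OF ar_in[OF R]] by simp
  ultimately have "balanced (ar R) (x R) (piece x R) (wts x R)" unfolding wts_def using d[OF R] by (intro bw_balanced)
  then show ?thesis by (simp add: balanced_def)
 qed
 fix us vs Q assume Q: "rs = us @ vs" "Q \<in> leaves vs"
 show "piece x Q \<in> convex_bodies" "measure \<nu> (piece x Q) = measure \<nu> K / real (prod_list vs)"
  using piece_body[OF d Q] by (auto simp: sub_body_def)
qed

lemma piece_tendsto: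
 assumes d: "\<And>R. node R ==> dist_sites (ar R) (x R)" "\<And>t R. node R ==> dist_sites (ar R) (xt t R)"
  and x: "\<And>R j. node R ==> j < ar R ==> (%t. xt t R j) \<longlonglongrightarrow> x R j"
 shows "tp Q ==> conv_sets (%t. piece (xt t) Q) (piece x Q)"
proof (induction Q)
 case Nil
 then show ?case using K' by (simp add: conv_sets_const compact_imp_closed)
next
 case (Cons j R)
 note t = tp_ConsD[OF Cons.prems]
 show ?case unfolding piece.simps
  by (rule bal_cell_tendsto[OF piece_tp[OF d(1) t(3)] piece_tp[OF d(2) t(3)] Cons.IH[OF t(3)] d(1)[OF t(1)] d(2)[OF t(1)] x[OF t(1)] t(2)])
qed

lemma piece_perm:
 assumes d: "\<And>R. node R ==> dist_sites (ar R) (x R)" and P: "node P" and s: "\<sigma> permutes {..<ar P}"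
  and x': "\<And>R j. x' (sh P \<sigma> R) (if R = P then \<sigma> j else j) = x R j"
 shows "tp Q ==> piece x' (sh P \<sigma> Q) = piece x Q"
proof (induction Q)
 case (Cons j R)
 note t = tp_ConsD[OF Cons.prems]
 have ar: "ar (sh P \<sigma> R) = ar R" by (simp add: ar_def)
 show ?case
 proof (cases "R = P")
  case True
  have "x' P (\<sigma> i) = x P i" for i using x'[of P i] by (simp add: sh_short)
  then show ?thesis using bal_cell_permute[OF piece_tp[OF d t(3)] d[OF t(1)], of \<sigma> "x' P" j] s t(2) Cons.IH[OF t(3)] True
   by (simp add: sh_short)
 next
  case False
  have "x' (sh P \<sigma> R) i = x R i" for i using x'[of R i] False by simp
  then show ?thesis using bal_cell_permute[OF piece_tp[OF d t(3)] d[OF t(1)], of id "x' (sh P \<sigma> R)" j] t(2) Cons.IH[OF t(3)] False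
   by (simp add: ar permutes_id)
 qed
qed simp

theorem equal_values:
 assumes p: "prime p" "\<And>n m. n \<in> set rs ==> 0 < m ==> m < n ==> p dvd (n choose m)"
  and D: "D < DIM('a)" and haus: "\<And>c. c < D ==> haus_continuous (\<phi> c)"
 shows "\<exists>u w. (\<forall>q c. \<bar>u q c\<bar> <= real Rn) \<and> eqtree K \<nu> (site u) w \<and> eqval K (site u) w D \<phi>"
proof -
 have d: "dist_sites (ar R) (site u R :: nat => 'a)" for u R by (rule site_dist[OF D])
 \<comment> \<open>The shift gives F the same component sums as u, as \<open>sumF\<close> demands. A
   zero of F then says that \<phi> c has the value - \<open>av u c\<close> on every leaf.\<close>
 define av where "av u c = ((\<Sum>q\<in>leaves rs. u q c) - (\<Sum>q\<in>leaves rs. \<phi> c (piece (site u) q))) / real Nl" for u c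
 define F where "F u q c = (if c < D then \<phi> c (piece (site u) q) + av u c else 0)" for u q c
 have N: "real Nl > 0" using Nl_pos by simp
 have pe: "sh P \<sigma> q \<in> leaves rs" "piece (site u') (sh P \<sigma> q) = piece (site u) q" "addr (site u' :: _ => _ => 'a) (sh P \<sigma> q) = addr (site u) q"
  if s: "rs = us @ n # vs" "P \<in> leaves vs" "\<sigma> permutes {..<n}" "strict_mono_on {..<m} \<sigma>" "strict_mono_on {m..<n} \<sigma>" "c < D"
   "\<forall>i<m. \<forall>j\<in>{m..<n}. Bsum rs u (i # P) c + 1 <= Bsum rs u (j # P) c"
   "\<forall>q\<in>leaves rs. \<forall>c<D. u' (sh P \<sigma> q) c = u q c" and q: "q \<in> leaves rs"
  for us n vs P \<sigma> m c q and u u' :: "nat list => nat => real"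
 proof -
  note sp = site_pe[OF s]
  have P: "node P" "ar P = n" unfolding node_def using s(1,2) ar_eq by blast+
  show "sh P \<sigma> q \<in> leaves rs" using sh_leaves[OF s(3,2,1)] q by blast
  show "piece (site u') (sh P \<sigma> q) = piece (site u) q"
   using piece_perm[OF d P(1) s(3)[folded P(2)] sp tp_leaf[OF q]] .
  show "addr (site u' :: _ => _ => 'a) (sh P \<sigma> q) = addr (site u) q"
  proof (induction q)
   case (Cons j R)
   then show ?case using sp[of R j] by (cases "R = P") (auto simp: sh_short)
  qed simp
 qed
 have peF: "pe_inv rs D F" unfolding pe_inv_def
 proof (intro allI impI ballI)
  fix us n vs P \<sigma> m c q and u u' :: "nat list => nat => real"
  assume s: "rs = us @ n # vs" "P \<in> leaves vs" "\<sigma> permutes {..<n}" "strict_mono_on {..<m} \<sigma>" "strict_mono_on {m..<n} \<sigma>" "m <= n" "c < D"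
   "\<forall>i<m. \<forall>j\<in>{m..<n}. Bsum rs u (i # P) c + 1 <= Bsum rs u (j # P) c"
   "\<forall>q\<in>leaves rs. \<forall>c<D. u' (sh P \<sigma> q) c = u q c" and q: "q \<in> leaves rs"
  note pe' = pe[OF s(1-5,7-9)]
  have re: "(\<Sum>q\<in>leaves rs. g q) = (\<Sum>q\<in>leaves rs. g (sh P \<sigma> q))" for g :: "nat list => real"
   by (rule sum.reindex_bij_witness[where j = "sh P (inv_into UNIV \<sigma>)" and i = "sh P \<sigma>"])
    (use sh_leaves[OF s(3,2,1)] sh_leaves[OF permutes_inv[OF s(3)] s(2,1)] in \<open>auto simp: sh_bij[OF s(3)]\<close>)
  have "av u' c = av u c" if "c < D" for c
   unfolding av_def re[of "%q. u' q c"] re[of "%q. \<phi> c (piece (site u') q)"] using pe'(2) s(9) that by simp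
  then show "F u' (sh P \<sigma> q) = F u q" unfolding F_def using pe'(2)[OF q] by auto
 qed
 have peA: "pe_inv rs D (%u. addr (site u :: _ => _ => 'a))" unfolding pe_inv_def
 proof (intro allI impI ballI)
  fix us n vs P \<sigma> m c q and u u' :: "nat list => nat => real"
  assume s: "rs = us @ n # vs" "P \<in> leaves vs" "\<sigma> permutes {..<n}" "strict_mono_on {..<m} \<sigma>" "strict_mono_on {m..<n} \<sigma>" "m <= n" "c < D"
   "\<forall>i<m. \<forall>j\<in>{m..<n}. Bsum rs u (i # P) c + 1 <= Bsum rs u (j # P) c"
   "\<forall>q\<in>leaves rs. \<forall>c<D. u' (sh P \<sigma> q) c = u q c" and q: "q \<in> leaves rs"
  show "addr (site u' :: _ => _ => 'a) (sh P \<sigma> q) = addr (site u) q" by (rule pe(3)[OF s(1-5,7-9) q])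
 qed
 have inj: "inj_on (addr (site u :: _ => _ => 'a)) (leaves rs)" for u
  by (rule inj_onI) (rule addr_inj[OF d tp_leaf tp_leaf])
 have body: "piece (site u) q \<in> convex_bodies" "piece (site u) q \<subseteq> K" if "q \<in> leaves rs" for u q
  using piece_tp[OF d tp_leaf[OF that]] by (auto simp: sub_body_def)
 have sumF: "(\<Sum>q\<in>leaves rs. F u q c) = (\<Sum>q\<in>leaves rs. u q c)" if "c < D" for u c
 proof -
  have "(\<Sum>q\<in>leaves rs. F u q c) = (\<Sum>q\<in>leaves rs. \<phi> c (piece (site u) q)) + real Nl * av u c"
   using that by (simp add: F_def sum.distrib Nl_def)
  then show ?thesis using N by (simp add: av_def)
 qed
 have cont: "(%t. F (ut t) q c) \<longlonglongrightarrow> F w q c"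
  if ut: "\<And>q c. (%t. ut t q c) \<longlonglongrightarrow> w q c" and q: "q \<in> leaves rs" and c: "c < D" for ut w q c
 proof -
  have ph: "(%t. \<phi> c (piece (site (ut t)) q)) \<longlonglongrightarrow> \<phi> c (piece (site w) q)" if q: "q \<in> leaves rs" for q
   by (rule conv_sets_haus_continuous[OF haus[OF c] body(1)[OF q] body(1)[OF q] K'(1) body(2)[OF q]
    piece_tendsto[OF d d site_tendsto[OF ut] tp_leaf[OF q]]])
  show ?thesis unfolding F_def av_def using c N by (simp, intro tendsto_intros ph q ut) auto
 qed
 have "\<exists>w. (\<forall>q c. \<bar>w q c\<bar> <= real Rn) \<and> (\<forall>q\<in>leaves rs. \<forall>c<D. F w q c = 0)"
 proof (rule pe_zero[OF p sumF peF peA inj cont])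
  fix w assume "\<And>q c. \<bar>w q c\<bar> <= real Rn" "\<And>q c. q \<in> leaves rs ==> c < D ==> F w q c = 0"
  then show ?thesis by (intro exI[of _ w] conjI allI ballI impI)
 qed assumption+
 then obtain w where w': "(\<forall>q c. \<bar>w q c\<bar> <= real Rn) \<and> (\<forall>q\<in>leaves rs. \<forall>c<D. F w q c = 0)" ..
 have w: "\<bar>w q c\<bar> <= real Rn" "q \<in> leaves rs ==> c < D ==> F w q c = 0" for q c using w' by simp_all
 have "eqval K (site w) (wts (site w)) D \<phi>" unfolding eqval_def gp_piece
 proof (intro allI impI ballI)
  fix c q q' assume "c < D" "q \<in> leaves rs" "q' \<in> leaves rs"
  then show "\<phi> c (piece (site w) q) = \<phi> c (piece (site w) q')" using w(2)[of q c] w(2)[of q' c] by (simp add: F_def)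
 qed
 then show ?thesis using w(1) piece_eqtree[of "site w", OF d] by (intro exI conjI allI)
qed

end

section \<open>From trees to numbered partitions\<close>

fun pth :: "nat list => nat => nat list" where
 "pth [] i = []"
| "pth (n # rs) i = (i mod n) # pth rs (i div n)"

lemma pth_leaves: "i < prod_list rs ==> pth rs i \<in> leaves rs"
proof (induction rs arbitrary: i)
 case (Cons n rs)
 have "n > 0" using Cons.prems by (cases n) auto
 moreover have "i div n < prod_list rs" using Cons.prems by (simp add: less_mult_imp_div_less mult.commute)
 ultimately show ?case using Cons.IH by simp
qed simp

context leaf_grid
begin

lemma eqtreeD:
 assumes "eqtree K \<nu> x w"
 shows "rs = us @ vs ==> Q \<in> leaves vs ==> gp K x w Q \<in> convex_bodies"
  and "rs = us @ vs ==> Q \<in> leaves vs ==> measure \<nu> (gp K x w Q) = measure \<nu> K / real (prod_list vs)"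
 using assms[unfolded eqtree_def, THEN conjunct2, rule_format, of us vs Q] by simp_all

lemma eqtree_iter:
 assumes e: "eqtree K \<mu> x w"
 shows "rs = us @ vs ==> iter_partition_rev \<mu> K vs (%i. gp K x w (pth vs i))"
proof (induction vs arbitrary: us)
 case (Cons n vs)
 have r: "rs = (us @ [n]) @ vs" using Cons.prems by simp
 have "regular_equipartition \<mu> (gp K x w (pth vs i)) n (%j. gp K x w (pth (n # vs) (i * n + j)))" if i: "i < prod_list vs" for i
 proof -
  define R where "R = pth vs i"
  have R: "R \<in> leaves vs" unfolding R_def by (rule pth_leaves[OF i])
  have n: "node R" "ar R = n" unfolding node_def using Cons.prems R ar_eq by blast+
  \<comment> \<open>Quotient and remainder in \<open>pth\<close> undo the numbering i * n + j of
    iterated partitions.\<close>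
  have pj: "pth (n # vs) (i * n + j) = j # R" if "j < n" for j using that by (simp add: R_def)
  have L: "j # R \<in> leaves (n # vs)" if "j < n" for j using R that by simp
  show ?thesis unfolding regular_equipartition_def R_def[symmetric]
  proof (intro exI[of _ "x R"] exI[of _ "w R"] conjI)
   have ds: "dist_sites (ar R) (x R)" "(\<Sum>i<ar R. w R i) = 0" using e n(1) unfolding eqtree_def by blast+
   show "\<forall>i<n. \<forall>j<n. i ~= j --> x R i ~= x R j" using ds(1) n(2) by (simp add: dist_sites_def)
   show "(\<Sum>i<n. w R i) = 0" using ds(2) n(2) by simp
   have b: "gp K x w (j # R) \<in> convex_bodies \<and> measure \<mu> (gp K x w (j # R)) = measure \<mu> K / real (prod_list (n # vs))" if "j < n" for j
    using eqtreeD[OF e Cons.prems L[OF that]] by (rule conjI)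
   show "\<forall>j<n. gp K x w (pth (n # vs) (i * n + j)) = gp K x w R \<inter> power_cell n (x R) (w R) j \<and> gp K x w (pth (n # vs) (i * n + j)) \<in> convex_bodies"
   proof (intro allI impI)
    fix j assume j: "j < n"
    show "gp K x w (pth (n # vs) (i * n + j)) = gp K x w R \<inter> power_cell n (x R) (w R) j \<and> gp K x w (pth (n # vs) (i * n + j)) \<in> convex_bodies"
     using b[OF j] n(2) unfolding pj[OF j] by simp
   qed
   show "\<forall>l<n. \<forall>j<n. measure \<mu> (gp K x w (pth (n # vs) (i * n + l))) = measure \<mu> (gp K x w (pth (n # vs) (i * n + j)))"
   proof (intro allI impI)
    fix l j assume "l < n" "j < n"
    then show "measure \<mu> (gp K x w (pth (n # vs) (i * n + l))) = measure \<mu> (gp K x w (pth (n # vs) (i * n + j)))"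
     using b[of l] b[of j] unfolding pj[OF \<open>l < n\<close>] pj[OF \<open>j < n\<close>] by simp
   qed
  qed
 qed
 then show ?case using Cons.IH[OF r] by (auto simp del: pth.simps)
qed simp

lemma eqtree_partition:
 assumes e: "eqtree K \<mu> x w" and v: "eqval K x w m \<phi>" and ns: "rs = rev ns"
 shows "\<exists>P. iterated_partition \<mu> K ns P \<and>
      (\<forall>i<prod_list ns. \<forall>j<prod_list ns. measure \<mu> (P i) = measure \<mu> (P j)) \<and>
      (\<forall>l < m. \<forall>i<prod_list ns. \<forall>j<prod_list ns. \<phi> l (P i) = \<phi> l (P j))"
proof (intro exI[of _ "%i. gp K x w (pth rs i)"] conjI allI impI)
 have "prod_list (rev l) = prod_list l" for l :: "nat list" by (induction l) (simp_all add: mult.commute)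
 then have pr: "prod_list rs = prod_list ns" by (simp only: ns)
 show "iterated_partition \<mu> K ns (%i. gp K x w (pth rs i))"
  unfolding iterated_partition_def ns[symmetric] by (rule eqtree_iter[OF e, of "[]"]) simp
 show "measure \<mu> (gp K x w (pth rs i)) = measure \<mu> (gp K x w (pth rs j))" if ij: "i < prod_list ns" "j < prod_list ns" for i j
 proof -
  have e0: "rs = [] @ rs" by simp
  have "measure \<mu> (gp K x w (pth rs i)) = measure \<mu> K / real (prod_list rs)" if "i < prod_list ns" for i
   by (rule eqtreeD(2)[OF e e0 pth_leaves]) (simp add: pr that)
  then show ?thesis by (simp only: ij)
 qed
 show "\<phi> l (gp K x w (pth rs i)) = \<phi> l (gp K x w (pth rs j))" if "l < m" "i < prod_list ns" "j < prod_list ns" for l i j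
  by (rule v[unfolded eqval_def, rule_format, OF that(1) pth_leaves pth_leaves]) (simp_all only: pr that)
qed

end

theorem partition_of_prime:
 fixes K :: "'a::euclidean_space set" and \<mu> :: "'a measure"
 assumes ns: "ns ~= []" "\<forall>m\<in>set ns. 2 <= m" and K: "K \<in> convex_bodies" and f: "finite_measure \<mu>" and s: "sets \<mu> = sets borel"
  and ac: "absolutely_continuous lborel \<mu>" and haus: "\<forall>l < DIM('a) - 1. haus_continuous (\<phi> l)"
  and p: "DIM('a) >= 2 ==> \<exists>p. prime p \<and> (\<forall>n\<in>set ns. \<forall>m. 0 < m --> m < n --> p dvd (n choose m))"
 shows "\<exists>P. iterated_partition \<mu> K ns P \<and>
      (\<forall>i<prod_list ns. \<forall>j<prod_list ns. measure \<mu> (P i) = measure \<mu> (P j)) \<and>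
      (\<forall>l < DIM('a) - 1. \<forall>i<prod_list ns. \<forall>j<prod_list ns. \<phi> l (P i) = \<phi> l (P j))"
proof (cases "DIM('a) >= 2")
 case True
 define D where "D = DIM('a) - 1"
 interpret leaf_grid "rev ns" D by unfold_locales (use ns True in \<open>auto simp: D_def\<close>)
 obtain p where p: "prime p" "\<And>n m. n \<in> set (rev ns) ==> 0 < m ==> m < n ==> p dvd (n choose m)" using p[OF True] by auto
 have hs: "haus_continuous (\<phi> c)" if "c < D" for c using haus that by (simp add: D_def)
 have DD: "D < DIM('a)" using True by (simp add: D_def)
 have "\<exists>x w. eqtree K \<mu> x w \<and> eqval K x w D \<phi>"
 proof (rule eqtree_limit[OF K f s ac, of "site" D \<phi> "real Rn"])
  show "dist_sites (ar R) (site u R :: nat => 'a)" for u R by (rule site_dist[OF DD])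
  show "(%t. site (ut t) R j :: 'a) \<longlonglongrightarrow> site u R j" if "\<And>q c. (%t. ut t q c) \<longlonglongrightarrow> u q c" for ut u R j
   by (rule site_tendsto[OF that])
  show "haus_continuous (\<phi> c)" if "c < D" for c by (rule hs[OF that])
  show "\<exists>u w. (\<forall>q c. \<bar>u q c\<bar> <= real Rn) \<and> eqtree K \<nu> (site u) w \<and> eqval K (site u) w D \<phi>" if nu: "body_mass K \<nu>" for \<nu>
  proof -
   interpret nu: grid_mass "rev ns" D K \<nu> using nu by (intro grid_mass.intro leaf_grid_axioms)
   show ?thesis by (rule nu.equal_values[OF p DD hs])
  qed
 qed
 then show ?thesis using eqtree_partition[of K \<mu> _ _ D \<phi> ns] by (auto simp: D_def)
next
 case False
 \<comment> \<open>In dimension one there is nothing to equalise and any distinct sites on the line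
   will do. The locale wants D to be positive, hence 1 instead of
   \<open>DIM('a) - 1\<close>.\<close>
 interpret leaf_grid "rev ns" 1 by unfold_locales (use ns in auto)
 define x :: "nat list => nat => 'a" where "x = (%R j. real j *\<^sub>R bs 0)"
 have "bs 0 ~= (0 :: 'a)" using bs_inner[of 0 0, where 'a = 'a] by auto
 then have d: "dist_sites (ar R) (x R)" for R :: "nat list" by (simp add: dist_sites_def x_def)
 have "\<exists>x w. eqtree K \<mu> x w \<and> eqval K x w 0 \<phi>"
 proof (rule eqtree_limit[OF K f s ac, of "%u. x" 0 \<phi> 0])
  show "dist_sites (ar R) (x R)" for R by (rule d)
  show "\<exists>(u :: nat list => nat => real) w. (\<forall>q c. \<bar>u q c\<bar> <= 0) \<and> eqtree K \<nu> x w \<and> eqval K x w 0 \<phi>" if nu: "body_mass K \<nu>" for \<nu>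
  proof -
   interpret nu: grid_mass "rev ns" 1 K \<nu> using nu by (intro grid_mass.intro leaf_grid_axioms)
   show ?thesis using nu.piece_eqtree[of x, OF d] by (rule_tac exI[of _ "%_ _. 0"], rule_tac exI[of _ "nu.wts x"]) (simp add: eqval_def)
  qed
 qed simp_all
 then show ?thesis using eqtree_partition[of K \<mu> _ _ 0 \<phi> ns] False by fastforce
qed

section \<open>Cancelling local degrees\<close>

definition ramp :: "real => real" where "ramp x = min 1 (max 0 ((x + 1) / 2))"

lemma ramp_simps: "x <= -1 ==> ramp x = 0" "1 <= x ==> ramp x = 1"
 by (auto simp: ramp_def)

lemma cis_2pi_int: "cis (2 * pi * of_int k) = 1"
 by (rule cis_multiple_2pi) simp

lemma cis_turn: "r = 0 \<or> r = 1 ==> cis (2 * pi * of_int k * r) = 1"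
 using cis_2pi_int[of k] by auto

text \<open>\<open>emb\<close> and \<open>plc\<close> identify the plane of e and f with the complex
  numbers: inclusion and, for orthonormal e and f, coordinates of the orthogonal projection.\<close>

definition emb :: "'v::real_inner => 'v => complex => 'v" where
 "emb e f c = Re c *\<^sub>R e + Im c *\<^sub>R f"

definition plc :: "'v::real_inner => 'v => 'v => complex" where
 "plc e f z = Complex (inner e z) (inner f z)"

lemma emb_add: "emb e f (a + b) = emb e f a + emb e f b"
 by (simp add: emb_def algebra_simps)
lemma emb_sum: "emb e f (\<Sum>i\<in>A. g i) = (\<Sum>i\<in>A. emb e f (g i))"
 by (simp add: emb_def sum.distrib scaleR_sum_left)
lemma emb_scale: "emb e f (of_real r * a) = r *\<^sub>R emb e f a"
 by (simp add: emb_def algebra_simps)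

text \<open>The rotation by \<open>2 \<pi> k\<close> times a ramp in the plane coordinate across the ray of \<open>e\<close>, damped off the
 plane: it changes the identity in a tube around that ray only and raises the degree by \<open>\<plusminus>k\<close>.\<close>

definition turn :: "real => int => complex => complex" where
 "turn \<rho> k w = of_real (min 1 (max 0 (Re w))) * (cis (2 * pi * of_int k * ramp (Im w / \<rho>)) - 1)"

definition damp :: "real => 'v::real_inner => 'v => 'v => real" where
 "damp \<rho> e f z = max 0 (1 - norm (z - emb e f (plc e f z)) / \<rho>)"

definition cap :: "real => int => 'v::real_inner => 'v => 'v => 'v" where
 "cap \<rho> k e f z = damp \<rho> e f z *\<^sub>R emb e f (turn \<rho> k (plc e f z) * plc e f z)"

definition onp :: "'v::real_inner => 'v => bool" where
 "onp e f \<longleftrightarrow> norm e = 1 \<and> norm f = 1 \<and> inner e f = 0"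

lemma onp_inner: "onp e f ==> inner e e = 1" "onp e f ==> inner f f = 1" "onp e f ==> inner e f = 0" "onp e f ==> inner f e = 0"
 by (auto simp: onp_def norm_eq_1 inner_commute)

lemma plc_emb: "onp e f ==> plc e f (emb e f c) = c"
 by (simp add: plc_def emb_def inner_add_right onp_inner complex_eq_iff)

lemma plc_add: "plc e f (a + b) = plc e f a + plc e f b"
 by (simp add: plc_def inner_add_right complex_eq_iff)

lemma plc_diff: "plc e f (a - b) = plc e f a - plc e f b"
 by (simp add: plc_def inner_diff_right complex_eq_iff)

lemma emb_eq_0: "onp e f ==> emb e f c = 0 ==> c = 0"
 using plc_emb[of e f c] by (simp add: plc_def complex_eq_iff)

lemma norm_emb: "onp e f ==> norm (emb e f c) = norm c"
 unfolding norm_eq_sqrt_inner[of "emb e f c"] cmod_def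
 by (simp add: emb_def inner_add_left inner_add_right onp_inner power2_eq_square)

lemma split_eq_0:
 assumes "onp e f" "(z - emb e f (plc e f z)) + emb e f c = 0"
 shows "c = 0" "z = emb e f (plc e f z)"
proof -
 have "plc e f ((z - emb e f (plc e f z)) + emb e f c) = c"
  using assms(1) by (simp add: plc_add plc_diff plc_emb)
 then show c: "c = 0" unfolding assms(2) by (simp add: plc_def complex_eq_iff)
 have "emb e f (0::complex) = 0" by (simp add: emb_def)
 then show "z = emb e f (plc e f z)" using assms(2) c by simp
qed

lemma damp_on: "z = emb e f (plc e f z) ==> damp \<rho> e f z = 1"
 by (simp add: damp_def)

lemma damp_range: "\<rho> > 0 ==> 0 <= damp \<rho> e f z" "\<rho> > 0 ==> damp \<rho> e f z ~= 0 ==> norm (z - emb e f (plc e f z)) < \<rho>"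
 by (auto simp: damp_def max_def field_simps split: if_splits)

text \<open>Outside the strip the ramp is 0 or 1, and rotation by a whole number of turns is the
  identity.\<close>

lemma turn_nz:
 assumes "\<rho> > 0" "turn \<rho> k w ~= 0" shows "Re w > 0" "\<bar>Im w\<bar> < \<rho>"
proof -
 show "Re w > 0" using assms by (auto simp: turn_def max_def split: if_splits)
 show "\<bar>Im w\<bar> < \<rho>"
 proof (rule ccontr)
  assume "\<not> \<bar>Im w\<bar> < \<rho>"
  then have "Im w / \<rho> <= -1 \<or> 1 <= Im w / \<rho>" using assms(1) by (auto simp: field_simps abs_if split: if_splits)
  then have "ramp (Im w / \<rho>) = 0 \<or> ramp (Im w / \<rho>) = 1" using ramp_simps by blast
  then show False using assms(2) cis_turn[of "ramp (Im w / \<rho>)" k] by (simp add: turn_def)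
 qed
qed

text \<open>Far out, a point of the half-strip has real part at least 1, so the cut-off factor is 1
  and 1 + \<open>turn\<close> is a pure rotation.\<close>

lemma turn_far:
 assumes \<rho>: "\<rho> > 0" and w: "norm w >= \<rho> + 1"
 shows "1 + turn \<rho> k w = (if Re w > 0 then cis (2 * pi * of_int k * ramp (Im w / \<rho>)) else 1)"
proof (cases "Re w > 0 \<and> \<bar>Im w\<bar> < \<rho>")
 case True
 then have "Re w >= 1" using w cmod_le[of w] by linarith
 then show ?thesis using True by (simp add: turn_def)
next
 case False
 then have t: "turn \<rho> k w = 0" using turn_nz[OF \<rho>] by blast
 show ?thesis
 proof (cases "Re w > 0")
  case True
  have "Im w / \<rho> <= -1 \<or> 1 <= Im w / \<rho>" using \<rho> False True by (auto simp: field_simps abs_if split: if_splits)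
  then have "ramp (Im w / \<rho>) = 0 \<or> ramp (Im w / \<rho>) = 1" using ramp_simps by blast
  then show ?thesis using t True cis_turn[of "ramp (Im w / \<rho>)" k] by simp
 qed (use t in simp)
qed

lemma cap_active:
 assumes o: "onp e f" and \<rho>: "\<rho> > 0" and ne: "cap \<rho> k e f z ~= 0"
 shows "inner e z > 0" "norm (z - inner e z *\<^sub>R e) < 2 * \<rho>" "turn \<rho> k (plc e f z) ~= 0" "damp \<rho> e f z ~= 0"
proof -
 have d: "damp \<rho> e f z ~= 0" and t: "turn \<rho> k (plc e f z) ~= 0" using ne by (auto simp: cap_def emb_def)
 show "damp \<rho> e f z ~= 0" "turn \<rho> k (plc e f z) ~= 0" by fact+
 note n = turn_nz[OF \<rho> t]
 show "inner e z > 0" using n(1) by (simp add: plc_def)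
 have "z - inner e z *\<^sub>R e = (z - emb e f (plc e f z)) + inner f z *\<^sub>R f" by (simp add: emb_def plc_def)
 also have "norm \<dots> <= norm (z - emb e f (plc e f z)) + \<bar>inner f z\<bar>"
  using norm_triangle_ineq[of "z - emb e f (plc e f z)" "inner f z *\<^sub>R f"] o by (simp add: onp_def)
 also have "\<dots> < \<rho> + \<rho>" using damp_range(2)[OF \<rho> d] n(2) by (intro add_strict_mono) (simp_all add: plc_def)
 finally show "norm (z - inner e z *\<^sub>R e) < 2 * \<rho>" by simp
qed

text \<open>A zero has to lie in the plane of e and f, and there, far out, the map multiplies by a
  complex number of modulus 1.\<close>

lemma cap_nonzero:
 assumes o: "onp e f" and \<rho>: "\<rho> > 0" and z: "norm z >= \<rho> + 1"
 shows "z + cap \<rho> k e f z ~= 0"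
proof
 assume e0: "z + cap \<rho> k e f z = 0"
 define w where "w = plc e f z"
 have "(z - emb e f (plc e f z)) + emb e f (w + of_real (damp \<rho> e f z) * (turn \<rho> k w * w)) = 0"
  using e0 by (simp add: cap_def emb_add emb_scale w_def del: of_real_mult)
 note s = split_eq_0[OF o this]
 have nw: "norm w = norm z" using s(2) norm_emb[OF o, of w] by (simp add: w_def)
 have "w + turn \<rho> k w * w = 0" using s(1) damp_on[OF s(2), of \<rho>] by simp
 then have "(1 + turn \<rho> k w) * w = 0" by (simp add: algebra_simps)
 moreover have "1 + turn \<rho> k w ~= 0" using turn_far[OF \<rho>, of w k] nw z by (auto split: if_splits)
 ultimately have "w = 0" by simp
 then show False using nw z \<rho> by simp
qed

text \<open>A point in both tubes is within 2 \<rho> of a multiple of e and of a multiple of e', so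
  the distance of e and e' is of order \<rho> / \<open>norm z\<close>. Far out, tubes around
  distinct rays are disjoint.\<close>

lemma cap_unique:
 assumes o: "onp e f" "onp e' f'" and \<rho>: "\<rho> > 0" and ne: "cap \<rho> k e f z ~= 0" "cap \<rho> k' e' f' z ~= 0"
 shows "(norm z - 2 * \<rho>) * norm (e - e') < 8 * \<rho>"
proof -
 define t t' where "t = inner e z" and "t' = inner e' z"
 note a = cap_active[OF o(1) \<rho> ne(1)] and a' = cap_active[OF o(2) \<rho> ne(2)]
 have n1: "norm e = 1" "norm e' = 1" using o by (auto simp: onp_def)
 have tn: "t >= norm z - 2 * \<rho>" using a(1,2) norm_triangle_ineq2[of z "t *\<^sub>R e"] n1 by (simp add: t_def)
 have d: "norm (t *\<^sub>R e - t' *\<^sub>R e') < 4 * \<rho>"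
  using norm_triangle_ineq4[of "z - t' *\<^sub>R e'" "z - t *\<^sub>R e"] a(2) a'(2) by (simp add: t_def t'_def)
 have "\<bar>t - t'\<bar> < 4 * \<rho>"
  using norm_triangle_ineq3[of "t *\<^sub>R e" "t' *\<^sub>R e'"] d n1 a(1) a'(1) by (simp add: t_def t'_def)
 have "t *\<^sub>R (e - e') = (t *\<^sub>R e - t' *\<^sub>R e') - (t - t') *\<^sub>R e'" by (simp add: algebra_simps)
 then have "norm (t *\<^sub>R (e - e')) <= norm (t *\<^sub>R e - t' *\<^sub>R e') + norm ((t - t') *\<^sub>R e')" using norm_triangle_ineq4 by metis
 then have "t * norm (e - e') < 8 * \<rho>" using d \<open>\<bar>t - t'\<bar> < 4 * \<rho>\<close> n1 a(1) by (simp add: t_def)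
 moreover have "(norm z - 2 * \<rho>) * norm (e - e') <= t * norm (e - e')" using tn by (intro mult_right_mono) auto
 ultimately show ?thesis by linarith
qed

lemma continuous_on_Complex [continuous_intros]:
 "continuous_on S f ==> continuous_on S g ==> continuous_on S (%x. Complex (f x) (g x))"
 unfolding Complex_eq by (intro continuous_intros)

lemma continuous_on_plc [continuous_intros]:
 "continuous_on S e ==> continuous_on S f ==> continuous_on S z ==> continuous_on S (%x. plc (e x) (f x) (z x))"
 unfolding plc_def by (intro continuous_intros)

lemma continuous_on_emb [continuous_intros]:
 "continuous_on S e ==> continuous_on S f ==> continuous_on S c ==> continuous_on S (%x. emb (e x) (f x) (c x))"
 unfolding emb_def by (intro continuous_intros)

lemma continuous_on_turn [continuous_intros]:
 "\<rho> > 0 ==> continuous_on S w ==> continuous_on S (%x. turn \<rho> k (w x))"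
 unfolding turn_def ramp_def by (intro continuous_intros) auto

lemma continuous_on_damp [continuous_intros]:
 "\<rho> > 0 ==> continuous_on S e ==> continuous_on S f ==> continuous_on S z ==> continuous_on S (%x. damp \<rho> (e x) (f x) (z x))"
 unfolding damp_def by (intro continuous_intros) auto

lemma continuous_on_cap [continuous_intros]:
 "\<rho> > 0 ==> continuous_on S e ==> continuous_on S f ==> continuous_on S z ==> continuous_on S (%x. cap \<rho> k (e x) (f x) (z x))"
 unfolding cap_def by (intro continuous_intros)

text \<open>The angle of one full turn across the positive ray times the conjugate of
  \<open>sgn w\<close>. The two factors wind in opposite directions, so their product has a
  continuous angle; the two arcsine branches fit together on the imaginary axis.\<close>

definition chi :: "real => complex => real" where
 "chi \<rho> w = (if Re w >= 0 then 2 * pi * ramp (Im w / \<rho>) - arcsin (Im w / norm w) else pi + arcsin (Im w / norm w))"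

lemma Im_ratio: "-1 <= Im w / norm w" "Im w / norm w <= 1"
 using abs_Im_le_cmod[of w] by (cases "w = 0"; auto simp: field_simps abs_le_iff)+

lemma continuous_on_chi:
 assumes \<rho>: "\<rho> > 0"
 shows "continuous_on {w. norm w >= \<rho>} (chi \<rho>)"
proof -
 have "continuous_on {w. norm w >= \<rho>} (%w. if - Re w <= 0 then 2 * pi * ramp (Im w / \<rho>) - arcsin (Im w / norm w) else pi + arcsin (Im w / norm w))"
 proof (rule continuous_on_cases_le)
  show "continuous_on {x \<in> {w. \<rho> <= norm w}. - Re x <= 0} (%w. 2 * pi * ramp (Im w / \<rho>) - arcsin (Im w / norm w))"
   unfolding ramp_def using \<rho> Im_ratio by (intro continuous_intros) auto
  show "continuous_on {x \<in> {w. \<rho> <= norm w}. 0 <= - Re x} (%w. pi + arcsin (Im w / norm w))"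
   using \<rho> Im_ratio by (intro continuous_intros) auto
  fix w assume w: "w \<in> {w. \<rho> <= norm w}" "- Re w = 0"
  then have n: "norm w = \<bar>Im w\<bar>" by (simp add: cmod_def)
  consider "Im w > 0" | "Im w < 0" using w n \<rho> by fastforce
  then show "2 * pi * ramp (Im w / \<rho>) - arcsin (Im w / norm w) = pi + arcsin (Im w / norm w)"
  proof cases
   case 1
   have n': "norm w = Im w" using n 1 by simp
   have "\<rho> <= Im w" using w(1) n' by simp
   then have "Im w / \<rho> >= 1" using \<rho> by (simp add: field_simps)
   moreover have "Im w / norm w = 1" using 1 unfolding n' by simp
   ultimately show ?thesis by (simp only: ramp_simps arcsin_1)
  next
   case 2
   then have "Im w / \<rho> <= -1" "Im w / norm w = -1" using w n \<rho> by (auto simp: field_simps)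
   then show ?thesis by (simp add: ramp_simps arcsin_minus_1)
  qed
 qed (intro continuous_intros)
 then show ?thesis unfolding chi_def by simp
qed

lemma cis_chi:
 assumes \<rho>: "\<rho> > 0" and w: "norm w >= \<rho>"
 shows "cis (chi \<rho> w) = (if Re w > 0 then cis (2 * pi * ramp (Im w / \<rho>)) else 1) * cnj (sgn w)"
proof -
 define \<theta> where "\<theta> = arcsin (Im w / norm w)"
 have nz: "norm w > 0" using assms by linarith
 have s: "sin \<theta> = Im w / norm w" unfolding \<theta>_def using Im_ratio by (intro sin_arcsin)
 have "cos \<theta> = sqrt (1 - (Im w / norm w)\<^sup>2)" unfolding \<theta>_def using Im_ratio by (intro cos_arcsin)
 also have "1 - (Im w / norm w)\<^sup>2 = (Re w / norm w)\<^sup>2"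
 proof -
  have "1 = (norm w)\<^sup>2 / (norm w)\<^sup>2" using nz by simp
  also have "\<dots> = (Re w)\<^sup>2 / (norm w)\<^sup>2 + (Im w)\<^sup>2 / (norm w)\<^sup>2"
   using cmod_power2[of w] by (simp only: add_divide_distrib[symmetric])
  finally show ?thesis by (simp add: power_divide)
 qed
 also have "sqrt \<dots> = \<bar>Re w\<bar> / norm w" by simp
 finally have c: "cos \<theta> = \<bar>Re w\<bar> / norm w" .
 have sg: "sgn w = Complex (Re w / norm w) (Im w / norm w)" by (simp add: complex_eq_iff sgn_div_norm divide_inverse mult.commute)
 show ?thesis
 proof (cases "Re w >= 0")
  case True
  have "cis (chi \<rho> w) = cis (2 * pi * ramp (Im w / \<rho>)) * cis (- \<theta>)"
   using True by (simp add: chi_def \<theta>_def cis_mult)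
  moreover have "cis (- \<theta>) = cnj (sgn w)" using s c True by (simp add: complex_eq_iff sg)
  moreover have "cis (2 * pi * ramp (Im w / \<rho>)) = 1" if "Re w = 0"
  proof -
   have "norm w = \<bar>Im w\<bar>" using that by (simp add: cmod_def)
   then have "Im w / \<rho> <= -1 \<or> 1 <= Im w / \<rho>" using \<rho> w by (auto simp: field_simps abs_if split: if_splits)
   then show ?thesis using ramp_simps by auto
  qed
  ultimately show ?thesis using True by (cases "Re w = 0") auto
 next
  case False
  have "cis (chi \<rho> w) = cis pi * cis \<theta>" using False unfolding chi_def cis_mult \<theta>_def by simp
  also have "\<dots> = cnj (sgn w)" using s c False by (simp add: complex_eq_iff sg)
  finally show ?thesis using False by simp
 qed
qed

lemma cis_sum: "finite A ==> cis (\<Sum>i\<in>A. f i) = (\<Prod>i\<in>A. cis (f i))"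
 by (induction A rule: finite_induct) (simp_all add: cis_mult[symmetric])

text \<open>Because \<open>\<Sum>k = -1\<close>, the factor \<open>w\<close> can be distributed over the rotations as \<open>cnj (sgn w)\<close> to the power \<open>k\<close>, and each
 of the resulting maps has a continuous logarithm.\<close>

lemma degree_zero_angle:
 fixes k :: "'i => int"
 assumes A: "finite A" and k: "(\<Sum>i\<in>A. k i) = -1" and \<rho>: "\<rho> > 0" and w: "norm w >= \<rho> + 1"
 shows "w * (\<Prod>i\<in>A. 1 + turn \<rho> (k i) (w * cis (- \<phi> i))) =
  of_real (norm w) * cis (\<Sum>i\<in>A. of_int (k i) * (chi \<rho> (w * cis (- \<phi> i)) - \<phi> i))"
proof -
 have w0: "w ~= 0" using w \<rho> by auto
 define \<theta> where "\<theta> = Arg w"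
 have sw: "sgn w = cis \<theta>" using cis_Arg[OF w0] by (simp add: \<theta>_def)
 define r where "r i = (if Re (w * cis (- \<phi> i)) > 0 then ramp (Im (w * cis (- \<phi> i)) / \<rho>) else 0)" for i
 have tn: "1 + turn \<rho> (k i) (w * cis (- \<phi> i)) = cis (of_int (k i) * (2 * pi * r i))" for i
  using turn_far[OF \<rho>, of "w * cis (- \<phi> i)" "k i"] w by (simp add: norm_mult r_def mult.assoc mult.left_commute)
 have c: "cis (chi \<rho> (w * cis (- \<phi> i)) - \<phi> i) = cis (2 * pi * r i - \<theta>)" for i
 proof -
  have "cis (chi \<rho> (w * cis (- \<phi> i))) = cis (2 * pi * r i) * cnj (sgn (w * cis (- \<phi> i)))"
   using cis_chi[OF \<rho>, of "w * cis (- \<phi> i)"] w by (simp add: norm_mult r_def)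
  also have "cnj (sgn (w * cis (- \<phi> i))) = cis (- \<theta>) * cis (\<phi> i)" by (simp add: sgn_mult sw cis_cnj)
  finally have "cis (chi \<rho> (w * cis (- \<phi> i))) * cis (- \<phi> i) = cis (2 * pi * r i) * cis (- \<theta>) * (cis (\<phi> i) * cis (- \<phi> i))" by (simp add: ac_simps)
  then show ?thesis by (simp add: cis_mult)
 qed
 have "cis (of_int (k i) * (chi \<rho> (w * cis (- \<phi> i)) - \<phi> i)) = cis (of_int (k i) * (2 * pi * r i) - of_int (k i) * \<theta>)" for i
  using arg_cong[OF c, of "%x. x powi k i" i] by (simp add: cis_power_int right_diff_distrib)
 then have "cis (\<Sum>i\<in>A. of_int (k i) * (chi \<rho> (w * cis (- \<phi> i)) - \<phi> i)) = cis (\<Sum>i\<in>A. of_int (k i) * (2 * pi * r i) - of_int (k i) * \<theta>)"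
  unfolding cis_sum[OF A] by simp
 also have "(\<Sum>i\<in>A. of_int (k i) * (2 * pi * r i) - of_int (k i) * \<theta>) = (\<Sum>i\<in>A. of_int (k i) * (2 * pi * r i)) + \<theta>"
 proof -
  have "(\<Sum>i\<in>A. of_int (k i) * \<theta>) = of_int (\<Sum>i\<in>A. k i) * \<theta>" by (simp add: sum_distrib_right)
  then show ?thesis by (simp add: sum_subtractf k)
 qed
 also have "cis \<dots> = (\<Prod>i\<in>A. 1 + turn \<rho> (k i) (w * cis (- \<phi> i))) * sgn w"
  unfolding tn cis_sum[OF A, symmetric] sw by (rule cis_mult[symmetric])
 finally have "of_real (norm w) * cis (\<Sum>i\<in>A. of_int (k i) * (chi \<rho> (w * cis (- \<phi> i)) - \<phi> i)) = (\<Prod>i\<in>A. 1 + turn \<rho> (k i) (w * cis (- \<phi> i))) * (of_real (norm w) * sgn w)"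
  by (simp add: ac_simps)
 also have "of_real (norm w) * sgn w = w" using w0 by (simp add: sgn_div_norm scaleR_conv_of_real)
 finally show ?thesis by (simp add: ac_simps)
qed

section \<open>Extending a map of total degree zero without zeros\<close>

definition gs2 :: "'v::real_inner => 'v => 'v" where
 "gs2 p u = sgn (u - inner u (sgn p) *\<^sub>R sgn p)"

lemma gs_onp:
 assumes "\<And>a b. a *\<^sub>R p + b *\<^sub>R u = 0 ==> a = 0 \<and> b = 0"
 shows "p ~= 0" "u - inner u (sgn p) *\<^sub>R sgn p ~= 0" "onp (sgn p) (gs2 p u)"
proof -
 show p: "p ~= 0" using assms[of 1 0] by auto
 have "u - inner u (sgn p) *\<^sub>R sgn p = (- inner u (sgn p) / norm p) *\<^sub>R p + 1 *\<^sub>R u" by (simp add: sgn_div_norm divide_inverse)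
 then show n: "u - inner u (sgn p) *\<^sub>R sgn p ~= 0" using assms[of "- inner u (sgn p) / norm p" 1] by auto
 have 1: "inner (sgn p) (sgn p) = 1" using p by (simp add: norm_eq_1[symmetric] norm_sgn)
 have "inner (sgn p) (u - inner u (sgn p) *\<^sub>R sgn p) = 0" by (simp add: inner_diff_right 1 inner_commute)
 then show "onp (sgn p) (gs2 p u)" using p n by (simp add: onp_def gs2_def norm_sgn) (simp add: sgn_div_norm)
qed

lemma gs_id: "onp e f ==> sgn e = e \<and> gs2 e f = f"
 by (simp add: onp_def gs2_def sgn_div_norm inner_commute)

lemma sgn_scale_eq: "p ~= 0 ==> p' ~= 0 ==> sgn p = sgn (p' :: 'v::real_inner) ==> \<exists>l>0. p = l *\<^sub>R p'"
proof -
 assume a: "p ~= 0" "p' ~= 0" "sgn p = sgn p'"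
 have "p = norm p *\<^sub>R sgn p" using a(1) by (simp add: sgn_div_norm)
 also have "\<dots> = norm p *\<^sub>R sgn p'" by (simp only: a(3))
 also have "\<dots> = (norm p / norm p') *\<^sub>R p'" by (simp add: sgn_div_norm divide_inverse)
 finally show ?thesis using a by (intro exI[of _ "norm p / norm p'"]) auto
qed

text \<open>Three homotopies through maps without zeros far out: turn all tubes into one common
  plane; there, unwind the angle, which is globally defined because the k i sum to - 1; push the
  result to a constant. Run through along the radius, they fill the ball.\<close>

theorem cap_filling:
 fixes p u :: "'i => 'v::real_inner" and k :: "'i => int"
 assumes A: "finite A" and k: "(\<Sum>i\<in>A. k i) = -1" and \<rho>: "\<rho> > 0"
  and o: "\<And>i. i \<in> A ==> onp (p i) (u i)" and inj: "inj_on p A"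
  and V: "subspace V" "\<And>i. i \<in> A ==> p i \<in> V" "\<And>i. i \<in> A ==> u i \<in> V" "E \<in> V" "G \<in> V"
  and EG: "onp E G"
  and gen: "\<And>i x y a b. i \<in> A ==> x *\<^sub>R E + y *\<^sub>R G = a *\<^sub>R p i + b *\<^sub>R u i ==> x = 0 \<and> y = 0"
   "\<And>i j x y a b. i \<in> A ==> j \<in> A ==> x *\<^sub>R E + y *\<^sub>R G = a *\<^sub>R p i + b *\<^sub>R p j ==> x = 0 \<and> y = 0"
 obtains F R where "continuous_on UNIV F" "\<And>z. F z ~= 0" "\<And>z. z \<in> V ==> F z \<in> V" "R > 0"
  "\<And>z. norm z >= R ==> F z = z + (\<Sum>i\<in>A. cap \<rho> (k i) (p i) (u i) z)"
  "\<And>z i j. norm z >= R ==> i \<in> A ==> j \<in> A ==> cap \<rho> (k i) (p i) (u i) z ~= 0 ==> cap \<rho> (k j) (p j) (u j) z ~= 0 ==> i = j"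
proof -
 \<comment> \<open>Distinct angles between 0 and \<pi>, where the cosine is injective: they keep the
   rays apart after the move into the plane.\<close>
 define \<phi> where "\<phi> i = 1 / (1 + real (to_nat_on A i))" for i
 have phi: "0 <= \<phi> i" "\<phi> i <= pi" for i
 proof -
  have "\<phi> i <= 1" by (simp add: \<phi>_def)
  then show "\<phi> i <= pi" using pi_gt3 by linarith
 qed (simp add: \<phi>_def)
 have phi_inj: "i = j" if "i \<in> A" "j \<in> A" "\<phi> i = \<phi> j" for i j
  using that inj_on_to_nat_on[OF countable_finite[OF A]] by (auto simp: \<phi>_def inj_on_def)
 define m where "m i = cos (\<phi> i) *\<^sub>R E + sin (\<phi> i) *\<^sub>R G" for i
 define v where "v i = (- sin (\<phi> i)) *\<^sub>R E + cos (\<phi> i) *\<^sub>R G" for i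
 note EGi = onp_inner[OF EG]
 have mv: "onp (m i) (v i)" for i
  unfolding onp_def norm_eq_1 m_def v_def
  by (simp add: inner_add_left inner_add_right inner_diff_left inner_diff_right EGi power2_eq_square[symmetric])
 have mE: "inner E (m i) = cos (\<phi> i)" for i by (simp add: m_def inner_add_right EGi)
 define P where "P s i = (1 - s) *\<^sub>R p i + s *\<^sub>R m i" for s i
 define Q where "Q s i = (1 - s) *\<^sub>R u i + s *\<^sub>R v i" for s i
 have pu0: "a = 0 \<and> b = 0" if i: "i \<in> A" and e: "a *\<^sub>R p i + b *\<^sub>R u i = 0" for i a b
 proof -
  have "inner (p i) (a *\<^sub>R p i + b *\<^sub>R u i) = 0" "inner (u i) (a *\<^sub>R p i + b *\<^sub>R u i) = 0" by (simp_all add: e)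
  then show ?thesis by (simp add: inner_add_right onp_inner[OF o[OF i]])
 qed
 have EG0: "a = 0 \<and> b = 0" if e: "a *\<^sub>R E + b *\<^sub>R G = 0" for a b
 proof -
  have "inner E (a *\<^sub>R E + b *\<^sub>R G) = 0" "inner G (a *\<^sub>R E + b *\<^sub>R G) = 0" by (simp_all add: e)
  then show ?thesis by (simp add: inner_add_right EGi)
 qed
 have mv0: "a = 0 \<and> b = 0" if e: "a *\<^sub>R m i + b *\<^sub>R v i = 0" for i a b
 proof -
  have "inner (m i) (a *\<^sub>R m i + b *\<^sub>R v i) = 0" "inner (v i) (a *\<^sub>R m i + b *\<^sub>R v i) = 0" by (simp_all add: e)
  then show ?thesis by (simp add: inner_add_right onp_inner[OF mv])
 qed
 \<comment> \<open>The moving frame never degenerates because the plane of E and G meets the span of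
   p i and u i only in 0. In \<open>distP\<close> the same fact for p i and p j keeps different rays
   apart.\<close>
 have ind: "a = 0 \<and> b = 0" if i: "i \<in> A" and e: "a *\<^sub>R P s i + b *\<^sub>R Q s i = 0" for a b s i
 proof -
  have "(a * s * cos (\<phi> i) - b * s * sin (\<phi> i)) *\<^sub>R E + (a * s * sin (\<phi> i) + b * s * cos (\<phi> i)) *\<^sub>R G =
   (- (a * (1 - s))) *\<^sub>R p i + (- (b * (1 - s))) *\<^sub>R u i"
   using e unfolding P_def Q_def m_def v_def by (simp add: algebra_simps add_eq_0_iff)
  then have z: "a * s * cos (\<phi> i) - b * s * sin (\<phi> i) = 0 \<and> a * s * sin (\<phi> i) + b * s * cos (\<phi> i) = 0" by (rule gen(1)[OF i])
  have "(a * s) *\<^sub>R m i + (b * s) *\<^sub>R v i = (a * s * cos (\<phi> i) - b * s * sin (\<phi> i)) *\<^sub>R E + (a * s * sin (\<phi> i) + b * s * cos (\<phi> i)) *\<^sub>R G"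
   unfolding m_def v_def by (simp add: algebra_simps)
  then have eq: "(a * s) *\<^sub>R m i + (b * s) *\<^sub>R v i = 0" unfolding conjunct1[OF z] conjunct2[OF z] by simp
  have as: "a * s = 0 \<and> b * s = 0" by (rule mv0[OF eq])
  have "(a * (1 - s)) *\<^sub>R p i + (b * (1 - s)) *\<^sub>R u i + ((a * s) *\<^sub>R m i + (b * s) *\<^sub>R v i) = 0"
   using e unfolding P_def Q_def by (simp add: algebra_simps)
  then have "(a * (1 - s)) *\<^sub>R p i + (b * (1 - s)) *\<^sub>R u i = 0" unfolding eq by simp
  from pu0[OF i this] as show ?thesis by (auto simp: algebra_simps)
 qed
 have gs: "P s i ~= 0" "Q s i - inner (Q s i) (sgn (P s i)) *\<^sub>R sgn (P s i) ~= 0" "onp (sgn (P s i)) (gs2 (P s i) (Q s i))" if "i \<in> A" for s i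
  using gs_onp[of "P s i" "Q s i", OF ind[OF that, of _ s]] by blast+
 have distP: "sgn (P s i) ~= sgn (P s j)" if ij: "i \<in> A" "j \<in> A" "i ~= j" for s i j
 proof
  assume "sgn (P s i) = sgn (P s j)"
  then obtain l where l: "l > 0" "P s i = l *\<^sub>R P s j" using sgn_scale_eq[OF gs(1)[OF ij(1)] gs(1)[OF ij(2)]] by blast
  then have "(s * cos (\<phi> i) - l * s * cos (\<phi> j)) *\<^sub>R E + (s * sin (\<phi> i) - l * s * sin (\<phi> j)) *\<^sub>R G = (- (1 - s)) *\<^sub>R p i + (l * (1 - s)) *\<^sub>R p j"
   unfolding P_def m_def by (simp add: algebra_simps)
  then have z: "s * cos (\<phi> i) - l * s * cos (\<phi> j) = 0 \<and> s * sin (\<phi> i) - l * s * sin (\<phi> j) = 0" by (rule gen(2)[OF ij(1,2)])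
  have "s *\<^sub>R m i - (l * s) *\<^sub>R m j = (s * cos (\<phi> i) - l * s * cos (\<phi> j)) *\<^sub>R E + (s * sin (\<phi> i) - l * s * sin (\<phi> j)) *\<^sub>R G"
   unfolding m_def by (simp add: algebra_simps)
  then have sm: "s *\<^sub>R m i = (l * s) *\<^sub>R m j" unfolding conjunct1[OF z] conjunct2[OF z] by simp
  have nm: "norm (m i) = 1" for i using mv[of i] by (simp add: onp_def)
  show False
  proof (cases "s = 0")
   case True
   then have e: "p i = l *\<^sub>R p j" using l(2) by (simp add: P_def)
   have "norm (p i) = 1" "norm (p j) = 1" using o ij by (auto simp: onp_def)
   then have "l = 1" using arg_cong[OF e, of norm] l(1) by simp
   then show False using e inj ij by (auto simp: inj_on_def)
  next
   case False
   then have e: "m i = l *\<^sub>R m j" using sm by (metis scaleR_cancel_left scaleR_scaleR mult.commute)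
   have "norm (m i) = \<bar>l\<bar> * norm (m j)" unfolding e by simp
   then have "l = 1" using l(1) nm by simp
   then have "cos (\<phi> i) = cos (\<phi> j)" using e mE by (metis scaleR_one)
   then have "\<phi> i = \<phi> j" using cos_inj_pi[of "\<phi> i" "\<phi> j"] phi by blast
   then show False using phi_inj ij by blast
  qed
 qed
 have cP: "continuous_on S (%x. P (s x) i)" "continuous_on S (%x. Q (s x) i)" if "continuous_on S s" for S :: "'w::topological_space set" and s i
  unfolding P_def Q_def using that by (intro continuous_intros; assumption)+
 have csg: "continuous_on S (%x. sgn (P (s x) i))" if "continuous_on S s" "i \<in> A" for S :: "'w::topological_space set" and s i
  using gs(1)[OF that(2)] by (intro continuous_on_sgn cP that) auto
 have cgs: "continuous_on S (%x. gs2 (P (s x) i) (Q (s x) i))" if "continuous_on S s" "i \<in> A" for S :: "'w::topological_space set" and s i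
  unfolding gs2_def using gs(2)[OF that(2)] by (intro continuous_on_sgn continuous_intros cP csg that) auto
 have "\<forall>x\<in>A \<times> A. \<exists>e>0. fst x ~= snd x --> (\<forall>s\<in>{0..1}. e <= norm (sgn (P s (fst x)) - sgn (P s (snd x))))"
 proof
  fix x assume x: "x \<in> A \<times> A"
  have "continuous_on {0..1} (%s. norm (sgn (P s (fst x)) - sgn (P s (snd x))))"
   using x by (intro continuous_intros csg) auto
  then obtain s0 where s0: "\<forall>s\<in>{0..1}. norm (sgn (P s0 (fst x)) - sgn (P s0 (snd x))) <= norm (sgn (P s (fst x)) - sgn (P s (snd x)))"
   using continuous_attains_inf[of "{0..1::real}"] by auto
  show "\<exists>e>0. fst x ~= snd x --> (\<forall>s\<in>{0..1}. e <= norm (sgn (P s (fst x)) - sgn (P s (snd x))))"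
  proof (cases "fst x = snd x")
   case True
   then show ?thesis by (intro exI[of _ 1]) simp
  next
   case False
   then have "norm (sgn (P s0 (fst x)) - sgn (P s0 (snd x))) > 0" using distP[of "fst x" "snd x" s0] x by auto
   then show ?thesis using s0 by blast
  qed
 qed
 from bchoice[OF this] obtain \<epsilon> where eps: "\<forall>x\<in>A \<times> A. 0 < \<epsilon> x \<and> (fst x ~= snd x --> (\<forall>s\<in>{0..1}. \<epsilon> x <= norm (sgn (P s (fst x)) - sgn (P s (snd x)))))" ..
 define e0 where "e0 = Min (insert 1 (\<epsilon> ` (A \<times> A)))"
 have e0: "e0 > 0" unfolding e0_def using A eps by (subst Min_gr_iff) auto
 have e0le: "e0 <= norm (sgn (P s i) - sgn (P s j))" if "i \<in> A" "j \<in> A" "i ~= j" "0 <= s" "s <= 1" for i j s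
 proof -
  have "e0 <= \<epsilon> (i, j)" unfolding e0_def using A that by (intro Min_le) auto
  also have "\<dots> <= norm (sgn (P s i) - sgn (P s j))" using eps that by fastforce
  finally show ?thesis .
 qed
 \<comment> \<open>Since e0 bounds the distance of any two ray directions from below at all times s,
   \<open>cap_unique\<close> makes the tubes disjoint beyond this radius during the whole
   motion.\<close>
 define R where "R = 2 * \<rho> + 2 + 8 * \<rho> / e0"
 have "8 * \<rho> / e0 > 0" using \<rho> e0 by simp
 then have R: "R >= 2 * \<rho> + 2" "R > 0" using \<rho> unfolding R_def by linarith+
 have "(R - 2 * \<rho>) * e0 = 2 * e0 + 8 * \<rho>" using e0 by (simp add: R_def field_simps)
 then have R2: "(R - 2 * \<rho>) * e0 >= 8 * \<rho>" using e0 by simp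
 define C where "C s i z = cap \<rho> (k i) (sgn (P s i)) (gs2 (P s i) (Q s i)) z" for s i z
 have uniq: "i = j" if z: "norm z >= R" and s: "0 <= s" "s <= 1" and ij: "i \<in> A" "j \<in> A" "C s i z ~= 0" "C s j z ~= 0" for s i j z
 proof (rule ccontr)
  assume ne: "i ~= j"
  have "(norm z - 2 * \<rho>) * norm (sgn (P s i) - sgn (P s j)) < 8 * \<rho>"
   by (rule cap_unique[OF gs(3)[OF ij(1)] gs(3)[OF ij(2)] \<rho> ij(3,4)[unfolded C_def]])
  moreover have "(R - 2 * \<rho>) * e0 <= (norm z - 2 * \<rho>) * norm (sgn (P s i) - sgn (P s j))"
   using z e0le[OF ij(1,2) ne s] e0 R \<rho> by (intro mult_mono) auto
  ultimately show False using R2 by linarith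
 qed
 define H1 where "H1 s z = z + (\<Sum>i\<in>A. C s i z)" for s z
 have H1nz: "H1 s z ~= 0" if z: "norm z >= R" and s: "0 <= s" "s <= 1" for s z
 proof (cases "\<exists>i\<in>A. C s i z ~= 0")
  case True
  then obtain i where i: "i \<in> A" "C s i z ~= 0" by blast
  have "(\<Sum>j\<in>A. C s j z) = (\<Sum>j\<in>{i}. C s j z)"
   using A i uniq[OF z s] by (intro sum.mono_neutral_right) auto
  then have "H1 s z = z + C s i z" by (simp add: H1_def)
  then show ?thesis unfolding C_def using cap_nonzero[where k = "k i", OF gs(3)[OF i(1)] \<rho>, of z] z R \<rho> by simp
 next
  case False
  then have "H1 s z = z" by (simp add: H1_def)
  then show ?thesis using z R by auto
 qed
 have H10: "H1 0 z = z + (\<Sum>i\<in>A. cap \<rho> (k i) (p i) (u i) z)" "i \<in> A ==> C 0 i z = cap \<rho> (k i) (p i) (u i) z" for z i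
  using gs_id[OF o] by (simp_all add: H1_def C_def P_def Q_def)
 have H1c: "continuous_on S (%z. H1 (s z) z)" if "continuous_on S s" for S s
  unfolding H1_def C_def using that \<rho> by (intro continuous_intros csg cgs) auto
 have EGV: "emb E G c \<in> V" for c using V by (simp add: emb_def subspace_add subspace_scale)
 have mV: "m i \<in> V" "v i \<in> V" for i
  using V unfolding m_def v_def by (simp_all only: subspace_add subspace_scale)
 have H1V: "H1 s z \<in> V" if z: "z \<in> V" for s z
 proof -
  have PQ: "P s i \<in> V" "Q s i \<in> V" if "i \<in> A" for i
   using V(1) V(2)[OF that] V(3)[OF that] mV unfolding P_def Q_def by (simp_all only: subspace_add subspace_scale)
  then have "sgn (P s i) \<in> V" "gs2 (P s i) (Q s i) \<in> V" if "i \<in> A" for i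
   using PQ[OF that] V(1) unfolding gs2_def sgn_div_norm by (auto intro!: subspace_scale subspace_diff)
  then show ?thesis unfolding H1_def C_def cap_def emb_def using V(1) z by (auto intro!: subspace_add subspace_sum subspace_scale)
 qed
 define y where "y z = z - emb E G (plc E G z)" for z
 define \<mu> where "\<mu> z = damp \<rho> E G z" for z
 define w where "w z = plc E G z" for z
 define X where "X z = (\<Sum>i\<in>A. of_int (k i) * (chi \<rho> (w z * cis (- \<phi> i)) - \<phi> i))" for z
 have m1: "sgn (P 1 i) = m i" "gs2 (P 1 i) (Q 1 i) = v i" for i using gs_id[OF mv] by (simp_all add: P_def Q_def)
 have rot: "emb (m i) (v i) c = emb E G (c * cis (\<phi> i))" "plc (m i) (v i) z = w z * cis (- \<phi> i)" for i c z
  by (simp_all add: emb_def plc_def w_def m_def v_def complex_eq_iff inner_add_left algebra_simps)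
 have rot': "emb (m i) (v i) (plc (m i) (v i) z) = emb E G (w z)" for i z
  unfolding rot by (simp add: mult.assoc cis_mult)
 have C1: "C 1 i z = emb E G (of_real (\<mu> z) * (turn \<rho> (k i) (w z * cis (- \<phi> i)) * w z))" for i z
 proof -
  have "damp \<rho> (m i) (v i) z = \<mu> z" unfolding damp_def rot' \<mu>_def w_def by simp
  moreover have "emb (m i) (v i) (turn \<rho> (k i) (w z * cis (- \<phi> i)) * (w z * cis (- \<phi> i))) = emb E G (turn \<rho> (k i) (w z * cis (- \<phi> i)) * w z)"
   unfolding rot(1) by (simp add: mult.assoc cis_mult)
  ultimately show ?thesis unfolding C_def m1 cap_def rot(2) by (simp only: emb_scale)
 qed
 have wbig: "norm (w z) >= \<rho> + 1" if "norm z >= R" "norm (y z) <= \<rho>" for z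
 proof -
  have "z = y z + emb E G (w z)" by (simp add: y_def w_def)
  then have "norm z <= norm (y z) + norm (w z)" using norm_triangle_ineq[of "y z" "emb E G (w z)"] norm_emb[OF EG] by simp
  then show ?thesis using that R by linarith
 qed
 have mu1: "\<mu> z = 0" if "norm (y z) >= \<rho>" for z using that \<rho> by (simp add: \<mu>_def damp_def y_def field_simps)
 have H11: "H1 1 z = y z + emb E G (of_real (1 - \<mu> z) * w z + of_real (\<mu> z) * (of_real (norm (w z)) * cis (X z)))"
  if z: "norm z >= R" and y: "norm (y z) < \<rho>" for z
 proof -
  have mu: "\<mu> z > 0" using y \<rho> by (simp add: \<mu>_def damp_def y_def)
  have wn: "norm (w z) >= \<rho> + 1" using wbig z y by simp
  then have w0: "w z ~= 0" using \<rho> by auto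
  let ?t = "%i. turn \<rho> (k i) (w z * cis (- \<phi> i))"
  have one: "i = j" if "i \<in> A" "j \<in> A" "?t i ~= 0" "?t j ~= 0" for i j
  proof (rule uniq[OF z _ _ that(1,2)])
   have "C 1 i z ~= 0" if "?t i ~= 0" for i
   proof
    assume "C 1 i z = 0"
    then have "of_real (\<mu> z) * (?t i * w z) = 0" unfolding C1 by (rule emb_eq_0[OF EG])
    then show False using mu w0 that by simp
   qed
   then show "C 1 i z ~= 0" "C 1 j z ~= 0" using that by blast+
  qed simp_all
  \<comment> \<open>At most one rotation is nontrivial at z, so the product in
    \<open>degree_zero_angle\<close> equals the sum by which H1 is defined.\<close>
  have pr: "(\<Prod>i\<in>A. 1 + ?t i) = 1 + (\<Sum>i\<in>A. ?t i)"
  proof (cases "\<exists>i\<in>A. ?t i ~= 0")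
   case True
   then obtain i where i: "i \<in> A" "?t i ~= 0" by blast
   have "(\<Prod>j\<in>A. 1 + ?t j) = (\<Prod>j\<in>{i}. 1 + ?t j)" using A i one by (intro prod.mono_neutral_right) auto
   moreover have "(\<Sum>j\<in>A. ?t j) = (\<Sum>j\<in>{i}. ?t j)" using A i one by (intro sum.mono_neutral_right) auto
   ultimately show ?thesis by simp
  qed (simp add: sum.neutral)
  have "H1 1 z = y z + emb E G (w z + (\<Sum>i\<in>A. of_real (\<mu> z) * (?t i * w z)))"
   unfolding H1_def C1 emb_add emb_sum by (simp add: y_def w_def)
  also have "w z + (\<Sum>i\<in>A. of_real (\<mu> z) * (?t i * w z)) = of_real (1 - \<mu> z) * w z + of_real (\<mu> z) * (w z * (1 + (\<Sum>i\<in>A. ?t i)))"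
   by (simp add: sum_distrib_left sum_distrib_right algebra_simps)
  also have "w z * (1 + (\<Sum>i\<in>A. ?t i)) = of_real (norm (w z)) * cis (X z)"
   unfolding pr[symmetric] X_def by (rule degree_zero_angle[OF A k \<rho> wn])
  finally show ?thesis .
 qed
 \<comment> \<open>Only the angle X is scaled down. At r = 1 the rotated part has become the
   positive real \<open>norm (w z)\<close>, still blended with the identity away from the
   plane.\<close>
 define H2 where "H2 r z = y z + emb E G (of_real (1 - \<mu> z) * w z + of_real (\<mu> z) * (of_real (norm (w z)) * cis ((1 - r) * X z)))" for r z
 have H20: "H2 0 z = H1 1 z" if z: "norm z >= R" for z
 proof (cases "norm (y z) < \<rho>")
  case True
  then show ?thesis using H11[OF z True] by (simp add: H2_def)
 next
  case False
  have mu: "\<mu> z = 0" using mu1 False by simp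
  have "C 1 i z = 0" for i unfolding C1 mu by (simp add: emb_def)
  then show ?thesis using mu by (simp add: H1_def H2_def y_def w_def)
 qed
 have H2nz: "H2 r z ~= 0" if z: "norm z >= R" for r z
 proof
  assume "H2 r z = 0"
  note s = split_eq_0[OF EG this[unfolded H2_def y_def]]
  have "\<mu> z = 1" unfolding \<mu>_def by (rule damp_on[OF s(2)])
  then have "norm (w z) = 0" using s(1) by simp
  moreover have "norm z = norm (w z)" using s(2) norm_emb[OF EG, of "w z"] by (simp add: w_def)
  ultimately show False using z R by simp
 qed
 have cy: "continuous_on S y" "continuous_on S \<mu>" "continuous_on S w" for S
  unfolding y_def \<mu>_def w_def using \<rho> by (intro continuous_intros; simp)+
 have H2c: "continuous_on S (%z. H2 (r z) z)" if S: "S \<subseteq> {z. norm z >= R}" and r: "continuous_on S r" for S r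
 proof -
  \<comment> \<open>\<open>chi\<close> is continuous only away from 0, and w z is known to be large
    only near the plane; farther from it H2 is the identity, and the two closed parts are
    glued.\<close>
  have "continuous_on S (%z. if norm (y z) <= \<rho> then H2 (r z) z else z)"
  proof (rule continuous_on_cases_le)
   have X: "continuous_on {z \<in> S. norm (y z) <= \<rho>} X" unfolding X_def
   proof (intro continuous_intros continuous_on_compose2[OF continuous_on_chi[OF \<rho>]] cy)
    fix i show "(%z. w z * cis (- \<phi> i)) ` {z \<in> S. norm (y z) <= \<rho>} \<subseteq> {w. \<rho> <= norm w}"
     using wbig S by (auto simp: norm_mult) (smt (verit) mem_Collect_eq subsetD)
   qed
   show "continuous_on {z \<in> S. norm (y z) <= \<rho>} (%z. H2 (r z) z)"
    unfolding H2_def by (intro continuous_intros cy X continuous_on_subset[OF r]) auto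
   show "continuous_on S (%z. norm (y z))" by (intro continuous_intros cy)
   fix z assume "z \<in> S" "norm (y z) = \<rho>"
   then show "H2 (r z) z = z" using mu1[of z] by (simp add: H2_def y_def w_def)
  qed (intro continuous_intros)
  moreover have "(if norm (y z) <= \<rho> then H2 (r z) z else z) = H2 (r z) z" for z
   using mu1[of z] by (simp add: H2_def y_def w_def)
  ultimately show ?thesis by simp
 qed
 have zy: "y z \<in> V" if "z \<in> V" for z using that V(1) EGV unfolding y_def by (intro subspace_diff)
 have H2V: "H2 r z \<in> V" if "z \<in> V" for r z unfolding H2_def using V(1) zy[OF that] EGV by (intro subspace_add)
 \<comment> \<open>In the plane the map is a positive multiple of E, so moving towards R times E
   cannot produce a zero.\<close>
 define H3 where "H3 r z = (1 - r) *\<^sub>R H2 1 z + r *\<^sub>R (R *\<^sub>R E)" for r z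
 have H3nz: "H3 r z ~= 0" if z: "norm z >= R" and r: "0 <= r" "r <= 1" for r z
 proof
  assume e: "H3 r z = 0"
  show False
  proof (cases "r = 1")
   case True
   then show False using e R EG by (auto simp: H3_def onp_def)
  next
   case False
   have "emb E G (of_real (r / (1 - r) * R)) = (r / (1 - r) * R) *\<^sub>R E" by (simp add: emb_def)
   then have "H2 1 z + emb E G (of_real (r / (1 - r) * R)) = (1 / (1 - r)) *\<^sub>R H3 r z"
    using False by (simp add: H3_def scaleR_add_right)
   then have "H2 1 z + emb E G (of_real (r / (1 - r) * R)) = 0" by (simp add: e)
   then have "y z + emb E G (of_real (1 - \<mu> z) * w z + of_real (\<mu> z) * of_real (norm (w z)) + of_real (r / (1 - r) * R)) = 0"
    unfolding H2_def emb_add by (simp add: add.assoc)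
   note s = split_eq_0[OF EG this[unfolded y_def]]
   have "\<mu> z = 1" unfolding \<mu>_def by (rule damp_on[OF s(2)])
   then have "of_real (norm (w z) + r / (1 - r) * R) = (0 :: complex)" using s(1) by simp
   then have "norm (w z) + r / (1 - r) * R = 0" by (simp only: of_real_eq_0_iff)
   moreover have "norm z = norm (w z)" using s(2) norm_emb[OF EG, of "w z"] by (simp add: w_def)
   moreover have "r / (1 - r) * R >= 0" using r R by simp
   ultimately show False using z R by linarith
  qed
 qed
 have H3V: "H3 r z \<in> V" if "z \<in> V" for r z unfolding H3_def using V H2V[OF that] by (intro subspace_add subspace_scale)
 \<comment> \<open>Constant on a ball, then the homotopies in reverse order on three shells of width
   R, each parameter falling from 1 at the inner to 0 at the outer radius.\<close>
 define F where "F z = (if norm z <= R then R *\<^sub>R E else if norm z <= 2 * R then H3 ((2 * R - norm z) / R) z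
  else if norm z <= 3 * R then H2 ((3 * R - norm z) / R) z else H1 (max 0 ((4 * R - norm z) / R)) z)" for z
 show thesis
 proof (rule that[of F "4 * R"])
  show "continuous_on UNIV F" unfolding F_def
  proof (intro continuous_on_cases_le)
   show "continuous_on {x \<in> {x \<in> {x \<in> UNIV. R <= norm x}. 2 * R <= norm x}. norm x <= 3 * R} (%x. H2 ((3 * R - norm x) / R) x)"
    using R by (intro H2c continuous_intros) auto
   show "continuous_on {x \<in> {x \<in> UNIV. R <= norm x}. norm x <= 2 * R} (%x. H3 ((2 * R - norm x) / R) x)"
    unfolding H3_def using R by (intro H2c continuous_intros) auto
   show "continuous_on {x \<in> {x \<in> {x \<in> UNIV. R <= norm x}. 2 * R <= norm x}. 3 * R <= norm x} (%x. H1 (max 0 ((4 * R - norm x) / R)) x)"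
    using R by (intro H1c continuous_intros) auto
  qed (use R H20 in \<open>auto intro!: continuous_intros simp: H3_def\<close>)
  show "F z ~= 0" for z
  proof -
   have E0: "E ~= 0" using EG by (auto simp: onp_def)
   consider "norm z <= R" | "R < norm z" "norm z <= 2 * R" | "2 * R < norm z" "norm z <= 3 * R" | "3 * R < norm z" by linarith
   then show ?thesis
   proof cases
    case 1
    then show ?thesis using R E0 by (simp add: F_def)
   next
    case 2
    then show ?thesis using H3nz[of z "(2 * R - norm z) / R"] R by (simp add: F_def field_simps)
   next
    case 3
    then show ?thesis using H2nz[of z] R by (simp add: F_def)
   next
    case 4
    then show ?thesis using H1nz[of z "max 0 ((4 * R - norm z) / R)"] R by (simp add: F_def field_simps)
   qed
  qed
  show "F z \<in> V" if "z \<in> V" for z unfolding F_def using H1V H2V H3V that V by (simp add: subspace_scale)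
  show "4 * R > 0" using R by simp
  show "F z = z + (\<Sum>i\<in>A. cap \<rho> (k i) (p i) (u i) z)" if "4 * R <= norm z" for z
  proof -
   have "max 0 ((4 * R - norm z) / R) = 0" using that R by (simp add: field_simps)
   then show ?thesis using that R H10(1)[of z] by (simp add: F_def)
  qed
  show "i = j" if "4 * R <= norm z" "i \<in> A" "j \<in> A" "cap \<rho> (k i) (p i) (u i) z ~= 0" "cap \<rho> (k j) (p j) (u j) z ~= 0" for z i j
   using uniq[of z 0 i j] that R by (simp add: H10(2))
 qed
qed

section \<open>Finitely supported vectors\<close>

text \<open>Suppose x avoids all subspaces but lies in the new one, U, and y lies outside U. The
  line y + t x misses U, and each earlier subspace contains at most one point of it because x is not
  in that subspace. So some t works.\<close>

lemma avoid_subspaces: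
 fixes V :: "'v::real_vector set"
 assumes "finite \<U>" "subspace V" "\<And>U. U \<in> \<U> ==> subspace U \<and> \<not> V \<subseteq> U"
 shows "\<exists>x\<in>V. \<forall>U\<in>\<U>. x \<notin> U"
 using assms(1,3)
proof (induction \<U> rule: finite_induct)
 case empty
 then show ?case using subspace_0[OF assms(2)] by auto
next
 case (insert U \<U>)
 then obtain x where x: "x \<in> V" "\<forall>W\<in>\<U>. x \<notin> W" by auto
 show ?case
 proof (cases "x \<in> U")
  case False
  then show ?thesis using x by blast
 next
  case True
  obtain y where y: "y \<in> V" "y \<notin> U" using insert.prems by blast
  have one: "t = t'" if W: "W \<in> \<U>" and t: "y + t *\<^sub>R x \<in> W" "y + t' *\<^sub>R x \<in> W" for W t t'
  proof (rule ccontr)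
   assume ne: "t ~= t'"
   have sW: "subspace W" using insert.prems W by blast
   have "(y + t *\<^sub>R x) - (y + t' *\<^sub>R x) \<in> W" by (rule subspace_diff[OF sW t])
   then have "(t - t') *\<^sub>R x \<in> W" by (simp add: scaleR_diff_left)
   then have "(1 / (t - t')) *\<^sub>R ((t - t') *\<^sub>R x) \<in> W" by (rule subspace_scale[OF sW])
   then show False using ne x(2) W by simp
  qed
  have "finite (\<Union>W\<in>\<U>. {t. y + t *\<^sub>R x \<in> W})"
  proof (intro finite_UN_I insert.hyps)
   fix W assume W: "W \<in> \<U>"
   show "finite {t. y + t *\<^sub>R x \<in> W}"
   proof (cases "\<exists>t. y + t *\<^sub>R x \<in> W")
    case True
    then obtain t where "y + t *\<^sub>R x \<in> W" by blast
    then have "{t. y + t *\<^sub>R x \<in> W} \<subseteq> {t}" using one[OF W] by blast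
    then show ?thesis by (rule finite_subset) simp
   qed simp
  qed
  then obtain t where t: "t \<notin> (\<Union>W\<in>\<U>. {t. y + t *\<^sub>R x \<in> W})" using ex_new_if_finite[OF infinite_UNIV_char_0] by blast
  have "y + t *\<^sub>R x \<notin> U"
  proof
   assume a: "y + t *\<^sub>R x \<in> U"
   have "subspace U" using insert.prems by blast
   then have "(y + t *\<^sub>R x) - t *\<^sub>R x \<in> U" using a True by (intro subspace_diff subspace_scale)
   then show False using y by simp
  qed
  moreover have "y + t *\<^sub>R x \<in> V" using assms(2) x y by (intro subspace_add subspace_scale)
  ultimately show ?thesis using t by blast
 qed
qed

text \<open>Choose m outside all \<open>span {a, b}\<close> and then v outside all
  \<open>span {a, b, m}\<close>. Three vectors cannot span V, so these are finitely many proper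
  subspaces to avoid, and orthonormalising does not change the plane.\<close>

lemma generic_plane:
 fixes V :: "'v::real_inner set"
 assumes V: "subspace V" and B: "B \<subseteq> V" "independent B" "finite B" "card B >= 4" and S: "finite S"
 obtains E G where "E \<in> V" "G \<in> V" "onp E G"
  "\<And>a b x y r s. (a, b) \<in> S ==> x *\<^sub>R E + y *\<^sub>R G = r *\<^sub>R a + s *\<^sub>R b ==> x = 0 \<and> y = 0"
proof -
 define S' where "S' = insert (0, 0) S"
 have fS: "finite S'" using S by (simp add: S'_def)
 have big: "\<not> V \<subseteq> span T" if T: "finite T" "card T <= 3" for T
 proof
  assume "V \<subseteq> span T"
  then have "card B <= card T" using independent_span_bound[OF T(1) B(2)] B(1) by blast
  then show False using T B by simp
 qed
 have card3: "card {a, b, c} <= 3" for a b c :: 'v using card_length[of "[a, b, c]"] by simp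
 obtain m where m: "m \<in> V" "\<And>a b. (a, b) \<in> S' ==> m \<notin> span {a, b}"
 proof -
  have "\<exists>x\<in>V. \<forall>U\<in>(%(a, b). span {a, b}) ` S'. x \<notin> U"
  proof (rule avoid_subspaces[OF _ V])
   fix U assume "U \<in> (%(a, b). span {a, b}) ` S'"
   then obtain a b where U: "U = span {a, b}" by auto
   show "subspace U \<and> \<not> V \<subseteq> U" unfolding U using big[of "{a, b}"] card3[of a b b] by (simp add: insert_commute)
  qed (use fS in simp)
  then show ?thesis using that by fastforce
 qed
 obtain v where v: "v \<in> V" "\<And>a b. (a, b) \<in> S' ==> v \<notin> span {a, b, m}"
 proof -
  have "\<exists>x\<in>V. \<forall>U\<in>(%(a, b). span {a, b, m}) ` S'. x \<notin> U"
  proof (rule avoid_subspaces[OF _ V])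
   fix U assume "U \<in> (%(a, b). span {a, b, m}) ` S'"
   then obtain a b where U: "U = span {a, b, m}" by auto
   show "subspace U \<and> \<not> V \<subseteq> U" unfolding U using big[of "{a, b, m}"] card3[of a b m] by simp
  qed (use fS in simp)
  then show ?thesis using that by fastforce
 qed
 have main: "x = 0 \<and> y = 0" if ab: "(a, b) \<in> S'" and e: "x *\<^sub>R m + y *\<^sub>R v = r *\<^sub>R a + s *\<^sub>R b" for a b x y r s
 proof -
  have ra: "r *\<^sub>R a + s *\<^sub>R b \<in> span {a, b}" by (intro span_add span_scale) (auto intro: span_base)
  have y0: "y = 0"
  proof (rule ccontr)
   assume y: "y ~= 0"
   have "r *\<^sub>R a + s *\<^sub>R b \<in> span {a, b, m}" "m \<in> span {a, b, m}" using ra span_mono[of "{a, b}" "{a, b, m}"] by (auto intro: span_base)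
   then have "(1 / y) *\<^sub>R (r *\<^sub>R a + s *\<^sub>R b - x *\<^sub>R m) \<in> span {a, b, m}" by (intro span_scale span_diff)
   moreover have "r *\<^sub>R a + s *\<^sub>R b - x *\<^sub>R m = y *\<^sub>R v" using e by (simp add: algebra_simps)
   ultimately show False using v(2)[OF ab] y by simp
  qed
  have "x = 0"
  proof (rule ccontr)
   assume x: "x ~= 0"
   have "(1 / x) *\<^sub>R (r *\<^sub>R a + s *\<^sub>R b) \<in> span {a, b}" by (rule span_scale[OF ra])
   moreover have "r *\<^sub>R a + s *\<^sub>R b = x *\<^sub>R m" using e y0 by simp
   ultimately show False using m(2)[OF ab] x by simp
  qed
  then show ?thesis using y0 by simp
 qed
 have i0: "x = 0 \<and> y = 0" if "x *\<^sub>R m + y *\<^sub>R v = 0" for x y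
  by (rule main[of 0 0 x y 0 0]) (use that in \<open>simp_all add: S'_def\<close>)
 note g = gs_onp[of m v, OF i0]
 define c where "c = 1 / norm (v - inner v (sgn m) *\<^sub>R sgn m)"
 have c: "c ~= 0" using g(2) by (simp add: c_def)
 have G: "gs2 m v = c *\<^sub>R v - (c * inner v (sgn m) / norm m) *\<^sub>R m"
  unfolding gs2_def sgn_div_norm[of "v - _"] c_def[symmetric] using c_def
  by (simp add: sgn_div_norm[of m] divide_inverse scaleR_diff_right ac_simps)
 show thesis
 proof (rule that[of "sgn m" "gs2 m v"])
  show "sgn m \<in> V" using m V by (simp add: sgn_div_norm subspace_scale)
  show "gs2 m v \<in> V" unfolding G using m v V by (intro subspace_diff subspace_scale)
  show "onp (sgn m) (gs2 m v)" by (rule g(3))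
  fix a b x y r s assume ab: "(a, b) \<in> S" and e: "x *\<^sub>R sgn m + y *\<^sub>R gs2 m v = r *\<^sub>R a + s *\<^sub>R b"
  have "(x / norm m - y * (c * inner v (sgn m) / norm m)) *\<^sub>R m + (y * c) *\<^sub>R v = r *\<^sub>R a + s *\<^sub>R b"
   using e unfolding G by (simp add: sgn_div_norm[of m] divide_inverse algebra_simps)
  from main[OF _ this] have "x / norm m - y * (c * inner v (sgn m) / norm m) = 0 \<and> y * c = 0" using ab by (simp add: S'_def)
  then show "x = 0 \<and> y = 0" using c g(1) by auto
 qed
qed

lemma finite_supp_diff:
 fixes f g :: "'i => real"
 assumes "finite {i. f i ~= 0}" "finite {i. g i ~= 0}"
 shows "finite {i. f i + g i ~= 0}" "finite {i. f i - g i ~= 0}"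
 using assms by (auto intro: finite_subset[of _ "{i. f i ~= 0} \<union> {i. g i ~= 0}"])

text \<open>The test space depends on the terms d and rs. All of them embed as subspaces in this one
  real inner product space, to which the construction of caps applies.\<close>

typedef fsv = "{f :: nat list \<times> nat \<times> nat => real. finite {i. f i ~= 0}}"
 by (intro exI[of _ "%_. 0"]) simp

setup_lifting type_definition_fsv

lift_definition co :: "fsv => nat list \<times> nat \<times> nat => real" is "%f. f" .

lemma fsv_eqI: "(\<And>i. co x i = co y i) ==> x = y"
 by transfer auto

lemma finite_supp: "finite {i. co x i ~= 0}"
 by transfer

instantiation fsv :: real_inner
begin

lift_definition zero_fsv :: fsv is "%_. 0" by simp
lift_definition plus_fsv :: "fsv => fsv => fsv" is "%f g i. f i + g i"
 by (rule finite_supp_diff)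
lift_definition minus_fsv :: "fsv => fsv => fsv" is "%f g i. f i - g i"
 by (rule finite_supp_diff)
lift_definition uminus_fsv :: "fsv => fsv" is "%f i. - f i" by simp
lift_definition scaleR_fsv :: "real => fsv => fsv" is "%r f i. r * f i"
 by (rule finite_subset[of _ "{i. _ i ~= 0}"]) auto

definition inner_fsv :: "fsv => fsv => real" where "inner_fsv x y = (\<Sum>i\<in>{i. co x i ~= 0}. co x i * co y i)"
definition norm_fsv :: "fsv => real" where "norm_fsv x = sqrt (inner x x)"
definition sgn_fsv :: "fsv => fsv" where "sgn_fsv x = inverse (norm x) *\<^sub>R x"
definition dist_fsv :: "fsv => fsv => real" where "dist_fsv x y = norm (x - y)"
definition uniformity_fsv :: "(fsv \<times> fsv) filter" where "uniformity_fsv = (INF e\<in>{0 <..}. principal {(x, y). dist x y < e})"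
definition open_fsv :: "fsv set => bool" where "open_fsv U \<longleftrightarrow> (\<forall>x\<in>U. \<forall>\<^sub>F (x', y) in uniformity. x' = x --> y \<in> U)"

lemma co_ops:
 "co (0 :: fsv) i = 0" "co (x + y) i = co x i + co y i" "co (x - y) i = co x i - co y i"
 "co (- x) i = - co x i" "co (r *\<^sub>R x) i = r * co x i"
 by (transfer; simp)+

lemma inner_fsv_on:
 assumes "finite T" "{i. co x i ~= 0} \<subseteq> T"
 shows "inner x y = (\<Sum>i\<in>T. co x i * co y i)"
 unfolding inner_fsv_def using assms by (intro sum.mono_neutral_left) auto

instance
proof
 fix x y z :: fsv and r s :: real
 show "x + y + z = x + (y + z)" "x + y = y + x" "0 + x = x" "- x + x = 0" "x - y = x + - y"
  "r *\<^sub>R (x + y) = r *\<^sub>R x + r *\<^sub>R y" "(r + s) *\<^sub>R x = r *\<^sub>R x + s *\<^sub>R x" "r *\<^sub>R s *\<^sub>R x = (r * s) *\<^sub>R x" "1 *\<^sub>R x = x"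
  by (intro fsv_eqI; simp add: co_ops algebra_simps)+
 define T where "T = {i. co x i ~= 0} \<union> {i. co y i ~= 0}"
 have T: "finite T" "{i. co x i ~= 0} \<subseteq> T" "{i. co y i ~= 0} \<subseteq> T" "{i. co (x + y) i ~= 0} \<subseteq> T" "{i. co (r *\<^sub>R x) i ~= 0} \<subseteq> T"
  using finite_supp by (auto simp: T_def co_ops)
 note on = inner_fsv_on[OF T(1)]
 show "inner x y = inner y x" unfolding on[OF T(2)] on[OF T(3)] by (simp add: mult.commute)
 show "inner (x + y) z = inner x z + inner y z" unfolding on[OF T(2)] on[OF T(3)] on[OF T(4)]
  by (simp add: co_ops sum.distrib distrib_right)
 show "inner (r *\<^sub>R x) y = r * inner x y" unfolding on[OF T(2)] on[OF T(5)] by (simp add: co_ops sum_distrib_left mult.assoc)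
 show "0 <= inner x x" unfolding inner_fsv_def by (intro sum_nonneg) simp
 show "inner x x = 0 \<longleftrightarrow> x = 0"
 proof
  assume "inner x x = 0"
  then have "\<forall>i\<in>{i. co x i ~= 0}. co x i * co x i = 0" unfolding inner_fsv_def using finite_supp[of x] by (subst (asm) sum_nonneg_eq_0_iff) auto
  then show "x = 0" by (intro fsv_eqI) (auto simp: co_ops)
 qed (simp add: inner_fsv_def co_ops)
qed (simp_all add: norm_fsv_def sgn_fsv_def dist_fsv_def uniformity_fsv_def open_fsv_def)

end

lift_definition un :: "nat list \<times> nat \<times> nat => fsv" is "%i j. if j = i then 1 else 0"
 by simp

lemma co_un: "co (un i) j = (if j = i then 1 else 0)"
 by transfer simp

lemma inner_un: "inner (un i) x = co x i"
 by (subst inner_fsv_on[of "{i}"]) (auto simp: co_un)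

lemma continuous_on_co [continuous_intros]: "continuous_on S f ==> continuous_on S (%x. co (f x) i)"
 unfolding inner_un[symmetric] by (intro continuous_intros)

lemma co_sum: "co (\<Sum>i\<in>A. f i) j = (\<Sum>i\<in>A. co (f i) j)"
 by (induction A rule: infinite_finite_induct) (simp_all add: co_ops)

section \<open>The iterated wreath product\<close>

abbreviation iv :: "(nat => nat) => nat => nat" where "iv \<equiv> inv_into UNIV"

lemma wr_Nil: "wr_act (n # rs) g x [] = (%i. x [] (iv (g []) i))"
 and wr_Cons: "wr_act (n # rs) g x (j # q) = wr_act rs (%q'. g (j # q')) (%q'. x (iv (g []) j # q')) q"
 by simp_all

declare wr_act.simps(2) [simp del]
declare wr_Nil [simp] wr_Cons [simp]

lemma path_ext: "f [] = g [] ==> (\<And>j q. f (j # q) = g (j # q)) ==> f = (g :: 'b list => 'c)"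
 by (metis ext neq_Nil_conv)

lemma iv_id: "iv (%a. a) = (%a. a)"
 using inv_id[where 'a = nat] by (simp add: id_def)

lemma wr_id [simp]: "wr_act rs (%_ a. a) x = x"
proof (induction rs arbitrary: x)
 case (Cons n rs)
 show ?case by (rule path_ext) (simp_all add: Cons iv_id)
qed simp

lemma Sg_id: "(%_. id) \<in> Sigma_group rs"
proof (induction rs)
 case (Cons n rs)
 have "id permutes {..<n}" by (rule permutes_id)
 then show ?case using Cons by (simp add: id_def)
qed (simp add: id_def)

lemma SgD:
 assumes "g \<in> Sigma_group (n # rs)"
 shows "g [] permutes {..<n}" "(%q. g (j # q)) \<in> Sigma_group rs" "n <= j ==> g (j # q) = id"
proof -
 show "g [] permutes {..<n}" "n <= j ==> g (j # q) = id" using assms by simp_all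
 show "(%q. g (j # q)) \<in> Sigma_group rs"
 proof (cases "j < n")
  case False
  then have "(%q. g (j # q)) = (%_. id)" using assms by simp
  then show ?thesis using Sg_id by simp
 qed (use assms in simp)
qed

lemma perm_lt: "p permutes {..<n::nat} ==> p i < n \<longleftrightarrow> i < n" "p permutes {..<n::nat} ==> iv p i < n \<longleftrightarrow> i < n"
 using permutes_in_image[of p "{..<n}" i] permutes_in_image[OF permutes_inv[of p "{..<n}"], of i] by auto

lemma perm_ge: "p permutes {..<n::nat} ==> n <= i ==> p i = i" "p permutes {..<n::nat} ==> n <= i ==> iv p i = i"
 using permutes_not_in[of p "{..<n}" i] permutes_not_in[OF permutes_inv[of p "{..<n}"], of i] by auto

text \<open>The product for which \<open>wr_act\<close> is a left action: the component of g at
  position j meets the component of h at the position from which that child came.\<close>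

fun gmul :: "(nat list => nat => nat) => (nat list => nat => nat) => nat list => nat => nat" where
 "gmul g h [] = g [] \<circ> h []"
| "gmul g h (j # q) = gmul (%q. g (j # q)) (%q. h (iv (g []) j # q)) q"

fun ginv :: "(nat list => nat => nat) => nat list => nat => nat" where
 "ginv g [] = iv (g [])"
| "ginv g (j # q) = ginv (%q. g (g [] j # q)) q"

lemma gmul_id: "gmul (%_ a. a) (%_ a. a) q = (%a. a)" and ginv_id: "ginv (%_ a. a) q = (%a. a)"
 by (induction q) (auto simp: iv_id)

lemma gmul_mem: "g \<in> Sigma_group rs ==> h \<in> Sigma_group rs ==> gmul g h \<in> Sigma_group rs"
proof (induction rs arbitrary: g h)
 case Nil
 then have "g = (%_ a. a)" "h = (%_ a. a)" by (auto simp: id_def)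
 then show ?case by (simp add: gmul_id id_def)
next
 case (Cons n rs)
 note g = SgD[OF Cons.prems(1)] and h = SgD[OF Cons.prems(2)]
 have "gmul g h (j # q) = id" if "n <= j" for j q
  using g(3)[OF that] h(3)[OF that] perm_ge(2)[OF g(1) that] by (simp add: gmul_id id_def)
 moreover have "(%q. gmul g h (j # q)) \<in> Sigma_group rs" for j
  using Cons.IH[OF g(2) h(2)] by simp
 ultimately show ?case using permutes_compose[OF h(1) g(1)] by simp
qed

lemma wr_gmul: "g \<in> Sigma_group rs ==> h \<in> Sigma_group rs ==> wr_act rs (gmul g h) x = wr_act rs g (wr_act rs h x)"
proof (induction rs arbitrary: g h x)
 case (Cons n rs)
 note g = SgD[OF Cons.prems(1)] and h = SgD[OF Cons.prems(2)]
 have i: "iv (g [] \<circ> h []) = iv (h []) \<circ> iv (g [])"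
  using permutes_bij[OF g(1)] permutes_bij[OF h(1)] by (rule o_inv_distrib)
 show ?case by (rule path_ext) (simp_all add: i Cons.IH[OF g(2) h(2)])
qed simp

lemma ginv_mem: "g \<in> Sigma_group rs ==> ginv g \<in> Sigma_group rs"
proof (induction rs arbitrary: g)
 case Nil
 then have "g = (%_ a. a)" by (auto simp: id_def)
 then show ?case by (simp add: ginv_id id_def)
next
 case (Cons n rs)
 note g = SgD[OF Cons.prems]
 have "ginv g (j # q) = id" if "n <= j" for j q
  using g(3)[OF that] perm_ge(1)[OF g(1) that] by (simp add: ginv_id id_def)
 moreover have "(%q. ginv g (j # q)) \<in> Sigma_group rs" for j using Cons.IH[OF g(2)] by simp
 ultimately show ?case using permutes_inv[OF g(1)] by simp
qed

lemma wr_ginv: "g \<in> Sigma_group rs ==> wr_act rs (ginv g) (wr_act rs g x) = x"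
proof (induction rs arbitrary: g x)
 case (Cons n rs)
 note g = SgD[OF Cons.prems]
 have i: "iv (iv (g [])) = g []" by (rule permutes_inv_inv[OF g(1)])
 show ?case by (rule path_ext) (simp_all add: i Cons.IH[OF g(2)] permutes_inverses[OF g(1)])
qed simp

lemma wr_inj: "g \<in> Sigma_group rs ==> wr_act rs g x = wr_act rs g y ==> x = y"
 by (metis wr_ginv)

lemma wr_ginv': "g \<in> Sigma_group rs ==> wr_act rs g (wr_act rs (ginv g) x) = x"
proof (induction rs arbitrary: g x)
 case (Cons n rs)
 note g = SgD[OF Cons.prems]
 have i: "iv (iv (g [])) = g []" by (rule permutes_inv_inv[OF g(1)])
 show ?case by (rule path_ext) (simp_all add: i Cons.IH[OF g(2)] permutes_inverses[OF g(1)])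
qed simp

lemma wr_map: "wr_act rs g (%p i. \<phi> (x p i)) = (%p i. \<phi> (wr_act rs g x p i))"
proof (induction rs arbitrary: g x)
 case (Cons n rs)
 show ?case by (rule path_ext) (simp_all add: Cons)
qed simp

lemma wr_map2: "wr_act rs g (%p i. \<phi> (x p i) (y p i)) = (%p i. \<phi> (wr_act rs g x p i) (wr_act rs g y p i))"
proof (induction rs arbitrary: g x y)
 case (Cons n rs)
 show ?case by (rule path_ext) (simp_all add: Cons)
qed simp

lemma finite_Sigma_group: "finite (Sigma_group rs)"
proof (induction rs)
 case Nil
 have "Sigma_group [] = {%_. id}" by auto
 then show ?case by simp
next
 case (Cons n rs)
 let ?f = "%g. (g [], \<lambda>j\<in>{..<n}. (%q. g (j # q)))"
 have fin: "finite ({p. p permutes {..<n}} \<times> (\<Pi>\<^sub>E j\<in>{..<n}. Sigma_group rs))"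
  using Cons by (intro finite_cartesian_product finite_PiE finite_permutations) auto
 have sub: "?f ` Sigma_group (n # rs) \<subseteq> {p. p permutes {..<n}} \<times> (\<Pi>\<^sub>E j\<in>{..<n}. Sigma_group rs)" by auto
 have inj: "inj_on ?f (Sigma_group (n # rs))"
 proof (rule inj_onI)
  fix g h assume a: "g \<in> Sigma_group (n # rs)" "h \<in> Sigma_group (n # rs)" "?f g = ?f h"
  show "g = h"
  proof (rule path_ext)
   show "g [] = h []" using a(3) by simp
   fix j q
   show "g (j # q) = h (j # q)"
   proof (cases "j < n")
    case True
    have "(\<lambda>j\<in>{..<n}. (%q. g (j # q))) j = (\<lambda>j\<in>{..<n}. (%q. h (j # q))) j" using a(3) by simp
    then show ?thesis using True by (simp add: fun_eq_iff)
   next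
    case False
    then show ?thesis using SgD(3)[OF a(1)] SgD(3)[OF a(2)] by simp
   qed
  qed
 qed
 show ?case by (rule finite_imageD[OF finite_subset[OF sub fin] inj])
qed

text \<open>Relabellings that preserve the order of related siblings. The component of g that acts
  on the old child l is stored at its new position \<open>g [] l\<close>.\<close>

fun keeps :: "nat list => (nat list => nat => nat) => (nat list => nat => nat => bool) => bool" where
 "keeps [] g N \<longleftrightarrow> True"
| "keeps (n # rs) g N \<longleftrightarrow> (\<forall>j<n. \<forall>i<j. N [] i j --> g [] i < g [] j) \<and>
   (\<forall>l<n. keeps rs (%q. g (g [] l # q)) (%q. N (l # q)))"

fun srt :: "nat list => (nat list => nat => real) => bool" where
 "srt [] h \<longleftrightarrow> True"
| "srt (n # rs) h \<longleftrightarrow> (\<forall>j<n. \<forall>i<j. h [] i <= h [] j) \<and> (\<forall>l<n. srt rs (%q. h (l # q)))"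

fun sepd :: "nat list => (nat list => nat => nat => bool) => (nat list => nat => real) => bool" where
 "sepd [] N h \<longleftrightarrow> True"
| "sepd (n # rs) N h \<longleftrightarrow> (\<forall>j<n. \<forall>i<j. N [] i j --> h [] i ~= h [] j) \<and> (\<forall>l<n. sepd rs (%q. N (l # q)) (%q. h (l # q)))"

definition near :: "real => (nat list => nat => nat => real) => nat list => nat => nat => bool" where
 "near \<theta> z P i j \<longleftrightarrow> (\<forall>c. \<bar>z P i c - z P j c\<bar> < \<theta>)"

lemma near_sym: "near \<theta> z P i j \<longleftrightarrow> near \<theta> z P j i"
 by (simp add: near_def abs_minus_commute)

lemma near_sub: "(%q. near \<theta> z (l # q)) = near \<theta> (%q. z (l # q))"
 by (simp add: near_def fun_eq_iff)

lemma keeps_mono: "keeps rs g N ==> (\<And>P i j. N' P i j ==> N P i j) ==> keeps rs g N'"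
proof (induction rs arbitrary: g N N')
 case (Cons n rs)
 show ?case unfolding keeps.simps
 proof (intro conjI allI impI)
  fix i j assume "j < n" "i < j" "N' [] i j"
  then show "g [] i < g [] j" using Cons.prems(1) Cons.prems(2)[of "[]" i j] by simp
 next
  fix l assume "l < n"
  then have "keeps rs (%q. g (g [] l # q)) (%q. N (l # q))" using Cons.prems(1) by simp
  then show "keeps rs (%q. g (g [] l # q)) (%q. N' (l # q))" by (rule Cons.IH) (rule Cons.prems(2))
 qed
qed simp

text \<open>A near pair reversed by the inverse would come from a near pair reversed by g. With
  this, arguments about z and its image can be run backwards.\<close>

lemma keeps_ginv: "g \<in> Sigma_group rs ==> keeps rs g (near \<theta> z) ==> keeps rs (ginv g) (near \<theta> (wr_act rs g z))"
proof (induction rs arbitrary: g z)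
 case (Cons n rs)
 note g = SgD[OF Cons.prems(1)]
 note pi = permutes_inverses[OF g(1)]
 have 1: "iv (g []) i < iv (g []) j" if ij: "j < n" "i < j" "near \<theta> z [] (iv (g []) i) (iv (g []) j)" for i j
 proof (rule ccontr)
  assume a: "\<not> ?thesis"
  have "iv (g []) i ~= iv (g []) j" using ij(2) by (simp add: inj_eq[OF permutes_inj[OF permutes_inv[OF g(1)]]])
  then have "iv (g []) j < iv (g []) i" using a by simp
  moreover have "iv (g []) i < n" using ij perm_lt(2)[OF g(1)] by simp
  ultimately have "g [] (iv (g []) j) < g [] (iv (g []) i)" using Cons.prems(2) ij(3) near_sym by auto
  then show False using ij(2) pi by simp
 qed
 have 2: "keeps rs (%q. ginv g (ginv g [] l # q)) (%q. near \<theta> (wr_act (n # rs) g z) (l # q))" if l: "l < n" for l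
 proof -
  have m: "iv (g []) l < n" using l perm_lt(2)[OF g(1)] by simp
  have "keeps rs (%q. g (g [] (iv (g []) l) # q)) (%q. near \<theta> z (iv (g []) l # q))" using Cons.prems(2) m by simp
  then have k: "keeps rs (%q. g (l # q)) (near \<theta> (%q. z (iv (g []) l # q)))" by (simp add: pi near_sub)
  from Cons.IH[OF g(2) k] show ?thesis by (simp add: pi near_sub)
 qed
 have "near \<theta> (wr_act (n # rs) g z) [] i j \<longleftrightarrow> near \<theta> z [] (iv (g []) i) (iv (g []) j)" for i j by (simp add: near_def)
 then show ?case unfolding keeps.simps using 1 2 by (simp del: ginv.simps(2) wr_Cons)
qed simp

text \<open>If the heights are sorted both before and after g, a pair whose order g reverses has
  equal heights; \<open>sepd\<close> excludes this for related siblings.\<close>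

lemma keeps_sorted: "g \<in> Sigma_group rs ==> srt rs H ==> srt rs (wr_act rs g H) ==> sepd rs N H ==> keeps rs g N"
proof (induction rs arbitrary: g H N)
 case (Cons n rs)
 note g = SgD[OF Cons.prems(1)]
 note pi = permutes_inverses[OF g(1)]
 have "g [] i < g [] j" if ij: "j < n" "i < j" "N [] i j" for i j
 proof (rule ccontr)
  assume a: "\<not> g [] i < g [] j"
  have "g [] i ~= g [] j" using ij(2) by (simp add: inj_eq[OF permutes_inj[OF g(1)]])
  then have lt: "g [] j < g [] i" using a by simp
  have "g [] i < n" using ij perm_lt(1)[OF g(1)] by simp
  then have "wr_act (n # rs) g H [] (g [] j) <= wr_act (n # rs) g H [] (g [] i)" using Cons.prems(3) lt by simp
  then have "H [] j <= H [] i" by (simp add: pi)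
  moreover have "H [] i <= H [] j" "H [] i ~= H [] j" using Cons.prems(2,4) ij by auto
  ultimately show False by linarith
 qed
 moreover have "keeps rs (%q. g (g [] l # q)) (%q. N (l # q))" if l: "l < n" for l
 proof (rule Cons.IH[OF g(2)])
  show "srt rs (%q. H (l # q))" "sepd rs (%q. N (l # q)) (%q. H (l # q))" using Cons.prems l by simp_all
  have "g [] l < n" using l perm_lt(1)[OF g(1)] by simp
  then have "srt rs (%q. wr_act (n # rs) g H (g [] l # q))" using Cons.prems(3) by (simp del: wr_Cons)
  then show "srt rs (wr_act rs (%q. g (g [] l # q)) (%q. H (l # q)))" by (simp add: pi)
 qed
 ultimately show ?case by simp
qed simp

lemma sort_perm:
 fixes h :: "nat => real"
 obtains s where "s permutes {..<n}" "\<And>i j. i < j ==> j < n ==> h (s i) <= h (s j)"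
proof -
 define xs where "xs = sort_key h [0..<n]"
 have l: "length xs = n" and d: "distinct xs" and st: "set xs = {..<n}" and so: "sorted (map h xs)"
  by (auto simp: xs_def)
 define s where "s i = (if i < n then xs ! i else i)" for i
 have b: "bij_betw ((!) xs) {..<n} {..<n}" by (rule bij_betw_nth[OF d]) (simp_all add: l st)
 have "bij_betw s {..<n} {..<n} \<longleftrightarrow> bij_betw ((!) xs) {..<n} {..<n}" by (rule bij_betw_cong) (simp add: s_def)
 then have "bij_betw s {..<n} {..<n}" using b by (rule iffD2)
 then have "s permutes {..<n}" by (rule bij_imp_permutes) (simp add: s_def)
 moreover have "h (s i) <= h (s j)" if "i < j" "j < n" for i j
  using sorted_nth_mono[OF so, of i j] that l by (simp add: s_def)
 ultimately show ?thesis by (rule that)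
qed

lemma sort_exists: "\<exists>g\<in>Sigma_group rs. srt rs (wr_act rs g h)"
proof (induction rs arbitrary: h)
 case Nil
 then show ?case using Sg_id[of "[]"] by auto
next
 case (Cons n rs)
 obtain s where s: "s permutes {..<n}" "\<And>i j. i < j ==> j < n ==> h [] (s i) <= h [] (s j)" by (rule sort_perm[of n "h []"]) (rule that)
 have "\<forall>j. \<exists>g. g \<in> Sigma_group rs \<and> srt rs (wr_act rs g (%q. h (s j # q)))"
  using Cons.IH[of "%q. h (s _ # q)", unfolded Bex_def] by (rule allI)
 from choice[OF this] obtain G where G': "\<forall>j. G j \<in> Sigma_group rs \<and> srt rs (wr_act rs (G j) (%q. h (s j # q)))" ..
 have G: "G j \<in> Sigma_group rs \<and> srt rs (wr_act rs (G j) (%q. h (s j # q)))" for j using G' by (rule spec)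
 define g where "g p = (case p of [] => iv s | j # q => if j < n then G j q else id)" for p
 have i: "iv (iv s) = s" by (rule permutes_inv_inv[OF s(1)])
 have "g \<in> Sigma_group (n # rs)" using permutes_inv[OF s(1)] G by (simp add: g_def)
 moreover have "srt (n # rs) (wr_act (n # rs) g h)" using s(2) G by (simp add: g_def i)
 ultimately show ?case by (intro bexI[of _ g])
qed

section \<open>The test space as a finite-dimensional orthogonal representation\<close>

fun J :: "nat => nat list => (nat list \<times> nat \<times> nat) set" where
 "J d [] = {}"
| "J d (n # rs) = (%(i, c). ([], i, c)) ` ({..<n} \<times> {..<d - 1}) \<union> (%(j, p, i, c). (j # p, i, c)) ` ({..<n} \<times> J d rs)"

lemma finite_J: "finite (J d rs)"
 by (induction rs) auto

lemma W_spaceD: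
 assumes "w \<in> W_space d (n # rs)"
 shows "(%q. w (j # q)) \<in> W_space d rs" "(\<Sum>i<n. w [] i c) = 0" "n <= i \<or> d - 1 <= c ==> w [] i c = 0" "n <= j ==> w (j # q) i c = 0"
proof -
 have 0: "(%_ _ _. 0) \<in> W_space d rs" by (induction rs) auto
 show "(%q. w (j # q)) \<in> W_space d rs"
 proof (cases "j < n")
  case False
  then have "n <= j" by simp
  then have "(%q. w (j # q)) = (%_ _ _. 0)" using assms by (simp add: fun_eq_iff)
  then show ?thesis using 0 by simp
 qed (use assms in simp)
qed (use assms in auto)

lemma W_supp: "w \<in> W_space d rs ==> w p i c ~= 0 ==> (p, i, c) \<in> J d rs"
proof (induction rs arbitrary: w p)
 case (Cons n rs)
 note W = W_spaceD[OF Cons.prems(1)]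
 show ?case
 proof (cases p)
  case Nil
  then have "i < n" "c < d - 1" using W(3)[of i c] Cons.prems(2) by (auto simp: not_le[symmetric])
  then show ?thesis using Nil by force
 next
  case (Cons j q)
  then have "j < n" using W(4)[of j q i c] Cons.prems(2) by (auto simp: not_le[symmetric])
  moreover have "(q, i, c) \<in> J d rs" using Cons.IH[OF W(1)[of j], of q] Cons.prems(2) Cons by simp
  ultimately show ?thesis using Cons by force
 qed
qed simp

lemma W_norm2_J: "W_norm2 d rs w = (\<Sum>x\<in>J d rs. (w (fst x) (fst (snd x)) (snd (snd x)))\<^sup>2)"
proof (induction rs arbitrary: w)
 case (Cons n rs)
 let ?A = "(%(i, c). ([], i, c)) ` ({..<n} \<times> {..<d - 1})" and ?B = "(%(j, p, i, c). (j # p, i, c)) ` ({..<n} \<times> J d rs)"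
 let ?f = "%x. (w (fst x) (fst (snd x)) (snd (snd x)))\<^sup>2"
 have "(\<Sum>x\<in>J d (n # rs). ?f x) = (\<Sum>x\<in>?A. ?f x) + (\<Sum>x\<in>?B. ?f x)"
  unfolding J.simps using finite_J by (intro sum.union_disjoint) auto
 also have "(\<Sum>x\<in>?A. ?f x) = (\<Sum>i<n. \<Sum>c<d - 1. (w [] i c)\<^sup>2)"
  by (subst sum.reindex) (auto simp: inj_on_def sum.cartesian_product intro!: sum.cong)
 also have "(\<Sum>x\<in>?B. ?f x) = (\<Sum>j<n. \<Sum>x\<in>J d rs. (w (j # fst x) (fst (snd x)) (snd (snd x)))\<^sup>2)"
  by (subst sum.reindex) (auto simp: inj_on_def sum.cartesian_product intro!: sum.cong)
 finally show ?case by (simp add: Cons)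
qed simp

lemma W_norm2_pos: "w \<in> W_space d rs ==> w ~= (%_ _ _. 0) ==> W_norm2 d rs w > 0"
proof -
 assume w: "w \<in> W_space d rs" "w ~= (%_ _ _. 0)"
 then obtain p i c where n: "w p i c ~= 0" by (auto simp: fun_eq_iff)
 then have J: "(p, i, c) \<in> J d rs" by (rule W_supp[OF w(1)])
 have "0 < (w p i c)\<^sup>2" using n by simp
 also have "\<dots> <= W_norm2 d rs w" unfolding W_norm2_J
  using member_le_sum[OF J, of "%x. (w (fst x) (fst (snd x)) (snd (snd x)))\<^sup>2"] finite_J by simp
 finally show ?thesis .
qed

lemma W_lin:
 "w \<in> W_space d rs ==> w' \<in> W_space d rs ==> (%p i c. a * w p i c + b * w' p i c) \<in> W_space d rs"
proof (induction rs arbitrary: w w')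
 case (Cons n rs)
 note W = W_spaceD[OF Cons.prems(1)] and W' = W_spaceD[OF Cons.prems(2)]
 show ?case using Cons.IH[OF W(1) W'(1)] W(2-4) W'(2-4)
  by (auto simp: sum.distrib sum_distrib_left[symmetric])
qed simp

lemma W_0: "(%_ _ _. 0) \<in> W_space d rs"
 by (induction rs) auto

lemma sum_iv: "p permutes {..<n} ==> (\<Sum>i<n. f (iv p i)) = (\<Sum>i<n. f i)" for f :: "nat => 'b::comm_monoid_add"
 using sum.permute[OF permutes_inv, of p "{..<n}" f] by (simp add: o_def)

lemma W_act: "g \<in> Sigma_group rs ==> w \<in> W_space d rs ==> wr_act rs g w \<in> W_space d rs"
proof (induction rs arbitrary: g w)
 case (Cons n rs)
 note g = SgD[OF Cons.prems(1)] and W = W_spaceD[OF Cons.prems(2)]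
 have "(%q. wr_act (n # rs) g w (j # q)) \<in> W_space d rs" for j
  using Cons.IH[OF g(2) W(1)] by simp
 moreover have "(\<Sum>i<n. wr_act (n # rs) g w [] i c) = 0" for c
  using W(2)[of c] sum_iv[OF g(1), of "%i. w [] i c"] by simp
 moreover have "wr_act (n # rs) g w [] i c = 0" if "n <= i \<or> d - 1 <= c" for i c
  using W(3)[of "iv (g []) i" c] that perm_ge(2)[OF g(1), of i] by auto
 moreover have "wr_act (n # rs) g w (j # q) i c = 0" if j: "n <= j" for j q i c
 proof -
  have "(%q. g (j # q)) = (%_ a. a)" using g(3)[OF j] by (simp add: id_def)
  then show ?thesis using W(4)[OF j] perm_ge(2)[OF g(1) j] by simp
 qed
 ultimately show ?case by (simp del: wr_Nil wr_Cons)
qed simp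

lemma W_norm2_act: "g \<in> Sigma_group rs ==> W_norm2 d rs (wr_act rs g w) = W_norm2 d rs w"
proof (induction rs arbitrary: g w)
 case (Cons n rs)
 note g = SgD[OF Cons.prems(1)]
 show ?case using sum_iv[OF g(1), of "%j. W_norm2 d rs (%q. w (j # q))"] sum_iv[OF g(1), of "%i. \<Sum>c<d - 1. (w [] i c)\<^sup>2"]
  by (simp add: Cons.IH[OF g(2)])
qed simp

definition fn :: "fsv => nat list => nat => nat => real" where "fn z p i c = co z (p, i, c)"

definition vec :: "(nat list => nat => nat => real) => fsv" where "vec w = Abs_fsv (%(p, i, c). w p i c)"

lemma fn_inj: "fn x = fn y ==> x = y"
proof -
 assume "fn x = fn y"
 then have "co x (p, i, c) = co y (p, i, c)" for p i c unfolding fn_def fun_eq_iff by blast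
 then show "x = y" by (intro fsv_eqI) (metis prod_cases3)
qed

lemma fn_vec: "w \<in> W_space d rs ==> fn (vec w) = w"
proof -
 assume w: "w \<in> W_space d rs"
 have "{x. (%(p, i, c). w p i c) x ~= 0} \<subseteq> J d rs" using W_supp[OF w] by auto
 then have "finite {x. (%(p, i, c). w p i c) x ~= 0}" using finite_J by (rule finite_subset)
 then have "co (vec w) = (%(p, i, c). w p i c)" unfolding vec_def co.rep_eq by (subst Abs_fsv_inverse) simp_all
 then show "fn (vec w) = w" by (simp add: fn_def fun_eq_iff)
qed

lemma fn_ops: "fn 0 = (%_ _ _. 0)" "fn (x + y) = (%p i c. fn x p i c + fn y p i c)" "fn (r *\<^sub>R x) = (%p i c. r * fn x p i c)"
 by (simp_all add: fn_def fun_eq_iff co_ops)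

definition Wf :: "nat => nat list => fsv set" where "Wf d rs = {z. fn z \<in> W_space d rs}"

lemma vec_Wf: "w \<in> W_space d rs ==> vec w \<in> Wf d rs"
 using fn_vec[of w d rs] by (simp add: Wf_def)

lemma subspace_Wf: "subspace (Wf d rs)"
proof (rule subspaceI)
 show "0 \<in> Wf d rs" by (simp add: Wf_def fn_ops W_0)
 show "x + y \<in> Wf d rs" if "x \<in> Wf d rs" "y \<in> Wf d rs" for x y
  using W_lin[of "fn x" d rs "fn y" 1 1] that by (simp add: Wf_def fn_ops)
 show "r *\<^sub>R x \<in> Wf d rs" if "x \<in> Wf d rs" for x r
  using W_lin[of "fn x" d rs "fn x" r 0] that by (simp add: Wf_def fn_ops)
qed

lemma norm_Wf: "z \<in> Wf d rs ==> (norm z)\<^sup>2 = W_norm2 d rs (fn z)"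
proof -
 assume z: "z \<in> Wf d rs"
 have "{x. co z x ~= 0} \<subseteq> J d rs" using W_supp[of "fn z" d rs] z by (auto simp: Wf_def fn_def)
 from inner_fsv_on[OF finite_J this, of z] show ?thesis
  unfolding power2_norm_eq_inner W_norm2_J by (simp add: fn_def power2_eq_square)
qed

definition av :: "nat list => (nat list => nat => nat) => fsv => fsv" where
 "av rs g z = vec (wr_act rs g (fn z))"

lemma fn_av: "g \<in> Sigma_group rs ==> z \<in> Wf d rs ==> fn (av rs g z) = wr_act rs g (fn z)"
 unfolding av_def by (rule fn_vec[of _ d rs]) (simp add: Wf_def W_act)

lemma av_Wf: "g \<in> Sigma_group rs ==> z \<in> Wf d rs ==> av rs g z \<in> Wf d rs"
 unfolding av_def by (rule vec_Wf) (simp add: Wf_def W_act)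

lemma av_lin:
 assumes g: "g \<in> Sigma_group rs" and x: "x \<in> Wf d rs" and y: "y \<in> Wf d rs"
 shows "av rs g (x + y) = av rs g x + av rs g y" "av rs g (r *\<^sub>R x) = r *\<^sub>R av rs g x"
proof -
 note s = subspace_Wf[of d rs]
 show "av rs g (x + y) = av rs g x + av rs g y"
  by (rule fn_inj) (simp add: fn_av[OF g subspace_add[OF s x y]] fn_ops fn_av[OF g x] fn_av[OF g y]
   wr_map2[of rs g "%u v c. u c + v c" "fn x" "fn y"])
 show "av rs g (r *\<^sub>R x) = r *\<^sub>R av rs g x"
  by (rule fn_inj) (simp add: fn_av[OF g subspace_scale[OF s x]] fn_ops fn_av[OF g x] wr_map[of rs g "%u c. r * u c" "fn x"])
qed

lemma av_norm: "g \<in> Sigma_group rs ==> z \<in> Wf d rs ==> norm (av rs g z) = norm z"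
proof -
 assume a: "g \<in> Sigma_group rs" "z \<in> Wf d rs"
 have "(norm (av rs g z))\<^sup>2 = (norm z)\<^sup>2" using norm_Wf[OF av_Wf[OF a]] norm_Wf[OF a(2)] by (simp add: fn_av[OF a] W_norm2_act[OF a(1)])
 then show "norm (av rs g z) = norm z" by simp
qed

lemma av_inner: "g \<in> Sigma_group rs ==> x \<in> Wf d rs ==> y \<in> Wf d rs ==> inner (av rs g x) (av rs g y) = inner x y"
proof -
 assume g: "g \<in> Sigma_group rs" and x: "x \<in> Wf d rs" and y: "y \<in> Wf d rs"
 have "norm (av rs g x + av rs g y) = norm (x + y)"
  using av_norm[OF g subspace_add[OF subspace_Wf x y]] by (simp add: av_lin(1)[OF g x y])
 then show ?thesis unfolding dot_norm using av_norm[OF g x] av_norm[OF g y] by simp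
qed

text \<open>A cap is built from linear combinations, inner products and norms, all of which the
  action respects.\<close>

lemma cap_av:
 assumes g: "g \<in> Sigma_group rs" and m: "e \<in> Wf d rs" "f \<in> Wf d rs" "z \<in> Wf d rs"
 shows "cap \<rho> k (av rs g e) (av rs g f) (av rs g z) = av rs g (cap \<rho> k e f z)"
proof -
 note s = subspace_Wf[of d rs]
 have E: "emb e f c \<in> Wf d rs" for c using s m by (simp add: emb_def subspace_add subspace_scale)
 have e: "emb (av rs g e) (av rs g f) c = av rs g (emb e f c)" for c
  unfolding emb_def using av_lin(1)[OF g subspace_scale[OF s m(1)] subspace_scale[OF s m(2)], of "Re c" "Im c"]
   av_lin(2)[OF g m(1) m(1), of "Re c"] av_lin(2)[OF g m(2) m(2), of "Im c"] by simp
 have p: "plc (av rs g e) (av rs g f) (av rs g z) = plc e f z" unfolding plc_def using av_inner[OF g] m by simp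
 have "av rs g z - av rs g (emb e f (plc e f z)) = av rs g (z - emb e f (plc e f z))"
  using av_lin(1)[OF g subspace_diff[OF s m(3) E] E, of "plc e f z" "plc e f z"] by (simp add: algebra_simps)
 then have "damp \<rho> (av rs g e) (av rs g f) (av rs g z) = damp \<rho> e f z"
  unfolding damp_def e p using av_norm[OF g subspace_diff[OF s m(3) E]] by simp
 then show ?thesis unfolding cap_def e p using av_lin(2)[OF g E E] by simp
qed

text \<open>Total inverse distance between siblings: invariant under relabelling, continuous on
  configurations and large when two points are close. The diagonal terms are
  \<open>inverse 0 = 0\<close>.\<close>

fun lam :: "nat list => (nat list => nat => 'a::euclidean_space) => real" where
 "lam [] x = 0"
| "lam (n # rs) x = (\<Sum>i<n. \<Sum>j<n. inverse (norm (x [] i - x [] j))) + (\<Sum>j<n. lam rs (%q. x (j # q)))"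

lemma lam_nonneg: "lam rs x >= 0"
 by (induction rs arbitrary: x) (auto intro!: add_nonneg_nonneg sum_nonneg)

lemma lam_act: "g \<in> Sigma_group rs ==> lam rs (wr_act rs g x) = lam rs x"
proof (induction rs arbitrary: g x)
 case (Cons n rs)
 note g = SgD[OF Cons.prems(1)]
 show ?case using sum_iv[OF g(1), of "%j. lam rs (%q. x (j # q))"]
   sum_iv[OF g(1), of "%i. \<Sum>j<n. inverse (norm (x [] i - x [] j))"] sum_iv[OF g(1), of "%j. inverse (norm (x [] _ - x [] j))"]
  by (simp add: Cons.IH[OF g(2)])
qed simp

lemma lam_ge:
 "i < n ==> j < n ==> inverse (norm (x [] i - x [] j)) <= lam (n # rs) x"
 "l < n ==> lam rs (%q. x (l # q)) <= lam (n # rs) x"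
proof -
 have s: "0 <= (\<Sum>j<n. lam rs (%q. x (j # q)))" "0 <= (\<Sum>i<n. \<Sum>j<n. inverse (norm (x [] i - x [] j)))"
  by (auto intro!: sum_nonneg lam_nonneg)
 show "inverse (norm (x [] i - x [] j)) <= lam (n # rs) x" if "i < n" "j < n"
 proof -
  have "inverse (norm (x [] i - x [] j)) <= (\<Sum>j<n. inverse (norm (x [] i - x [] j)))" using that by (intro member_le_sum) auto
  also have "\<dots> <= (\<Sum>i<n. \<Sum>j<n. inverse (norm (x [] i - x [] j)))" using that by (intro member_le_sum) (auto intro!: sum_nonneg)
  finally show ?thesis using s by simp
 qed
 show "lam rs (%q. x (l # q)) <= lam (n # rs) x" if "l < n"
 proof -
  have "lam rs (%q. x (l # q)) <= (\<Sum>j<n. lam rs (%q. x (j # q)))" using that by (intro member_le_sum) (auto intro!: lam_nonneg)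
  then show ?thesis using s by simp
 qed
qed

lemma continuous_on_at_path: "continuous_on S (%x :: nat list => nat => 'b::topological_space. x p i)"
proof -
 have 1: "continuous_on S (%x :: nat list => nat => 'b. x p)" by (intro continuous_on_subset[OF continuous_on_product_coordinates]) simp
 show ?thesis by (rule continuous_on_compose2[OF continuous_on_product_coordinates 1]) simp
qed

lemma continuous_on_subtree: "continuous_on S (%(x :: nat list => nat => 'b::topological_space) q. x (j # q))"
 by (intro continuous_on_coordinatewise_then_product) (rule continuous_on_at_path)

lemma continuous_on_lam: "continuous_on (C_space rs) (lam rs :: _ => real)"
proof (induction rs)
 case Nil
 have "lam [] = (%x :: _ => _ => 'a. 0)" by (rule ext) simp
 then show ?case by simp
next
 case (Cons n rs)
 have "continuous_on (C_space (n # rs)) (%x. inverse (norm (x [] i - x [] j :: 'a)))" if "i < n" "j < n" for i j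
 proof (cases "i = j")
  case False
  then show ?thesis using that by (intro continuous_intros continuous_on_at_path) auto
 qed simp
 moreover have "continuous_on (C_space (n # rs)) (%x. lam rs (%q. x (j # q) :: nat => 'a))" if "j < n" for j
  by (rule continuous_on_compose2[OF Cons continuous_on_subtree]) (use that in auto)
 ultimately show ?case unfolding lam.simps
  by (intro continuous_on_add continuous_on_sum) (simp_all del: C_space.simps)
qed

text \<open>The last coordinate of the points is left out here; it becomes the height by which
  siblings are sorted.\<close>

fun cen :: "nat list => (nat list => nat => 'a::euclidean_space) => nat list => nat => nat => real" where
 "cen [] x p i c = 0"
| "cen (n # rs) x [] i c = (if i < n \<and> c < DIM('a) - 1 then inner (x [] i) (bs c) - (\<Sum>j<n. inner (x [] j) (bs c)) / n else 0)"
| "cen (n # rs) x (j # q) i c = (if j < n then cen rs (%q. x (j # q)) q i c else 0)"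

lemma cen_W: "cen rs (x :: _ => _ => 'a::euclidean_space) \<in> W_space DIM('a) rs"
proof (induction rs arbitrary: x)
 case (Cons n rs)
 have "(\<Sum>i<n. cen (n # rs) x [] i c) = 0" for c
 proof (cases "c < DIM('a) - 1 \<and> n > 0")
  case True
  then show ?thesis by (simp add: sum_subtractf)
 qed auto
 moreover have "(%q. cen (n # rs) x (j # q)) = (if j < n then cen rs (%q. x (j # q)) else (%_ _ _. 0))" for j
  by (auto simp: fun_eq_iff)
 ultimately show ?case using Cons by auto
qed auto

lemma cen_act: "g \<in> Sigma_group rs ==> cen rs (wr_act rs g x) = wr_act rs g (cen rs x)"
proof (induction rs arbitrary: g x)
 case (Cons n rs)
 note g = SgD[OF Cons.prems(1)]
 show ?case
 proof (rule path_ext)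
  show "cen (n # rs) (wr_act (n # rs) g x) [] = wr_act (n # rs) g (cen (n # rs) x) []"
   using perm_lt(2)[OF g(1)] sum_iv[OF g(1), of "%j. inner (x [] j) (bs _)"] by (auto simp: fun_eq_iff)
  fix j q
  show "cen (n # rs) (wr_act (n # rs) g x) (j # q) = wr_act (n # rs) g (cen (n # rs) x) (j # q)"
  proof (cases "j < n")
   case True
   then have l: "iv (g []) j < n" using perm_lt(2)[OF g(1)] by simp
   have "(%q. cen (n # rs) x (iv (g []) j # q)) = cen rs (%q. x (iv (g []) j # q))" using l by (simp add: fun_eq_iff)
   moreover have "cen (n # rs) (wr_act (n # rs) g x) (j # q) = cen rs (wr_act rs (%q'. g (j # q')) (%q'. x (iv (g []) j # q'))) q"
    using True by (simp add: fun_eq_iff)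
   ultimately show ?thesis by (simp add: Cons.IH[OF g(2)])
  next
   case False
   then have j: "n <= j" by simp
   have id: "(%q. g (j # q)) = (%_ a. a)" using g(3)[OF j] by (simp add: id_def)
   show ?thesis
   proof (intro ext)
    fix i c
    show "cen (n # rs) (wr_act (n # rs) g x) (j # q) i c = wr_act (n # rs) g (cen (n # rs) x) (j # q) i c"
     unfolding wr_Cons[of n rs g "cen (n # rs) x"] id wr_id perm_ge(2)[OF g(1) j] using False by simp
   qed
  qed
 qed
qed (simp add: fun_eq_iff)

lemma continuous_on_cen: "continuous_on S (%x :: _ => _ => 'a::euclidean_space. cen rs x p i c)"
proof -
 have "continuous_on UNIV (%x :: _ => _ => 'a. cen rs x p i c)"
 proof (induction rs arbitrary: p)
  case (Cons n rs)
  show ?case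
  proof (cases p)
   case Nil
   show ?thesis unfolding Nil cen.simps by (cases "i < n \<and> c < DIM('a) - 1") (auto intro!: continuous_intros continuous_on_at_path)
  next
   case (Cons j q)
   show ?thesis
   proof (cases "j < n")
    case True
    then show ?thesis unfolding Cons using continuous_on_compose2[OF Cons.IH[of q] continuous_on_subtree[of UNIV j]] by simp
   qed (simp add: Cons)
  qed
 qed simp
 then show ?thesis by (rule continuous_on_subset) simp
qed

lemma norm_le_bs: "norm x <= (\<Sum>c<DIM('a). \<bar>inner x (bs c)\<bar>)" for x :: "'a::euclidean_space"
proof -
 have "\<exists>h. bij_betw h {..<DIM('a)} (Basis :: 'a set)"
  using ex_bij_betw_nat_finite[OF finite_Basis] unfolding atLeast0LessThan by blast
 then have b: "bij_betw bs {..<DIM('a)} (Basis :: 'a set)" unfolding bs_def by (rule someI_ex)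
 show ?thesis using norm_le_l1[of x] sum.reindex_bij_betw[OF b, of "%b. \<bar>inner x b\<bar>"] by simp
qed

text \<open>Siblings at distance r contribute 1 / r to \<open>lam\<close>, so after scaling by L
  their difference has length at least d. If the heights agree, the d - 1 other coordinates cannot
  all differ by less than 1.\<close>

lemma sepd_cen:
 fixes x :: "nat list => nat => 'a::euclidean_space"
 assumes "x \<in> C_space rs" "L >= real DIM('a) * lam rs x"
 shows "sepd rs (near 1 (%p i c. L * cen rs x p i c)) (%p i. inner (x p i) (bs (DIM('a) - 1)))"
 using assms
proof (induction rs arbitrary: x)
 case (Cons n rs)
 let ?d = "DIM('a)"
 have L: "L >= real ?d * lam (n # rs) x" by (rule Cons.prems(2))
 have "inner (x [] i) (bs (?d - 1)) ~= inner (x [] j) (bs (?d - 1))"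
  if ij: "j < n" "i < j" and nr: "near 1 (%p i c. L * cen (n # rs) x p i c) [] i j" for i j
 proof
  assume e: "inner (x [] i) (bs (?d - 1)) = inner (x [] j) (bs (?d - 1))"
  have ne: "x [] i ~= x [] j" using Cons.prems(1) ij by auto
  define y where "y = x [] i - x [] j"
  have y: "norm y > 0" using ne by (simp add: y_def)
  have L0: "L >= 0" using L lam_nonneg[of "n # rs" x] by (meson mult_nonneg_nonneg of_nat_0_le_iff order_trans)
  have b: "L * \<bar>inner y (bs c)\<bar> <= 1" if c: "c < ?d" for c
  proof (cases "c < ?d - 1")
   case True
   have "\<bar>L * cen (n # rs) x [] i c - L * cen (n # rs) x [] j c\<bar> < 1" using nr unfolding near_def by blast
   then have "\<bar>L * inner y (bs c)\<bar> < 1" using True ij by (simp add: y_def inner_diff_left right_diff_distrib)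
   then show ?thesis using L0 by (simp add: abs_mult)
  next
   case False
   then have "c = ?d - 1" using c by simp
   then show ?thesis using e by (simp add: y_def inner_diff_left)
  qed
  have "L * norm y <= L * (\<Sum>c<?d. \<bar>inner y (bs c)\<bar>)" using norm_le_bs L0 by (intro mult_left_mono)
  also have "\<dots> = (\<Sum>c<?d. L * \<bar>inner y (bs c)\<bar>)" by (simp add: sum_distrib_left)
  also have "{..<?d} = insert (?d - 1) {..<?d - 1}" using DIM_positive[where 'a = 'a] by auto
  also have "(\<Sum>c\<in>insert (?d - 1) {..<?d - 1}. L * \<bar>inner y (bs c)\<bar>) = (\<Sum>c<?d - 1. L * \<bar>inner y (bs c)\<bar>)"
   using e by (simp add: y_def inner_diff_left)
  also have "\<dots> <= (\<Sum>c<?d - 1. 1)" using b by (intro sum_mono) auto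
  finally have u: "L * norm y <= real (?d - 1)" by simp
  have "real ?d * inverse (norm y) <= L"
   using L lam_ge(1)[of i n j x rs] ij by (intro order_trans[OF mult_left_mono L]) (auto simp: y_def)
  then have "real ?d * inverse (norm y) * norm y <= L * norm y" using y by (intro mult_right_mono) auto
  then have "real ?d * (inverse (norm y) * norm y) <= L * norm y" by (simp only: mult.assoc)
  moreover have "inverse (norm y) * norm y = 1" using y by simp
  ultimately have "real ?d <= L * norm y" by (simp only: mult_1_right)
  moreover have "real (?d - 1) < real ?d" using DIM_positive[where 'a = 'a] by simp
  ultimately show False using u by linarith
 qed
 moreover have "sepd rs (%q. near 1 (%p i c. L * cen (n # rs) x p i c) (l # q)) (%q i. inner (x (l # q) i) (bs (?d - 1)))" if l: "l < n" for l
 proof -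
  have "real ?d * lam rs (%q. x (l # q)) <= L" using lam_ge(2)[OF l, of rs x] by (intro order_trans[OF mult_left_mono L]) auto
  moreover have "(%q. x (l # q)) \<in> C_space rs" using Cons.prems(1) l by simp
  ultimately have "sepd rs (near 1 (%p i c. L * cen rs (%q. x (l # q)) p i c)) (%p i. inner (x (l # p) i) (bs (?d - 1)))"
   by (intro Cons.IH)
  moreover have "(%q i c. L * cen (n # rs) x (l # q) i c) = (%p i c. L * cen rs (%q. x (l # q)) p i c)" using l by simp
  ultimately show ?thesis unfolding near_sub by simp
 qed
 ultimately show ?case by simp
qed simp

section \<open>Relabellings acting at a single node\<close>

lemma perm_mono_id:
 assumes p: "p permutes {..<n::nat}" and m: "\<And>i j. i < j ==> j < n ==> p i < p j"
 shows "p = id"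
proof -
 have ge: "i <= q i" if "q permutes {..<n}" "\<And>i j. i < j ==> j < n ==> q i < q j" "i < n" for q :: "nat => nat" and i
  using that(3)
 proof (induction i)
  case (Suc i)
  then have "i <= q i" "q i < q (Suc i)" using that(2)[of i "Suc i"] by auto
  then show ?case by simp
 qed simp
 note pi = permutes_inverses[OF p]
 have m': "iv p i < iv p j" if ij: "i < j" "j < n" for i j
 proof (rule ccontr)
  assume a: "\<not> ?thesis"
  have "iv p i ~= iv p j" using ij(1) by (simp add: inj_eq[OF permutes_inj[OF permutes_inv[OF p]]])
  then have "iv p j < iv p i" using a by simp
  moreover have "iv p i < n" using ij perm_lt(2)[OF p] by simp
  ultimately have "p (iv p j) < p (iv p i)" by (rule m)
  then show False using ij pi by simp
 qed
 have "p i = i" for i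
 proof (cases "i < n")
  case True
  then have "p i < n" using perm_lt(1)[OF p] by simp
  then have "p i <= iv p (p i)" using ge[OF permutes_inv[OF p] m'] by blast
  then show ?thesis using ge[OF p m True] pi by simp
 qed (use perm_ge(1)[OF p] in simp)
 then show ?thesis by auto
qed

text \<open>If s is increasing on S and on its complement, then s after the representative of S
  differs from the representative of the image by an increasing permutation, and that is the
  identity.\<close>

lemma shuffle_unique:
 assumes S: "S \<subseteq> {..<n}" and s: "s permutes {..<n}"
  and m: "\<And>i j. i < j ==> j < n ==> (i \<in> S \<longleftrightarrow> j \<in> S) ==> s i < s j"
 shows "s \<circ> shuffle n S = shuffle n (s ` S)"
proof -
 let ?a = "shuffle n S" and ?b = "shuffle n (s ` S)"
 have S': "s ` S \<subseteq> {..<n}" using S permutes_image[OF s] by blast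
 have cS: "card (s ` S) = card S" using permutes_inj_on[OF s] by (rule card_image)
 note a = shuffle[OF S] and b = shuffle[OF S', unfolded cS]
 have cn: "card S <= n" using card_mono[OF _ S] by simp
 define p where "p = iv ?b \<circ> (s \<circ> ?a)"
 have p: "p permutes {..<n}" unfolding p_def by (intro permutes_compose permutes_inv a(1) b(1) s)
 have bp: "?b (p i) = s (?a i)" for i by (simp add: p_def permutes_inverses[OF b(1)])
 have aS: "?a i \<in> S \<longleftrightarrow> i < card S" for i
  using a(2) inj_image_mem_iff[OF permutes_inj[OF a(1)], of i "{..<card S}"] by simp
 have bS: "?b i \<in> s ` S \<longleftrightarrow> i < card S" for i
  using b(2) inj_image_mem_iff[OF permutes_inj[OF b(1)], of i "{..<card S}"] by simp
 have pS: "p i < card S \<longleftrightarrow> i < card S" for i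
  using bS[of "p i"] aS[of i] inj_image_mem_iff[OF permutes_inj[OF s], of "?a i" S] by (simp add: bp)
 have "p i < p j" if ij: "i < j" "j < n" for i j
 proof -
  have pn: "p i < n" "p j < n" using perm_lt(1)[OF p] ij by auto
  consider "j < card S" | "i < card S" "card S <= j" | "card S <= i" using ij by linarith
  then show ?thesis
  proof cases
   case 1
   have "?a i < ?a j" using a(3) 1 ij by (auto simp: strict_mono_on_def)
   then have "s (?a i) < s (?a j)" using 1 ij aS perm_lt(1)[OF a(1)] by (intro m) auto
   then have "?b (p i) < ?b (p j)" by (simp add: bp)
   then show ?thesis using strict_mono_on_less[OF b(3), of "p i" "p j"] pS 1 ij by auto
  next
   case 2
   then show ?thesis using pS[of i] pS[of j] by linarith
  next
   case 3
   have "?a i < ?a j" using a(4) 3 ij by (auto simp: strict_mono_on_def)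
   then have "s (?a i) < s (?a j)" using 3 ij aS perm_lt(1)[OF a(1)] by (intro m) auto
   then have "?b (p i) < ?b (p j)" by (simp add: bp)
   moreover have "card S <= p i" "card S <= p j" using pS[of i] pS[of j] 3 ij by linarith+
   ultimately show ?thesis using strict_mono_on_less[OF b(4), of "p i" "p j"] pn by auto
  qed
 qed
 from perm_mono_id[OF p this] have "?b \<circ> p = ?b" by simp
 then show ?thesis using bp by (simp add: fun_eq_iff)
qed

text \<open>The leftmost node stands for its whole level; \<open>nel l s\<close> permutes its
  children by s and does nothing else.\<close>

definition pi0 :: "nat => nat list" where "pi0 l = replicate l 0"

lemma pi0_simps [simp]: "pi0 0 = []" "pi0 (Suc l) = 0 # pi0 l"
 by (simp_all add: pi0_def)

definition nel :: "nat => (nat => nat) => nat list => nat => nat" where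
 "nel l s p = (if p = pi0 l then s else id)"

lemma nel_sub: "(%q. nel 0 s (j # q)) = (%_ a. a)" "(%q. nel (Suc l) s (0 # q)) = nel l s"
 "j ~= 0 ==> (%q. nel (Suc l) s (j # q)) = (%_ a. a)" "nel (Suc l) s [] = id" "nel 0 s [] = s"
 by (auto simp: nel_def fun_eq_iff)

lemma Sg_id': "(%_ a. a) \<in> Sigma_group rs"
 using Sg_id[of rs] by (simp add: id_def)

lemma nel_mem:
 assumes "\<And>n. n \<in> set rs ==> 1 <= n" "l < length rs" "s permutes {..<rs ! l}"
 shows "nel l s \<in> Sigma_group rs"
 using assms
proof (induction rs arbitrary: l)
 case (Cons n rs)
 have n: "1 <= n" using Cons.prems(1) by simp
 show ?case
 proof (cases l)
  case 0
  then show ?thesis using Cons.prems(3) by (simp add: nel_sub Sg_id') (simp add: nel_def)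
 next
  case (Suc l')
  have ih: "nel l' s \<in> Sigma_group rs" using Cons Suc by simp
  have "(%q. nel l s (j # q)) \<in> Sigma_group rs" for j
   unfolding Suc by (cases "j = 0") (simp_all add: nel_sub ih Sg_id')
  moreover have "nel l s (j # q) = id" if "n <= j" for j q using that n by (simp add: nel_def Suc)
  moreover have "nel l s [] permutes {..<n}" unfolding Suc nel_sub(4) by (rule permutes_id)
  ultimately show ?thesis by simp
 qed
qed simp

lemma gmul_nel: "gmul (nel l s) (nel l t) = nel l (s \<circ> t)"
proof (induction l)
 case 0
 show ?case by (rule path_ext) (simp_all add: nel_sub gmul_id, simp add: nel_def id_def)
next
 case (Suc l)
 show ?case
 proof (rule path_ext)
  show "gmul (nel (Suc l) s) (nel (Suc l) t) [] = nel (Suc l) (s \<circ> t) []" by (simp add: nel_sub)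
  fix j q
  have i: "iv id j = j" using iv_id by (simp add: id_def)
  show "gmul (nel (Suc l) s) (nel (Suc l) t) (j # q) = nel (Suc l) (s \<circ> t) (j # q)"
  proof (cases "j = 0")
   case True
   then show ?thesis using Suc i by (simp add: nel_sub) (simp add: nel_def o_def)
  next
   case False
   then show ?thesis using i by (simp add: nel_sub gmul_id) (simp add: nel_def id_def)
  qed
 qed
qed

lemma wr_nel_at: "l < length rs ==> wr_act rs (nel l s) x (pi0 l) = (%i. x (pi0 l) (iv s i))"
proof (induction rs arbitrary: l x)
 case (Cons n rs)
 have i: "iv id 0 = 0" using iv_id by (simp add: id_def)
 show ?case using Cons i by (cases l) (simp_all add: nel_sub)
qed simp

lemma wr_nel_off:
 "(\<And>P i. P ~= pi0 l ==> x P i = z) ==> P ~= pi0 l ==> wr_act rs (nel l s) x P i = z"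
proof (induction rs arbitrary: l x P)
 case (Cons n rs)
 have i: "iv id j = j" for j using iv_id by (simp add: id_def)
 show ?case
 proof (cases P)
  case Nil
  then obtain l' where l: "l = Suc l'" using Cons.prems(2) by (cases l) auto
  then show ?thesis using Nil Cons.prems(1)[of "[]"] by (simp add: nel_sub i)
 next
  case P: (Cons j q)
  show ?thesis
  proof (cases l)
   case 0
   then show ?thesis using P Cons.prems(1) by (simp add: nel_sub)
  next
   case (Suc l')
   show ?thesis
   proof (cases "j = 0")
    case True
    have "q ~= pi0 l'" using Cons.prems(2) P Suc True by simp
    then have "wr_act rs (nel l' s) (%q. x (0 # q)) q i = z" using Cons.prems(1) Suc by (intro Cons.IH) auto
    then show ?thesis using P Suc True by (simp add: nel_sub i)
   next
    case False
    then show ?thesis using P Suc Cons.prems(1)[of "j # q"] by (simp add: nel_sub i)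
   qed
  qed
 qed
qed simp

lemma keeps_all:
 assumes "g \<in> Sigma_group rs" "keeps rs g N" "\<And>P i j. N P i j" shows "g = (%_ a. a)"
 using assms
proof (induction rs arbitrary: g N)
 case Nil
 then show ?case by (auto simp: id_def)
next
 case (Cons n rs)
 note g = SgD[OF Cons.prems(1)]
 have "g [] = id" using Cons.prems(2,3) by (intro perm_mono_id[OF g(1)]) simp
 moreover have "(%q. g (j # q)) = (%_ a. a)" for j
 proof (cases "j < n")
  case True
  then have k: "keeps rs (%q. g (j # q)) (%q. N (j # q))" using Cons.prems(2) \<open>g [] = id\<close> by simp
  show ?thesis by (rule Cons.IH[OF g(2) k]) (rule Cons.prems(3))
 next
  case False
  then show ?thesis using g(3) by (simp add: fun_eq_iff)
 qed
 ultimately show ?case by (intro path_ext) (auto simp: fun_eq_iff)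
qed

text \<open>At every node but one all siblings are related, so g must be trivial there; at
  \<open>pi0 l\<close> only the order between S and its complement is free.\<close>

lemma keeps_nel:
 assumes "g \<in> Sigma_group rs" "l < length rs" "keeps rs g N"
  "\<And>P i j. P ~= pi0 l ==> N P i j" "\<And>i j. i < rs ! l ==> j < rs ! l ==> (i \<in> S \<longleftrightarrow> j \<in> S) ==> N (pi0 l) i j"
 shows "\<exists>s. s permutes {..<rs ! l} \<and> g = nel l s \<and> (\<forall>i j. i < j --> j < rs ! l --> (i \<in> S \<longleftrightarrow> j \<in> S) --> s i < s j)"
 using assms
proof (induction rs arbitrary: g N l)
 case (Cons n rs)
 note g = SgD[OF Cons.prems(1)]
 have out: "(%q. g (j # q)) = (%_ a. a)" if "n <= j" for j using g(3)[OF that] by (simp add: fun_eq_iff)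
 show ?case
 proof (cases l)
  case 0
  have "(%q. g (j # q)) = (%_ a. a)" for j
  proof (cases "j < n")
   case True
   define m where "m = iv (g []) j"
   have m: "m < n" "g [] m = j" using True perm_lt(2)[OF g(1)] permutes_inverses[OF g(1)] by (simp_all add: m_def)
   then have k: "keeps rs (%q. g (j # q)) (%q. N (m # q))" using Cons.prems(3) by force
   show ?thesis by (rule keeps_all[OF g(2) k]) (rule Cons.prems(4), simp add: 0)
  next
   case False
   then show ?thesis using out by simp
  qed
  then have "g = nel l (g [])" by (intro path_ext) (auto simp: 0 nel_def fun_eq_iff)
  moreover have "g [] i < g [] j" if "i < j" "j < n" "i \<in> S \<longleftrightarrow> j \<in> S" for i j
   using Cons.prems(3) Cons.prems(5)[of i j] that 0 by simp
  ultimately show ?thesis using g(1) 0 by (intro exI[of _ "g []"]) simp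
 next
  case (Suc l')
  have gid: "g [] = id"
  proof (rule perm_mono_id[OF g(1)])
   fix i j assume "i < j" "j < n"
   then show "g [] i < g [] j" using Cons.prems(3) Cons.prems(4)[of "[]" i j] Suc by simp
  qed
  have k: "keeps rs (%q. g (j # q)) (%q. N (j # q))" if "j < n" for j using Cons.prems(3) gid that by simp
  have other: "(%q. g (j # q)) = (%_ a. a)" if j: "j ~= 0" for j
  proof (cases "j < n")
   case True
   show ?thesis by (rule keeps_all[OF g(2) k[OF True]]) (rule Cons.prems(4), simp add: Suc j)
  next
   case False
   then show ?thesis using out by simp
  qed
  show ?thesis
  proof (cases "n = 0")
   case True
   have "(%q. g (0 # q)) = (%_ a. a)" using out[of 0] True by simp
   then have all: "(%q. g (j # q)) = (%_ a. a)" for j using other[of j] by (cases "j = 0") simp_all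
   have "g = nel l id"
   proof (rule path_ext)
    show "g [] = nel l id []" using gid by (simp add: nel_def)
    show "g (j # q) = nel l id (j # q)" for j q using fun_cong[OF all[of j], of q] by (simp add: nel_def id_def)
   qed
   show ?thesis
   proof (intro exI[of _ id] conjI allI impI)
    show "id permutes {..<(n # rs) ! l}" by (rule permutes_id)
    show "g = nel l id" by fact
    show "id i < id j" if "i < j" for i j :: nat using that by simp
   qed
  next
   case False
   have "\<exists>s. s permutes {..<rs ! l'} \<and> (%q. g (0 # q)) = nel l' s \<and> (\<forall>i j. i < j --> j < rs ! l' --> (i \<in> S \<longleftrightarrow> j \<in> S) --> s i < s j)"
   proof (rule Cons.IH[OF g(2) _ k])
    show "N (0 # P) i j" if "P ~= pi0 l'" for P i j using Cons.prems(4) Suc that by simp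
    show "N (0 # pi0 l') i j" if "i < rs ! l'" "j < rs ! l'" "i \<in> S \<longleftrightarrow> j \<in> S" for i j
     using Cons.prems(5)[of i j] that Suc by simp
   qed (use Cons.prems(2) Suc False in auto)
   then obtain s where s: "s permutes {..<rs ! l'}" "(%q. g (0 # q)) = nel l' s" "\<forall>i j. i < j --> j < rs ! l' --> (i \<in> S \<longleftrightarrow> j \<in> S) --> s i < s j" by blast
   have "g = nel l s"
   proof (rule path_ext)
    show "g [] = nel l s []" using gid Suc by (simp add: nel_def)
    fix j q
    show "g (j # q) = nel l s (j # q)"
    proof (cases "j = 0")
     case True
     then show ?thesis using fun_cong[OF s(2), of q] Suc by (simp add: nel_def)
    next
     case False
     then show ?thesis using fun_cong[OF other[OF False], of q] Suc by (simp add: nel_def id_def)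
    qed
   qed
   then show ?thesis using s Suc by (intro exI[of _ s]) simp
  qed
 qed
qed simp

section \<open>Integer combinations of binomial coefficients\<close>

lemma bezout_sum:
 fixes a :: "'i => int"
 assumes "finite I" shows "\<exists>k. (\<Sum>i\<in>I. k i * a i) = Gcd (a ` I)"
 using assms
proof (induction I rule: finite_induct)
 case (insert i I)
 then obtain k where k: "(\<Sum>i\<in>I. k i * a i) = Gcd (a ` I)" by blast
 obtain x y where xy: "x * a i + y * Gcd (a ` I) = gcd (a i) (Gcd (a ` I))" using bezout_int by blast
 have "(\<Sum>j\<in>insert i I. (if j = i then x else y * k j) * a j) = x * a i + (\<Sum>j\<in>I. y * k j * a j)"
  using insert by (simp add: sum.insert) (intro sum.cong, auto)
 also have "\<dots> = Gcd (a ` insert i I)" using xy k by (simp add: sum_distrib_left[symmetric] mult.assoc)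
 finally show ?case by (intro exI[of _ "%j. if j = i then x else y * k j"])
qed simp

text \<open>Without a common prime the gcd is 1. The value - 1 is the one that cancels the degree 1
  of the identity.\<close>

lemma no_prime_bezout:
 fixes a :: "'i => nat"
 assumes "finite I" "\<not> (\<exists>p. prime p \<and> (\<forall>i\<in>I. p dvd a i))"
 obtains k :: "'i => int" where "(\<Sum>i\<in>I. k i * int (a i)) = -1"
proof -
 have "Gcd (a ` I) = 1"
 proof (rule ccontr)
  assume "Gcd (a ` I) ~= 1"
  then obtain p where p: "prime p" "p dvd Gcd (a ` I)" using prime_factor_nat by blast
  then have "\<forall>i\<in>I. p dvd a i" by (auto intro: dvd_trans[OF _ Gcd_dvd])
  then show False using assms(2) p(1) by blast
 qed
 then have g1: "Gcd ((%i. int (a i)) ` I) = 1" using Gcd_int_eq[of "a ` I"] by (simp add: image_image)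
 have "\<exists>k. (\<Sum>i\<in>I. k i * int (a i)) = 1" using bezout_sum[OF assms(1), of "%i. int (a i)"] unfolding g1 .
 then obtain k where "(\<Sum>i\<in>I. k i * int (a i)) = 1" ..
 then have "(\<Sum>i\<in>I. - k i * int (a i)) = -1" by (simp add: sum_negf)
 then show ?thesis by (rule that)
qed

section \<open>Orbits of caps\<close>

text \<open>Indices of linearly independent test vectors: \<open>fw\<close> is the i-th unit vector
  minus the last one at the given node, in component c = 0. Each node contributes one less than its
  arity, which telescopes to one less than the number of leaves.\<close>

fun fr :: "nat list => (nat list \<times> nat) set" where
 "fr [] = {}"
| "fr (n # rs) = (%i. ([], i)) ` {..<n - 1} \<union> (%(j, p, i). (j # p, i)) ` ({..<n} \<times> fr rs)"

fun fw :: "nat list => nat list => nat => nat list => nat => nat => real" where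
 "fw (n # rs) [] i [] i' c = (if c = 0 then if i' = i then 1 else if i' = n - 1 then -1 else 0 else 0)"
| "fw (n # rs) (j # p) i (j' # q) i' c = (if j' = j then fw rs p i q i' c else 0)"
| "fw _ _ _ _ _ _ = 0"

lemma finite_fr: "finite (fr rs)"
 by (induction rs) auto

lemma card_fr: "(\<And>n. n \<in> set rs ==> 1 <= n) ==> card (fr rs) + 1 = prod_list rs"
proof (induction rs)
 case (Cons n rs)
 have n: "1 <= n" using Cons.prems by simp
 have "card (fr (n # rs)) = card ((%i. ([], i) :: nat list \<times> nat) ` {..<n - 1}) + card ((%(j, p, i). (j # p, i)) ` ({..<n} \<times> fr rs))"
  unfolding fr.simps using finite_fr by (intro card_Un_disjoint) auto
 also have "card ((%i. ([], i) :: nat list \<times> nat) ` {..<n - 1}) = n - 1" by (subst card_image) (auto simp: inj_on_def)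
 also have "card ((%(j, p, i). (j # p, i)) ` ({..<n} \<times> fr rs)) = n * card (fr rs)"
  by (subst card_image) (auto simp: inj_on_def card_cartesian_product)
 finally have "card (fr (n # rs)) + 1 = n * (card (fr rs) + 1)" using n by simp
 moreover have "card (fr rs) + 1 = prod_list rs" using Cons.IH Cons.prems by simp
 ultimately show ?case by (simp only: prod_list.Cons)
qed simp

lemma fw_W: "d >= 2 ==> (p, i) \<in> fr rs ==> fw rs p i \<in> W_space d rs"
proof (induction rs arbitrary: p)
 case (Cons n rs)
 show ?case
 proof (cases p)
  case Nil
  then have i: "i < n - 1" using Cons.prems by auto
  have "(\<Sum>i'<n. if i' = i then 1 else if i' = n - 1 then -1 else (0::real)) = (\<Sum>i'\<in>{i, n - 1}. if i' = i then 1 else if i' = n - 1 then -1 else 0)"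
   using i by (intro sum.mono_neutral_right) auto
  also have "\<dots> = 0" using i by simp
  finally have sm: "(\<Sum>i'<n. fw (n # rs) [] i [] i' c) = 0" for c by (cases "c = 0") simp_all
  have z: "(%q. fw (n # rs) [] i (j # q)) = (%_ _ _. 0)" for j by (simp add: fun_eq_iff)
  show ?thesis unfolding Nil W_space.simps mem_Collect_eq
  proof (intro conjI allI impI)
   show "(\<Sum>i'<n. fw (n # rs) [] i [] i' c) = 0" for c by (rule sm)
   show "(%q. fw (n # rs) [] i (j # q)) \<in> W_space d rs" for j unfolding z by (rule W_0)
   show "fw (n # rs) [] i [] i' c = 0" if "n <= i' \<or> d - 1 <= c" for i' c
    using that i Cons.prems(1) by auto
  qed simp
 next
  case (Cons j q)
  then have jq: "j < n" "(q, i) \<in> fr rs" using Cons.prems by auto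
  have "(%q'. fw (n # rs) p i (j' # q')) = (if j' = j then fw rs q i else (%_ _ _. 0))" for j'
   using Cons by (simp add: fun_eq_iff)
  then show ?thesis using Cons Cons.IH[OF Cons.prems(1) jq(2)] W_0 jq(1) by auto
 qed
qed simp

lemma fw_dual: "(p, i) \<in> fr rs ==> (q, i') \<in> fr rs ==> fw rs p i q i' 0 = (if q = p \<and> i' = i then 1 else 0)"
proof (induction rs arbitrary: p q)
 case (Cons n rs)
 then show ?case by (cases p; cases q) auto
qed simp

lemma independent_Wf:
 assumes d: "d >= 2" and rs: "\<And>n. n \<in> set rs ==> 1 <= n"
 obtains B where "B \<subseteq> Wf d rs" "independent B" "finite B" "card B + 1 = prod_list rs"
proof -
 define b where "b x = vec (fw rs (fst x) (snd x))" for x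
 have cob: "co (b x) (fst y, snd y, 0) = (if y = x then 1 else 0)" if xy: "x \<in> fr rs" "y \<in> fr rs" for x y
 proof -
  have "fn (b x) = fw rs (fst x) (snd x)" unfolding b_def by (rule fn_vec[OF fw_W[OF d]]) (use xy in simp)
  then have "co (b x) (fst y, snd y, 0) = fw rs (fst x) (snd x) (fst y) (snd y) 0" unfolding fn_def by metis
  then show ?thesis using fw_dual[of "fst x" "snd x" rs "fst y" "snd y"] xy by (simp add: prod_eq_iff)
 qed
 have inj: "inj_on b (fr rs)"
 proof (rule inj_onI)
  fix x y assume xy: "x \<in> fr rs" "y \<in> fr rs" "b x = b y"
  then show "x = y" using cob[of x x] cob[of y x] by (auto split: if_splits)
 qed
 show thesis
 proof (rule that[of "b ` fr rs"])
  show "b ` fr rs \<subseteq> Wf d rs" unfolding b_def using fw_W[OF d] vec_Wf by fastforce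
  show "finite (b ` fr rs)" using finite_fr by simp
  show "card (b ` fr rs) + 1 = prod_list rs" using card_image[OF inj] card_fr[OF rs] by simp
  show "independent (b ` fr rs)"
  proof
   assume "dependent (b ` fr rs)"
   then obtain x where x: "x \<in> fr rs" "b x \<in> span (b ` fr rs - {b x})" unfolding dependent_def by blast
   have "span (b ` fr rs - {b x}) \<subseteq> {v. co v (fst x, snd x, 0) = 0}"
   proof (rule span_minimal)
    show "b ` fr rs - {b x} \<subseteq> {v. co v (fst x, snd x, 0) = 0}" using cob x(1) by auto
    show "subspace {v. co v (fst x, snd x, 0) = 0}" by (rule subspaceI) (simp_all add: co_ops)
   qed
   then show False using x cob[OF x(1) x(1)] by auto
  qed
 qed
qed

text \<open>Arities with product at most 4 are powers of one prime, namely of 2 or of 3. Together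
  with \<open>independent_Wf\<close> this yields the four dimensions that
  \<open>generic_plane\<close> asks for.\<close>

lemma prod_ge_5:
 assumes rs: "\<And>n. n \<in> set rs ==> 2 <= n"
  and np: "\<not> (\<exists>p. prime p \<and> (\<forall>n\<in>set rs. \<forall>m. 0 < m --> m < n --> p dvd (n choose m)))"
 shows "prod_list rs >= 5"
proof (rule ccontr)
 assume a: "\<not> prod_list rs >= 5"
 have pos: "prod_list rs > 0" using rs by (induction rs) (auto, force)
 have le: "n <= 4" if "n \<in> set rs" for n
 proof -
  have "n dvd prod_list rs" using that by (rule prod_list_dvd)
  then have "n <= prod_list rs" using pos by (rule dvd_imp_le)
  then show ?thesis using a by simp
 qed
 have c4: "even (4 choose m)" if "0 < m" "m < 4" for m :: nat
 proof -
  have "m = 1 \<or> m = 2 \<or> m = 3" using that by arith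
  moreover have "4 choose 1 = (4::nat)" "4 choose 2 = (6::nat)" "4 choose 3 = (4::nat)" by (simp_all add: numeral_eq_Suc)
  ultimately show ?thesis by auto
 qed
 show False
 proof (cases "3 \<in> set rs")
  case True
  have "n = 3" if n: "n \<in> set rs" for n
  proof (rule ccontr)
   assume "n ~= 3"
   then have n24: "n = 2 \<or> n = 4" using le[OF n] rs[OF n] by arith
   have "3 dvd prod_list rs" using True by (rule prod_list_dvd)
   moreover have "2 dvd prod_list rs" using dvd_trans[of 2 n, OF _ prod_list_dvd[OF n]] n24 by auto
   moreover have "prod_list rs = 1 \<or> prod_list rs = 2 \<or> prod_list rs = 3 \<or> prod_list rs = 4" using pos a by arith
   ultimately show False by auto
  qed
  note n3 = this
  have c3: "3 dvd (3 choose m)" if "0 < m" "m < 3" for m :: nat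
  proof -
   have "m = 1 \<or> m = 2" using that by arith
   then show ?thesis by (auto simp: numeral_eq_Suc)
  qed
  have "\<forall>n\<in>set rs. \<forall>m. 0 < m --> m < n --> 3 dvd (n choose m)"
  proof (intro ballI allI impI)
   fix n m assume "n \<in> set rs" "0 < m" "m < n"
   then show "3 dvd (n choose m)" using c3[of m] n3[of n] by simp
  qed
  moreover have "prime (3::nat)" by simp
  ultimately have "\<exists>p. prime p \<and> (\<forall>n\<in>set rs. \<forall>m. 0 < m --> m < n --> p dvd (n choose m))"
   by (intro exI[of _ "3::nat"] conjI)
  then show False using np by (rule notE[rotated])
 next
  case False
  have "even (n choose m)" if n: "n \<in> set rs" and m: "0 < m" "m < n" for n m
  proof -
   have "n ~= 3" using False n by blast
   then have "n = 2 \<or> n = 4" using le[OF n] rs[OF n] by arith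
   then show ?thesis
   proof
    assume "n = 2"
    then have "m = 1" using m by arith
    then show ?thesis using \<open>n = 2\<close> by simp
   qed (use c4 m in auto)
  qed
  then have "\<forall>n\<in>set rs. \<forall>m. 0 < m --> m < n --> 2 dvd (n choose m)" by (intro ballI allI impI)
  then have "\<exists>p. prime p \<and> (\<forall>n\<in>set rs. \<forall>m. 0 < m --> m < n --> p dvd (n choose m))"
   using two_is_prime_nat by (intro exI[of _ "2::nat"] conjI)
  then show False using np by (rule notE[rotated])
 qed
qed

lemma W_single:
 "d >= 2 ==> (\<And>n. n \<in> set rs ==> 1 <= n) ==> l < length rs ==> (\<Sum>i<rs ! l. v i) = 0 ==>
  (%p i c. if p = pi0 l \<and> c = 0 \<and> i < rs ! l then v i else 0) \<in> W_space d rs"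
proof (induction rs arbitrary: l)
 case (Cons n rs)
 have n: "1 <= n" using Cons.prems(2) by simp
 show ?case
 proof (cases l)
  case 0
  have "(\<Sum>i<n. if c = 0 then v i else 0) = 0" for c :: nat using Cons.prems(4) 0 by (cases "c = 0") simp_all
  then show ?thesis using 0 Cons.prems W_0[of d rs] by auto
 next
  case (Suc l')
  have "(%p i c. if p = pi0 l' \<and> c = 0 \<and> i < rs ! l' then v i else 0) \<in> W_space d rs"
   using Cons.prems Suc by (intro Cons.IH) auto
  then have "(%q i c. if j = 0 \<and> q = pi0 l' \<and> c = 0 \<and> i < rs ! l' then v i else 0) \<in> W_space d rs" for j :: nat
   using W_0[of d rs] by (cases "j = 0") simp_all
  then show ?thesis using Suc n by auto
 qed
qed simp

section \<open>Tubes around two-cluster vectors\<close>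

locale cap_orbit =
 fixes d :: nat and rs :: "nat list" and B :: "fsv set"
 assumes d: "d >= 2" and rs: "\<And>n. n \<in> set rs ==> 2 <= n"
  and B: "B \<subseteq> Wf d rs" "independent B" "finite B" "card B >= 4"
begin

abbreviation "W \<equiv> Wf d rs"

text \<open>One tube for each level and each proper nonempty set of children of its leftmost node,
  so \<open>rs ! l choose m\<close> tubes of each size m.\<close>

definition "Ix = Sigma {..<length rs} (%l. {S. S \<subseteq> {..<rs ! l} \<and> S ~= {} \<and> S ~= {..<rs ! l}})"

text \<open>Two clusters of m and \<open>rs ! l - m\<close> siblings, with values weighted so that
  the sum is 0.\<close>

definition rw :: "nat => nat => nat => real" where
 "rw l m i = (if i < m then - real (rs ! l - m) else real m)"

definition raw :: "nat => nat => nat list => nat => nat => real" where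
 "raw l m = (%p i c. if p = pi0 l \<and> c = 0 \<and> i < rs ! l then rw l m i else 0)"

definition p0 :: "nat => nat => fsv" where "p0 l m = sgn (vec (raw l m))"

definition u0 :: "nat => nat => fsv" where "u0 l m = (SOME u. u \<in> W \<and> onp (p0 l m) u)"

text \<open>The frame is chosen once for each level and size and transported by
  \<open>shuffle\<close>, so that the relabellings in question map frames to frames in spite of the
  arbitrary choice of \<open>u0\<close>.\<close>

definition pc :: "nat \<times> nat set => fsv" where
 "pc x = av rs (nel (fst x) (shuffle (rs ! fst x) (snd x))) (p0 (fst x) (card (snd x)))"

definition uc :: "nat \<times> nat set => fsv" where
 "uc x = av rs (nel (fst x) (shuffle (rs ! fst x) (snd x))) (u0 (fst x) (card (snd x)))"

lemma rs1: "n \<in> set rs ==> 1 <= n" using rs by force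

lemma finite_Ix: "finite Ix"
 unfolding Ix_def by (intro finite_SigmaI) (auto intro: finite_subset[of _ "Pow {..<_}"])

lemma IxD:
 assumes "(l, S) \<in> Ix"
 shows "l < length rs" "S \<subseteq> {..<rs ! l}" "0 < card S" "card S < rs ! l"
proof -
 show l: "l < length rs" and S: "S \<subseteq> {..<rs ! l}" using assms by (auto simp: Ix_def)
 have "S ~= {}" "S \<subset> {..<rs ! l}" using assms by (auto simp: Ix_def)
 moreover have "finite S" using S finite_subset by blast
 ultimately show "0 < card S" "card S < rs ! l" using psubset_card_mono[of "{..<rs ! l}" S] by (auto simp: card_gt_0_iff)
qed

lemma raw_W: "l < length rs ==> m <= rs ! l ==> raw l m \<in> W_space d rs"
 unfolding raw_def
proof (rule W_single[OF d rs1])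
 assume m: "m <= rs ! l"
 have "(\<Sum>i<rs ! l. rw l m i) = (\<Sum>i\<in>{..<rs ! l} \<inter> {i. i < m}. - real (rs ! l - m)) + (\<Sum>i\<in>{..<rs ! l} \<inter> - {i. i < m}. real m)"
  unfolding rw_def by (rule sum.If_cases) simp
 also have "{..<rs ! l} \<inter> {i. i < m} = {..<m}" using m by auto
 also have "{..<rs ! l} \<inter> - {i. i < m} = {m..<rs ! l}" by auto
 finally show "(\<Sum>i<rs ! l. rw l m i) = 0" by simp
qed

lemma p0:
 assumes l: "l < length rs" and m: "0 < m" "m < rs ! l"
 shows "p0 l m \<in> W" "norm (p0 l m) = 1" "\<exists>r>0. fn (p0 l m) = (%p i c. r * raw l m p i c)"
proof -
 have W: "raw l m \<in> W_space d rs" using raw_W l m by simp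
 have f: "fn (vec (raw l m)) = raw l m" by (rule fn_vec[OF W])
 have "raw l m (pi0 l) 0 0 ~= 0" using m by (simp add: raw_def rw_def)
 then have nz: "vec (raw l m) ~= 0" using f by (metis fn_ops(1))
 show "p0 l m \<in> W" unfolding p0_def sgn_div_norm by (intro subspace_scale[OF subspace_Wf] vec_Wf W)
 show "norm (p0 l m) = 1" using nz by (simp add: p0_def norm_sgn)
 show "\<exists>r>0. fn (p0 l m) = (%p i c. r * raw l m p i c)"
  unfolding p0_def sgn_div_norm fn_ops f using nz by (intro exI[of _ "inverse (norm (vec (raw l m)))"]) simp
qed

lemma u0:
 assumes l: "l < length rs" and m: "0 < m" "m < rs ! l"
 shows "u0 l m \<in> W" "onp (p0 l m) (u0 l m)"
proof -
 note p = p0[OF assms]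
 have "\<not> W \<subseteq> span {p0 l m}"
 proof
  assume "W \<subseteq> span {p0 l m}"
  then have "card B <= card {p0 l m}" using independent_span_bound[OF _ B(2), of "{p0 l m}"] B(1) by auto
  then show False using B(4) by simp
 qed
 then obtain v where v: "v \<in> W" "v \<notin> span {p0 l m}" by blast
 have ind: "a = 0 \<and> b = 0" if e: "a *\<^sub>R p0 l m + b *\<^sub>R v = 0" for a b
 proof -
  have b: "b = 0"
  proof (rule ccontr)
   assume b: "b ~= 0"
   have "(- a / b) *\<^sub>R p0 l m \<in> span {p0 l m}" by (intro span_scale span_base) simp
   moreover have "b *\<^sub>R v = (- a) *\<^sub>R p0 l m" using e by (simp only: scaleR_minus_left eq_neg_iff_add_eq_0 add.commute)
   then have "(1 / b) *\<^sub>R (b *\<^sub>R v) = (1 / b) *\<^sub>R ((- a) *\<^sub>R p0 l m)" by (rule arg_cong)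
   then have "v = (- a / b) *\<^sub>R p0 l m" using b by simp
   ultimately show False using v(2) by simp
  qed
  have "p0 l m ~= 0" using p(2) by auto
  then show ?thesis using e b by simp
 qed
 note g = gs_onp[of "p0 l m" v, OF ind]
 have s: "sgn (p0 l m) = p0 l m" using p(2) by (simp add: sgn_div_norm)
 have "gs2 (p0 l m) v \<in> W" unfolding gs2_def s sgn_div_norm[of "v - _"]
  using p(1) v(1) by (intro subspace_scale[OF subspace_Wf] subspace_diff[OF subspace_Wf])
 then have "gs2 (p0 l m) v \<in> W \<and> onp (p0 l m) (gs2 (p0 l m) v)" using g(3)[unfolded s] by (rule conjI)
 then have "\<exists>u. u \<in> W \<and> onp (p0 l m) u" by (rule exI)
 from someI_ex[OF this] show "u0 l m \<in> W" "onp (p0 l m) (u0 l m)" unfolding u0_def by (rule conjunct1, rule conjunct2)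
qed

lemma nel_Sg: "(l, S) \<in> Ix ==> nel l (shuffle (rs ! l) S) \<in> Sigma_group rs"
 using IxD[of l S] shuffle(1)[of S "rs ! l"] rs1 by (intro nel_mem) auto

lemma pc_uc:
 assumes "(l, S) \<in> Ix"
 shows "pc (l, S) \<in> W" "uc (l, S) \<in> W" "onp (pc (l, S)) (uc (l, S))"
proof -
 note D = IxD[OF assms] and n = nel_Sg[OF assms]
 note p = p0[OF D(1,3,4)] and u = u0[OF D(1,3,4)]
 show "pc (l, S) \<in> W" "uc (l, S) \<in> W" unfolding pc_def uc_def using av_Wf[OF n] p(1) u(1) by simp_all
 show "onp (pc (l, S)) (uc (l, S))" using u(2) unfolding onp_def pc_def uc_def
  by (simp add: av_norm[OF n p(1)] av_norm[OF n u(1)] av_inner[OF n p(1) u(1)])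
qed

lemma pc_at:
 assumes x: "(l, S) \<in> Ix"
 obtains r where "r > 0" "\<And>i c. i < rs ! l ==> fn (pc (l, S)) (pi0 l) i c = (if c = 0 then r * (if i \<in> S then - real (rs ! l - card S) else real (card S)) else 0)"
  "\<And>P i c. P ~= pi0 l ==> fn (pc (l, S)) P i c = 0"
proof -
 note D = IxD[OF x] and n = nel_Sg[OF x]
 note sh = shuffle[OF D(2)]
 obtain r where r: "r > 0" "fn (p0 l (card S)) = (%p i c. r * raw l (card S) p i c)" using p0(3)[OF D(1,3,4)] by blast
 have f: "fn (pc (l, S)) = wr_act rs (nel l (shuffle (rs ! l) S)) (%p i c. r * raw l (card S) p i c)"
  unfolding pc_def fst_conv snd_conv fn_av[OF n p0(1)[OF D(1,3,4)]] r(2) ..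
 have inS: "iv (shuffle (rs ! l) S) i < card S \<longleftrightarrow> i \<in> S" for i
  using sh(2) inj_image_mem_iff[OF permutes_inj[OF sh(1)], of "iv (shuffle (rs ! l) S) i" "{..<card S}"]
  by (simp add: permutes_inverses[OF sh(1)])
 show thesis
 proof (rule that[OF r(1)])
  fix i c assume i: "i < rs ! l"
  then show "fn (pc (l, S)) (pi0 l) i c = (if c = 0 then r * (if i \<in> S then - real (rs ! l - card S) else real (card S)) else 0)"
   unfolding f wr_nel_at[OF D(1)] using perm_lt(2)[OF sh(1)] inS by (simp add: raw_def rw_def)
 next
  fix P i c assume P: "P ~= pi0 l"
  have "wr_act rs (nel l (shuffle (rs ! l) S)) (%p i c. r * raw l (card S) p i c) P i = (%_. 0)"
   by (rule wr_nel_off[OF _ P]) (simp add: raw_def fun_eq_iff)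
  then show "fn (pc (l, S)) P i c = 0" unfolding f by simp
 qed
qed

text \<open>The level is visible in the support of the vector, the set S in the signs of its
  entries.\<close>

lemma inj_pc: "inj_on pc Ix"
proof (rule inj_onI, clarify)
 fix l S l' S' assume x: "(l, S) \<in> Ix" and x': "(l', S') \<in> Ix" and e: "pc (l, S) = pc (l', S')"
 note D = IxD[OF x] and D' = IxD[OF x']
 obtain r where r: "r > 0" "\<And>i c. i < rs ! l ==> fn (pc (l, S)) (pi0 l) i c = (if c = 0 then r * (if i \<in> S then - real (rs ! l - card S) else real (card S)) else 0)"
  by (rule pc_at[OF x]) (rule that)
 obtain r' where r': "r' > 0" "\<And>i c. i < rs ! l' ==> fn (pc (l', S')) (pi0 l') i c = (if c = 0 then r' * (if i \<in> S' then - real (rs ! l' - card S') else real (card S')) else 0)"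
  "\<And>P i c. P ~= pi0 l' ==> fn (pc (l', S')) P i c = 0" by (rule pc_at[OF x']) (rule that)
 have nz: "fn (pc (l, S)) (pi0 l) 0 0 ~= 0" using r D by (subst r(2)) (auto simp: mult_less_0_iff)
 have "pi0 l = pi0 l'" using nz r'(3)[of "pi0 l" 0 0] e by metis
 then have ll: "l = l'" by (simp add: pi0_def)
 have "i \<in> S \<longleftrightarrow> i \<in> S'" if i: "i < rs ! l" for i
 proof -
  have "i \<in> S \<longleftrightarrow> fn (pc (l, S)) (pi0 l) i 0 < 0" using r D i by (simp add: mult_less_0_iff)
  moreover have "i \<in> S' \<longleftrightarrow> fn (pc (l', S')) (pi0 l') i 0 < 0" using r' D' i ll by (simp add: mult_less_0_iff)
  ultimately show ?thesis using e ll by simp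
 qed
 then have "S = S'" using D(2) D'(2) ll by blast
 then show "l = l' \<and> S = S'" using ll by simp
qed

abbreviation "cp k x z \<equiv> cap (1 / 8) (k (fst x) (card (snd x))) (pc x) (uc x) z"

text \<open>Where a tube of radius 1 / 8 is active, z is within 1 / 4 of the ray of
  \<open>pc (l, S)\<close>, so siblings with equal entries on the ray are near in z. Hence g is
  \<open>nel l s\<close> with s increasing on S and on its complement, and it carries the frame of S
  to that of its image. This is why one node per level is enough.\<close>

lemma cap_move:
 assumes g: "g \<in> Sigma_group rs" and z: "z \<in> W" and k: "keeps rs g (near 1 (fn z))"
  and x: "(l, S) \<in> Ix" and ne: "cp \<kappa> (l, S) z ~= 0"
 obtains S' where "(l, S') \<in> Ix" "cp \<kappa> (l, S') (av rs g z) = av rs g (cp \<kappa> (l, S) z)"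
proof -
 note D = IxD[OF x] and n = nel_Sg[OF x]
 note p = p0(1)[OF D(1,3,4)] and u = u0(1)[OF D(1,3,4)]
 obtain r where r: "\<And>i c. i < rs ! l ==> fn (pc (l, S)) (pi0 l) i c = (if c = 0 then r * (if i \<in> S then - real (rs ! l - card S) else real (card S)) else 0)"
  "\<And>P i c. P ~= pi0 l ==> fn (pc (l, S)) P i c = 0" by (rule pc_at[OF x]) (rule that)
 define t where "t = inner (pc (l, S)) z"
 have nz: "norm (z - t *\<^sub>R pc (l, S)) < 1 / 4" using cap_active(2)[OF pc_uc(3)[OF x] _ ne] by (simp add: t_def)
 have cl: "\<bar>fn z P i c - t * fn (pc (l, S)) P i c\<bar> < 1 / 4" for P i c
 proof -
  have "norm (un (P, i, c)) = 1" by (simp add: norm_eq_1 inner_un co_un)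
  then have "\<bar>co (z - t *\<^sub>R pc (l, S)) (P, i, c)\<bar> <= norm (z - t *\<^sub>R pc (l, S))"
   using Cauchy_Schwarz_ineq2[of "un (P, i, c)" "z - t *\<^sub>R pc (l, S)"] by (simp add: inner_un)
  then show ?thesis using nz by (simp add: fn_def co_ops)
 qed
 have nr: "near 1 (fn z) P i j" if e: "\<And>c. fn (pc (l, S)) P i c = fn (pc (l, S)) P j c" for P i j
  unfolding near_def
 proof
  fix c
  show "\<bar>fn z P i c - fn z P j c\<bar> < 1" using cl[of P i c] cl[of P j c] e[of c] by (simp add: abs_if split: if_splits)
 qed
 have "\<exists>s. s permutes {..<rs ! l} \<and> g = nel l s \<and> (\<forall>i j. i < j --> j < rs ! l --> (i \<in> S \<longleftrightarrow> j \<in> S) --> s i < s j)"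
 proof (rule keeps_nel[OF g D(1) k])
  show "near 1 (fn z) P i j" if "P ~= pi0 l" for P i j by (rule nr) (simp add: r(2)[OF that])
  show "near 1 (fn z) (pi0 l) i j" if "i < rs ! l" "j < rs ! l" "i \<in> S \<longleftrightarrow> j \<in> S" for i j
   by (rule nr) (simp add: r(1) that)
 qed
 then obtain s where s: "s permutes {..<rs ! l}" "g = nel l s" "\<And>i j. i < j ==> j < rs ! l ==> (i \<in> S \<longleftrightarrow> j \<in> S) ==> s i < s j" by blast
 define S' where "S' = s ` S"
 have cS: "card S' = card S" unfolding S'_def using permutes_inj_on[OF s(1)] by (rule card_image)
 have S'n: "S' \<subseteq> {..<rs ! l}" unfolding S'_def using D(2) permutes_image[OF s(1)] by blast
 have x': "(l, S') \<in> Ix" using D S'n cS by (auto simp: Ix_def)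
 have sh: "s \<circ> shuffle (rs ! l) S = shuffle (rs ! l) S'" unfolding S'_def by (rule shuffle_unique[OF D(2) s(1,3)])
 have mv: "av rs g (av rs (nel l (shuffle (rs ! l) S)) v) = av rs (nel l (shuffle (rs ! l) S')) v" if v: "v \<in> W" for v
 proof (rule fn_inj)
  show "fn (av rs g (av rs (nel l (shuffle (rs ! l) S)) v)) = fn (av rs (nel l (shuffle (rs ! l) S')) v)"
   unfolding fn_av[OF g av_Wf[OF n v]] fn_av[OF n v] fn_av[OF nel_Sg[OF x'] v] wr_gmul[OF g n, symmetric]
   unfolding s(2) gmul_nel sh ..
 qed
 have "pc (l, S') = av rs g (pc (l, S))" "uc (l, S') = av rs g (uc (l, S))"
  unfolding pc_def uc_def fst_conv snd_conv cS using mv[OF p] mv[OF u] by simp_all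
 then have "cp \<kappa> (l, S') (av rs g z) = av rs g (cp \<kappa> (l, S) z)"
  using cap_av[OF g pc_uc(1,2)[OF x] z] cS by simp
 then show thesis using x' that by blast
qed

end

lemma subset_card_sum:
 fixes f :: "nat => int"
 shows "(\<Sum>S\<in>{S. S \<subseteq> {..<n::nat} \<and> S ~= {} \<and> S ~= {..<n}}. f (card S)) = (\<Sum>m\<in>{0<..<n}. f m * int (n choose m))"
proof -
 let ?A = "{S. S \<subseteq> {..<n} \<and> S ~= {} \<and> S ~= {..<n}}"
 have fin: "finite ?A" by (rule finite_subset[of _ "Pow {..<n}"]) auto
 have c: "card S \<in> {0<..<n}" if "S \<in> ?A" for S
 proof -
  have S: "S \<subseteq> {..<n}" "S ~= {}" "S ~= {..<n}" using that by simp_all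
  have "finite S" by (rule finite_subset[OF S(1)]) simp
  then have "0 < card S" using S(2) by (simp add: card_gt_0_iff)
  moreover have "card S < card {..<n}" by (rule psubset_card_mono[OF finite_lessThan psubsetI[OF S(1,3)]])
  ultimately show ?thesis by simp
 qed
 have "(\<Sum>S\<in>?A. f (card S)) = (\<Sum>m\<in>{0<..<n}. \<Sum>S\<in>{S \<in> ?A. card S = m}. f (card S))"
  by (rule sum.group[symmetric, OF fin finite_greaterThanLessThan]) (rule image_subsetI, rule c)
 also have "\<dots> = (\<Sum>m\<in>{0<..<n}. f m * int (n choose m))"
 proof (rule sum.cong[OF refl])
  fix m assume m: "m \<in> {0<..<n}"
  have eq: "{S \<in> ?A. card S = m} = {S. S \<subseteq> {..<n} \<and> card S = m}"
  proof (intro equalityI subsetI)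
   fix S assume S: "S \<in> {S. S \<subseteq> {..<n} \<and> card S = m}"
   then have "S ~= {}" "S ~= {..<n}" using m by auto
   then show "S \<in> {S \<in> ?A. card S = m}" using S by simp
  qed simp
  have "(\<Sum>S\<in>{S \<in> ?A. card S = m}. f (card S)) = (\<Sum>S\<in>{S. S \<subseteq> {..<n} \<and> card S = m}. f m)"
   unfolding eq by (rule sum.cong[OF refl]) simp
  also have "\<dots> = f m * int (n choose m)" using n_subsets[of "{..<n}" m] by simp
  finally show "(\<Sum>S\<in>{S \<in> ?A. card S = m}. f (card S)) = f m * int (n choose m)" .
 qed
 finally show ?thesis .
qed

lemma continuous_on_finite_closed_cover:
 fixes f :: "'c::topological_space => 'b::topological_space"
 assumes "finite I" "\<And>i. i \<in> I ==> closed (A i)" "\<And>i. i \<in> I ==> continuous_on (S \<inter> A i) f" "S \<subseteq> (\<Union>i\<in>I. A i)"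
 shows "continuous_on S f"
 unfolding continuous_on_closed_invariant
proof (intro allI impI)
 fix B :: "'b set" assume B: "closed B"
 have "\<forall>i\<in>I. \<exists>C. closed C \<and> C \<inter> (S \<inter> A i) = f -` B \<inter> (S \<inter> A i)"
  using assms(3) B unfolding continuous_on_closed_invariant by blast
 from bchoice[OF this] obtain C where C: "\<forall>i\<in>I. closed (C i) \<and> C i \<inter> (S \<inter> A i) = f -` B \<inter> (S \<inter> A i)" ..
 have "closed (\<Union>i\<in>I. C i \<inter> A i)" using C assms(1,2) by (intro closed_UN closed_Int) auto
 moreover have "(\<Union>i\<in>I. C i \<inter> A i) \<inter> S = f -` B \<inter> S"
 proof
  show "(\<Union>i\<in>I. C i \<inter> A i) \<inter> S \<subseteq> f -` B \<inter> S" using C by blast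
  show "f -` B \<inter> S \<subseteq> (\<Union>i\<in>I. C i \<inter> A i) \<inter> S"
  proof
   fix x assume x: "x \<in> f -` B \<inter> S"
   then obtain i where i: "i \<in> I" "x \<in> A i" using assms(4) by blast
   then have "x \<in> C i \<inter> (S \<inter> A i)" using C x by blast
   then show "x \<in> (\<Union>i\<in>I. C i \<inter> A i) \<inter> S" using i by blast
  qed
 qed
 ultimately show "\<exists>A. closed A \<and> A \<inter> S = f -` B \<inter> S" by blast
qed

text \<open>All tubes of one level and size get the same strength, so the total strength is an
  integer combination of binomials, and the relabellings that keep near siblings in order merely
  permute the tubes.\<close>

theorem nonvanishing_pe_map:
 assumes d: "d >= 2" and rs: "\<And>n. n \<in> set rs ==> 2 <= n"
  and np: "\<not> (\<exists>p. prime p \<and> (\<forall>n\<in>set rs. \<forall>m. 0 < m --> m < n --> p dvd (n choose m)))"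
 obtains F where "continuous_on UNIV F" "\<And>z. z \<in> Wf d rs ==> F z \<in> Wf d rs" "\<And>z. F z ~= 0"
  "\<And>g z. z \<in> Wf d rs ==> g \<in> Sigma_group rs ==> keeps rs g (near 1 (fn z)) ==> F (av rs g z) = av rs g (F z)"
proof -
 have rs1: "n \<in> set rs ==> 1 <= n" for n using rs[of n] by simp
 obtain B where B: "B \<subseteq> Wf d rs" "independent B" "finite B" "card B + 1 = prod_list rs"
  by (rule independent_Wf[of d rs, OF d], erule rs1, rule that)
 have "card B >= 4" using prod_ge_5[OF rs np] B(4) by simp
 then interpret cap_orbit d rs B using d rs B by unfold_locales
 define I where "I = Sigma {..<length rs} (%l. {0<..<rs ! l})"
 have fI: "finite I" by (simp add: I_def)
 have npI: "\<not> (\<exists>p. prime p \<and> (\<forall>i\<in>I. p dvd (rs ! fst i choose snd i)))"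
 proof
  assume "\<exists>p. prime p \<and> (\<forall>i\<in>I. p dvd (rs ! fst i choose snd i))"
  then obtain p where p: "prime p" "\<forall>i\<in>I. p dvd (rs ! fst i choose snd i)" by blast
  have "p dvd (n choose m)" if n: "n \<in> set rs" and m: "0 < m" "m < n" for n m
  proof -
   obtain l where "l < length rs" "rs ! l = n" using n by (auto simp: in_set_conv_nth)
   then show ?thesis using p(2)[rule_format, of "(l, m)"] m by (simp add: I_def)
  qed
  then show False using np p(1) by blast
 qed
 obtain k where k: "(\<Sum>i\<in>I. k i * int (rs ! fst i choose snd i)) = -1" by (rule no_prime_bezout[OF fI npI]) (rule that)
 define \<kappa> where "\<kappa> l m = k (l, m)" for l m
 have sumk: "(\<Sum>x\<in>Ix. \<kappa> (fst x) (card (snd x))) = -1"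
 proof -
  have finS: "finite {S. S \<subseteq> {..<rs ! l} \<and> S ~= {} \<and> S ~= {..<rs ! l}}" for l
   by (rule finite_subset[of _ "Pow {..<rs ! l}"]) auto
  have "(\<Sum>x\<in>Ix. \<kappa> (fst x) (card (snd x))) = (\<Sum>l<length rs. \<Sum>S\<in>{S. S \<subseteq> {..<rs ! l} \<and> S ~= {} \<and> S ~= {..<rs ! l}}. \<kappa> l (card S))"
   unfolding Ix_def using finS by (subst sum.Sigma) (simp_all add: case_prod_beta)
  also have "\<dots> = (\<Sum>l<length rs. \<Sum>m\<in>{0<..<rs ! l}. \<kappa> l m * int (rs ! l choose m))" by (simp only: subset_card_sum)
  also have "\<dots> = (\<Sum>i\<in>I. k i * int (rs ! fst i choose snd i))"
   unfolding I_def by (subst sum.Sigma) (simp_all add: \<kappa>_def case_prod_beta)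
  finally show ?thesis using k by simp
 qed
 \<comment> \<open>The spans that the common plane has to avoid: each frame, so that it stays
   independent during the motion, and each pair of rays, so that they stay distinct.\<close>
 define PS where "PS = (%(x, y). (pc x, pc y)) ` (Ix \<times> Ix) \<union> (%x. (pc x, uc x)) ` Ix"
 have fPS: "finite PS" using finite_Ix by (simp add: PS_def)
 obtain E G where EG: "E \<in> W" "G \<in> W" "onp E G"
  "\<And>a b x y r s. (a, b) \<in> PS ==> x *\<^sub>R E + y *\<^sub>R G = r *\<^sub>R a + s *\<^sub>R b ==> x = 0 \<and> y = 0"
  by (rule generic_plane[OF subspace_Wf B(1-3) \<open>card B >= 4\<close> fPS]) (rule that)
 have pu: "pc x \<in> W" "uc x \<in> W" "onp (pc x) (uc x)" if "x \<in> Ix" for x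
  using pc_uc[of "fst x" "snd x"] that by simp_all
 have PS1: "(pc x, uc x) \<in> PS" if "x \<in> Ix" for x using that by (auto simp: PS_def)
 have PS2: "(pc x, pc y) \<in> PS" if "x \<in> Ix" "y \<in> Ix" for x y using that by (force simp: PS_def)
 have g1: "x = 0 \<and> y = 0" if "i \<in> Ix" "x *\<^sub>R E + y *\<^sub>R G = a *\<^sub>R pc i + b *\<^sub>R uc i" for i x y a b
  by (rule EG(4)[OF PS1[OF that(1)] that(2)])
 have g2: "x = 0 \<and> y = 0" if "i \<in> Ix" "j \<in> Ix" "x *\<^sub>R E + y *\<^sub>R G = a *\<^sub>R pc i + b *\<^sub>R pc j" for i j x y a b
  by (rule EG(4)[OF PS2[OF that(1,2)] that(3)])
 have rho: "(1 / 8 :: real) > 0" by simp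
 obtain F R where F: "continuous_on UNIV F" "\<And>z. F z ~= 0" "\<And>z. z \<in> W ==> F z \<in> W" "R > 0"
  and F0: "\<And>z. norm z >= R ==> F z = z + (\<Sum>x\<in>Ix. cp \<kappa> x z)"
  and un: "\<And>z x y. norm z >= R ==> x \<in> Ix ==> y \<in> Ix ==> cp \<kappa> x z ~= 0 ==> cp \<kappa> y z ~= 0 ==> x = y"
  by (rule cap_filling[where A = Ix and k = "%x. \<kappa> (fst x) (card (snd x))" and \<rho> = "1 / 8" and p = pc and u = uc and V = W and E = E and G = G,
   OF finite_Ix sumk rho pu(3) inj_pc subspace_Wf pu(1,2) EG(1-3) g1 g2], assumption+, rule that)
 \<comment> \<open>Inside the ball of radius R the filling has no symmetry. Scaling by c puts only
   those z there whose entries are all within 1 of each other, and for such z the identity is the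
   only relabelling to be respected.\<close>
 define c where "c = 2 * R + 1"
 have c: "c >= 1" using F(4) by (simp add: c_def)
 have zero: "av rs g 0 = 0" if "g \<in> Sigma_group rs" for g
  using av_lin(2)[OF that subspace_0[OF subspace_Wf] subspace_0[OF subspace_Wf], where r = 0] by simp
 have single: "(\<Sum>y\<in>Ix. cp \<kappa> y z) = cp \<kappa> x z" if z: "norm z >= R" and x: "x \<in> Ix" "cp \<kappa> x z ~= 0" for x z
 proof -
  have "(\<Sum>y\<in>Ix. cp \<kappa> y z) = (\<Sum>y\<in>{x}. cp \<kappa> y z)"
  proof (rule sum.mono_neutral_right[OF finite_Ix])
   show "{x} \<subseteq> Ix" using x(1) by simp
   show "\<forall>y\<in>Ix - {x}. cp \<kappa> y z = 0"
   proof (rule ballI, rule ccontr)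
    fix y assume y: "y \<in> Ix - {x}" "cp \<kappa> y z ~= 0"
    have yI: "y \<in> Ix" using y(1) by simp
    have "x = y" by (rule un[OF z x(1) yI x(2) y(2)])
    then show False using y(1) by simp
   qed
  qed
  then show ?thesis by simp
 qed
 have capW: "cp \<kappa> x z \<in> W" if "x \<in> Ix" for x z
  using pu[OF that] by (simp add: cap_def emb_def subspace_add[OF subspace_Wf] subspace_scale[OF subspace_Wf])
 have caps: "(\<Sum>x\<in>Ix. cp \<kappa> x (av rs g z)) = av rs g (\<Sum>x\<in>Ix. cp \<kappa> x z)"
  if z: "z \<in> W" "norm z >= R" and g: "g \<in> Sigma_group rs" and kp: "keeps rs g (near 1 (fn z))" for g z
 proof (cases "\<exists>x\<in>Ix. cp \<kappa> x z ~= 0")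
  case True
  then obtain y where y: "y \<in> Ix" "cp \<kappa> y z ~= 0" by (elim bexE)
  obtain l S where ls: "y = (l, S)" by (cases y)
  note x = y[unfolded ls]
  obtain S' where S': "(l, S') \<in> Ix" "cp \<kappa> (l, S') (av rs g z) = av rs g (cp \<kappa> (l, S) z)"
   by (rule cap_move[where \<kappa> = \<kappa>, OF g z(1) kp x]) (rule that)
  have nn: "norm (cp \<kappa> (l, S') (av rs g z)) = norm (cp \<kappa> (l, S) z)" unfolding S'(2) by (rule av_norm[OF g capW[OF x(1)]])
  have "norm (cp \<kappa> (l, S') (av rs g z)) ~= 0" unfolding nn norm_eq_zero by (rule x(2))
  then have "cp \<kappa> (l, S') (av rs g z) ~= 0" by (simp only: norm_eq_zero not_False_eq_True)
  then have "(\<Sum>x\<in>Ix. cp \<kappa> x (av rs g z)) = cp \<kappa> (l, S') (av rs g z)"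
   using av_norm[OF g z(1)] z(2) by (intro single S'(1)) simp_all
  then show ?thesis unfolding single[OF z(2) x] S'(2) .
 next
  case False
  \<comment> \<open>A tube active at the image would be carried back by \<open>ginv g\<close> to one
    active at z.\<close>
  have "cp \<kappa> (l, S) (av rs g z) = 0" if x: "(l, S) \<in> Ix" for l S
  proof (rule ccontr)
   assume ne: "cp \<kappa> (l, S) (av rs g z) ~= 0"
   note gi = ginv_mem[OF g] and gz = av_Wf[OF g z(1)]
   have kg: "keeps rs (ginv g) (near 1 (fn (av rs g z)))" unfolding fn_av[OF g z(1)] by (rule keeps_ginv[OF g kp])
   have bak: "av rs (ginv g) (av rs g z) = z" by (rule fn_inj) (simp only: fn_av[OF gi gz] fn_av[OF g z(1)] wr_ginv[OF g])
   obtain S' where S': "(l, S') \<in> Ix" "cp \<kappa> (l, S') (av rs (ginv g) (av rs g z)) = av rs (ginv g) (cp \<kappa> (l, S) (av rs g z))"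
    by (rule cap_move[where \<kappa> = \<kappa>, OF gi gz kg x ne]) (rule that)
   have nn: "norm (cp \<kappa> (l, S') z) = norm (cp \<kappa> (l, S) (av rs g z))"
    using S'(2) unfolding bak by (simp only: av_norm[OF gi capW[OF x]])
   have z0: "cp \<kappa> (l, S') z = 0"
   proof (rule ccontr)
    assume "cp \<kappa> (l, S') z ~= 0"
    then have "\<exists>x\<in>Ix. cp \<kappa> x z ~= 0" using S'(1) by (rule bexI)
    then show False using False by (rule notE[rotated])
   qed
   have "norm (cp \<kappa> (l, S) (av rs g z)) = 0" unfolding nn[symmetric] z0 by (rule norm_zero)
   then show False using ne by (simp only: norm_eq_zero not_True_eq_False)
  qed
  note n0 = this
  have s1: "(\<Sum>x\<in>Ix. cp \<kappa> x (av rs g z)) = 0"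
  proof (rule sum.neutral, rule ballI)
   fix y assume y: "y \<in> Ix"
   obtain l S where ls: "y = (l, S)" by (cases y)
   show "cp \<kappa> y (av rs g z) = 0" unfolding ls by (rule n0) (use y ls in simp)
  qed
  have s2: "(\<Sum>x\<in>Ix. cp \<kappa> x z) = 0"
  proof (rule sum.neutral, rule ballI, rule ccontr)
   fix y assume y: "y \<in> Ix" "cp \<kappa> y z ~= 0"
   then have "\<exists>x\<in>Ix. cp \<kappa> x z ~= 0" by (rule bexI[rotated])
   then show False using False by (rule notE[rotated])
  qed
  show ?thesis unfolding s1 s2 zero[OF g] ..
 qed
 show thesis
 proof (rule that[of "%z. F (c *\<^sub>R z)"])
  show "continuous_on UNIV (%z. F (c *\<^sub>R z))"
   by (rule continuous_on_compose2[OF F(1)]) (auto intro!: continuous_intros)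
  show "F (c *\<^sub>R z) \<in> W" if "z \<in> W" for z by (rule F(3)[OF subspace_scale[OF subspace_Wf that]])
  show "F (c *\<^sub>R z) ~= 0" for z by (rule F(2))
  fix g z assume z: "z \<in> W" and g: "g \<in> Sigma_group rs" and kp: "keeps rs g (near 1 (fn z))"
  have cz: "c *\<^sub>R z \<in> W" by (rule subspace_scale[OF subspace_Wf z])
  have sc: "c *\<^sub>R av rs g z = av rs g (c *\<^sub>R z)" by (rule av_lin(2)[OF g z z, symmetric])
  show "F (c *\<^sub>R av rs g z) = av rs g (F (c *\<^sub>R z))"
  proof (cases "norm (c *\<^sub>R z) >= R")
   case True
   have "keeps rs g (near 1 (fn (c *\<^sub>R z)))"
   proof (rule keeps_mono[OF kp])
    fix P i j assume n: "near 1 (fn (c *\<^sub>R z)) P i j"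
    show "near 1 (fn z) P i j" unfolding near_def
    proof
     fix e
     have "c * \<bar>fn z P i e - fn z P j e\<bar> < 1"
      using n c unfolding near_def fn_ops by (simp add: right_diff_distrib[symmetric] abs_mult)
     moreover have "1 * \<bar>fn z P i e - fn z P j e\<bar> <= c * \<bar>fn z P i e - fn z P j e\<bar>" using c by (intro mult_right_mono) auto
     ultimately show "\<bar>fn z P i e - fn z P j e\<bar> < 1" by simp
    qed
   qed
   note cs = caps[OF cz True g this]
   have ge: "R <= norm (av rs g (c *\<^sub>R z))" using True av_norm[OF g cz] by simp
   have "F (av rs g (c *\<^sub>R z)) = av rs g (c *\<^sub>R z) + av rs g (\<Sum>x\<in>Ix. cp \<kappa> x (c *\<^sub>R z))" by (simp only: F0[OF ge] cs)
   also have "\<dots> = av rs g (F (c *\<^sub>R z))"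
    unfolding F0[OF True] by (rule av_lin(1)[OF g cz, symmetric]) (intro subspace_sum[OF subspace_Wf] capW)
   finally show ?thesis unfolding sc .
  next
   case False
   have small: "\<bar>c * fn z P i e\<bar> < R" for P i e
   proof -
    have n1: "norm (un (P, i, e)) = 1" by (simp add: norm_eq_1 inner_un co_un)
    have "\<bar>co (c *\<^sub>R z) (P, i, e)\<bar> <= norm (c *\<^sub>R z)"
     using Cauchy_Schwarz_ineq2[of "un (P, i, e)" "c *\<^sub>R z"] unfolding inner_un n1 mult_1 .
    then show ?thesis using False by (simp add: fn_def co_ops)
   qed
   have "near 1 (fn z) P i j" for P i j unfolding near_def
   proof
    fix e
    have "\<bar>c * fn z P i e - c * fn z P j e\<bar> < c" using small[of P i e] small[of P j e] unfolding c_def by linarith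
    then have "c * \<bar>fn z P i e - fn z P j e\<bar> < c * 1" using c by (simp add: right_diff_distrib[symmetric] abs_mult)
    then show "\<bar>fn z P i e - fn z P j e\<bar> < 1" using c by (simp only: mult_less_cancel_left_pos)
   qed
   from keeps_all[OF g kp this] have gid: "g = (%_ a. a)" .
   have "av rs g y = y" if "y \<in> W" for y by (rule fn_inj) (simp only: fn_av[OF g that], simp add: gid)
   then show ?thesis using z cz F(3)[OF cz] by simp
  qed
 qed
qed

text \<open>Sort by heights with some s, apply the partially equivariant map, undo s. Two sorting
  elements differ by one that keeps near siblings in order (\<open>sepd_cen\<close>,
  \<open>keeps_sorted\<close>), so the value does not depend on s. Continuity follows since each s
  sorts on a closed set and there are finitely many s.\<close>

theorem equivariant_map:
 assumes d: "DIM('a::euclidean_space) >= 2" and rs: "\<And>n. n \<in> set rs ==> 2 <= n"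
  and np: "\<not> (\<exists>p. prime p \<and> (\<forall>n\<in>set rs. \<forall>m. 0 < m --> m < n --> p dvd (n choose m)))"
 shows "equivariant_map_exists TYPE('a) rs"
proof -
 let ?d = "DIM('a)"
 let ?C = "C_space rs :: (nat list => nat => 'a) set"
 obtain F where F: "continuous_on UNIV F" "\<And>z. z \<in> Wf ?d rs ==> F z \<in> Wf ?d rs" "\<And>z. F z ~= 0"
  and pe: "\<And>g z. z \<in> Wf ?d rs ==> g \<in> Sigma_group rs ==> keeps rs g (near 1 (fn z)) ==> F (av rs g z) = av rs g (F z)"
  by (rule nonvanishing_pe_map[of "DIM('a)" rs, OF d rs np], assumption, rule that)
 define Z where "Z x = (%p i c. (real ?d * lam rs x) * cen rs x p i c)" for x :: "nat list => nat => 'a"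
 define H where "H x = (%p i. inner (x p i) (bs (?d - 1)))" for x :: "nat list => nat => 'a"
 define G where "G w = fn (F (vec w))" for w
 have ZW: "Z x \<in> W_space ?d rs" for x
  using W_lin[OF cen_W[of rs x] cen_W[of rs x], of "real ?d * lam rs x" 0] by (simp add: Z_def)
 have Zact: "Z (wr_act rs g x) = wr_act rs g (Z x)" if "g \<in> Sigma_group rs" for g x
  unfolding Z_def lam_act[OF that] cen_act[OF that] by (rule wr_map[of rs g "%u c. (real ?d * lam rs x) * u c" "cen rs x", symmetric])
 have Hact: "H (wr_act rs g x) = wr_act rs g (H x)" for g x
  unfolding H_def by (rule wr_map[of rs g "%u. inner u (bs (?d - 1))" x, symmetric])
 have GW: "G w \<in> W_space ?d rs" if "w \<in> W_space ?d rs" for w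
  using F(2)[OF vec_Wf[OF that]] by (simp add: G_def Wf_def)
 have Gnz: "G w ~= (%_ _ _. 0)" for w using F(3)[of "vec w"] fn_inj[of "F (vec w)" 0] by (auto simp: G_def fn_ops)
 have Gpe: "G (wr_act rs g w) = wr_act rs g (G w)" if w: "w \<in> W_space ?d rs" and g: "g \<in> Sigma_group rs" and k: "keeps rs g (near 1 w)" for g w
 proof -
  have v: "vec w \<in> Wf ?d rs" "fn (vec w) = w" using vec_Wf[OF w] fn_vec[OF w] by simp_all
  have "vec (wr_act rs g w) = av rs g (vec w)" by (simp add: av_def v(2))
  then show ?thesis unfolding G_def using pe[OF v(1) g] k fn_av[OF g F(2)[OF v(1)]] by (simp add: v(2))
 qed
 define srtd where "srtd s x \<longleftrightarrow> s \<in> Sigma_group rs \<and> srt rs (wr_act rs s (H x))" for s x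
 define f where "f s x = wr_act rs (ginv s) (G (wr_act rs s (Z x)))" for s x
 have Cact: "wr_act rs g x \<in> ?C" if "g \<in> Sigma_group rs" "x \<in> ?C" for g x
  using that
 proof (induction rs arbitrary: g x)
  case (Cons n rs)
  note g = SgD[OF Cons.prems(1)]
  have "(%q. wr_act (n # rs) g x (j # q)) \<in> C_space rs" if "j < n" for j
   using Cons.IH[OF g(2), of "%q. x (iv (g []) j # q)" j] Cons.prems(2) that perm_lt(2)[OF g(1)] by simp
  moreover have "wr_act (n # rs) g x [] i ~= wr_act (n # rs) g x [] i'" if "i < n" "i' < n" "i ~= i'" for i i'
   using Cons.prems(2) that perm_lt(2)[OF g(1)] inj_eq[OF permutes_inj[OF permutes_inv[OF g(1)]]] by simp
  moreover have "wr_act (n # rs) g x [] i = 0" if "n <= i" for i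
   using Cons.prems(2) that perm_ge(2)[OF g(1)] by simp
  moreover have "wr_act (n # rs) g x (j # q) i = 0" if j: "n <= j" for j q i
  proof -
   have "(%q. g (j # q)) = (%_ a. a)" using g(3)[OF j] by (simp add: id_def)
   then show ?thesis using Cons.prems(2) perm_ge(2)[OF g(1) j] j by simp
  qed
  ultimately show ?case by (simp del: wr_Nil wr_Cons)
 qed simp
 have same: "f s x = f s' x" if x: "x \<in> ?C" and s: "srtd s x" "srtd s' x" for s s' x
 proof -
  have sg: "s \<in> Sigma_group rs" "s' \<in> Sigma_group rs" using s by (auto simp: srtd_def)
  define t where "t = gmul s' (ginv s)"
  have t: "t \<in> Sigma_group rs" unfolding t_def by (intro gmul_mem ginv_mem sg)
  have tsR: "wr_act rs t (wr_act rs s (H x)) = wr_act rs s' (H x)" "wr_act rs t (wr_act rs s (Z x)) = wr_act rs s' (Z x)"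
   unfolding t_def wr_gmul[OF sg(2) ginv_mem[OF sg(1)]] wr_ginv[OF sg(1)] by (rule refl)+
  let ?w = "wr_act rs s (Z x)"
  have "sepd rs (near 1 (Z (wr_act rs s x))) (H (wr_act rs s x))"
   unfolding Z_def H_def by (rule sepd_cen[OF Cact[OF sg(1) x]]) simp
  then have sp: "sepd rs (near 1 ?w) (wr_act rs s (H x))" unfolding Zact[OF sg(1)] Hact .
  have "keeps rs t (near 1 ?w)"
   by (rule keeps_sorted[OF t _ _ sp]) (use s tsR in \<open>simp_all add: srtd_def\<close>)
  from Gpe[OF W_act[OF sg(1) ZW] t this] have "G (wr_act rs s' (Z x)) = wr_act rs t (G ?w)" unfolding tsR .
  then have "f s' x = wr_act rs (ginv s') (wr_act rs s' (wr_act rs (ginv s) (G ?w)))"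
   unfolding f_def t_def wr_gmul[OF sg(2) ginv_mem[OF sg(1)]] by simp
  then show ?thesis unfolding wr_ginv[OF sg(2)] f_def by simp
 qed
 define srtx where "srtx x = (SOME s. srtd s x)" for x
 have srtx: "srtd (srtx x) x" for x
 proof -
  have "\<exists>s. srtd s x" unfolding srtd_def by (rule sort_exists[of rs "H x", unfolded Bex_def])
  then show ?thesis unfolding srtx_def by (rule someI_ex)
 qed
 define h where "h x = f (srtx x) x" for x
 have hf: "h x = f s x" if "x \<in> ?C" "srtd s x" for s x unfolding h_def by (rule same[OF that(1) srtx that(2)])
 have hW: "h x \<in> W_space ?d rs" and hnz: "h x ~= (%_ _ _. 0)" for x
 proof -
  have s: "srtx x \<in> Sigma_group rs" using srtx[of x] by (simp add: srtd_def)
  show "h x \<in> W_space ?d rs" unfolding h_def f_def by (intro W_act ginv_mem GW ZW s)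
  show "h x ~= (%_ _ _. 0)"
  proof
   assume h0: "h x = (%_ _ _. 0)"
   have a: "wr_act rs (srtx x) (h x) = G (wr_act rs (srtx x) (Z x))"
    unfolding h_def f_def by (rule wr_ginv'[OF s])
   have b: "wr_act rs (srtx x) (%_ _ _. 0) = (%_ _ _. 0 :: real)"
    using wr_map[of rs "srtx x" "%_ _. 0 :: real" "%_ _. 0 :: nat"] by simp
   have "G (wr_act rs (srtx x) (Z x)) = (%_ _ _. 0)" by (rule trans[OF sym[OF a[unfolded h0]] b])
   with Gnz show False by (rule notE)
  qed
 qed
 have heq: "h (wr_act rs g x) = wr_act rs g (h x)" if g: "g \<in> Sigma_group rs" and x: "x \<in> ?C" for g x
 proof -
  define s where "s = srtx (wr_act rs g x)"
  have s: "s \<in> Sigma_group rs" "srt rs (wr_act rs s (wr_act rs g (H x)))"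
   using srtx[of "wr_act rs g x"] unfolding srtd_def Hact s_def by auto
  have sg: "gmul s g \<in> Sigma_group rs" by (rule gmul_mem[OF s(1) g])
  have sd: "srtd (gmul s g) x" unfolding srtd_def using sg s by (simp add: wr_gmul[OF s(1) g])
  have "wr_act rs (gmul s g) (h x) = G (wr_act rs (gmul s g) (Z x))"
   unfolding hf[OF x sd] f_def by (rule wr_ginv'[OF sg])
  then have A: "wr_act rs s (wr_act rs g (h x)) = G (wr_act rs s (Z (wr_act rs g x)))"
   unfolding wr_gmul[OF s(1) g] Zact[OF g] .
  have B: "wr_act rs s (h (wr_act rs g x)) = G (wr_act rs s (Z (wr_act rs g x)))"
   unfolding h_def f_def s_def[symmetric] by (rule wr_ginv'[OF s(1)])
  show ?thesis by (rule wr_inj[OF s(1) trans[OF B sym[OF A]]])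
 qed
 have wr_cont: "continuous_on S (%x. wr_act r g (u x) p i)" if "\<And>p i. continuous_on S (%x. u x p i)"
  for S :: "(nat list => nat => 'a) set" and r g p i and u :: "_ => nat list => nat => 'z::topological_space"
  using that
 proof (induction r arbitrary: g u p)
  case (Cons n r)
  then show ?case by (cases p) (simp_all add: Cons.IH)
 qed simp
 have Zc: "continuous_on ?C (%x. Z x p i)" for p i
  unfolding Z_def by (intro continuous_on_coordinatewise_then_product continuous_on_mult continuous_on_const continuous_on_lam continuous_on_cen)
 have Hc: "continuous_on S (%x. H x p i)" for S p i
  unfolding H_def by (intro continuous_intros continuous_on_at_path)
 have vc: "continuous_on ?C (%x. vec (wr_act rs s (Z x)))" if s: "s \<in> Sigma_group rs" for s
 proof -
  have vecs: "vec w = (\<Sum>y\<in>J ?d rs. w (fst y) (fst (snd y)) (snd (snd y)) *\<^sub>R un y)" if w: "w \<in> W_space ?d rs" for w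
  proof (rule fsv_eqI)
   fix y :: "nat list \<times> nat \<times> nat"
   obtain p i c where y: "y = (p, i, c)" by (cases y)
   have "fn (vec w) p i c = w p i c" by (simp only: fn_vec[OF w])
   then have "co (vec w) y = w p i c" by (simp only: fn_def y)
   moreover have "co (\<Sum>y\<in>J ?d rs. w (fst y) (fst (snd y)) (snd (snd y)) *\<^sub>R un y) y = (\<Sum>y'\<in>J ?d rs. if y = y' then w p i c else 0)"
    unfolding co_sum co_ops co_un by (intro sum.cong) (auto simp: y)
   moreover have "y \<notin> J ?d rs ==> w p i c = 0" using W_supp[OF w, of p i c] y by blast
   ultimately show "co (vec w) y = co (\<Sum>y\<in>J ?d rs. w (fst y) (fst (snd y)) (snd (snd y)) *\<^sub>R un y) y"
    using finite_J by (cases "y \<in> J ?d rs") (simp_all add: sum.delta)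
  qed
  have eq: "vec (wr_act rs s (Z x)) = (\<Sum>y\<in>J ?d rs. wr_act rs s (Z x) (fst y) (fst (snd y)) (snd (snd y)) *\<^sub>R un y)" for x
   by (rule vecs[OF W_act[OF s ZW]])
  have cw: "continuous_on ?C (%x. wr_act rs s (Z x) p i c)" for p i c
   by (rule continuous_on_product_then_coordinatewise[OF wr_cont[OF Zc]])
  show ?thesis unfolding eq by (intro continuous_on_sum continuous_on_scaleR cw continuous_on_const)
 qed
 have fc: "continuous_on ?C (%x. f s x p i)" if s: "s \<in> Sigma_group rs" for s p i
 proof -
  have "continuous_on ?C (%x. F (vec (wr_act rs s (Z x))))" by (rule continuous_on_compose2[OF F(1) vc[OF s]]) simp
  then have "continuous_on ?C (%x. G (wr_act rs s (Z x)) p i)" for p i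
   unfolding G_def fn_def by (intro continuous_on_coordinatewise_then_product continuous_on_co)
  then show ?thesis unfolding f_def by (rule wr_cont)
 qed
 have srt_closed: "closed {x. srt r (u x)}" if "\<And>p i. continuous_on UNIV (%x. u x p i)"
  for r and u :: "(nat list => nat => 'a) => nat list => nat => real"
  using that
 proof (induction r arbitrary: u)
  case (Cons n r)
  have "{x. srt (n # r) (u x)} = (\<Inter>j\<in>{..<n}. \<Inter>i\<in>{..<j}. {x. u x [] i <= u x [] j}) \<inter> (\<Inter>l\<in>{..<n}. {x. srt r (%q. u x (l # q))})" by auto
  then show ?case by (simp only:) (intro closed_Int closed_INT ballI closed_Collect_le Cons.prems Cons.IH)
 qed simp
 have hc: "continuous_on ?C h"
 proof -
  have "continuous_on ?C (%x. h x)"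
  proof (intro continuous_on_coordinatewise_then_product)
   fix p i c
   show "continuous_on ?C (%x. h x p i c)"
   proof (rule continuous_on_finite_closed_cover[OF finite_Sigma_group])
    fix s assume s: "s \<in> Sigma_group rs"
    show "closed {x. srt rs (wr_act rs s (H x))}" by (rule srt_closed, rule wr_cont, rule Hc)
    have "continuous_on (?C \<inter> {x. srt rs (wr_act rs s (H x))}) (%x. f s x p i c)"
     by (rule continuous_on_subset[OF continuous_on_product_then_coordinatewise[OF fc[OF s]]]) simp
    then show "continuous_on (?C \<inter> {x. srt rs (wr_act rs s (H x))}) (%x. h x p i c)"
    proof (rule continuous_on_eq)
     fix x assume x: "x \<in> ?C \<inter> {x. srt rs (wr_act rs s (H x))}"
     then have "srtd s x" using s by (simp add: srtd_def)
     then show "f s x p i c = h x p i c" using hf[of x s] x by simp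
    qed
   next
    show "?C \<subseteq> (\<Union>s\<in>Sigma_group rs. {x. srt rs (wr_act rs s (H x))})" using srtx by (auto simp: srtd_def)
   qed
  qed
  then show ?thesis by simp
 qed
 define e where "e x = (%p i c. (1 / sqrt (W_norm2 ?d rs (h x))) * h x p i c)" for x :: "nat list => nat => 'a"
 have pos: "W_norm2 ?d rs (h x) > 0" for x by (rule W_norm2_pos[OF hW hnz])
 have "e x \<in> W_sphere ?d rs" for x
 proof -
  have "e x \<in> W_space ?d rs" using W_lin[OF hW[of x] hW[of x], of "1 / sqrt (W_norm2 ?d rs (h x))" 0] by (simp add: e_def)
  moreover have "W_norm2 ?d rs (e x) = (1 / sqrt (W_norm2 ?d rs (h x)))\<^sup>2 * W_norm2 ?d rs (h x)"
   unfolding W_norm2_J e_def by (simp only: power_mult_distrib sum_distrib_left)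
  moreover have "(1 / sqrt (W_norm2 ?d rs (h x)))\<^sup>2 * W_norm2 ?d rs (h x) = 1" using pos[of x] by (simp add: power_divide)
  ultimately show ?thesis by (simp add: W_sphere_def)
 qed
 moreover have "continuous_on ?C e"
 proof -
  have hcc: "continuous_on ?C (%x. h x p i c)" for p i c
   by (rule continuous_on_product_then_coordinatewise[OF continuous_on_product_then_coordinatewise[OF continuous_on_product_then_coordinatewise[OF hc]]])
  have cW: "continuous_on ?C (%x. W_norm2 ?d rs (h x))" unfolding W_norm2_J
   by (intro continuous_on_sum continuous_on_power hcc)
  have nz: "sqrt (W_norm2 ?d rs (h x)) ~= 0" for x using pos[of x] by simp
  have "continuous_on ?C (%x. e x)" unfolding e_def
   by (intro continuous_on_coordinatewise_then_product continuous_on_mult continuous_on_divide continuous_on_const continuous_on_real_sqrt cW hcc ballI nz)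
  then show ?thesis by simp
 qed
 moreover have "e (wr_act rs g x) = wr_act rs g (e x)" if g: "g \<in> Sigma_group rs" and x: "x \<in> ?C" for g x
  unfolding e_def heq[OF g x] W_norm2_act[OF g] by (rule wr_map[of rs g "%u c. (1 / sqrt (W_norm2 ?d rs (h x))) * u c" "h x", symmetric])
 ultimately show ?thesis unfolding equivariant_map_exists_def by (intro exI[of _ e] conjI ballI image_subsetI)
qed

theorem theorem2p10:
  fixes K :: "'a::euclidean_space set" and ns :: "nat list"
    and \<mu> :: "'a measure" and \<phi> :: "nat \<Rightarrow> 'a set \<Rightarrow> real"
  assumes "ns \<noteq> []" and "\<forall>m\<in>set ns. 2 \<le> m"
    and "K \<in> convex_bodies"
    and "\<not> equivariant_map_exists TYPE('a) (rev ns)"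
    and "prob_space \<mu>" and "sets \<mu> = sets borel" and "absolutely_continuous lborel \<mu>"
    and "\<forall>l < DIM('a) - 1. haus_continuous (\<phi> l)"
  shows "\<exists>P. iterated_partition \<mu> K ns P \<and>
           (\<forall>i<prod_list ns. \<forall>j<prod_list ns. measure \<mu> (P i) = measure \<mu> (P j)) \<and>
           (\<forall>l < DIM('a) - 1. \<forall>i<prod_list ns. \<forall>j<prod_list ns. \<phi> l (P i) = \<phi> l (P j))"
\<comment> \<open>Dimension one joins the prime case: there are no functions to equalise, and
  \<open>equivariant_map\<close> is available from dimension two on.\<close>
proof (cases "DIM('a) >= 2 --> (\<exists>p. prime p \<and> (\<forall>n\<in>set ns. \<forall>m. 0 < m --> m < n --> p dvd (n choose m)))")
 case True
 interpret prob_space \<mu> by fact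
 show ?thesis
  by (rule partition_of_prime[OF assms(1-3) finite_measure_axioms assms(6,7,8)]) (use True in blast)
next
 case False
 have "2 <= n" if "n \<in> set (rev ns)" for n using that assms(2) by simp
 moreover have "\<not> (\<exists>p. prime p \<and> (\<forall>n\<in>set (rev ns). \<forall>m. 0 < m --> m < n --> p dvd (n choose m)))"
  using False by simp
 ultimately have "equivariant_map_exists TYPE('a) (rev ns)" using False by (intro equivariant_map) auto
 with assms(4) show ?thesis by (rule notE)
qed

end
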